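(* Let $K$ be a field, $q\in K$ a primitive $n$'th root of unity with $n\geq2$, and $A_1=K\langle x,y\mid xy-qyx=1\rangle$; put $h=yx+\frac1{q-1}$, $t=x^n$, $r=y^n$, $s=h^n$. The set $\mathrm{Spec}_c(A_1)$ of completely prime ideals of $A_1$ consists precisely of the following ideals: - $\{0\}$ and $(h)$; - $(h,f)$ where $f\in\mathrm{Irr}_m(K[x])\setminus\{x\}$; - $A_1\mathfrak{p}$ where $0\neq\mathfrak{p}\in\mathrm{Spec}\,Z(A_1)$ is such that $t,r,s\notin\mathfrak{p}$, the algebra $E(s,\mathfrak{p})=k(\mathfrak{p})[h]/(h^n-s)$ is a field, and $n=\min\{d'\ge1\mid d'\mid n$ and there is a matrix $X\in M_{d'}(E(s,\mathfrak{p}))$ such that $X^{\sigma^{n-1}}\cdots X^\sigma X=a\}$, where $k(\mathfrak{p})$ is the field of fractions of the commutative domain $Z(A_1)/\mathfrak{p}$, $\sigma$ is the $k(\mathfrak{p})$-automorphism of $E(s,\mathfrak{p})$ with $\sigma(h)=qh$, and $a$ is the image of $t$ in $k(\mathfrak{p})$.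
   Context: A prime ideal $P$ of a ring $R$ is completely prime if $R/P$ is a domain. The centre of $A_1$ is the polynomial algebra $Z(A_1)=K[r,t]$, and $s=(-1)^{n-1}rt+\frac1{(q-1)^n}\in Z(A_1)$; in $E(s,\mathfrak{p})$, $s$ stands for its image in $k(\mathfrak{p})$. $\mathrm{Irr}_m(K[x])$ is the set of monic irreducible polynomials in $K[x]$. $(\ldots)$ is the two-sided ideal of $A_1$ generated by the listed elements. For a matrix $X=(x_{ij})$, $X^{\sigma^k}=(\sigma^k(x_{ij}))$; in the matrix equation $a$ stands for the scalar matrix. *)

theory Defs
  imports
    "HOL-Library.Poly_Mapping"
    "HOL-Computational_Algebra.Computational_Algebra"
    "HOL-Algebra.Algebraic_Closure_Type"
    "HOL-Algebra.Ideal_Product"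
    "HOL-Algebra.Polynomial_Divisibility"
    "Jordan_Normal_Form.Matrix"
begin

section \<open>Notions for rings that are not necessarily commutative\<close>

text \<open>
  The library locales \<open>domain\<close> and \<open>primeideal\<close> require commutativity; \<open>ideal\<close>, \<open>Idl\<close>,
  \<open>Quot\<close> and \<open>ideal_prod\<close> are two-sided and are used as they are.
\<close>

definition nc_domain :: "('a, 'b) ring_scheme \<Rightarrow> bool" where
  "nc_domain R \<longleftrightarrow> ring R \<and> \<one>\<^bsub>R\<^esub> \<noteq> \<zero>\<^bsub>R\<^esub> \<and>
     (\<forall>a \<in> carrier R. \<forall>b \<in> carrier R. a \<otimes>\<^bsub>R\<^esub> b = \<zero>\<^bsub>R\<^esub> \<longrightarrow> a = \<zero>\<^bsub>R\<^esub> \<or> b = \<zero>\<^bsub>R\<^esub>)"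

definition nc_prime_ideal :: "'a set \<Rightarrow> ('a, 'b) ring_scheme \<Rightarrow> bool" where
  "nc_prime_ideal P R \<longleftrightarrow> ideal P R \<and> P \<noteq> carrier R \<and>
     (\<forall>I J. ideal I R \<longrightarrow> ideal J R \<longrightarrow> ideal_prod R I J \<subseteq> P \<longrightarrow> I \<subseteq> P \<or> J \<subseteq> P)"

definition Spec_c :: "('a, 'b) ring_scheme \<Rightarrow> 'a set set" where
  "Spec_c R = {P. nc_prime_ideal P R \<and> nc_domain (R Quot P)}"

definition ring_center :: "'a ring \<Rightarrow> 'a ring" where
  "ring_center R =
     R\<lparr>carrier := {z \<in> carrier R. \<forall>a \<in> carrier R. z \<otimes>\<^bsub>R\<^esub> a = a \<otimes>\<^bsub>R\<^esub> z}\<rparr>"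


section \<open>Field of fractions of a commutative domain\<close>

definition frac_rel :: "('a, 'b) ring_scheme \<Rightarrow> (('a \<times> 'a) \<times> ('a \<times> 'a)) set" where
  "frac_rel D = {((a, b), (c, d)).
     a \<in> carrier D \<and> b \<in> carrier D - {\<zero>\<^bsub>D\<^esub>} \<and> c \<in> carrier D \<and> d \<in> carrier D - {\<zero>\<^bsub>D\<^esub>} \<and>
     a \<otimes>\<^bsub>D\<^esub> d = c \<otimes>\<^bsub>D\<^esub> b}"

definition fraction :: "('a, 'b) ring_scheme \<Rightarrow> 'a \<Rightarrow> 'a \<Rightarrow> ('a \<times> 'a) set" where
  "fraction D a b = frac_rel D `` {(a, b)}"

definition fraction_field :: "('a, 'b) ring_scheme \<Rightarrow> ('a \<times> 'a) set ring" where
  "fraction_field D = \<lparr>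
     carrier = {fraction D a b | a b. a \<in> carrier D \<and> b \<in> carrier D - {\<zero>\<^bsub>D\<^esub>}},
     monoid.mult = (\<lambda>P Q. \<Union>(a, b) \<in> P. \<Union>(c, d) \<in> Q. fraction D (a \<otimes>\<^bsub>D\<^esub> c) (b \<otimes>\<^bsub>D\<^esub> d)),
     one = fraction D \<one>\<^bsub>D\<^esub> \<one>\<^bsub>D\<^esub>,
     ring.zero = fraction D \<zero>\<^bsub>D\<^esub> \<one>\<^bsub>D\<^esub>,
     add = (\<lambda>P Q. \<Union>(a, b) \<in> P. \<Union>(c, d) \<in> Q.
              fraction D ((a \<otimes>\<^bsub>D\<^esub> d) \<oplus>\<^bsub>D\<^esub> (c \<otimes>\<^bsub>D\<^esub> b)) (b \<otimes>\<^bsub>D\<^esub> d))\<rparr>"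


section \<open>Square matrices over a ring with explicit carrier\<close>

definition mats :: "('a, 'b) ring_scheme \<Rightarrow> nat \<Rightarrow> 'a mat set" where
  "mats R d = {M \<in> carrier_mat d d. elements_mat M \<subseteq> carrier R}"

definition mat_prod :: "('a, 'b) ring_scheme \<Rightarrow> nat \<Rightarrow> 'a mat \<Rightarrow> 'a mat \<Rightarrow> 'a mat" where
  "mat_prod R d M N =
     mat d d (\<lambda>(i, j). \<Oplus>\<^bsub>R\<^esub> k \<in> {..<d}. M $$ (i, k) \<otimes>\<^bsub>R\<^esub> N $$ (k, j))"

definition scalar_mat :: "('a, 'b) ring_scheme \<Rightarrow> nat \<Rightarrow> 'a \<Rightarrow> 'a mat" where
  "scalar_mat R d a = mat d d (\<lambda>(i, j). if i = j then a else \<zero>\<^bsub>R\<^esub>)"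

text \<open>\<open>twisted_power R d \<sigma> M m\<close> is the product \<open>M^{\<sigma>^{m-1}} ... M^\<sigma> M\<close>, in this order.\<close>

primrec twisted_power ::
  "('a, 'b) ring_scheme \<Rightarrow> nat \<Rightarrow> ('a \<Rightarrow> 'a) \<Rightarrow> 'a mat \<Rightarrow> nat \<Rightarrow> 'a mat" where
  "twisted_power R d \<sigma> M 0 = scalar_mat R d \<one>\<^bsub>R\<^esub>"
| "twisted_power R d \<sigma> M (Suc m) =
     mat_prod R d (map_mat (\<sigma> ^^ m) M) (twisted_power R d \<sigma> M m)"


section \<open>The free algebra on two generators\<close>

datatype letter = Letter_x | Letter_y

text \<open>
  Words form a monoid under concatenation, written additively because \<open>Poly_Mapping\<close>
  takes the monoid ring of an additive monoid. So \<open>nc_word \<Rightarrow>\<^sub>0 'k\<close> is \<open>'k\<langle>x, y\<rangle>\<close>.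
\<close>

datatype nc_word = Word (letters: "letter list")

instantiation nc_word :: monoid_add
begin

definition zero_nc_word :: nc_word where
  "zero_nc_word = Word []"

definition plus_nc_word :: "nc_word \<Rightarrow> nc_word \<Rightarrow> nc_word" where
  "plus_nc_word u v = Word (letters u @ letters v)"

instance
  by standard (simp_all add: zero_nc_word_def plus_nc_word_def)

end

type_synonym 'k free_alg = "nc_word \<Rightarrow>\<^sub>0 'k"

definition free_x :: "'k::field free_alg" where
  "free_x = Poly_Mapping.single (Word [Letter_x]) 1"

definition free_y :: "'k::field free_alg" where
  "free_y = Poly_Mapping.single (Word [Letter_y]) 1"

definition free_const :: "'k::field \<Rightarrow> 'k free_alg" where
  "free_const c = Poly_Mapping.single 0 c"

definition Free :: "'k::field free_alg ring" where
  "Free = ring_of_type_algebra"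


section \<open>The algebra \<open>A\<^sub>1 = K\<langle>x, y | xy - qyx = 1\<rangle>\<close>\<close>

definition qweyl_ideal :: "'k::field \<Rightarrow> 'k free_alg set" where
  "qweyl_ideal q = Idl\<^bsub>Free\<^esub> {free_x * free_y - free_const q * free_y * free_x - 1}"

definition A1 :: "'k::field \<Rightarrow> 'k free_alg set ring" where
  "A1 q = Free Quot qweyl_ideal q"

definition A1_class :: "'k::field \<Rightarrow> 'k free_alg \<Rightarrow> 'k free_alg set" where
  "A1_class q u = qweyl_ideal q +>\<^bsub>Free\<^esub> u"

definition A1_x :: "'k::field \<Rightarrow> 'k free_alg set" where
  "A1_x q = A1_class q free_x"

definition A1_y :: "'k::field \<Rightarrow> 'k free_alg set" where
  "A1_y q = A1_class q free_y"

definition A1_const :: "'k::field \<Rightarrow> 'k \<Rightarrow> 'k free_alg set" where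
  "A1_const q c = A1_class q (free_const c)"

definition A1_h :: "'k::field \<Rightarrow> 'k free_alg set" where
  "A1_h q = (A1_y q \<otimes>\<^bsub>A1 q\<^esub> A1_x q) \<oplus>\<^bsub>A1 q\<^esub> A1_const q (1 / (q - 1))"

definition A1_t :: "'k::field \<Rightarrow> nat \<Rightarrow> 'k free_alg set" where
  "A1_t q n = A1_x q [^]\<^bsub>A1 q\<^esub> n"

definition A1_r :: "'k::field \<Rightarrow> nat \<Rightarrow> 'k free_alg set" where
  "A1_r q n = A1_y q [^]\<^bsub>A1 q\<^esub> n"

definition A1_s :: "'k::field \<Rightarrow> nat \<Rightarrow> 'k free_alg set" where
  "A1_s q n = A1_h q [^]\<^bsub>A1 q\<^esub> n"

text \<open>The image of \<open>f \<in> K[x]\<close> in \<open>A\<^sub>1\<close>.\<close>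

definition A1_poly :: "'k::field \<Rightarrow> 'k poly \<Rightarrow> 'k free_alg set" where
  "A1_poly q f =
     A1_class q (\<Sum>i\<le>Polynomial.degree f. free_const (Polynomial.coeff f i) * free_x ^ i)"

definition Irr_m :: "'k::field poly set" where
  "Irr_m = {f. Factorial_Ring.irreducible f \<and> Polynomial.lead_coeff f = 1}"

definition Z1 :: "'k::field \<Rightarrow> 'k free_alg set ring" where
  "Z1 q = ring_center (A1 q)"


section \<open>The field \<open>k(\<pp>)\<close> and the algebra \<open>E(s, \<pp>) = k(\<pp>)[h]/(h\<^sup>n - s)\<close>\<close>

text \<open>Here \<open>p\<close> is an ideal of the ring \<open>Z1 q\<close>, and its cosets are taken in \<open>Z1 q\<close>.\<close>

type_synonym 'k kfield = "('k free_alg set set \<times> 'k free_alg set set) set"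

definition kp :: "'k::field \<Rightarrow> 'k free_alg set set \<Rightarrow> 'k kfield ring" where
  "kp q p = fraction_field (Z1 q Quot p)"

text \<open>The canonical map \<open>Z(A\<^sub>1) \<rightarrow> Z(A\<^sub>1)/\<pp> \<rightarrow> k(\<pp>)\<close>.\<close>

definition kp_of :: "'k::field \<Rightarrow> 'k free_alg set set \<Rightarrow> 'k free_alg set \<Rightarrow> 'k kfield" where
  "kp_of q p z = fraction (Z1 q Quot p) (p +>\<^bsub>Z1 q\<^esub> z) \<one>\<^bsub>Z1 q Quot p\<^esub>"

definition kp_poly :: "'k::field \<Rightarrow> 'k free_alg set set \<Rightarrow> 'k kfield list ring" where
  "kp_poly q p = univ_poly (kp q p) (carrier (kp q p))"

text \<open>The polynomial \<open>h\<^sup>n - s\<close> in \<open>k(\<pp>)[h]\<close>.\<close>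

definition E_modulus :: "'k::field \<Rightarrow> nat \<Rightarrow> 'k free_alg set set \<Rightarrow> 'k kfield list" where
  "E_modulus q n p =
     (X\<^bsub>kp q p\<^esub> [^]\<^bsub>kp_poly q p\<^esub> n)
       \<ominus>\<^bsub>kp_poly q p\<^esub> ring.poly_of_const (kp q p) (kp_of q p (A1_s q n))"

definition E :: "'k::field \<Rightarrow> nat \<Rightarrow> 'k free_alg set set \<Rightarrow> 'k kfield list set ring" where
  "E q n p = Rupt\<^bsub>kp q p\<^esub> (carrier (kp q p)) (E_modulus q n p)"

definition E_class ::
  "'k::field \<Rightarrow> nat \<Rightarrow> 'k free_alg set set \<Rightarrow> 'k kfield list \<Rightarrow> 'k kfield list set" where
  "E_class q n p g = (PIdl\<^bsub>kp_poly q p\<^esub> (E_modulus q n p)) +>\<^bsub>kp_poly q p\<^esub> g"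

definition E_h :: "'k::field \<Rightarrow> nat \<Rightarrow> 'k free_alg set set \<Rightarrow> 'k kfield list set" where
  "E_h q n p = E_class q n p X\<^bsub>kp q p\<^esub>"

definition E_const ::
  "'k::field \<Rightarrow> nat \<Rightarrow> 'k free_alg set set \<Rightarrow> 'k kfield \<Rightarrow> 'k kfield list set" where
  "E_const q n p c = E_class q n p (ring.poly_of_const (kp q p) c)"

text \<open>
  \<open>\<sigma>\<close> is a \<open>k(\<pp>)\<close>-automorphism of \<open>E(s, \<pp>)\<close> with \<open>\<sigma>(h) = qh\<close>. Since \<open>h\<close> generates \<open>E(s, \<pp>)\<close>
  over \<open>k(\<pp>)\<close>, this determines \<open>\<sigma>\<close> on the carrier (its values elsewhere are irrelevant).
\<close>

definition is_sigma ::
  "'k::field \<Rightarrow> nat \<Rightarrow> 'k free_alg set set \<Rightarrow> ('k kfield list set \<Rightarrow> 'k kfield list set) \<Rightarrow> bool"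
where
  "is_sigma q n p \<sigma> \<longleftrightarrow>
     \<sigma> \<in> ring_iso (E q n p) (E q n p) \<and>
     (\<forall>c \<in> carrier (kp q p). \<sigma> (E_const q n p c) = E_const q n p c) \<and>
     \<sigma> (E_h q n p) = E_const q n p (kp_of q p (A1_const q q)) \<otimes>\<^bsub>E q n p\<^esub> E_h q n p"

end

theory Submission
  imports Defs
begin

text \<open>
  Over a prime \<open>p\<close> of the centre with \<open>t, s \<notin> p\<close> the algebra \<open>A\<^sub>1\<close> becomes, after inverting central
  elements outside \<open>p\<close>, the cyclic algebra \<open>\<Oplus> E x\<^sup>j\<close> (\<open>j < n\<close>) with \<open>x e = \<sigma>(e) x\<close>, \<open>x\<^sup>n = a\<close>. Its left
  ideals are the \<open>\<sigma>\<close>-stable subspaces of \<open>E\<^sup>n\<close>; one of dimension \<open>d\<close> is a solution of the matrix equation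
  of size \<open>d\<close>, and conversely a solution of size \<open>d < n\<close> turns \<open>E\<^sup>d\<close> into a module, in which an element has a proper
  nonzero annihilator. Hence the cyclic algebra is a domain exactly when no \<open>d < n\<close> occurs,
  and \<open>d\<close> may be taken to divide \<open>n\<close> because the algebra is simple. A completely prime ideal containing neither
  \<open>x\<close> nor \<open>h\<close> is generated by its central elements, since eigenvectors of conjugation by \<open>x\<close> and \<open>h\<close>
  can be separated; modulo \<open>h\<close> the algebra is \<open>K[x, 1/x]\<close>, whose primes are the remaining cases.
\<close>

text \<open>Ideals of \<open>A1\<close> are replaced by ideals of the free algebra that contain the
  kernel of a faithful action on K[x][y]; this action supplies normal forms and the domain property.
  The cyclic algebra is not built as a ring: only its coordinate space E^n occurs, with left
  multiplication by x as a shift and right multiplications as linear maps, and \<open>A1\<close> is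
  mapped to it by u -> u * 1. For a completely prime ideal it is a conclusion that E is a field, so
  this map is set up over a commutative ring in which just the central elements outside p are
  assumed to be units. Two families of elements carry the argument. The y^b x^a with a, b < n form a
  basis over K[t, r] and so detect the ideal generated by p, but conjugation by x does not scale
  them. The h^i x^j are scaled by conjugation with x and with h, but they span only after t is
  inverted; multiplication by a power of t passes between the two families. The constant 1/(q-1)
  solves 1 + c = q c, which turns xy = qyx + 1 into xh = qhx and hy = qyh.\<close>

section \<open>Coordinate spaces over a commutative ring\<close>

text \<open>The space R^d carries a pointwise product because \<open>dimension\<close>,
  \<open>Span\<close> and \<open>independent\<close> concern subspaces of a ring over a subfield;
  the subfield will be the diagonal \<open>Scal d\<close>. Vectors are total functions that vanish
  from d on, so equality of vectors is equality of functions.\<close>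

definition fun_ring :: "('a, 'b) ring_scheme \<Rightarrow> nat \<Rightarrow> (nat \<Rightarrow> 'a) ring" where
  "fun_ring R d = \<lparr>
     carrier = {f. (\<forall>i<d. f i \<in> carrier R) \<and> (\<forall>i\<ge>d. f i = \<zero>\<^bsub>R\<^esub>)},
     monoid.mult = (\<lambda>f g i. f i \<otimes>\<^bsub>R\<^esub> g i),
     one = (\<lambda>i. if i < d then \<one>\<^bsub>R\<^esub> else \<zero>\<^bsub>R\<^esub>),
     ring.zero = (\<lambda>i. \<zero>\<^bsub>R\<^esub>),
     add = (\<lambda>f g i. f i \<oplus>\<^bsub>R\<^esub> g i)\<rparr>"

text \<open>Scalar multiplication without reference to the length of the vector;
  \<open>const_fun_mult\<close> identifies it with the product by a diagonal element.\<close>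

definition smul :: "('a, 'b) ring_scheme \<Rightarrow> 'a \<Rightarrow> (nat \<Rightarrow> 'a) \<Rightarrow> nat \<Rightarrow> 'a" where
  "smul R e f = (\<lambda>i. e \<otimes>\<^bsub>R\<^esub> f i)"

definition const_fun :: "('a, 'b) ring_scheme \<Rightarrow> nat \<Rightarrow> 'a \<Rightarrow> nat \<Rightarrow> 'a" where
  "const_fun R d e = (\<lambda>i. if i < d then e else \<zero>\<^bsub>R\<^esub>)"

definition unit_fun :: "('a, 'b) ring_scheme \<Rightarrow> nat \<Rightarrow> nat \<Rightarrow> 'a" where
  "unit_fun R j = (\<lambda>i. if i = j then \<one>\<^bsub>R\<^esub> else \<zero>\<^bsub>R\<^esub>)"

context cring
begin

abbreviation V :: "nat \<Rightarrow> (nat \<Rightarrow> 'a) ring" where "V d \<equiv> fun_ring R d"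

abbreviation Scal :: "nat \<Rightarrow> (nat \<Rightarrow> 'a) set" where "Scal d \<equiv> const_fun R d ` carrier R"

lemma V_simps:
  "monoid.mult (V d) f g = (\<lambda>i. f i \<otimes> g i)"
  "add (V d) f g = (\<lambda>i. f i \<oplus> g i)"
  "\<one>\<^bsub>V d\<^esub> = (\<lambda>i. if i < d then \<one> else \<zero>)"
  "\<zero>\<^bsub>V d\<^esub> = (\<lambda>i. \<zero>)"
  by (simp_all add: fun_ring_def)

lemma V_carrier_iff: "f \<in> carrier (V d) \<longleftrightarrow> (\<forall>i. f i \<in> carrier R) \<and> (\<forall>i\<ge>d. f i = \<zero>)"
  by (auto simp: fun_ring_def) (metis not_le zero_closed)

lemma V_mem: "f \<in> carrier (V d) \<Longrightarrow> f i \<in> carrier R"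
  by (simp add: V_carrier_iff)

lemma V_zero_above: "f \<in> carrier (V d) \<Longrightarrow> d \<le> i \<Longrightarrow> f i = \<zero>"
  by (simp add: V_carrier_iff)

lemma V_cring: "cring (V d)"
proof (rule cringI)
  show "abelian_group (V d)"
  proof (rule abelian_groupI)
    fix f assume f: "f \<in> carrier (V d)"
    show "\<exists>g\<in>carrier (V d). g \<oplus>\<^bsub>V d\<^esub> f = \<zero>\<^bsub>V d\<^esub>"
      by (rule bexI[of _ "\<lambda>i. \<ominus> f i"]) (use f in \<open>auto simp: V_simps V_carrier_iff l_neg\<close>)
  qed (auto simp: V_simps V_carrier_iff a_ac)
  show "Group.comm_monoid (V d)"
    by (rule comm_monoidI)
       (auto simp: V_simps V_carrier_iff m_ac not_le intro!: ext)
qed (auto simp: V_simps V_carrier_iff l_distr)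

lemma V_ring: "ring (V d)"
  using V_cring by (rule cring.axioms)

lemma V_a_inv:
  assumes "f \<in> carrier (V d)"
  shows "\<ominus>\<^bsub>V d\<^esub> f = (\<lambda>i. \<ominus> f i)"
proof -
  interpret V: cring "V d" by (rule V_cring)
  have "(\<lambda>i. \<ominus> f i) \<in> carrier (V d)"
    using assms by (auto simp: V_carrier_iff)
  moreover have "(\<lambda>i. \<ominus> f i) \<oplus>\<^bsub>V d\<^esub> f = \<zero>\<^bsub>V d\<^esub>"
    using assms by (auto simp: V_simps V_carrier_iff l_neg)
  ultimately show ?thesis
    using assms V.minus_equality by blast
qed

lemma V_finsum:
  assumes "finite J" "\<And>j. j \<in> J \<Longrightarrow> F j \<in> carrier (V d)"
  shows "(\<Oplus>\<^bsub>V d\<^esub> j \<in> J. F j) = (\<lambda>i. \<Oplus> j \<in> J. F j i)"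
  using assms
proof (induction J rule: finite_induct)
  case empty
  interpret V: cring "V d" by (rule V_cring)
  show ?case by (simp add: V_simps)
next
  case (insert j J)
  interpret V: cring "V d" by (rule V_cring)
  show ?case
    using insert by (auto simp: V_simps V_carrier_iff Pi_iff)
qed

lemma const_fun_in_V: "e \<in> carrier R \<Longrightarrow> const_fun R d e \<in> carrier (V d)"
  by (auto simp: const_fun_def V_carrier_iff)

lemma const_fun_mult:
  "e \<in> carrier R \<Longrightarrow> f \<in> carrier (V d) \<Longrightarrow> const_fun R d e \<otimes>\<^bsub>V d\<^esub> f = smul R e f"
  by (auto simp: const_fun_def V_simps V_carrier_iff smul_def)

lemma smul_in_V: "e \<in> carrier R \<Longrightarrow> f \<in> carrier (V d) \<Longrightarrow> smul R e f \<in> carrier (V d)"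
  by (auto simp: smul_def V_carrier_iff)

lemma unit_fun_in_V: "j < d \<Longrightarrow> unit_fun R j \<in> carrier (V d)"
  by (auto simp: unit_fun_def V_carrier_iff)

lemma smul_smul:
  "e \<in> carrier R \<Longrightarrow> e' \<in> carrier R \<Longrightarrow> f \<in> carrier (V d) \<Longrightarrow>
   smul R e (smul R e' f) = smul R (e \<otimes> e') f"
  by (auto simp: smul_def V_carrier_iff m_assoc)

lemma smul_one: "f \<in> carrier (V d) \<Longrightarrow> smul R \<one> f = f"
  by (auto simp: smul_def V_carrier_iff)

lemma smul_zero: "f \<in> carrier (V d) \<Longrightarrow> smul R \<zero> f = \<zero>\<^bsub>V d\<^esub>"
  by (auto simp: smul_def V_carrier_iff V_simps)

lemma smul_add:
  "e \<in> carrier R \<Longrightarrow> f \<in> carrier (V d) \<Longrightarrow> g \<in> carrier (V d) \<Longrightarrow>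
   smul R e (f \<oplus>\<^bsub>V d\<^esub> g) = smul R e f \<oplus>\<^bsub>V d\<^esub> smul R e g"
  by (auto simp: smul_def V_carrier_iff V_simps r_distr)

lemma add_smul:
  "e \<in> carrier R \<Longrightarrow> e' \<in> carrier R \<Longrightarrow> f \<in> carrier (V d) \<Longrightarrow>
   smul R (e \<oplus> e') f = smul R e f \<oplus>\<^bsub>V d\<^esub> smul R e' f"
  by (auto simp: smul_def V_carrier_iff V_simps l_distr)

lemma V_finsum_smul:
  assumes "finite J" "\<And>j. j \<in> J \<Longrightarrow> c j \<in> carrier R" "\<And>j. j \<in> J \<Longrightarrow> v j \<in> carrier (V d)"
  shows "(\<Oplus>\<^bsub>V d\<^esub> j \<in> J. smul R (c j) (v j)) i = (\<Oplus>j\<in>J. c j \<otimes> v j i)"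
proof -
  have "smul R (c j) (v j) \<in> carrier (V d)" if "j \<in> J" for j
    using assms(2,3)[OF that] by (rule smul_in_V)
  from V_finsum[OF assms(1) this] show ?thesis
    by (simp add: smul_def)
qed

lemma finsum_single:
  assumes "finite J" "j \<in> J" "f j \<in> carrier R" "\<And>i. i \<in> J \<Longrightarrow> i \<noteq> j \<Longrightarrow> f i = \<zero>"
  shows "(\<Oplus>i\<in>J. f i) = f j"
proof -
  have "(\<Oplus>i\<in>J. f i) = (\<Oplus>i\<in>{j}. f i)"
    using assms by (intro add.finprod_mono_neutral_cong_right) (auto simp: Pi_iff, metis zero_closed)
  thus ?thesis
    using assms by simp
qed

lemma finsum_swap:
  assumes "finite I" "finite J" "\<And>i j. i \<in> I \<Longrightarrow> j \<in> J \<Longrightarrow> f i j \<in> carrier R"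
  shows "(\<Oplus>i\<in>I. \<Oplus>j\<in>J. f i j) = (\<Oplus>j\<in>J. \<Oplus>i\<in>I. f i j)"
  using assms(1,3)
proof (induction I rule: finite_induct)
  case empty
  thus ?case by simp
next
  case (insert k I)
  have "(\<Oplus>i\<in>insert k I. \<Oplus>j\<in>J. f i j) = (\<Oplus>j\<in>J. f k j) \<oplus> (\<Oplus>j\<in>J. \<Oplus>i\<in>I. f i j)"
    using insert by (subst finsum_insert) (auto intro!: finsum_closed)
  also have "\<dots> = (\<Oplus>j\<in>J. f k j \<oplus> (\<Oplus>i\<in>I. f i j))"
    using insert by (subst finsum_addf) (auto intro!: finsum_closed)
  also have "\<dots> = (\<Oplus>j\<in>J. \<Oplus>i\<in>insert k I. f i j)"
    using insert by (intro finsum_cong') (auto intro!: finsum_closed)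
  finally show ?case .
qed

lemma V_unit_expansion:
  assumes "b \<in> carrier (V d)"
  shows "b = (\<Oplus>\<^bsub>V d\<^esub> j \<in> {..<d}. smul R (b j) (unit_fun R j))"
proof
  fix i
  have "(\<Oplus>\<^bsub>V d\<^esub> j \<in> {..<d}. smul R (b j) (unit_fun R j)) i = (\<Oplus>j\<in>{..<d}. b j \<otimes> (if i = j then \<one> else \<zero>))"
    using assms
    by (subst V_finsum) (auto simp: smul_def unit_fun_def V_carrier_iff)
  also have "\<dots> = b i"
  proof (cases "i < d")
    case True
    thus ?thesis
      using assms by (subst finsum_single[of _ i]) (auto simp: V_carrier_iff)
  next
    case False
    hence "(\<Oplus>j\<in>{..<d}. b j \<otimes> (if i = j then \<one> else \<zero>)) = (\<Oplus>j\<in>{..<d}. \<zero>)"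
      using assms by (intro finsum_cong') (auto simp: V_carrier_iff)
    thus ?thesis
      using assms False by (simp add: V_carrier_iff)
  qed
  finally show "b i = (\<Oplus>\<^bsub>V d\<^esub> j \<in> {..<d}. smul R (b j) (unit_fun R j)) i"
    by simp
qed

end

text \<open>Serves to pass between the lists in which bases and relations are given and sums over
  indices. The lists are split at their end because \<open>{..<Suc m}\<close> gains its last
  index.\<close>

lemma (in ring) combine_eq_finsum:
  assumes "length Ks = length Us" "set Ks \<subseteq> carrier R" "set Us \<subseteq> carrier R"
  shows "combine Ks Us = (\<Oplus>i\<in>{..<length Us}. Ks ! i \<otimes> Us ! i)"
  using assms
proof (induction Us arbitrary: Ks rule: rev_induct)
  case Nil
  thus ?case by simp
next
  case (snoc u Us)
  from snoc.prems(1) obtain Ks' k where Ks: "Ks = Ks' @ [k]" "length Ks' = length Us"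
    by (metis length_append_singleton length_Suc_conv_rev)
  have carr: "k \<in> carrier R" "u \<in> carrier R" "set Ks' \<subseteq> carrier R" "set Us \<subseteq> carrier R"
    using snoc.prems Ks by auto
  hence nth: "i < length Us \<Longrightarrow> Ks' ! i \<in> carrier R \<and> Us ! i \<in> carrier R" for i
    using Ks(2) by (auto simp: subset_iff)
  have 1: "combine Ks (Us @ [u]) = combine Ks' Us \<oplus> combine [k] [u]"
    using carr Ks by (subst combine_append) auto
  have "combine Ks' Us = (\<Oplus>i\<in>{..<length Us}. Ks' ! i \<otimes> Us ! i)"
    using snoc.IH carr Ks by auto
  also have "\<dots> = (\<Oplus>i\<in>{..<length Us}. Ks ! i \<otimes> (Us @ [u]) ! i)"
    using nth Ks by (intro finsum_cong') (auto simp: nth_append)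
  finally have 2: "combine Ks' Us = (\<Oplus>i\<in>{..<length Us}. Ks ! i \<otimes> (Us @ [u]) ! i)" .
  have 3: "(\<lambda>i. Ks ! i \<otimes> (Us @ [u]) ! i) \<in> {..<length Us} \<rightarrow> carrier R"
    using nth Ks by (auto simp: nth_append)
  hence "(\<Oplus>i\<in>{..<length Us}. Ks ! i \<otimes> (Us @ [u]) ! i) \<in> carrier R"
    by (rule finsum_closed)
  with 3 show ?case
    unfolding 1 2 using carr Ks by (simp add: lessThan_Suc nth_append a_comm)
qed

section \<open>Subspaces, linear maps and dimension\<close>

context cring
begin

definition linear_map :: "nat \<Rightarrow> ((nat \<Rightarrow> 'a) \<Rightarrow> nat \<Rightarrow> 'a) \<Rightarrow> bool" where
  "linear_map d F \<longleftrightarrow>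
     (\<forall>v\<in>carrier (V d). F v \<in> carrier (V d)) \<and>
     (\<forall>v\<in>carrier (V d). \<forall>w\<in>carrier (V d). F (v \<oplus>\<^bsub>V d\<^esub> w) = F v \<oplus>\<^bsub>V d\<^esub> F w) \<and>
     (\<forall>e\<in>carrier R. \<forall>v\<in>carrier (V d). F (smul R e v) = smul R e (F v))"

lemma linear_mapD:
  assumes "linear_map d F" "v \<in> carrier (V d)"
  shows "F v \<in> carrier (V d)"
    "w \<in> carrier (V d) \<Longrightarrow> F (v \<oplus>\<^bsub>V d\<^esub> w) = F v \<oplus>\<^bsub>V d\<^esub> F w"
    "e \<in> carrier R \<Longrightarrow> F (smul R e v) = smul R e (F v)"
  using assms unfolding linear_map_def by simp_all

abbreviation subspace :: "nat \<Rightarrow> (nat \<Rightarrow> 'a) set \<Rightarrow> bool" where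
  "subspace d L \<equiv> subalgebra (Scal d) L (V d)"

abbreviation vdim :: "nat \<Rightarrow> nat \<Rightarrow> (nat \<Rightarrow> 'a) set \<Rightarrow> bool" where
  "vdim d m L \<equiv> ring.dimension (V d) m (Scal d) L"

lemma Scal_carrier: "Scal d \<subseteq> carrier (V d)"
  using const_fun_in_V by auto

lemma subspaceI:
  assumes "L \<subseteq> carrier (V d)" "\<zero>\<^bsub>V d\<^esub> \<in> L"
    "\<And>v w. v \<in> L \<Longrightarrow> w \<in> L \<Longrightarrow> v \<oplus>\<^bsub>V d\<^esub> w \<in> L"
    "\<And>e v. e \<in> carrier R \<Longrightarrow> v \<in> L \<Longrightarrow> smul R e v \<in> L"
  shows "subspace d L"
proof -
  interpret V: cring "V d" by (rule V_cring)
  \<comment> \<open>Negation is multiplication by the scalar -1.\<close>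
  have neg: "\<ominus>\<^bsub>V d\<^esub> v \<in> L" if "v \<in> L" for v
  proof -
    have "\<ominus>\<^bsub>V d\<^esub> v = smul R (\<ominus> \<one>) v"
      using that assms(1) by (subst V_a_inv) (auto simp: smul_def V_carrier_iff l_minus)
    thus ?thesis
      using assms(4)[of "\<ominus> \<one>" v] that by simp
  qed
  show ?thesis
  proof
    show "k \<otimes>\<^bsub>V d\<^esub> v \<in> L" if "k \<in> Scal d" "v \<in> L" for k v
      using that assms(1,4) const_fun_mult by auto
    show "inv\<^bsub>add_monoid (V d)\<^esub> x \<in> L" if "x \<in> L" for x
      using neg[OF that] by (simp add: a_inv_def)
  qed (use assms in auto)
qed

lemma subspaceD:
  assumes "subspace d L"
  shows "L \<subseteq> carrier (V d)" "\<zero>\<^bsub>V d\<^esub> \<in> L"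
    "\<And>v w. v \<in> L \<Longrightarrow> w \<in> L \<Longrightarrow> v \<oplus>\<^bsub>V d\<^esub> w \<in> L"
    "\<And>e v. e \<in> carrier R \<Longrightarrow> v \<in> L \<Longrightarrow> smul R e v \<in> L"
proof -
  interpret V: cring "V d" by (rule V_cring)
  interpret L: subalgebra "Scal d" L "V d" by fact
  show sub: "L \<subseteq> carrier (V d)"
    using L.subset by simp
  show "\<zero>\<^bsub>V d\<^esub> \<in> L" "\<And>v w. v \<in> L \<Longrightarrow> w \<in> L \<Longrightarrow> v \<oplus>\<^bsub>V d\<^esub> w \<in> L"
    using L.one_closed L.m_closed by simp_all
  show "smul R e v \<in> L" if "e \<in> carrier R" "v \<in> L" for e v
  proof -
    have "const_fun R d e \<otimes>\<^bsub>V d\<^esub> v \<in> L"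
      using that by (intro L.smult_closed imageI)
    moreover have "v \<in> carrier (V d)"
      using that(2) sub by (rule subsetD[rotated])
    ultimately show ?thesis
      using const_fun_mult[OF that(1)] by simp
  qed
qed

lemma subspace_finsum:
  assumes "subspace d L" "finite J" "\<And>j. j \<in> J \<Longrightarrow> F j \<in> L"
  shows "(\<Oplus>\<^bsub>V d\<^esub> j \<in> J. F j) \<in> L"
  using assms(2,3)
proof (induction J rule: finite_induct)
  case empty
  interpret V: cring "V d" by (rule V_cring)
  show ?case using subspaceD(2)[OF assms(1)] by simp
next
  case (insert j J)
  interpret V: cring "V d" by (rule V_cring)
  have "F \<in> J \<rightarrow> carrier (V d)" "F j \<in> carrier (V d)"
    using insert subspaceD(1)[OF assms(1)] by auto
  thus ?case using insert subspaceD(3)[OF assms(1)] by simp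
qed

lemma linear_map_finsum:
  assumes "linear_map d F" "finite J" "\<And>j. j \<in> J \<Longrightarrow> v j \<in> carrier (V d)"
  shows "F (\<Oplus>\<^bsub>V d\<^esub> j \<in> J. v j) = (\<Oplus>\<^bsub>V d\<^esub> j \<in> J. F (v j))"
proof -
  interpret V: cring "V d" by (rule V_cring)
  have z: "\<zero>\<^bsub>V d\<^esub> \<in> carrier (V d)" by simp
  \<comment> \<open>F(0) = 0 is drawn from homogeneity with the scalar 0.\<close>
  have "smul R \<zero> (\<zero>\<^bsub>V d\<^esub>) = \<zero>\<^bsub>V d\<^esub>" "smul R \<zero> (F (\<zero>\<^bsub>V d\<^esub>)) = \<zero>\<^bsub>V d\<^esub>"
    using assms(1) z smul_zero unfolding linear_map_def by blast+
  hence F0: "F (\<zero>\<^bsub>V d\<^esub>) = \<zero>\<^bsub>V d\<^esub>"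
    using assms(1) z unfolding linear_map_def by (metis zero_closed)
  show ?thesis
    using assms(2,3)
  proof (induction J rule: finite_induct)
    case empty
    show ?case using F0 by simp
  next
    case (insert j J)
    have "F (v j \<oplus>\<^bsub>V d\<^esub> (\<Oplus>\<^bsub>V d\<^esub> j \<in> J. v j)) = F (v j) \<oplus>\<^bsub>V d\<^esub> F (\<Oplus>\<^bsub>V d\<^esub> j \<in> J. v j)"
      using insert assms(1) unfolding linear_map_def by (auto intro!: V.finsum_closed)
    thus ?case using insert assms(1) by (auto simp: linear_map_def Pi_iff)
  qed
qed

lemma linear_map_zero:
  assumes "linear_map d F" shows "F (\<zero>\<^bsub>V d\<^esub>) = \<zero>\<^bsub>V d\<^esub>"
proof -
  interpret V: cring "V d" by (rule V_cring)
  show ?thesis using linear_map_finsum[OF assms, of "{}"] by simp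
qed

end

context field
begin

text \<open>The diagonal is the image of the field under a ring homomorphism; d > 0 makes 1 and 0
  differ in the product ring.\<close>

lemma Scal_subfield:
  assumes "d > 0"
  shows "subfield (Scal d) (V d)"
proof -
  interpret V: cring "V d" by (rule V_cring)
  have "ring_hom_ring R (V d) (const_fun R d)"
    by (intro ring_hom_ringI2[OF ring_axioms V_ring] ring_hom_memI const_fun_in_V)
       (auto simp: const_fun_def V_simps intro!: ext)
  then interpret H: ring_hom_ring R "V d" "const_fun R d" .
  have "const_fun R d \<one> 0 \<noteq> const_fun R d \<zero> 0"
    using assms by (simp add: const_fun_def)
  hence "\<one>\<^bsub>V d\<^esub> \<noteq> \<zero>\<^bsub>V d\<^esub>"
    using H.hom_one H.hom_zero by metis
  thus ?thesis
    using H.img_is_subfield(2)[OF carrier_is_subfield] by simp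
qed

text \<open>The flag of the subspaces \<open>W m\<close> of vectors supported below m grows by one
  unit vector at each step.\<close>

lemma V_dimension:
  assumes "d > 0"
  shows "vdim d d (carrier (V d))"
proof -
  interpret V: cring "V d" by (rule V_cring)
  define W where "W m = {f \<in> carrier (V d). \<forall>i\<ge>m. f i = \<zero>}" for m
  have "vdim d m (W m)" if "m \<le> d" for m
    using that
  proof (induction m)
    case 0
    have "W 0 = {\<zero>\<^bsub>V d\<^esub>}"
      by (auto simp: W_def V_simps V_carrier_iff)
    thus ?case by simp
  next
    case (Suc m)
    have "W (Suc m) = V.line_extension (Scal d) (unit_fun R m) (W m)"
    proof (intro equalityI subsetI)
      fix f assume f: "f \<in> W (Suc m)"
      hence fm: "f m \<in> carrier R" "\<And>i. f i \<in> carrier R" by (auto simp: W_def V_carrier_iff)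
      have "f = const_fun R d (f m) \<otimes>\<^bsub>V d\<^esub> unit_fun R m \<oplus>\<^bsub>V d\<^esub> f(m := \<zero>)"
        using fm f Suc.prems by (auto simp: V_simps const_fun_def unit_fun_def fun_eq_iff)
      moreover have "f(m := \<zero>) \<in> W m"
        using f by (auto simp: W_def V_carrier_iff)
      ultimately show "f \<in> V.line_extension (Scal d) (unit_fun R m) (W m)"
        using fm unfolding V.line_extension_mem_iff by blast
    next
      fix f assume "f \<in> V.line_extension (Scal d) (unit_fun R m) (W m)"
      then obtain e w where e: "e \<in> carrier R" "w \<in> W m"
        "f = const_fun R d e \<otimes>\<^bsub>V d\<^esub> unit_fun R m \<oplus>\<^bsub>V d\<^esub> w"
        unfolding V.line_extension_mem_iff by blast
      have "f \<in> carrier (V d)"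
        using e Suc.prems by (auto simp: W_def const_fun_in_V unit_fun_in_V)
      moreover have "f i = \<zero>" if "i \<ge> Suc m" for i
        using e that by (auto simp: W_def V_simps unit_fun_def const_fun_def)
      ultimately show "f \<in> W (Suc m)" by (simp add: W_def)
    qed
    moreover have "unit_fun R m \<notin> W m"
      by (auto simp: W_def unit_fun_def)
    ultimately show ?case
      using Suc unit_fun_in_V[of m d] by (auto intro!: V.Suc_dim)
  qed
  from this[of d] have "vdim d d (W d)" by simp
  also have "W d = carrier (V d)" by (auto simp: W_def V_carrier_iff)
  finally show ?thesis .
qed

text \<open>A basis of \<open>L\<close> is an independent list in a space of dimension d, so it has
  at most d members, and with d members it spans the whole space.\<close>

lemma subspace_dim:
  assumes "d > 0" "subspace d L"
  obtains m where "vdim d m L" "m \<le> d" "m = d \<longleftrightarrow> L = carrier (V d)"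
proof -
  interpret V: cring "V d" by (rule V_cring)
  note sf = Scal_subfield[OF assms(1)]
  have sub: "L \<subseteq> carrier (V d)" using subspaceD(1)[OF assms(2)] .
  have "V.finite_dimension (Scal d) L"
    using V.subalbegra_incl_imp_finite_dimension[OF sf V.finite_dimensionI[OF V_dimension[OF assms(1)]] assms(2) sub] .
  then obtain m where m: "vdim d m L"
    unfolding V.finite_dimension_def by (elim exE)
  obtain Us where Us: "set Us \<subseteq> carrier (V d)" "V.independent (Scal d) Us" "length Us = m" "V.Span (Scal d) Us = L"
    using V.exists_base[OF sf m] by (elim exE conjE)
  have "m \<le> d"
    using V.independent_length_le_dimension[OF sf V_dimension[OF assms(1)] Us(2,1)] Us(3) by simp
  moreover have "m = d \<longleftrightarrow> L = carrier (V d)"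
    using V.independent_length_eq_dimension[OF sf V_dimension[OF assms(1)] Us(2,1)] Us by simp
  ultimately show ?thesis by (rule that[OF m])
qed

lemma subspace_dim_mono:
  assumes "d > 0" "subspace d L" "vdim d m' L'" "L \<subseteq> L'"
  obtains m where "vdim d m L" "m \<le> m'" "m = m' \<longleftrightarrow> L = L'"
proof -
  interpret V: cring "V d" by (rule V_cring)
  note sf = Scal_subfield[OF assms(1)]
  obtain m where m: "vdim d m L" by (rule subspace_dim[OF assms(1,2)])
  obtain Us where Us: "set Us \<subseteq> carrier (V d)" "V.independent (Scal d) Us" "length Us = m" "V.Span (Scal d) Us = L"
    using V.exists_base[OF sf m] by (elim exE conjE)
  have "set Us \<subseteq> L'"
    using V.Span_base_incl[OF sf Us(1)] Us(4) assms(4) by auto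
  hence "m \<le> m'" "m = m' \<longleftrightarrow> L = L'"
    using V.independent_length_le_dimension[OF sf assms(3) Us(2)]
      V.independent_length_eq_dimension[OF sf assms(3) Us(2)] Us(3,4) by auto
  thus ?thesis by (rule that[OF m])
qed

lemma linear_map_Span:
  assumes "d > 0" "linear_map d F" "set Us \<subseteq> carrier (V d)"
  shows "ring.Span (V d) (Scal d) (map F Us) = F ` ring.Span (V d) (Scal d) Us"
  using assms(3)
proof (induction Us)
  case Nil
  interpret V: cring "V d" by (rule V_cring)
  show ?case using linear_map_zero[OF assms(2)] by simp
next
  case (Cons u Us)
  interpret V: cring "V d" by (rule V_cring)
  note sf = Scal_subfield[OF assms(1)]
  have sub: "V.Span (Scal d) Us \<subseteq> carrier (V d)"
    using Cons.prems V.Span_in_carrier[OF Scal_carrier] by auto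
  have eq: "F (const_fun R d e \<otimes>\<^bsub>V d\<^esub> u \<oplus>\<^bsub>V d\<^esub> w) = const_fun R d e \<otimes>\<^bsub>V d\<^esub> F u \<oplus>\<^bsub>V d\<^esub> F w"
    if "e \<in> carrier R" "w \<in> V.Span (Scal d) Us" for e w
  proof -
    have w: "w \<in> carrier (V d)" "u \<in> carrier (V d)"
      using that sub Cons.prems by auto
    show ?thesis
      using w that(1) linear_mapD[OF assms(2)] by (simp add: const_fun_mult smul_in_V)
  qed
  have "V.line_extension (Scal d) (F u) (F ` V.Span (Scal d) Us) = F ` V.line_extension (Scal d) u (V.Span (Scal d) Us)"
  proof (intro equalityI subsetI)
    fix x assume "x \<in> V.line_extension (Scal d) (F u) (F ` V.Span (Scal d) Us)"
    then obtain e w where "e \<in> carrier R" "w \<in> V.Span (Scal d) Us" "x = const_fun R d e \<otimes>\<^bsub>V d\<^esub> F u \<oplus>\<^bsub>V d\<^esub> F w"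
      unfolding V.line_extension_mem_iff by blast
    hence "x = F (const_fun R d e \<otimes>\<^bsub>V d\<^esub> u \<oplus>\<^bsub>V d\<^esub> w)"
      using eq by simp
    moreover have "const_fun R d e \<otimes>\<^bsub>V d\<^esub> u \<oplus>\<^bsub>V d\<^esub> w \<in> V.line_extension (Scal d) u (V.Span (Scal d) Us)"
      unfolding V.line_extension_mem_iff using \<open>e \<in> carrier R\<close> \<open>w \<in> V.Span (Scal d) Us\<close> by blast
    ultimately show "x \<in> F ` V.line_extension (Scal d) u (V.Span (Scal d) Us)"
      by (rule image_eqI)
  next
    fix x assume "x \<in> F ` V.line_extension (Scal d) u (V.Span (Scal d) Us)"
    then obtain z where z: "z \<in> V.line_extension (Scal d) u (V.Span (Scal d) Us)" "x = F z"
      by (rule imageE)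
    then obtain e w where ew: "e \<in> carrier R" "w \<in> V.Span (Scal d) Us" "z = const_fun R d e \<otimes>\<^bsub>V d\<^esub> u \<oplus>\<^bsub>V d\<^esub> w"
      unfolding V.line_extension_mem_iff by blast
    with z have "x = const_fun R d e \<otimes>\<^bsub>V d\<^esub> F u \<oplus>\<^bsub>V d\<^esub> F w"
      using eq by simp
    thus "x \<in> V.line_extension (Scal d) (F u) (F ` V.Span (Scal d) Us)"
      unfolding V.line_extension_mem_iff using \<open>e \<in> carrier R\<close> \<open>w \<in> V.Span (Scal d) Us\<close> by blast
  qed
  moreover have "V.Span (Scal d) (map F Us) = F ` V.Span (Scal d) Us"
    using Cons by auto
  ultimately show ?case
    by simp
qed

text \<open>A basis is carried to an independent list, by induction on the list: injectivity keeps
  the image of the new vector out of the image of the span of the others.\<close>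

lemma linear_map_dim:
  assumes "d > 0" "linear_map d F" "vdim d m L" "inj_on F L"
  shows "vdim d m (F ` L)"
proof -
  interpret V: cring "V d" by (rule V_cring)
  note sf = Scal_subfield[OF assms(1)]
  obtain Us where Us: "set Us \<subseteq> carrier (V d)" "V.independent (Scal d) Us" "length Us = m" "V.Span (Scal d) Us = L"
    using V.exists_base[OF sf assms(3)] by (elim exE conjE)
  have "V.independent (Scal d) (map F Us)" if "set Us \<subseteq> carrier (V d)" "V.independent (Scal d) Us"
     "inj_on F (V.Span (Scal d) Us)" for Us
    using that
  proof (induction Us)
    case (Cons u Us)
    have carr: "u \<in> carrier (V d)" "set Us \<subseteq> carrier (V d)"
      using Cons.prems(1) by auto
    have mono: "V.Span (Scal d) Us \<subseteq> V.Span (Scal d) (u # Us)"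
      by (rule V.mono_Span[OF sf carr(2,1)])
    have "u \<in> V.Span (Scal d) (u # Us)"
      using V.Span_base_incl[OF sf Cons.prems(1)] by (simp del: V.Span.simps)
    hence "F u \<notin> F ` V.Span (Scal d) Us"
      using Cons.prems(3) mono V.independent_backwards(1)[OF Cons.prems(2)]
      by (auto simp: inj_on_def simp del: V.Span.simps)
    moreover have "V.independent (Scal d) (map F Us)"
      by (rule Cons.IH[OF carr(2) V.independent_backwards(2)[OF Cons.prems(2)] inj_on_subset[OF Cons.prems(3) mono]])
    ultimately show ?case
      using linear_map_Span[OF assms(1,2) carr(2)] linear_mapD(1)[OF assms(2) carr(1)]
      by (auto intro!: V.li_Cons simp del: V.Span.simps)
  qed auto
  from V.dimension_independent[OF this[OF Us(1,2)]] show ?thesis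
    using Us assms(4) linear_map_Span[OF assms(1,2) Us(1)] by simp
qed

end

section \<open>Semilinear maps and twisted products of matrices\<close>

context cring
begin

text \<open>In a module over the cyclic algebra, multiplication by x is of this kind, because x e =
  \<theta>(e) x.\<close>

definition semilinear :: "nat \<Rightarrow> ('a \<Rightarrow> 'a) \<Rightarrow> ((nat \<Rightarrow> 'a) \<Rightarrow> nat \<Rightarrow> 'a) \<Rightarrow> bool" where
  "semilinear d \<theta> T \<longleftrightarrow>
     (\<forall>v\<in>carrier (V d). T v \<in> carrier (V d)) \<and>
     (\<forall>v\<in>carrier (V d). \<forall>w\<in>carrier (V d). T (v \<oplus>\<^bsub>V d\<^esub> w) = T v \<oplus>\<^bsub>V d\<^esub> T w) \<and>
     (\<forall>e\<in>carrier R. \<forall>v\<in>carrier (V d). T (smul R e v) = smul R (\<theta> e) (T v))"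

lemma semilinearD:
  assumes "semilinear d \<theta> T" "v \<in> carrier (V d)"
  shows "T v \<in> carrier (V d)"
    "w \<in> carrier (V d) \<Longrightarrow> T (v \<oplus>\<^bsub>V d\<^esub> w) = T v \<oplus>\<^bsub>V d\<^esub> T w"
    "e \<in> carrier R \<Longrightarrow> T (smul R e v) = smul R (\<theta> e) (T v)"
  using assms unfolding semilinear_def by simp_all

lemma semilinear_finsum:
  assumes "semilinear d \<theta> T" "\<theta> \<in> Ring.ring_hom R R" "finite J" "\<And>j. j \<in> J \<Longrightarrow> v j \<in> carrier (V d)"
  shows "T (\<Oplus>\<^bsub>V d\<^esub> j \<in> J. v j) = (\<Oplus>\<^bsub>V d\<^esub> j \<in> J. T (v j))"
proof -
  interpret V: cring "V d" by (rule V_cring)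
  have z: "\<zero>\<^bsub>V d\<^esub> \<in> carrier (V d)" by simp
  have "T (\<zero>\<^bsub>V d\<^esub> \<oplus>\<^bsub>V d\<^esub> \<zero>\<^bsub>V d\<^esub>) = T (\<zero>\<^bsub>V d\<^esub>) \<oplus>\<^bsub>V d\<^esub> T (\<zero>\<^bsub>V d\<^esub>)"
    by (rule semilinearD(2)[OF assms(1) z z])
  hence T0: "T (\<zero>\<^bsub>V d\<^esub>) = \<zero>\<^bsub>V d\<^esub>"
    using semilinearD(1)[OF assms(1) z] V.add.l_cancel_one' by simp
  show ?thesis
    using assms(3,4)
  proof (induction J rule: finite_induct)
    case empty
    show ?case using T0 by simp
  next
    case (insert j J)
    have carr: "v j \<in> carrier (V d)" "v \<in> J \<rightarrow> carrier (V d)" "(\<lambda>j. T (v j)) \<in> J \<rightarrow> carrier (V d)"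
      "T (v j) \<in> carrier (V d)"
      using insert.prems semilinearD(1)[OF assms(1)] by auto
    have "T (v j \<oplus>\<^bsub>V d\<^esub> (\<Oplus>\<^bsub>V d\<^esub> j \<in> J. v j)) = T (v j) \<oplus>\<^bsub>V d\<^esub> T (\<Oplus>\<^bsub>V d\<^esub> j \<in> J. v j)"
      using carr by (intro semilinearD(2)[OF assms(1)] V.finsum_closed)
    thus ?case using insert carr by simp
  qed
qed

lemma hom_pow_closed:
  assumes "\<theta> \<in> Ring.ring_hom R R" "e \<in> carrier R"
  shows "(\<theta> ^^ m) e \<in> carrier R"
  using assms by (induction m) (auto simp: ring_hom_closed)

lemma hom_pow:
  assumes "\<theta> \<in> Ring.ring_hom R R"
  shows "\<theta> ^^ m \<in> Ring.ring_hom R R"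
proof (induction m)
  case 0
  show ?case by (auto intro!: ring_hom_memI)
next
  case (Suc m)
  have "\<theta> \<circ> \<theta> ^^ m \<in> Ring.ring_hom R R"
    by (rule ring_hom_trans[OF Suc assms])
  thus ?case by (simp add: comp_def)
qed

lemma semilinear_pow:
  assumes "semilinear d \<theta> T" "\<theta> \<in> Ring.ring_hom R R"
  shows "semilinear d (\<theta> ^^ m) (T ^^ m)"
proof (induction m)
  case 0
  show ?case by (simp add: semilinear_def)
next
  case (Suc m)
  show ?case
    unfolding semilinear_def
  proof (intro conjI ballI)
    fix v w assume v: "v \<in> carrier (V d)" and w: "w \<in> carrier (V d)"
    note D = semilinearD[OF Suc v]
    show "(T ^^ Suc m) (v \<oplus>\<^bsub>V d\<^esub> w) = (T ^^ Suc m) v \<oplus>\<^bsub>V d\<^esub> (T ^^ Suc m) w"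
      using D(2)[OF w] semilinearD(2)[OF assms(1) D(1) semilinearD(1)[OF Suc w]] by simp
  next
    fix e v assume e: "e \<in> carrier R" and v: "v \<in> carrier (V d)"
    note D = semilinearD[OF Suc v]
    show "(T ^^ Suc m) (smul R e v) = smul R ((\<theta> ^^ Suc m) e) ((T ^^ Suc m) v)"
      using D(3)[OF e] semilinearD(3)[OF assms(1) D(1) hom_pow_closed[OF assms(2) e]] by simp
  next
    fix v assume v: "v \<in> carrier (V d)"
    show "(T ^^ Suc m) v \<in> carrier (V d)"
      using semilinearD(1)[OF assms(1) semilinearD(1)[OF Suc v]] by simp
  qed
qed

text \<open>The product of b_0 + b_1 x + ... + b_(n-1) x^(n-1) with a module element v, when x acts
  as \<open>T\<close>.\<close>

definition orbit_comb :: "nat \<Rightarrow> ((nat \<Rightarrow> 'a) \<Rightarrow> nat \<Rightarrow> 'a) \<Rightarrow> nat \<Rightarrow> (nat \<Rightarrow> 'a) \<Rightarrow> (nat \<Rightarrow> 'a) \<Rightarrow> nat \<Rightarrow> 'a" where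
  "orbit_comb n T d v b = (\<Oplus>\<^bsub>V d\<^esub> j \<in> {..<n}. smul R (b j) ((T ^^ j) v))"

lemma mats_mem: "M \<in> mats R d \<Longrightarrow> i < d \<Longrightarrow> j < d \<Longrightarrow> M $$ (i, j) \<in> carrier R"
  by (fastforce simp: mats_def elements_mat_def)

lemma mat_in_mats:
  "(\<And>i j. i < d \<Longrightarrow> j < d \<Longrightarrow> f (i, j) \<in> carrier R) \<Longrightarrow> mat d d f \<in> mats R d"
  by (auto simp: mats_def elements_mat_def)

lemma twisted_power_in_mats:
  assumes "\<theta> \<in> Ring.ring_hom R R" "M \<in> mats R d"
  shows "twisted_power R d \<theta> M m \<in> mats R d"
proof (induction m)
  case 0
  show ?case by (auto simp: scalar_mat_def intro!: mat_in_mats)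
next
  case (Suc m)
  have "(\<Oplus>k\<in>{..<d}. map_mat (\<theta> ^^ m) M $$ (i, k) \<otimes> twisted_power R d \<theta> M m $$ (k, j)) \<in> carrier R"
    if "i < d" "j < d" for i j
  proof (rule finsum_closed, rule Pi_I)
    fix k assume "k \<in> {..<d}"
    moreover from this that have "map_mat (\<theta> ^^ m) M $$ (i, k) = (\<theta> ^^ m) (M $$ (i, k))"
      using assms(2) by (auto simp: mats_def)
    ultimately show "map_mat (\<theta> ^^ m) M $$ (i, k) \<otimes> twisted_power R d \<theta> M m $$ (k, j) \<in> carrier R"
      using that hom_pow_closed[OF assms(1) mats_mem[OF assms(2)]] mats_mem[OF Suc] by simp
  qed
  thus ?case by (auto simp: mat_prod_def intro!: mat_in_mats)
qed

text \<open>Row i of \<open>M\<close> holds the coordinates of T(u_i). Each further application of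
  \<open>T\<close> brings in one more twisted copy of \<open>M\<close>, and this is how the product
  in the matrix equation arises.\<close>

lemma twisted_power_action:
  assumes T: "semilinear D \<theta> T" and \<theta>: "\<theta> \<in> Ring.ring_hom R R" and M: "M \<in> mats R d"
    and u: "\<And>i. i < d \<Longrightarrow> u i \<in> carrier (V D)"
    and Tu: "\<And>i. i < d \<Longrightarrow> T (u i) = (\<Oplus>\<^bsub>V D\<^esub> j \<in> {..<d}. smul R (M $$ (i, j)) (u j))"
    and i: "i < d"
  shows "(T ^^ m) (u i) = (\<Oplus>\<^bsub>V D\<^esub> j \<in> {..<d}. smul R (twisted_power R d \<theta> M m $$ (i, j)) (u j))"
  using i
proof (induction m arbitrary: i)
  case 0
  interpret V: cring "V D" by (rule V_cring)
  have ui: "smul R \<one> (u i) = u i" "u i \<in> carrier (V D)"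
    using u 0 by (auto intro: smul_one)
  have "(\<Oplus>\<^bsub>V D\<^esub> j \<in> {..<d}. smul R (twisted_power R d \<theta> M 0 $$ (i, j)) (u j)) =
      smul R (twisted_power R d \<theta> M 0 $$ (i, i)) (u i)"
    using u 0 ui
    by (intro V.finsum_single[of "{..<d}" i "\<lambda>j. smul R (twisted_power R d \<theta> M 0 $$ (i, j)) (u j)"])
       (auto simp: scalar_mat_def smul_zero)
  also have "\<dots> = u i"
    using 0 ui by (simp add: scalar_mat_def)
  finally show ?case by simp
next
  case (Suc m)
  interpret V: cring "V D" by (rule V_cring)
  let ?t = "\<lambda>i j. twisted_power R d \<theta> M m $$ (i, j)"
  let ?s = "\<lambda>j. (\<theta> ^^ m) (M $$ (i, j))"
  have t: "?t j k \<in> carrier R" if "j < d" "k < d" for j k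
    by (rule mats_mem[OF twisted_power_in_mats[OF \<theta> M] that])
  have s: "?s j \<in> carrier R" if "j < d" for j
    by (rule hom_pow_closed[OF \<theta> mats_mem[OF M Suc.prems that]])
  have uc: "u k p \<in> carrier R" if "k < d" for k p
    by (rule V_mem[OF u[OF that]])
  note Tm = semilinear_pow[OF T \<theta>, of m]
  have inner: "(\<Oplus>\<^bsub>V D\<^esub> k \<in> {..<d}. smul R (?t j k) (u k)) \<in> carrier (V D)" if "j < d" for j
    using u t that by (intro V.finsum_closed) (auto intro: smul_in_V)
  have step: "(T ^^ m) (smul R (M $$ (i, j)) (u j)) = smul R (?s j) (\<Oplus>\<^bsub>V D\<^esub> k \<in> {..<d}. smul R (?t j k) (u k))"
    if "j < d" for j
    using semilinearD(3)[OF Tm u[OF that] mats_mem[OF M Suc.prems that]] Suc.IH[OF that] by simp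
  \<comment> \<open>T^(m+1) is read as T^m after T, so that the factor twisted by \<theta>^m stands
    on the left, as in \<open>twisted_power\<close>.\<close>
  have "(T ^^ Suc m) (u i) = (T ^^ m) (\<Oplus>\<^bsub>V D\<^esub> j \<in> {..<d}. smul R (M $$ (i, j)) (u j))"
    using Tu[OF Suc.prems] by (simp add: funpow_swap1)
  also have "\<dots> = (\<Oplus>\<^bsub>V D\<^esub> j \<in> {..<d}. (T ^^ m) (smul R (M $$ (i, j)) (u j)))"
    using u mats_mem[OF M Suc.prems] by (intro semilinear_finsum[OF Tm hom_pow[OF \<theta>]]) (auto intro!: smul_in_V)
  also have "\<dots> = (\<Oplus>\<^bsub>V D\<^esub> j \<in> {..<d}. smul R (?s j) (\<Oplus>\<^bsub>V D\<^esub> k \<in> {..<d}. smul R (?t j k) (u k)))"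
    using step inner s by (intro V.finsum_cong') (simp_all add: smul_in_V)
  also have "\<dots> = (\<Oplus>\<^bsub>V D\<^esub> k \<in> {..<d}. smul R (twisted_power R d \<theta> M (Suc m) $$ (i, k)) (u k))"
  proof
    fix p
    have "(\<Oplus>\<^bsub>V D\<^esub> j \<in> {..<d}. smul R (?s j) (\<Oplus>\<^bsub>V D\<^esub> k \<in> {..<d}. smul R (?t j k) (u k))) p =
      (\<Oplus>j\<in>{..<d}. ?s j \<otimes> (\<Oplus>k\<in>{..<d}. ?t j k \<otimes> u k p))"
    proof -
      have eq: "(\<Oplus>\<^bsub>V D\<^esub> k \<in> {..<d}. smul R (?t j k) (u k)) p = (\<Oplus>k\<in>{..<d}. ?t j k \<otimes> u k p)" if "j < d" for j
        using u t that by (intro V_finsum_smul) auto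
      have "(\<Oplus>k\<in>{..<d}. ?t j k \<otimes> u k p) \<in> carrier R" if "j < d" for j
        using uc t that by (intro finsum_closed) auto
      hence "(\<Oplus>j\<in>{..<d}. ?s j \<otimes> (\<Oplus>\<^bsub>V D\<^esub> k \<in> {..<d}. smul R (?t j k) (u k)) p) =
        (\<Oplus>j\<in>{..<d}. ?s j \<otimes> (\<Oplus>k\<in>{..<d}. ?t j k \<otimes> u k p))"
        using s eq by (intro finsum_cong') auto
      thus ?thesis
        using inner s by (subst V_finsum_smul) auto
    qed
    also have "\<dots> = (\<Oplus>j\<in>{..<d}. \<Oplus>k\<in>{..<d}. ?s j \<otimes> ?t j k \<otimes> u k p)"
    proof -
      have "?s j \<otimes> (\<Oplus>k\<in>{..<d}. ?t j k \<otimes> u k p) = (\<Oplus>k\<in>{..<d}. ?s j \<otimes> ?t j k \<otimes> u k p)" if "j < d" for j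
      proof -
        have "?s j \<otimes> (\<Oplus>k\<in>{..<d}. ?t j k \<otimes> u k p) = (\<Oplus>k\<in>{..<d}. ?s j \<otimes> (?t j k \<otimes> u k p))"
          using that s t uc by (intro finsum_rdistr) auto
        also have "\<dots> = (\<Oplus>k\<in>{..<d}. ?s j \<otimes> ?t j k \<otimes> u k p)"
          using that s t uc by (intro finsum_cong') (auto simp: m_assoc)
        finally show ?thesis .
      qed
      thus ?thesis
        using s t uc by (intro finsum_cong') (auto intro!: finsum_closed)
    qed
    also have "\<dots> = (\<Oplus>k\<in>{..<d}. \<Oplus>j\<in>{..<d}. ?s j \<otimes> ?t j k \<otimes> u k p)"
      using s t uc by (intro finsum_swap) auto
    also have "\<dots> = (\<Oplus>k\<in>{..<d}. (\<Oplus>j\<in>{..<d}. ?s j \<otimes> ?t j k) \<otimes> u k p)"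
    proof -
      have "(\<Oplus>j\<in>{..<d}. ?s j \<otimes> ?t j k \<otimes> u k p) = (\<Oplus>j\<in>{..<d}. ?s j \<otimes> ?t j k) \<otimes> u k p" if "k < d" for k
        using that s t uc by (intro finsum_ldistr[symmetric]) auto
      thus ?thesis
        using s t uc by (intro finsum_cong') (auto intro!: finsum_closed)
    qed
    also have "\<dots> = (\<Oplus>k\<in>{..<d}. (twisted_power R d \<theta> M (Suc m) $$ (i, k)) \<otimes> u k p)"
    proof -
      have "twisted_power R d \<theta> M (Suc m) $$ (i, k) = (\<Oplus>j\<in>{..<d}. ?s j \<otimes> ?t j k)" if "k < d" for k
      proof -
        have "map_mat (\<theta> ^^ m) M $$ (i, j) = ?s j" if "j < d" for j
          using that Suc.prems M by (auto simp: mats_def)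
        hence "(\<Oplus>j\<in>{..<d}. map_mat (\<theta> ^^ m) M $$ (i, j) \<otimes> ?t j k) = (\<Oplus>j\<in>{..<d}. ?s j \<otimes> ?t j k)"
          using s t that by (intro finsum_cong') auto
        thus ?thesis
          using that Suc.prems by (simp add: mat_prod_def)
      qed
      moreover have "(\<Oplus>j\<in>{..<d}. ?s j \<otimes> ?t j k) \<in> carrier R" if "k < d" for k
        using s t that by (intro finsum_closed) auto
      ultimately show ?thesis
        using uc by (intro finsum_cong') auto
    qed
    also have "\<dots> = (\<Oplus>\<^bsub>V D\<^esub> k \<in> {..<d}. smul R (twisted_power R d \<theta> M (Suc m) $$ (i, k)) (u k)) p"
      using u mats_mem[OF twisted_power_in_mats[OF \<theta> M] Suc.prems]
      by (subst V_finsum_smul) (auto simp del: twisted_power.simps)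
    finally show "(\<Oplus>\<^bsub>V D\<^esub> j \<in> {..<d}. smul R (?s j) (\<Oplus>\<^bsub>V D\<^esub> k \<in> {..<d}. smul R (?t j k) (u k))) p =
       (\<Oplus>\<^bsub>V D\<^esub> k \<in> {..<d}. smul R (twisted_power R d \<theta> M (Suc m) $$ (i, k)) (u k)) p" .
  qed
  finally show ?case .
qed

end

section \<open>The cyclic algebra in coordinates\<close>

text \<open>The data of the algebra with basis 1, x, ..., x^(n-1) over \<open>R\<close>, where x e =
  \<theta>(e) x and x^n = a. That \<theta> fixes a makes a commute with x, and \<theta>^n = 1 makes
  x^n commute with \<open>R\<close>.\<close>

locale twisted_shift = cring R for R (structure) +
  fixes \<theta> :: "'a \<Rightarrow> 'a" and n :: nat and a :: 'a
  assumes hom: "\<theta> \<in> Ring.ring_hom R R"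
    and n_pos: "n > 0"
    and a_closed: "a \<in> carrier R"
    and fix_a: "\<theta> a = a"
    and hom_order: "e \<in> carrier R \<Longrightarrow> (\<theta> ^^ n) e = e"
begin

text \<open>Left multiplication by x: the coefficient of x^i is twisted and moves to x^(i+1), and
  the top one returns to place 0 with the factor a = x^n.\<close>

definition shift :: "(nat \<Rightarrow> 'a) \<Rightarrow> nat \<Rightarrow> 'a" where
  "shift b = (\<lambda>i. if i < n then if i = 0 then a \<otimes> \<theta> (b (n - 1)) else \<theta> (b (i - 1)) else \<zero>)"

lemma hom_closed: "e \<in> carrier R \<Longrightarrow> \<theta> e \<in> carrier R"
  using hom by (rule ring_hom_closed)

lemma semilinear_shift: "semilinear n \<theta> shift"
  unfolding semilinear_def
proof (intro conjI ballI)
  fix v assume v: "v \<in> carrier (V n)"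
  show "shift v \<in> carrier (V n)"
    using v a_closed hom_closed by (auto simp: V_carrier_iff shift_def)
next
  fix v w assume v: "v \<in> carrier (V n)" and w: "w \<in> carrier (V n)"
  show "shift (v \<oplus>\<^bsub>V n\<^esub> w) = shift v \<oplus>\<^bsub>V n\<^esub> shift w"
    using v w a_closed hom_closed ring_hom_add[OF hom]
    by (auto simp: V_carrier_iff shift_def V_simps r_distr)
next
  fix e v assume e: "e \<in> carrier R" and v: "v \<in> carrier (V n)"
  show "shift (smul R e v) = smul R (\<theta> e) (shift v)"
    using v e a_closed hom_closed ring_hom_mult[OF hom]
    by (auto simp: V_carrier_iff shift_def smul_def m_lcomm)
qed

lemmas shift_closed = semilinearD(1)[OF semilinear_shift]
lemmas shift_add = semilinearD(2)[OF semilinear_shift]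
lemma shift_pow_closed: "v \<in> carrier (V n) \<Longrightarrow> (shift ^^ m) v \<in> carrier (V n)"
  by (rule semilinearD(1)[OF semilinear_pow[OF semilinear_shift hom]])

text \<open>For m at most n an index wraps around at most once, hence at most one factor a.\<close>

lemma shift_pow:
  assumes "b \<in> carrier (V n)" "m \<le> n"
  shows "(shift ^^ m) b = (\<lambda>i. if i < n then if i < m then a \<otimes> (\<theta> ^^ m) (b (n + i - m)) else (\<theta> ^^ m) (b (i - m)) else \<zero>)"
  using assms(2)
proof (induction m)
  case 0
  show ?case using assms(1) by (auto simp: V_carrier_iff)
next
  case (Suc m)
  have b: "b i \<in> carrier R" "(\<theta> ^^ m) (b i) \<in> carrier R" for i
    using V_mem[OF assms(1)] hom_pow_closed[OF hom] by auto
  have "\<theta> (a \<otimes> (\<theta> ^^ m) (b i)) = a \<otimes> \<theta> ((\<theta> ^^ m) (b i))" for i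
    using ring_hom_mult[OF hom a_closed b(2)[of i]] fix_a by simp
  moreover have "n - 1 - m = n - Suc m" by simp
  moreover have "i - 1 - m = i - Suc m" "i > 0 \<Longrightarrow> n + (i - 1) - m = n + i - Suc m" for i by simp_all
  ultimately show ?case
    using Suc by (auto simp: shift_def fun_eq_iff)
qed

lemma shift_pow_n:
  assumes "b \<in> carrier (V n)"
  shows "(shift ^^ n) b = smul R a b"
  using assms hom_order a_closed shift_pow[OF assms order_refl] by (auto simp: V_carrier_iff smul_def fun_eq_iff)

lemma shift_pow_unit:
  assumes "j < n"
  shows "(shift ^^ j) (unit_fun R 0) = unit_fun R j"
proof -
  have [simp]: "(\<theta> ^^ j) \<one> = \<one>" "(\<theta> ^^ j) \<zero> = \<zero>"
    using ring_hom_one[OF hom_pow[OF hom]] ring_hom_zero[OF hom_pow[OF hom] ring_axioms ring_axioms] by auto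
  show ?thesis
    using assms shift_pow[of "unit_fun R 0" j] unit_fun_in_V[OF n_pos] a_closed
    by (auto simp: unit_fun_def fun_eq_iff)
qed

context
  fixes T d v
  assumes T: "semilinear d \<theta> T" and v: "v \<in> carrier (V d)"
begin

lemma T_pow_closed: "(T ^^ j) v \<in> carrier (V d)"
  by (rule semilinearD(1)[OF semilinear_pow[OF T hom] v])

lemma orbit_comb_apply:
  assumes "b \<in> carrier (V n)"
  shows "orbit_comb n T d v b p = (\<Oplus>j\<in>{..<n}. b j \<otimes> (T ^^ j) v p)"
  unfolding orbit_comb_def using V_mem[OF assms] T_pow_closed by (intro V_finsum_smul) auto

lemma orbit_comb_closed:
  assumes "b \<in> carrier (V n)"
  shows "orbit_comb n T d v b \<in> carrier (V d)"
proof -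
  interpret V: cring "V d" by (rule V_cring)
  show ?thesis
    unfolding orbit_comb_def using V_mem[OF assms] T_pow_closed
    by (intro V.finsum_closed) (auto intro!: smul_in_V)
qed

lemma orbit_comb_add:
  assumes b: "b \<in> carrier (V n)" and c: "c \<in> carrier (V n)"
  shows "orbit_comb n T d v (b \<oplus>\<^bsub>V n\<^esub> c) = orbit_comb n T d v b \<oplus>\<^bsub>V d\<^esub> orbit_comb n T d v c"
proof
  fix p
  interpret V: cring "V n" by (rule V_cring)
  note mem = V_mem[OF b] V_mem[OF c] V_mem[OF T_pow_closed]
  have "(\<Oplus>j\<in>{..<n}. (b j \<oplus> c j) \<otimes> (T ^^ j) v p) = (\<Oplus>j\<in>{..<n}. b j \<otimes> (T ^^ j) v p \<oplus> c j \<otimes> (T ^^ j) v p)"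
    using mem by (intro finsum_cong') (auto simp: l_distr)
  also have "\<dots> = (\<Oplus>j\<in>{..<n}. b j \<otimes> (T ^^ j) v p) \<oplus> (\<Oplus>j\<in>{..<n}. c j \<otimes> (T ^^ j) v p)"
    using mem by (intro finsum_addf) auto
  finally show "orbit_comb n T d v (b \<oplus>\<^bsub>V n\<^esub> c) p = (orbit_comb n T d v b \<oplus>\<^bsub>V d\<^esub> orbit_comb n T d v c) p"
    using b c V.a_closed[OF b c] by (simp add: orbit_comb_apply V_simps)
qed

lemma orbit_comb_smul:
  assumes b: "b \<in> carrier (V n)" and e: "e \<in> carrier R"
  shows "orbit_comb n T d v (smul R e b) = smul R e (orbit_comb n T d v b)"
proof
  fix p
  note mem = V_mem[OF b] V_mem[OF T_pow_closed] e
  have "(\<Oplus>j\<in>{..<n}. e \<otimes> b j \<otimes> (T ^^ j) v p) = (\<Oplus>j\<in>{..<n}. e \<otimes> (b j \<otimes> (T ^^ j) v p))"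
    using mem by (intro finsum_cong') (auto simp: m_assoc)
  also have "\<dots> = e \<otimes> (\<Oplus>j\<in>{..<n}. b j \<otimes> (T ^^ j) v p)"
    using mem by (intro finsum_rdistr[symmetric]) auto
  finally show "orbit_comb n T d v (smul R e b) p = smul R e (orbit_comb n T d v b) p"
    using b smul_in_V[OF e b] by (simp add: orbit_comb_apply smul_def)
qed

lemma orbit_comb_unit:
  assumes "j < n"
  shows "orbit_comb n T d v (unit_fun R j) = (T ^^ j) v"
proof
  fix p
  have "(\<Oplus>i\<in>{..<n}. unit_fun R j i \<otimes> (T ^^ i) v p) = unit_fun R j j \<otimes> (T ^^ j) v p"
    using assms V_mem[OF T_pow_closed]
    by (intro finsum_single[of "{..<n}" j "\<lambda>i. unit_fun R j i \<otimes> (T ^^ i) v p"]) (auto simp: unit_fun_def)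
  thus "orbit_comb n T d v (unit_fun R j) p = (T ^^ j) v p"
    using assms unit_fun_in_V[OF assms] V_mem[OF T_pow_closed] by (simp add: orbit_comb_apply unit_fun_def)
qed

text \<open>The two sums agree term by term after a cyclic move of the index; the hypothesis on T^n
  v is what matches the old top term with the new term at 0.\<close>

lemma orbit_comb_shift:
  assumes b: "b \<in> carrier (V n)" and Tn: "(T ^^ n) v = smul R a v"
  shows "orbit_comb n T d v (shift b) = T (orbit_comb n T d v b)"
proof -
  interpret V: cring "V d" by (rule V_cring)
  obtain m where m: "n = Suc m" using n_pos by (cases n) auto
  note mem = V_mem[OF b]
  have sm: "smul R c ((T ^^ j) v) \<in> carrier (V d)" if "c \<in> carrier R" for c j
    using that T_pow_closed by (intro smul_in_V)
  have "T (orbit_comb n T d v b) = (\<Oplus>\<^bsub>V d\<^esub> j \<in> {..<n}. T (smul R (b j) ((T ^^ j) v)))"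
    unfolding orbit_comb_def using mem sm by (intro semilinear_finsum[OF T hom]) auto
  also have "\<dots> = (\<Oplus>\<^bsub>V d\<^esub> j \<in> {..<n}. smul R (\<theta> (b j)) ((T ^^ Suc j) v))"
    using mem sm[OF hom_closed[OF mem]] semilinearD(3)[OF T T_pow_closed mem] sm[of _ "Suc _"] hom_closed
    by (intro V.finsum_cong') (auto simp del: funpow.simps simp: funpow.simps(2)[unfolded comp_def])
  also have "\<dots> = (\<Oplus>\<^bsub>V d\<^esub> j \<in> {..<n}. smul R (shift b j) ((T ^^ j) v))"
  proof -
    define F where "F j = smul R (\<theta> (b j)) ((T ^^ Suc j) v)" for j
    define G where "G j = smul R (shift b j) ((T ^^ j) v)" for j
    have F: "F j \<in> carrier (V d)" for j
      unfolding F_def using mem hom_closed by (intro sm) auto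
    have G: "G j \<in> carrier (V d)" for j
      unfolding G_def using V_mem[OF shift_closed[OF b]] by (intro sm) auto
    have bm: "shift b 0 = a \<otimes> \<theta> (b m)" "n - 1 = m"
      unfolding shift_def using m by simp_all
    have "F m = smul R (\<theta> (b m)) (smul R a v)"
      unfolding F_def m[symmetric] Tn ..
    also have "\<dots> = G 0"
      unfolding G_def using v mem hom_closed a_closed by (simp add: bm smul_smul m_comm)
    finally have G0: "G 0 = F m" by simp
    have GS: "G (Suc j) = F j" if "j < m" for j
      unfolding G_def F_def shift_def using that m by simp
    have "(\<Oplus>\<^bsub>V d\<^esub> j \<in> {..<n}. G j) = (\<Oplus>\<^bsub>V d\<^esub> j \<in> insert 0 (Suc ` {..<m}). G j)"
      unfolding m lessThan_Suc_eq_insert_0 ..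
    also have "\<dots> = G 0 \<oplus>\<^bsub>V d\<^esub> (\<Oplus>\<^bsub>V d\<^esub> j \<in> Suc ` {..<m}. G j)"
      using G by (intro V.finsum_insert) auto
    also have "(\<Oplus>\<^bsub>V d\<^esub> j \<in> Suc ` {..<m}. G j) = (\<Oplus>\<^bsub>V d\<^esub> j \<in> {..<m}. G (Suc j))"
      using G by (intro V.add.finprod_reindex) auto
    also have "\<dots> = (\<Oplus>\<^bsub>V d\<^esub> j \<in> {..<m}. F j)"
      using F GS by (intro V.finsum_cong') auto
    also have "G 0 \<oplus>\<^bsub>V d\<^esub> (\<Oplus>\<^bsub>V d\<^esub> j \<in> {..<m}. F j) = (\<Oplus>\<^bsub>V d\<^esub> j \<in> insert m {..<m}. F j)"
      unfolding G0 using F by (intro V.finsum_insert[symmetric]) auto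
    also have "insert m {..<m} = {..<n}"
      unfolding m lessThan_Suc ..
    finally show ?thesis by (simp add: F_def G_def)
  qed
  finally show ?thesis by (simp add: orbit_comb_def)
qed

end

lemma orbit_comb_linear:
  assumes v: "v \<in> carrier (V n)"
  shows "linear_map n (orbit_comb n shift n v)"
  unfolding linear_map_def
  using orbit_comb_closed[OF semilinear_shift v] orbit_comb_add[OF semilinear_shift v]
    orbit_comb_smul[OF semilinear_shift v] by blast

text \<open>The map \<open>orbit_comb n shift n v\<close> is right multiplication by \<open>v\<close> in the cyclic algebra.\<close>

abbreviation rmult :: "(nat \<Rightarrow> 'a) \<Rightarrow> (nat \<Rightarrow> 'a) \<Rightarrow> nat \<Rightarrow> 'a" where
  "rmult \<equiv> orbit_comb n shift n"

lemma rmult_shift: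
  "v \<in> carrier (V n) \<Longrightarrow> b \<in> carrier (V n) \<Longrightarrow> rmult v (shift b) = shift (rmult v b)"
  by (rule orbit_comb_shift[OF semilinear_shift _ _ shift_pow_n])

lemma rmult_shift_pow:
  "v \<in> carrier (V n) \<Longrightarrow> b \<in> carrier (V n) \<Longrightarrow> rmult v ((shift ^^ j) b) = (shift ^^ j) (rmult v b)"
  by (induction j) (auto simp: rmult_shift shift_pow_closed)

lemma rmult_unit: "v \<in> carrier (V n) \<Longrightarrow> rmult v (unit_fun R 0) = v"
  using orbit_comb_unit[OF semilinear_shift _ n_pos] by simp

lemma rmult_closed: "v \<in> carrier (V n) \<Longrightarrow> b \<in> carrier (V n) \<Longrightarrow> rmult v b \<in> carrier (V n)"
  by (rule orbit_comb_closed[OF semilinear_shift])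

text \<open>Associativity, (b w) v = b (w v). It follows since right multiplication by v is linear
  and commutes with x, without a product on E^n being defined.\<close>

lemma rmult_rmult:
  assumes v: "v \<in> carrier (V n)" and w: "w \<in> carrier (V n)" and b: "b \<in> carrier (V n)"
  shows "rmult v (rmult w b) = rmult (rmult v w) b"
proof -
  interpret V: cring "V n" by (rule V_cring)
  have "rmult v (rmult w b) = (\<Oplus>\<^bsub>V n\<^esub> j \<in> {..<n}. rmult v (smul R (b j) ((shift ^^ j) w)))"
    unfolding orbit_comb_def[of n shift n w]
    using V_mem[OF b] shift_pow_closed[OF w]
    by (intro linear_map_finsum[OF orbit_comb_linear[OF v]]) (auto intro!: smul_in_V)
  also have "\<dots> = (\<Oplus>\<^bsub>V n\<^esub> j \<in> {..<n}. smul R (b j) ((shift ^^ j) (rmult v w)))"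
    using V_mem[OF b] shift_pow_closed[OF w] rmult_shift_pow[OF v w]
      orbit_comb_smul[OF semilinear_shift v] shift_pow_closed[OF rmult_closed[OF v w]]
    by (intro V.finsum_cong') (auto intro!: smul_in_V)
  finally show ?thesis by (simp add: orbit_comb_def)
qed

text \<open>Since x^j h = \<theta>^j(h) x^j, right multiplication by h is diagonal in
  coordinates.\<close>

lemma rmult_const:
  assumes h: "h \<in> carrier R" and b: "b \<in> carrier (V n)"
  shows "rmult (smul R h (unit_fun R 0)) b = (\<lambda>j. b j \<otimes> (\<theta> ^^ j) h)"
proof
  fix p
  note u = unit_fun_in_V[OF n_pos]
  have eq: "(shift ^^ j) (smul R h (unit_fun R 0)) = smul R ((\<theta> ^^ j) h) (unit_fun R j)" if "j < n" for j
    using semilinearD(3)[OF semilinear_pow[OF semilinear_shift hom] u h] shift_pow_unit[OF that] by simp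
  have "rmult (smul R h (unit_fun R 0)) b p = (\<Oplus>j\<in>{..<n}. b j \<otimes> ((\<theta> ^^ j) h \<otimes> unit_fun R j p))"
    using V_mem[OF b] hom_pow_closed[OF hom h] eq V_mem[OF unit_fun_in_V]
    by (subst orbit_comb_apply[OF semilinear_shift smul_in_V[OF h u] b])
       (auto simp: smul_def intro!: finsum_cong')
  also have "\<dots> = b p \<otimes> (\<theta> ^^ p) h"
  proof (cases "p < n")
    case True
    have "(\<Oplus>j\<in>{..<n}. b j \<otimes> ((\<theta> ^^ j) h \<otimes> unit_fun R j p)) = b p \<otimes> ((\<theta> ^^ p) h \<otimes> unit_fun R p p)"
      using True V_mem[OF b] hom_pow_closed[OF hom h]
      by (intro finsum_single[of "{..<n}" p "\<lambda>j. b j \<otimes> ((\<theta> ^^ j) h \<otimes> unit_fun R j p)"]) (auto simp: unit_fun_def)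
    thus ?thesis using V_mem[OF b] hom_pow_closed[OF hom h] by (simp add: unit_fun_def)
  next
    case False
    have "(\<Oplus>j\<in>{..<n}. b j \<otimes> ((\<theta> ^^ j) h \<otimes> unit_fun R j p)) = (\<Oplus>j\<in>{..<n}. \<zero>)"
      using False V_mem[OF b] hom_pow_closed[OF hom h] by (intro finsum_cong') (auto simp: unit_fun_def)
    thus ?thesis using False V_zero_above[OF b] hom_pow_closed[OF hom h] by simp
  qed
  finally show "rmult (smul R h (unit_fun R 0)) b p = b p \<otimes> (\<theta> ^^ p) h" .
qed

text \<open>The left ideals of the cyclic algebra, in coordinates.\<close>

definition shift_subspace :: "(nat \<Rightarrow> 'a) set \<Rightarrow> bool" where
  "shift_subspace L \<longleftrightarrow> subspace n L \<and> (\<forall>v\<in>L. shift v \<in> L)"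

lemma shift_subspaceD:
  assumes "shift_subspace L"
  shows "subspace n L" "v \<in> L \<Longrightarrow> shift v \<in> L"
  using assms unfolding shift_subspace_def by auto

lemma shift_subspace_pow: "shift_subspace L \<Longrightarrow> v \<in> L \<Longrightarrow> (shift ^^ j) v \<in> L"
  by (induction j) (auto simp: shift_subspaceD)

lemma shift_subspace_rmult:
  assumes "shift_subspace L" "v \<in> L" "b \<in> carrier (V n)"
  shows "rmult v b \<in> L"
  unfolding orbit_comb_def
  using subspaceD(4)[OF shift_subspaceD(1)[OF assms(1)] V_mem[OF assms(3)] shift_subspace_pow[OF assms(1,2)]]
  by (intro subspace_finsum[OF shift_subspaceD(1)[OF assms(1)]]) auto

lemma shift_subspace_unit:
  assumes "shift_subspace L" "unit_fun R 0 \<in> L"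
  shows "L = carrier (V n)"
proof -
  have "b \<in> L" if b: "b \<in> carrier (V n)" for b
  proof -
    have "unit_fun R j \<in> L" if "j < n" for j
      using shift_subspace_pow[OF assms, of j] shift_pow_unit[OF that] by simp
    hence "(\<Oplus>\<^bsub>V n\<^esub> j \<in> {..<n}. smul R (b j) (unit_fun R j)) \<in> L"
      using V_mem[OF b] subspaceD(4)[OF shift_subspaceD(1)[OF assms(1)]]
      by (intro subspace_finsum[OF shift_subspaceD(1)[OF assms(1)]]) auto
    thus ?thesis using V_unit_expansion[OF b] by simp
  qed
  thus ?thesis using subspaceD(1)[OF shift_subspaceD(1)[OF assms(1)]] by blast
qed

end

lemma (in cring) linear_map_inj_on:
  assumes F: "linear_map d F" and I: "subspace d I"
    and ker: "\<And>v. v \<in> I \<Longrightarrow> F v = \<zero>\<^bsub>V d\<^esub> \<Longrightarrow> v = \<zero>\<^bsub>V d\<^esub>"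
  shows "inj_on F I"
proof (rule inj_onI)
  note Id = subspaceD[OF I]
  note lin = linear_mapD[OF F]
  have IV: "v \<in> I \<Longrightarrow> v \<in> carrier (V d)" for v using Id(1) by (rule subsetD)
  fix x y assume x: "x \<in> I" and y: "y \<in> I" and eq: "F x = F y"
  have m1: "\<ominus> \<one> \<in> carrier R" by simp
  have mx: "smul R (\<ominus> \<one>) y \<in> I" by (rule Id(4)[OF m1 y])
  have "F (x \<oplus>\<^bsub>V d\<^esub> smul R (\<ominus> \<one>) y) = F x \<oplus>\<^bsub>V d\<^esub> smul R (\<ominus> \<one>) (F y)"
    unfolding lin(2)[OF IV[OF x] IV[OF mx]] lin(3)[OF IV[OF y] m1] ..
  also have "\<dots> = \<zero>\<^bsub>V d\<^esub>"
    unfolding eq using V_mem[OF lin(1)[OF IV[OF y]]] by (auto simp: V_simps smul_def l_minus r_neg)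
  finally have "x \<oplus>\<^bsub>V d\<^esub> smul R (\<ominus> \<one>) y = \<zero>\<^bsub>V d\<^esub>"
    by (rule ker[OF Id(3)[OF x mx]])
  hence z: "x i \<oplus> \<ominus> \<one> \<otimes> y i = \<zero>" for i
    by (simp add: V_simps smul_def fun_eq_iff)
  show "x = y"
  proof
    fix i
    have carr: "x i \<in> carrier R" "y i \<in> carrier R" using IV[OF x] IV[OF y] by (auto intro: V_mem)
    have "x i \<ominus> y i = \<zero>" using z[of i] carr by (simp add: l_minus minus_eq)
    thus "x i = y i" using carr by simp
  qed
qed

section \<open>Left ideals of a cyclic algebra over a field, and the matrix equation\<close>

text \<open>The last condition says that the one element h tells every \<theta>^j with 0 < j < n
  apart from the identity; simplicity of the algebra rests on it.\<close>

locale cyclic_data = field R + twisted_shift R \<theta> n a for R (structure) and \<theta> n a +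
  fixes h :: 'a
  assumes h_closed: "h \<in> carrier R"
    and a_nonzero: "a \<noteq> \<zero>"
    and hom_h: "0 < j \<Longrightarrow> j < n \<Longrightarrow> (\<theta> ^^ j) h \<noteq> h"
begin

text \<open>\<open>J\<close> is a left ideal closed under right multiplication by h. The combination
  \<theta>^k(h) w - w h multiplies the coordinate at j by \<theta>^k(h) - \<theta>^j(h): it kills
  place k, preserves zeros, and keeps place 0 nonzero. Doing this for k = 1, ..., n-1 leaves a
  nonzero multiple of 1.\<close>

lemma simplicity:
  assumes J: "shift_subspace J" and J_rmult: "\<And>v. v \<in> J \<Longrightarrow> rmult (smul R h (unit_fun R 0)) v \<in> J"
    and u: "u \<in> J" "u \<noteq> \<zero>\<^bsub>V n\<^esub>"
  shows "unit_fun R 0 \<in> J"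
proof -
  note sub = subspaceD[OF shift_subspaceD(1)[OF J]]
  have uV: "u \<in> carrier (V n)" by (rule subsetD[OF sub(1) u(1)])
  obtain i where i: "u i \<noteq> \<zero>" using u(2) by (auto simp: V_simps fun_eq_iff)
  hence in': "i < n" using V_zero_above[OF uV] not_le by blast
  \<comment> \<open>Multiplication by x^(n-i) moves the nonzero coordinate at i to place 0.\<close>
  define w where "w = (shift ^^ (n - i)) u"
  have w: "w \<in> J" unfolding w_def by (rule shift_subspace_pow[OF J u(1)])
  have inj: "e = \<zero>" if "e \<in> carrier R" "(\<theta> ^^ m) e = \<zero>" for e m
  proof (rule ccontr)
    assume "e \<noteq> \<zero>"
    hence "e \<in> Units R"
      using field_Units that(1) by simp
    hence e: "inv e \<in> carrier R" "e \<otimes> inv e = \<one>"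
      by (rule Units_inv_closed, rule Units_r_inv)
    have "(\<theta> ^^ m) (e \<otimes> inv e) = (\<theta> ^^ m) e \<otimes> (\<theta> ^^ m) (inv e)"
      by (rule ring_hom_mult[OF hom_pow[OF hom] that(1) e(1)])
    hence "\<one> = \<zero> \<otimes> (\<theta> ^^ m) (inv e)"
      unfolding e(2) that(2) ring_hom_one[OF hom_pow[OF hom]] .
    thus False
      using hom_pow_closed[OF hom e(1), of m] by simp
  qed
  have "n + 0 - (n - i) = i"
    using in' by simp
  hence "w 0 = a \<otimes> (\<theta> ^^ (n - i)) (u i)"
    unfolding w_def using shift_pow[OF uV, of "n - i"] in' n_pos by simp
  hence "w 0 \<noteq> \<zero>"
    using inj[OF V_mem[OF uV], of "n - i" i] i a_nonzero a_closed hom_pow_closed[OF hom V_mem[OF uV]]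
    by (auto simp: integral_iff)
  have "\<exists>w\<in>J. w 0 \<noteq> \<zero> \<and> (\<forall>j. 1 \<le> j \<and> j \<le> k \<longrightarrow> w j = \<zero>)" if "k < n" for k
    using that
  proof (induction k)
    case 0
    show ?case using w \<open>w 0 \<noteq> \<zero>\<close> by auto
  next
    case (Suc k)
    then obtain w where w: "w \<in> J" "w 0 \<noteq> \<zero>" "\<And>j. 1 \<le> j \<Longrightarrow> j \<le> k \<Longrightarrow> w j = \<zero>" by auto
    have wV: "w \<in> carrier (V n)" by (rule subsetD[OF sub(1) w(1)])
    let ?c = "(\<theta> ^^ Suc k) h"
    let ?r = "rmult (smul R h (unit_fun R 0)) w"
    have c: "?c \<in> carrier R" by (rule hom_pow_closed[OF hom h_closed])
    let ?w = "smul R ?c w \<oplus>\<^bsub>V n\<^esub> smul R (\<ominus> \<one>) ?r"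
    have "?w \<in> J"
      using c w(1) J_rmult sub(3,4) by simp
    moreover have eq: "?w j = w j \<otimes> (?c \<ominus> (\<theta> ^^ j) h)" for j
    proof -
      have "c \<otimes> x \<oplus> \<ominus> \<one> \<otimes> (x \<otimes> y) = x \<otimes> (c \<ominus> y)"
        if "c \<in> carrier R" "x \<in> carrier R" "y \<in> carrier R" for c x y
        using that by algebra
      hence "?c \<otimes> w j \<oplus> \<ominus> \<one> \<otimes> ?r j = w j \<otimes> (?c \<ominus> (\<theta> ^^ j) h)"
        unfolding rmult_const[OF h_closed wV] using c V_mem[OF wV] hom_pow_closed[OF hom h_closed] by blast
      moreover have "?w j = ?c \<otimes> w j \<oplus> \<ominus> \<one> \<otimes> ?r j"
        unfolding V_simps smul_def[of R ?c] smul_def[of R "\<ominus> \<one>"] ..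
      ultimately show ?thesis by (rule trans[rotated])
    qed
    moreover have "?w 0 \<noteq> \<zero>"
    proof -
      have "?c \<ominus> h \<noteq> \<zero>"
        using c h_closed hom_h[of "Suc k"] Suc.prems by (simp del: funpow.simps)
      thus ?thesis
        unfolding eq using w(2) V_mem[OF wV, of 0] c h_closed
        by (simp del: funpow.simps(2) add: integral_iff)
    qed
    moreover have "?w j = \<zero>" if "1 \<le> j" "j \<le> Suc k" for j
    proof (cases "j = Suc k")
      case True
      thus ?thesis unfolding eq using V_mem[OF wV, of j] c by (simp del: funpow.simps add: minus_eq r_neg)
    next
      case False
      thus ?thesis unfolding eq using w(3)[of j] that c hom_pow_closed[OF hom h_closed, of j]
        by (simp del: funpow.simps)
    qed
    ultimately show ?case by blast
  qed
  from this[of "n - 1"] n_pos obtain w where w: "w \<in> J" "w 0 \<noteq> \<zero>" "\<And>j. 1 \<le> j \<Longrightarrow> j \<le> n - 1 \<Longrightarrow> w j = \<zero>"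
    by force
  have wV: "w \<in> carrier (V n)" by (rule subsetD[OF sub(1) w(1)])
  have inv: "inv (w 0) \<in> carrier R" "inv (w 0) \<otimes> w 0 = \<one>"
  proof -
    have "w 0 \<in> Units R"
      using field_Units w(2) V_mem[OF wV, of 0] by simp
    thus "inv (w 0) \<in> carrier R" "inv (w 0) \<otimes> w 0 = \<one>"
      by (rule Units_inv_closed, rule Units_l_inv)
  qed
  have "smul R (inv (w 0)) w j = unit_fun R 0 j" for j
  proof (cases "j = 0")
    case True
    thus ?thesis using inv by (simp add: smul_def unit_fun_def)
  next
    case False
    hence "w j = \<zero>"
      using w(3)[of j] V_zero_above[OF wV, of j] by (cases "j \<le> n - 1") simp_all
    thus ?thesis using inv False by (simp add: smul_def unit_fun_def)
  qed
  hence "smul R (inv (w 0)) w = unit_fun R 0" by blast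
  thus ?thesis using sub(4)[OF inv(1) w(1)] by simp
qed

lemma units_carrier: "unit_fun R 0 \<in> carrier (V n)"
  by (rule unit_fun_in_V[OF n_pos])

lemma shift_subspaceI:
  assumes "L \<subseteq> carrier (V n)" "\<zero>\<^bsub>V n\<^esub> \<in> L"
    "\<And>v w. v \<in> L \<Longrightarrow> w \<in> L \<Longrightarrow> v \<oplus>\<^bsub>V n\<^esub> w \<in> L"
    "\<And>e v. e \<in> carrier R \<Longrightarrow> v \<in> L \<Longrightarrow> smul R e v \<in> L"
    "\<And>v. v \<in> L \<Longrightarrow> shift v \<in> L"
  shows "shift_subspace L"
  unfolding shift_subspace_def using subspaceI[OF assms(1-4)] assms(5) by blast

text \<open>The matrix of x on a basis of \<open>L\<close> is a solution, because x^n acts as a and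
  coordinates in a basis are unique.\<close>

lemma shift_subspace_matrix:
  assumes L: "shift_subspace L" and dim: "vdim n d L"
  shows "\<exists>M\<in>mats R d. twisted_power R d \<theta> M n = scalar_mat R d a"
proof -
  interpret V: cring "V n" by (rule V_cring)
  note sf = Scal_subfield[OF n_pos]
  note Lc = subspaceD[OF shift_subspaceD(1)[OF L]]
  obtain Us where Us: "set Us \<subseteq> carrier (V n)" "V.independent (Scal n) Us" "length Us = d" "V.Span (Scal n) Us = L"
    using V.exists_base[OF sf dim] by (elim exE conjE)
  have U: "Us ! i \<in> carrier (V n)" if "i < d" for i
    using that Us(1,3) by (auto simp: subset_iff)
  have comb: "V.combine (map (\<lambda>j. const_fun R n (c j)) [0..<d]) Us = (\<Oplus>\<^bsub>V n\<^esub> j \<in> {..<d}. smul R (c j) (Us ! j))"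
    if "\<And>j. j < d \<Longrightarrow> c j \<in> carrier R" for c
  proof -
    have "V.combine (map (\<lambda>j. const_fun R n (c j)) [0..<d]) Us =
       (\<Oplus>\<^bsub>V n\<^esub> j \<in> {..<d}. map (\<lambda>j. const_fun R n (c j)) [0..<d] ! j \<otimes>\<^bsub>V n\<^esub> Us ! j)"
      using Us(1,3) that by (subst V.combine_eq_finsum) (auto intro!: const_fun_in_V)
    also have "\<dots> = (\<Oplus>\<^bsub>V n\<^esub> j \<in> {..<d}. smul R (c j) (Us ! j))"
      using that U by (intro V.finsum_cong') (auto simp: const_fun_mult intro!: smul_in_V)
    finally show ?thesis .
  qed
  have "\<exists>c. (\<forall>j<d. c j \<in> carrier R) \<and> shift (Us ! i) = (\<Oplus>\<^bsub>V n\<^esub> j \<in> {..<d}. smul R (c j) (Us ! j))"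
    if i: "i < d" for i
  proof -
    have "Us ! i \<in> L"
      using V.Span_base_incl[OF sf Us(1)] i Us(3,4) nth_mem by blast
    hence "shift (Us ! i) \<in> V.Span (Scal n) Us"
      using shift_subspaceD(2)[OF L] Us(4) by simp
    then obtain Ks where Ks: "set Ks \<subseteq> Scal n" "length Ks = d" "shift (Us ! i) = V.combine Ks Us"
      using V.Span_mem_iff_length_version[OF sf Us(1)] Us(3) by metis
    have "\<forall>j<d. \<exists>e\<in>carrier R. Ks ! j = const_fun R n e"
      using Ks(1,2) nth_mem by blast
    then obtain c where c: "\<And>j. j < d \<Longrightarrow> c j \<in> carrier R \<and> Ks ! j = const_fun R n (c j)"
      by metis
    have "Ks = map (\<lambda>j. const_fun R n (c j)) [0..<d]"
      using c Ks(2) by (intro nth_equalityI) auto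
    thus ?thesis
      using Ks(3) comb[of c] c by auto
  qed
  then obtain N where N: "\<And>i j. i < d \<Longrightarrow> j < d \<Longrightarrow> N i j \<in> carrier R"
    "\<And>i. i < d \<Longrightarrow> shift (Us ! i) = (\<Oplus>\<^bsub>V n\<^esub> j \<in> {..<d}. smul R (N i j) (Us ! j))"
    by metis
  define M where "M = mat d d (\<lambda>(i, j). N i j)"
  have M: "M \<in> mats R d" unfolding M_def using N(1) by (intro mat_in_mats) auto
  have Mu: "shift (Us ! i) = (\<Oplus>\<^bsub>V n\<^esub> j \<in> {..<d}. smul R (M $$ (i, j)) (Us ! j))" if "i < d" for i
    unfolding N(2)[OF that] using that N(1) U
    by (intro V.finsum_cong') (auto simp: M_def intro!: smul_in_V)
  let ?P = "twisted_power R d \<theta> M n"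
  have P: "?P \<in> mats R d" by (rule twisted_power_in_mats[OF hom M])
  have "?P $$ (i, j) = scalar_mat R d a $$ (i, j)" if i: "i < d" and j: "j < d" for i j
  proof -
    let ?S = "scalar_mat R d a"
    have S: "?S $$ (i, j) \<in> carrier R" if "j < d" for j
      using i that a_closed by (simp add: scalar_mat_def)
    have Pij: "?P $$ (i, j) \<in> carrier R" if "j < d" for j
      by (rule mats_mem[OF P i that])
    have "(\<Oplus>\<^bsub>V n\<^esub> j \<in> {..<d}. smul R (?S $$ (i, j)) (Us ! j)) = smul R (?S $$ (i, i)) (Us ! i)"
      using i a_closed U
      by (intro V.finsum_single[of "{..<d}" i "\<lambda>j. smul R (?S $$ (i, j)) (Us ! j)"])
         (auto simp: scalar_mat_def smul_zero intro!: smul_in_V)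
    also have "\<dots> = (shift ^^ n) (Us ! i)"
      using i shift_pow_n[OF U[OF i]] by (simp add: scalar_mat_def)
    also have "\<dots> = (\<Oplus>\<^bsub>V n\<^esub> j \<in> {..<d}. smul R (?P $$ (i, j)) (Us ! j))"
      by (rule twisted_power_action[OF semilinear_shift hom M U Mu i])
    finally have eq: "V.combine (map (\<lambda>j. const_fun R n (?S $$ (i, j))) [0..<d]) Us =
        V.combine (map (\<lambda>j. const_fun R n (?P $$ (i, j))) [0..<d]) Us"
      using comb[of "\<lambda>j. ?S $$ (i, j)"] comb[of "\<lambda>j. ?P $$ (i, j)"] S Pij by simp
    let ?a = "V.combine (map (\<lambda>j. const_fun R n (?S $$ (i, j))) [0..<d]) Us"
    have sets: "set (map (\<lambda>j. const_fun R n (?S $$ (i, j))) [0..<d]) \<subseteq> Scal n"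
      "set (map (\<lambda>j. const_fun R n (?P $$ (i, j))) [0..<d]) \<subseteq> Scal n"
      using S Pij by auto
    have "?a \<in> V.Span (Scal n) Us"
      using V.Span_mem_iff_length_version[OF sf Us(1)] sets(1) Us(3)
      by (metis length_map length_upt minus_nat.diff_0)
    from V.unique_decomposition[OF sf Us(2) this]
    have "map (\<lambda>j. const_fun R n (?S $$ (i, j))) [0..<d] = map (\<lambda>j. const_fun R n (?P $$ (i, j))) [0..<d]"
      using sets eq Us(3) by (metis (no_types, lifting) length_map length_upt minus_nat.diff_0)
    \<comment> \<open>Equal diagonal vectors are compared at place 0, which lies in the range as n >
      0.\<close>
    hence "const_fun R n (?S $$ (i, j)) 0 = const_fun R n (?P $$ (i, j)) 0"
      using j by (simp add: map_eq_conv)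
    thus ?thesis using n_pos by (simp add: const_fun_def)
  qed
  hence "?P = scalar_mat R d a"
    using P by (intro eq_matI) (auto simp: mats_def scalar_mat_def)
  thus ?thesis using M by blast
qed

lemma shift_subspace_carrier: "shift_subspace (carrier (V n))"
proof -
  interpret V: cring "V n" by (rule V_cring)
  show ?thesis
    by (rule shift_subspaceI) (auto intro: smul_in_V shift_closed)
qed

text \<open>A solution makes the space E^d of rows a module over the cyclic algebra, with x acting
  by v -> \<theta>(v) M. The annihilator of the first unit vector is the desired left ideal: it
  omits 1, and it is nonzero because the n vectors v, T v, ..., T^(n-1) v in a space of dimension d
  < n satisfy a relation.\<close>

lemma proper_subspace_of_matrix:
  assumes M: "M \<in> mats R d" and tp: "twisted_power R d \<theta> M n = scalar_mat R d a" and d: "1 \<le> d" "d < n"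
  shows "\<exists>L. shift_subspace L \<and> L \<noteq> carrier (V n) \<and> L \<noteq> {\<zero>\<^bsub>V n\<^esub>}"
proof -
  interpret Vd: cring "V d" by (rule V_cring)
  interpret Vn: cring "V n" by (rule V_cring)
  define T where "T v = (\<lambda>k. if k < d then \<Oplus>j\<in>{..<d}. \<theta> (v j) \<otimes> M $$ (j, k) else \<zero>)" for v
  note Mm = mats_mem[OF M]
  have T: "semilinear d \<theta> T"
    unfolding semilinear_def
  proof (intro conjI ballI)
    fix v assume v: "v \<in> carrier (V d)"
    have "(\<Oplus>j\<in>{..<d}. \<theta> (v j) \<otimes> M $$ (j, k)) \<in> carrier R" if "k < d" for k
      using V_mem[OF v] hom_closed Mm that by (intro finsum_closed) auto
    thus "T v \<in> carrier (V d)" by (auto simp: T_def V_carrier_iff)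
  next
    fix v w assume v: "v \<in> carrier (V d)" and w: "w \<in> carrier (V d)"
    have "(\<Oplus>j\<in>{..<d}. \<theta> (v j \<oplus> w j) \<otimes> M $$ (j, k)) =
      (\<Oplus>j\<in>{..<d}. \<theta> (v j) \<otimes> M $$ (j, k)) \<oplus> (\<Oplus>j\<in>{..<d}. \<theta> (w j) \<otimes> M $$ (j, k))" if k: "k < d" for k
    proof -
      have "(\<Oplus>j\<in>{..<d}. \<theta> (v j \<oplus> w j) \<otimes> M $$ (j, k)) =
        (\<Oplus>j\<in>{..<d}. \<theta> (v j) \<otimes> M $$ (j, k) \<oplus> \<theta> (w j) \<otimes> M $$ (j, k))"
        using V_mem[OF v] V_mem[OF w] hom_closed Mm k ring_hom_add[OF hom]
        by (intro finsum_cong') (auto simp: l_distr)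
      thus ?thesis
        using V_mem[OF v] V_mem[OF w] hom_closed Mm k by (simp add: finsum_addf Pi_iff)
    qed
    thus "T (v \<oplus>\<^bsub>V d\<^esub> w) = T v \<oplus>\<^bsub>V d\<^esub> T w"
      by (auto simp: T_def V_simps fun_eq_iff)
  next
    fix e v assume e: "e \<in> carrier R" and v: "v \<in> carrier (V d)"
    have "(\<Oplus>j\<in>{..<d}. \<theta> (e \<otimes> v j) \<otimes> M $$ (j, k)) = \<theta> e \<otimes> (\<Oplus>j\<in>{..<d}. \<theta> (v j) \<otimes> M $$ (j, k))"
      if k: "k < d" for k
    proof -
      have "(\<Oplus>j\<in>{..<d}. \<theta> (e \<otimes> v j) \<otimes> M $$ (j, k)) = (\<Oplus>j\<in>{..<d}. \<theta> e \<otimes> (\<theta> (v j) \<otimes> M $$ (j, k)))"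
        using V_mem[OF v] e hom_closed Mm k ring_hom_mult[OF hom]
        by (intro finsum_cong') (auto simp: m_assoc)
      thus ?thesis
        using V_mem[OF v] e hom_closed Mm k by (simp add: finsum_rdistr Pi_iff)
    qed
    thus "T (smul R e v) = smul R (\<theta> e) (T v)"
      using hom_closed[OF e] by (auto simp: T_def smul_def fun_eq_iff)
  qed
  note u = unit_fun_in_V[where d = d]
  have Tu: "T (unit_fun R i) = (\<Oplus>\<^bsub>V d\<^esub> j \<in> {..<d}. smul R (M $$ (i, j)) (unit_fun R j))" if i: "i < d" for i
  proof -
    have Ti: "T (unit_fun R i) k = M $$ (i, k)" if k: "k < d" for k
    proof -
      have "(\<Oplus>j\<in>{..<d}. \<theta> (unit_fun R i j) \<otimes> M $$ (j, k)) = \<theta> (unit_fun R i i) \<otimes> M $$ (i, k)"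
        using i k Mm ring_hom_one[OF hom] ring_hom_zero[OF hom ring_axioms ring_axioms]
        by (intro finsum_single[of "{..<d}" i "\<lambda>j. \<theta> (unit_fun R i j) \<otimes> M $$ (j, k)"]) (auto simp: unit_fun_def)
      thus ?thesis using k i Mm ring_hom_one[OF hom] by (simp add: T_def unit_fun_def)
    qed
    have "T (unit_fun R i) = (\<Oplus>\<^bsub>V d\<^esub> j \<in> {..<d}. smul R (T (unit_fun R i) j) (unit_fun R j))"
      by (rule V_unit_expansion[OF semilinearD(1)[OF T u[OF i]]])
    also have "\<dots> = (\<Oplus>\<^bsub>V d\<^esub> j \<in> {..<d}. smul R (M $$ (i, j)) (unit_fun R j))"
      using Ti i Mm u by (intro Vd.finsum_cong') (auto intro!: smul_in_V)
    finally show ?thesis .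
  qed
  define v where "v = unit_fun R 0"
  have v: "v \<in> carrier (V d)" using u[of 0] d by (simp add: v_def)
  have "(T ^^ n) v = (\<Oplus>\<^bsub>V d\<^esub> j \<in> {..<d}. smul R (scalar_mat R d a $$ (0, j)) (unit_fun R j))"
    using twisted_power_action[OF T hom M u Tu, of 0 n] d by (simp add: tp v_def)
  also have "\<dots> = smul R (scalar_mat R d a $$ (0, 0)) (unit_fun R 0)"
    using d a_closed u
    by (intro Vd.finsum_single[of "{..<d}" 0 "\<lambda>j. smul R (scalar_mat R d a $$ (0, j)) (unit_fun R j)"])
       (auto simp: scalar_mat_def smul_zero intro!: smul_in_V)
  finally have Tn: "(T ^^ n) v = smul R a v"
    using d by (simp add: scalar_mat_def v_def)
  define L where "L = {b \<in> carrier (V n). orbit_comb n T d v b = \<zero>\<^bsub>V d\<^esub>}"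
  have T0: "T (\<zero>\<^bsub>V d\<^esub>) = \<zero>\<^bsub>V d\<^esub>"
    using semilinear_finsum[OF T hom, of "{}"] by simp
  have z: "\<zero>\<^bsub>V n\<^esub> = smul R \<zero> (unit_fun R 0)"
    using smul_zero[OF units_carrier] by simp
  have "shift_subspace L"
  proof (rule shift_subspaceI)
    show "\<zero>\<^bsub>V n\<^esub> \<in> L"
    proof -
      have "orbit_comb n T d v (\<zero>\<^bsub>V n\<^esub>) = \<zero>\<^bsub>V d\<^esub>"
        unfolding z orbit_comb_smul[OF T v units_carrier zero_closed]
        by (rule smul_zero[OF orbit_comb_closed[OF T v units_carrier]])
      thus ?thesis by (simp add: L_def)
    qed
    show "b \<oplus>\<^bsub>V n\<^esub> c \<in> L" if "b \<in> L" "c \<in> L" for b c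
      using that orbit_comb_add[OF T v] by (simp add: L_def)
    show "smul R e b \<in> L" if "e \<in> carrier R" "b \<in> L" for e b
      using that orbit_comb_smul[OF T v] by (simp add: L_def smul_in_V) (simp add: V_simps smul_def)
    show "shift b \<in> L" if "b \<in> L" for b
      using that orbit_comb_shift[OF T v _ Tn] T0 by (simp add: L_def shift_closed)
  qed (auto simp: L_def)
  moreover have "unit_fun R 0 \<notin> L"
  proof
    assume "unit_fun R 0 \<in> L"
    hence "v = \<zero>\<^bsub>V d\<^esub>" using orbit_comb_unit[OF T v n_pos] by (simp add: L_def)
    hence "v 0 = \<zero>" by (simp add: V_simps)
    thus False by (simp add: v_def unit_fun_def)
  qed
  hence "L \<noteq> carrier (V n)" using units_carrier by blast
  moreover have "L \<noteq> {\<zero>\<^bsub>V n\<^esub>}"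
  proof -
    let ?Us = "map (\<lambda>j. (T ^^ j) v) [0..<n]"
    have d0: "d > 0" using d by simp
    note sf = Scal_subfield[OF d0]
    have Us: "set ?Us \<subseteq> carrier (V d)" using T_pow_closed[OF T v] by auto
    have "\<not> Vd.independent (Scal d) ?Us"
      using Vd.independent_length_le_dimension[OF sf V_dimension[OF d0] _ Us] d(2) by auto
    then obtain Ks where Ks: "length Ks = length ?Us" "Vd.combine Ks ?Us = \<zero>\<^bsub>V d\<^esub>" "set Ks \<subseteq> Scal d" "set Ks \<noteq> {\<zero>\<^bsub>V d\<^esub>}"
      by (rule Vd.dependent_imp_non_trivial_combine[OF sf Us])
    have "\<forall>j<n. \<exists>e\<in>carrier R. Ks ! j = const_fun R d e"
      using Ks(1,3) nth_mem by fastforce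
    then obtain c where c: "\<And>j. j < n \<Longrightarrow> c j \<in> carrier R \<and> Ks ! j = const_fun R d (c j)"
      by metis
    define b where "b j = (if j < n then c j else \<zero>)" for j
    have b: "b \<in> carrier (V n)" using c by (auto simp: b_def V_carrier_iff)
    have Kc: "set Ks \<subseteq> carrier (V d)" using Ks(3) Scal_carrier by blast
    have "(\<Oplus>\<^bsub>V d\<^esub> j \<in> {..<n}. Ks ! j \<otimes>\<^bsub>V d\<^esub> ?Us ! j) = \<zero>\<^bsub>V d\<^esub>"
      using Vd.combine_eq_finsum[OF Ks(1) Kc Us] Ks(2) by simp
    moreover have "(\<Oplus>\<^bsub>V d\<^esub> j \<in> {..<n}. Ks ! j \<otimes>\<^bsub>V d\<^esub> ?Us ! j) = orbit_comb n T d v b"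
      unfolding orbit_comb_def using c T_pow_closed[OF T v]
      by (intro Vd.finsum_cong') (auto simp: b_def const_fun_mult intro!: smul_in_V)
    ultimately have "b \<in> L" using b by (simp add: L_def)
    moreover have "b \<noteq> \<zero>\<^bsub>V n\<^esub>"
    proof
      assume "b = \<zero>\<^bsub>V n\<^esub>"
      hence "c j = \<zero>" if "j < n" for j
        using that by (auto simp: b_def V_simps fun_eq_iff dest: spec[of _ j])
      hence "Ks ! j = \<zero>\<^bsub>V d\<^esub>" if "j < n" for j
        using c[OF that] that by (auto simp: const_fun_def V_simps)
      hence "set Ks \<subseteq> {\<zero>\<^bsub>V d\<^esub>}" using Ks(1) by (auto simp: in_set_conv_nth)
      moreover have "set Ks \<noteq> {}" using Ks(1) n_pos by auto
      ultimately show False using Ks(4) by (metis subset_singletonD)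
    qed
    ultimately show ?thesis by blast
  qed
  ultimately show ?thesis by blast
qed

lemma rmult_zero_right:
  assumes v: "v \<in> carrier (V n)"
  shows "rmult v (\<zero>\<^bsub>V n\<^esub>) = \<zero>\<^bsub>V n\<^esub>"
  by (rule linear_map_zero[OF orbit_comb_linear[OF v]])

lemma rmult_preimage:
  assumes b: "b \<in> carrier (V n)" and I: "shift_subspace I" and W: "shift_subspace W"
  shows "shift_subspace {v \<in> I. rmult b v \<in> W}"
proof (rule shift_subspaceI)
  note Id = subspaceD[OF shift_subspaceD(1)[OF I]] and Wd = subspaceD[OF shift_subspaceD(1)[OF W]]
  note lin = linear_mapD[OF orbit_comb_linear[OF b]]
  have IV: "v \<in> I \<Longrightarrow> v \<in> carrier (V n)" for v using Id(1) by (rule subsetD)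
  show "{v \<in> I. rmult b v \<in> W} \<subseteq> carrier (V n)" using IV by auto
  show "\<zero>\<^bsub>V n\<^esub> \<in> {v \<in> I. rmult b v \<in> W}" using Id(2) Wd(2) rmult_zero_right[OF b] by simp
  show "v \<oplus>\<^bsub>V n\<^esub> w \<in> {v \<in> I. rmult b v \<in> W}"
    if "v \<in> {v \<in> I. rmult b v \<in> W}" "w \<in> {v \<in> I. rmult b v \<in> W}" for v w
    using that Id(3) Wd(3) lin(2)[of v w] IV by simp
  show "smul R e v \<in> {v \<in> I. rmult b v \<in> W}"
    if "e \<in> carrier R" "v \<in> {v \<in> I. rmult b v \<in> W}" for e v
    using that Id(4) Wd(4) lin(3)[of v e] IV by simp
  show "shift v \<in> {v \<in> I. rmult b v \<in> W}" if "v \<in> {v \<in> I. rmult b v \<in> W}" for v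
    using that shift_subspaceD(2)[OF I] shift_subspaceD(2)[OF W] rmult_shift[OF b] IV by simp
qed

lemma shift_subspace_sum:
  assumes I: "shift_subspace I" and W: "shift_subspace W"
  shows "shift_subspace (I <+>\<^bsub>V n\<^esub> W)"
proof (rule shift_subspaceI)
  interpret V: cring "V n" by (rule V_cring)
  note Id = subspaceD[OF shift_subspaceD(1)[OF I]] and Wd = subspaceD[OF shift_subspaceD(1)[OF W]]
  have IV: "v \<in> I \<Longrightarrow> v \<in> carrier (V n)" for v using Id(1) by (rule subsetD)
  have WV: "v \<in> W \<Longrightarrow> v \<in> carrier (V n)" for v using Wd(1) by (rule subsetD)
  have mem: "x \<in> I <+>\<^bsub>V n\<^esub> W \<longleftrightarrow> (\<exists>v\<in>I. \<exists>w\<in>W. x = v \<oplus>\<^bsub>V n\<^esub> w)" for x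
    by (auto simp: set_add_def set_mult_def)
  show "I <+>\<^bsub>V n\<^esub> W \<subseteq> carrier (V n)"
    using IV WV by (auto simp: mem)
  show "\<zero>\<^bsub>V n\<^esub> \<in> I <+>\<^bsub>V n\<^esub> W"
    unfolding mem by (intro bexI[OF _ Id(2)] bexI[OF _ Wd(2)]) simp
  show "x \<oplus>\<^bsub>V n\<^esub> y \<in> I <+>\<^bsub>V n\<^esub> W" if xy: "x \<in> I <+>\<^bsub>V n\<^esub> W" "y \<in> I <+>\<^bsub>V n\<^esub> W" for x y
  proof -
    obtain v w v' w' where *: "v \<in> I" "w \<in> W" "x = v \<oplus>\<^bsub>V n\<^esub> w" "v' \<in> I" "w' \<in> W" "y = v' \<oplus>\<^bsub>V n\<^esub> w'"
      using xy unfolding mem by blast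
    have "x \<oplus>\<^bsub>V n\<^esub> y = (v \<oplus>\<^bsub>V n\<^esub> v') \<oplus>\<^bsub>V n\<^esub> (w \<oplus>\<^bsub>V n\<^esub> w')"
      unfolding *(3,6) using IV[OF *(1)] IV[OF *(4)] WV[OF *(2)] WV[OF *(5)] by (simp add: V.a_ac)
    thus ?thesis unfolding mem using Id(3)[OF *(1,4)] Wd(3)[OF *(2,5)] by blast
  qed
  show "smul R e x \<in> I <+>\<^bsub>V n\<^esub> W" if e: "e \<in> carrier R" and x: "x \<in> I <+>\<^bsub>V n\<^esub> W" for e x
  proof -
    obtain v w where *: "v \<in> I" "w \<in> W" "x = v \<oplus>\<^bsub>V n\<^esub> w"
      using x unfolding mem by blast
    have "smul R e x = smul R e v \<oplus>\<^bsub>V n\<^esub> smul R e w"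
      unfolding *(3) by (rule smul_add[OF e IV[OF *(1)] WV[OF *(2)]])
    thus ?thesis unfolding mem using Id(4)[OF e *(1)] Wd(4)[OF e *(2)] by blast
  qed
  show "shift x \<in> I <+>\<^bsub>V n\<^esub> W" if x: "x \<in> I <+>\<^bsub>V n\<^esub> W" for x
  proof -
    obtain v w where *: "v \<in> I" "w \<in> W" "x = v \<oplus>\<^bsub>V n\<^esub> w"
      using x unfolding mem by blast
    have "shift x = shift v \<oplus>\<^bsub>V n\<^esub> shift w"
      unfolding *(3) by (rule shift_add[OF IV[OF *(1)] WV[OF *(2)]])
    thus ?thesis unfolding mem using shift_subspaceD(2)[OF I *(1)] shift_subspaceD(2)[OF W *(2)] by blast
  qed
qed

lemma shift_subspace_zero: "shift_subspace {\<zero>\<^bsub>V n\<^esub>}"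
proof -
  interpret V: cring "V n" by (rule V_cring)
  have "shift (\<zero>\<^bsub>V n\<^esub>) = \<zero>\<^bsub>V n\<^esub>"
    using semilinear_finsum[OF semilinear_shift hom, of "{}"] by simp
  moreover have "smul R e (\<zero>\<^bsub>V n\<^esub>) = \<zero>\<^bsub>V n\<^esub>" if "e \<in> carrier R" for e
    using that by (simp add: V_simps smul_def)
  ultimately show ?thesis
    by (intro shift_subspaceI) auto
qed

lemma shift_subspace_image:
  assumes b: "b \<in> carrier (V n)" and I: "shift_subspace I"
  shows "shift_subspace (rmult b ` I)"
proof (rule shift_subspaceI)
  note Id = subspaceD[OF shift_subspaceD(1)[OF I]]
  note lin = linear_mapD[OF orbit_comb_linear[OF b]]
  have IV: "v \<in> I \<Longrightarrow> v \<in> carrier (V n)" for v using Id(1) by (rule subsetD)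
  show "rmult b ` I \<subseteq> carrier (V n)" using lin(1) IV by auto
  show "\<zero>\<^bsub>V n\<^esub> \<in> rmult b ` I"
    using rmult_zero_right[OF b] Id(2) by (intro image_eqI) auto
  show "x \<oplus>\<^bsub>V n\<^esub> y \<in> rmult b ` I" if xy: "x \<in> rmult b ` I" "y \<in> rmult b ` I" for x y
  proof -
    obtain v w where *: "v \<in> I" "w \<in> I" "x = rmult b v" "y = rmult b w" using xy by blast
    show ?thesis
      unfolding *(3,4) lin(2)[OF IV[OF *(1)] IV[OF *(2)], symmetric] by (intro imageI Id(3) *)
  qed
  show "smul R e x \<in> rmult b ` I" if e: "e \<in> carrier R" and x: "x \<in> rmult b ` I" for e x
  proof -
    obtain v where *: "v \<in> I" "x = rmult b v" using x by blast
    show ?thesis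
      unfolding *(2) lin(3)[OF IV[OF *(1)] e, symmetric] by (intro imageI Id(4) * e)
  qed
  show "shift x \<in> rmult b ` I" if x: "x \<in> rmult b ` I" for x
  proof -
    obtain v where *: "v \<in> I" "x = rmult b v" using x by blast
    show ?thesis
      unfolding *(2) rmult_shift[OF b IV[OF *(1)], symmetric] by (intro imageI shift_subspaceD(2)[OF I] *)
  qed
qed

text \<open>A nonzero left ideal \<open>I\<close> of minimal dimension \<open>d\<close> is simple, and the cyclic algebra, being
  simple, is a sum of images \<open>I b\<close>, each of which is zero or of dimension \<open>d\<close>.\<close>

lemma minimal_dimension_dvd:
  assumes I: "shift_subspace I" and dim: "vdim n d I" and d: "d \<ge> 1"
    and min: "\<And>L k. shift_subspace L \<Longrightarrow> vdim n k L \<Longrightarrow> 1 \<le> k \<Longrightarrow> d \<le> k"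
  shows "d dvd n"
proof -
  interpret V: cring "V n" by (rule V_cring)
  note sf = Scal_subfield[OF n_pos]
  note Id = subspaceD[OF shift_subspaceD(1)[OF I]]
  \<comment> \<open>In place of a sum of images of \<open>I\<close>, any left ideal \<open>W\<close>
    of dimension m d with the largest possible m is taken.\<close>
  define Q where "Q m \<longleftrightarrow> (\<exists>W. shift_subspace W \<and> vdim n (m * d) W)" for m
  have "Q 0"
    unfolding Q_def using shift_subspace_zero by (intro exI[of _ "{\<zero>\<^bsub>V n\<^esub>}"]) simp
  moreover have Qn: "m \<le> n" if Qm: "Q m" for m
  proof -
    obtain W where W: "shift_subspace W" "vdim n (m * d) W" using Qm Q_def by auto
    obtain k where "vdim n k W" "k \<le> n"
      by (rule subspace_dim[OF n_pos shift_subspaceD(1)[OF W(1)]])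
    hence "m * d \<le> n" using V.dimension_is_inj[OF sf W(2)] by simp
    moreover have "m * 1 \<le> m * d" using d by (intro mult_le_mono) auto
    ultimately show ?thesis by linarith
  qed
  ultimately have "finite {m. Q m}" "{m. Q m} \<noteq> {}"
    by (auto intro: finite_subset[of _ "{..n}"])
  hence "Max {m. Q m} \<in> {m. Q m}" "\<And>m'. m' \<in> {m. Q m} \<Longrightarrow> m' \<le> Max {m. Q m}"
    by (rule Max_in, intro Max_ge)
  then obtain m where m: "Q m" "\<And>m'. Q m' \<Longrightarrow> m' \<le> m"
    by simp
  from m(1) obtain W where W: "shift_subspace W" "vdim n (m * d) W" using Q_def by auto
  note Wd = subspaceD[OF shift_subspaceD(1)[OF W(1)]]
  have absorb: "rmult b v \<in> W" if b: "b \<in> carrier (V n)" and v: "v \<in> I" for b v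
  proof (rule ccontr)
    assume nw: "rmult b v \<notin> W"
    \<comment> \<open>If I b is not inside \<open>W\<close>, minimality of d makes the part of
      \<open>I\<close> sent into \<open>W\<close> zero. So b is injective on \<open>I\<close>, the
      image I b meets \<open>W\<close> only in 0, and I b + W has dimension (m + 1) d.\<close>
    define I' where "I' = {v \<in> I. rmult b v \<in> W}"
    have I': "shift_subspace I'" unfolding I'_def by (rule rmult_preimage[OF b I W(1)])
    obtain k where k: "vdim n k I'" "k \<le> d" "k = d \<longleftrightarrow> I' = I"
      by (rule subspace_dim_mono[OF n_pos shift_subspaceD(1)[OF I'] dim]) (auto simp: I'_def)
    have "I' \<noteq> I" using v nw by (auto simp: I'_def)
    hence "k < d" using k(2,3) by simp
    hence "k = 0" using min[OF I' k(1)] by (cases "1 \<le> k") auto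
    hence I'0: "I' = {\<zero>\<^bsub>V n\<^esub>}" using V.dimension_zero[OF sf] k(1) by simp
    have IV: "v \<in> I \<Longrightarrow> v \<in> carrier (V n)" for v using Id(1) by (rule subsetD)
    note lin = linear_mapD[OF orbit_comb_linear[OF b]]
    have "v = \<zero>\<^bsub>V n\<^esub>" if "v \<in> I" "rmult b v = \<zero>\<^bsub>V n\<^esub>" for v
    proof -
      have "v \<in> I'" using that Wd(2) by (simp add: I'_def)
      thus ?thesis unfolding I'0 by simp
    qed
    hence "inj_on (rmult b) I"
      by (rule linear_map_inj_on[OF orbit_comb_linear[OF b] shift_subspaceD(1)[OF I]])
    hence dimI: "vdim n d (rmult b ` I)"
      by (rule linear_map_dim[OF n_pos orbit_comb_linear[OF b] dim])
    have "rmult b ` I \<inter> W = {\<zero>\<^bsub>V n\<^esub>}"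
    proof (intro equalityI subsetI)
      fix x assume "x \<in> rmult b ` I \<inter> W"
      then obtain y where "y \<in> I'" "x = rmult b y" by (auto simp: I'_def)
      thus "x \<in> {\<zero>\<^bsub>V n\<^esub>}" using rmult_zero_right[OF b] unfolding I'0 by simp
    next
      fix x assume "x \<in> {\<zero>\<^bsub>V n\<^esub>}"
      thus "x \<in> rmult b ` I \<inter> W"
        using subspaceD(2)[OF shift_subspaceD(1)[OF shift_subspace_image[OF b I]]] Wd(2) by simp
    qed
    hence "vdim n (d + m * d) (rmult b ` I <+>\<^bsub>V n\<^esub> W)"
      by (rule V.dimension_direct_sum_space[OF sf dimI W(2)])
    hence "Q (Suc m)"
      unfolding Q_def using shift_subspace_sum[OF shift_subspace_image[OF b I] W(1)] by auto
    thus False using m(2)[of "Suc m"] by simp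
  qed
  \<comment> \<open>The elements v with v b in \<open>W\<close> for all b. This is a two-sided
    ideal; it contains \<open>I\<close> by \<open>absorb\<close>, and it lies in \<open>W\<close>
    because b = 1 is allowed.\<close>
  define J where "J = {v \<in> carrier (V n). \<forall>b\<in>carrier (V n). rmult b v \<in> W}"
  have J_alt: "v \<in> J \<longleftrightarrow> v \<in> carrier (V n) \<and> (\<forall>b\<in>carrier (V n). v \<in> {v \<in> carrier (V n). rmult b v \<in> W})" for v
    by (auto simp: J_def)
  note pre = rmult_preimage[OF _ shift_subspace_carrier W(1)]
  have J: "shift_subspace J"
  proof (rule shift_subspaceI)
    show "J \<subseteq> carrier (V n)" by (auto simp: J_def)
    show "\<zero>\<^bsub>V n\<^esub> \<in> J"
      unfolding J_alt using subspaceD(2)[OF shift_subspaceD(1)[OF pre]] by blast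
    show "v \<oplus>\<^bsub>V n\<^esub> w \<in> J" if "v \<in> J" "w \<in> J" for v w
      using that subspaceD(3)[OF shift_subspaceD(1)[OF pre], of _ v w] unfolding J_alt by simp
    show "smul R e v \<in> J" if "e \<in> carrier R" "v \<in> J" for e v
      using that subspaceD(4)[OF shift_subspaceD(1)[OF pre], of _ e v] unfolding J_alt by (simp add: smul_in_V)
    show "shift v \<in> J" if "v \<in> J" for v
      using that shift_subspaceD(2)[OF pre, of _ v] unfolding J_alt by (simp add: shift_closed)
  qed
  obtain v where v: "v \<in> I" "v \<noteq> \<zero>\<^bsub>V n\<^esub>"
  proof -
    have "I \<noteq> {\<zero>\<^bsub>V n\<^esub>}"
    proof
      assume "I = {\<zero>\<^bsub>V n\<^esub>}"
      hence "vdim n 0 I" by simp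
      thus False using V.dimension_is_inj[OF sf dim] d by simp
    qed
    thus ?thesis using Id(2) that by blast
  qed
  have vJ: "v \<in> J" using absorb v(1) subsetD[OF Id(1) v(1)] by (simp add: J_def)
  have hV: "smul R h (unit_fun R 0) \<in> carrier (V n)" by (rule smul_in_V[OF h_closed units_carrier])
  have "rmult (smul R h (unit_fun R 0)) w \<in> J" if w: "w \<in> J" for w
  proof -
    have wV: "w \<in> carrier (V n)" using w by (simp add: J_def)
    have "rmult b (rmult (smul R h (unit_fun R 0)) w) \<in> W" if b: "b \<in> carrier (V n)" for b
      using w rmult_rmult[OF b hV wV] rmult_closed[OF b hV] by (simp add: J_def)
    thus ?thesis using rmult_closed[OF hV wV] by (simp add: J_def)
  qed
  from simplicity[OF J this vJ v(2)] have "unit_fun R 0 \<in> J" .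
  hence "unit_fun R 0 \<in> W"
    using rmult_unit[OF units_carrier] units_carrier by (auto simp: J_def)
  hence "W = carrier (V n)" by (rule shift_subspace_unit[OF W(1)])
  hence "m * d = n"
    using V.dimension_is_inj[OF sf W(2)] V_dimension[OF n_pos] by simp
  thus ?thesis by (metis dvd_triv_right)
qed

text \<open>The least positive dimension d of a left ideal is the divisor sought; it is less than n
  because \<open>L\<close> is proper and nonzero.\<close>

lemma divisor_of_proper_subspace:
  assumes L: "shift_subspace L" "L \<noteq> carrier (V n)" "L \<noteq> {\<zero>\<^bsub>V n\<^esub>}"
  shows "\<exists>d M. 1 \<le> d \<and> d < n \<and> d dvd n \<and> M \<in> mats R d \<and> twisted_power R d \<theta> M n = scalar_mat R d a"
proof -
  interpret V: cring "V n" by (rule V_cring)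
  note sf = Scal_subfield[OF n_pos]
  define P where "P k \<longleftrightarrow> 1 \<le> k \<and> (\<exists>I. shift_subspace I \<and> vdim n k I)" for k
  obtain k where k: "vdim n k L" "k \<le> n" "k = n \<longleftrightarrow> L = carrier (V n)"
    by (rule subspace_dim[OF n_pos shift_subspaceD(1)[OF L(1)]])
  have "k \<noteq> 0" using V.dimension_zero[OF sf] k(1) L(3) by auto
  hence "P k" using k(1) L(1) by (auto simp: P_def)
  define d where "d = (LEAST k. P k)"
  have "P d" and le: "\<And>k. P k \<Longrightarrow> d \<le> k"
    unfolding d_def using \<open>P k\<close> by (auto intro: LeastI Least_le)
  then obtain I where I: "shift_subspace I" "vdim n d I" and d: "1 \<le> d"
    by (auto simp: P_def)
  have "d dvd n"
    by (rule minimal_dimension_dvd[OF I d]) (auto intro!: le simp: P_def)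
  moreover have "d < n" using le[OF \<open>P k\<close>] k L(2) by simp
  ultimately show ?thesis
    using shift_subspace_matrix[OF I] d by blast
qed

text \<open>By dimension an injective right multiplication by u is onto, so u alone generates
  everything as a left ideal. In a domain this rules out proper nonzero left ideals.\<close>

lemma shift_subspace_full:
  assumes L: "shift_subspace L" and u: "u \<in> L"
    and inj: "\<And>b. b \<in> carrier (V n) \<Longrightarrow> rmult u b = \<zero>\<^bsub>V n\<^esub> \<Longrightarrow> b = \<zero>\<^bsub>V n\<^esub>"
  shows "L = carrier (V n)"
proof -
  interpret V: cring "V n" by (rule V_cring)
  note sf = Scal_subfield[OF n_pos]
  note Ld = subspaceD[OF shift_subspaceD(1)[OF L]]
  have uV: "u \<in> carrier (V n)" by (rule subsetD[OF Ld(1) u])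
  note lin = linear_mapD[OF orbit_comb_linear[OF uV]]
  have "inj_on (rmult u) (carrier (V n))"
    using inj by (rule linear_map_inj_on[OF orbit_comb_linear[OF uV] shift_subspaceD(1)[OF shift_subspace_carrier]])
  hence "vdim n n (rmult u ` carrier (V n))"
    by (rule linear_map_dim[OF n_pos orbit_comb_linear[OF uV] V_dimension[OF n_pos]])
  moreover obtain k where k: "vdim n k (rmult u ` carrier (V n))"
     "k = n \<longleftrightarrow> rmult u ` carrier (V n) = carrier (V n)"
    by (rule subspace_dim[OF n_pos shift_subspaceD(1)[OF shift_subspace_image[OF uV shift_subspace_carrier]]])
  ultimately have "rmult u ` carrier (V n) = carrier (V n)"
    using V.dimension_is_inj[OF sf] by blast
  moreover have "rmult u ` carrier (V n) \<subseteq> L"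
    using shift_subspace_rmult[OF L u] by auto
  ultimately show ?thesis using Ld(1) by auto
qed

end

section \<open>Evaluation homomorphisms from the free algebra and from polynomial rings\<close>

text \<open>The instances are the free algebra, the operators on K[x][y] and the field K(x).
  Homomorphisms from the free algebra are taken into the last two.\<close>

locale central_scalars =
  fixes C :: "'k::field \<Rightarrow> 'r::ring_1"
  assumes C_add: "C (a + b) = C a + C b"
    and C_mult: "C (a * b) = C a * C b"
    and C_1: "C 1 = 1"
    and C_central: "C a * z = z * C a"
begin

lemma C_0: "C 0 = 0"
  using C_add[of 0 0] by simp

lemma C_uminus: "C (- a) = - C a"
proof -
  have "C (- a) + C a = 0" using C_add[of "- a" a] C_0 by simp
  thus ?thesis by (simp add: eq_neg_iff_add_eq_0)
qed

lemma C_diff: "C (a - b) = C a - C b"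
  using C_add[of a "- b"] by (simp add: C_uminus)

lemma C_inverse: "a \<noteq> 0 \<Longrightarrow> C (inverse a) * (C a * z) = z"
  by (simp add: mult.assoc[symmetric] C_mult[symmetric] C_1)

lemma C_left_commute: "z * (C a * w) = C a * (z * w)"
  by (metis C_central mult.assoc)

definition word_value :: "'r \<Rightarrow> 'r \<Rightarrow> nc_word \<Rightarrow> 'r" where
  "word_value x y w = prod_list (map (\<lambda>l. case l of Letter_x \<Rightarrow> x | Letter_y \<Rightarrow> y) (letters w))"

lemma word_value_plus: "word_value x y (v + w) = word_value x y v * word_value x y w"
  by (simp add: word_value_def plus_nc_word_def)

lemma word_value_0: "word_value x y 0 = 1"
  by (simp add: word_value_def zero_nc_word_def)

definition free_eval :: "'r \<Rightarrow> 'r \<Rightarrow> 'k free_alg \<Rightarrow> 'r" where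
  "free_eval x y u = (\<Sum>w\<in>Poly_Mapping.keys u. C (Poly_Mapping.lookup u w) * word_value x y w)"

lemma free_eval_superset:
  assumes "finite A" "Poly_Mapping.keys u \<subseteq> A"
  shows "free_eval x y u = (\<Sum>w\<in>A. C (Poly_Mapping.lookup u w) * word_value x y w)"
  unfolding free_eval_def using assms
  by (intro sum.mono_neutral_left) (auto simp: in_keys_iff C_0)

lemma free_eval_add: "free_eval x y (u + v) = free_eval x y u + free_eval x y v"
proof -
  let ?A = "Poly_Mapping.keys u \<union> Poly_Mapping.keys v"
  have "Poly_Mapping.keys (u + v) \<subseteq> ?A" by (rule keys_add)
  thus ?thesis
    by (simp add: free_eval_superset[of ?A] lookup_add C_add distrib_right sum.distrib)
qed

lemma free_eval_single: "free_eval x y (Poly_Mapping.single w c) = C c * word_value x y w"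
  by (subst free_eval_superset[of "{w}"]) (auto simp: lookup_single)

lemma free_eval_0: "free_eval x y 0 = 0"
  by (simp add: free_eval_def)

end

lemma free_const_mult_single: "free_const c * Poly_Mapping.single w d = Poly_Mapping.single w (c * d)"
  by (simp add: free_const_def mult_single)

text \<open>A word is built from the empty one by putting letters in front, which fits maps that are
  described by how x and y act on the left.\<close>

lemma free_alg_induct [case_names const add x y]:
  assumes "\<And>c. P (free_const c)" "\<And>u v. P u \<Longrightarrow> P v \<Longrightarrow> P (u + v)"
    "\<And>u. P u \<Longrightarrow> P (free_x * u)" "\<And>u. P u \<Longrightarrow> P (free_y * u)"
  shows "P u"
proof (induction u rule: Poly_Mapping.update_induct)
  case const
  have "P (free_const 0)" by (rule assms)
  thus ?case by (simp add: free_const_def)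
next
  case (update f w c)
  have single: "P (Poly_Mapping.single (Word l) c)" for l
  proof (induction l)
    case Nil
    show ?case using assms(1)[of c] by (simp add: free_const_def zero_nc_word_def)
  next
    case (Cons a l)
    show ?case
      using assms(3)[OF Cons] assms(4)[OF Cons]
      by (cases a) (simp_all add: free_x_def free_y_def mult_single plus_nc_word_def)
  qed
  have "Poly_Mapping.update w c f = f + Poly_Mapping.single w c"
    using update.hyps
    by (intro poly_mapping_eqI) (auto simp: lookup_add lookup_update lookup_single when_def in_keys_iff)
  moreover obtain l where "w = Word l" by (cases w)
  ultimately show ?case using assms(2)[OF update.IH single[of l]] by simp
qed

interpretation free: central_scalars "free_const :: 'k::field \<Rightarrow> 'k free_alg"
proof
  fix a b :: 'k and z :: "'k free_alg"
  show "free_const (a + b) = free_const a + free_const b" by (simp add: free_const_def single_add)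
  show "free_const (a * b) = free_const a * free_const b" by (simp add: free_const_def mult_single)
  show "free_const (1::'k) = 1" by (simp add: free_const_def)
  have s: "free_const a * Poly_Mapping.single w d = Poly_Mapping.single w d * free_const a" for w d
    by (simp add: free_const_def mult_single mult.commute)
  show "free_const a * z = z * free_const a"
  proof (induction z rule: Poly_Mapping.update_induct)
    case const
    show ?case by simp
  next
    case (update f w c)
    have "Poly_Mapping.update w c f = f + Poly_Mapping.single w c"
      using update.hyps
      by (intro poly_mapping_eqI) (auto simp: lookup_add lookup_update lookup_single when_def in_keys_iff)
    thus ?case using update.IH s by (simp add: distrib_left distrib_right)
  qed
qed

context central_scalars
begin

lemma free_eval_const: "free_eval x y (free_const c) = C c"
  by (simp add: free_const_def free_eval_single word_value_0)

lemma free_eval_x: "free_eval x y free_x = x"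
  by (simp add: free_x_def free_eval_single word_value_def C_1)

lemma free_eval_y: "free_eval x y free_y = y"
  by (simp add: free_y_def free_eval_single word_value_def C_1)

lemma free_eval_single_mult:
  "free_eval x y (Poly_Mapping.single w c * v) = C c * word_value x y w * free_eval x y v"
proof (induction v rule: Poly_Mapping.update_induct)
  case const
  show ?case by (simp add: free_eval_0)
next
  case (update f w' d)
  have "Poly_Mapping.update w' d f = f + Poly_Mapping.single w' d"
    using update.hyps
    by (intro poly_mapping_eqI) (auto simp: lookup_add lookup_update lookup_single when_def in_keys_iff)
  moreover have "C c * word_value x y w * (C d * word_value x y w') = C (c * d) * word_value x y (w + w')"
    unfolding C_mult word_value_plus by (metis C_central mult.assoc)
  ultimately show ?case
    using update.IH by (simp add: distrib_left free_eval_add mult_single free_eval_single)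
qed

lemma free_eval_mult: "free_eval x y (u * v) = free_eval x y u * free_eval x y v"
proof (induction u rule: free_alg_induct)
  case (const c)
  show ?case by (simp add: free_const_def free_eval_single free_eval_single_mult word_value_0)
next
  case (add u v)
  thus ?case by (simp add: distrib_right free_eval_add)
next
  case (x u)
  have "free_eval x y (free_x * z) = x * free_eval x y z" for z
    by (simp add: free_x_def free_eval_single_mult word_value_def C_1)
  thus ?case using x by (simp add: mult.assoc)
next
  case (y u)
  have "free_eval x y (free_y * z) = y * free_eval x y z" for z
    by (simp add: free_y_def free_eval_single_mult word_value_def C_1)
  thus ?case using y by (simp add: mult.assoc)
qed

lemma free_eval_1: "free_eval x y 1 = 1"
  using free_eval_const[of x y 1] by (simp add: C_1 free.C_1)

lemma free_eval_uminus: "free_eval x y (- u) = - free_eval x y u"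
proof -
  have "free_eval x y (- u) + free_eval x y u = 0"
    using free_eval_add[of x y "- u" u] by (simp add: free_eval_0)
  thus ?thesis by (simp add: eq_neg_iff_add_eq_0)
qed

lemma free_eval_diff: "free_eval x y (u - v) = free_eval x y u - free_eval x y v"
  using free_eval_add[of x y u "- v"] by (simp add: free_eval_uminus)

lemma free_eval_power: "free_eval x y (u ^ k) = free_eval x y u ^ k"
  by (induction k) (simp_all add: free_eval_1 free_eval_mult)

lemma free_eval_sum: "free_eval x y (sum f A) = (\<Sum>a\<in>A. free_eval x y (f a))"
  by (induction A rule: infinite_finite_induct) (simp_all add: free_eval_0 free_eval_add)

lemmas free_eval_simps = free_eval_const free_eval_x free_eval_y free_eval_add free_eval_mult
  free_eval_0 free_eval_1 free_eval_uminus free_eval_diff free_eval_power free_eval_sum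

end

text \<open>Commutation is asked between scalars and z only, and the scalars may themselves be
  polynomials: with \<open>central_eval_compose\<close> this gives the evaluation of K[t][r] at two
  commuting elements.\<close>

locale central_eval =
  fixes C :: "'k::comm_ring_1 \<Rightarrow> 'r::ring_1" and z :: 'r
  assumes C_add: "C (a + b) = C a + C b"
    and C_mult: "C (a * b) = C a * C b"
    and C_1: "C 1 = 1"
    and C_comm: "C a * z = z * C a"
begin

lemma C_0: "C 0 = 0"
  using C_add[of 0 0] by simp

definition ev :: "'k poly \<Rightarrow> 'r" where
  "ev f = (\<Sum>i\<le>Polynomial.degree f. C (Polynomial.coeff f i) * z ^ i)"

lemma ev_bound: "Polynomial.degree f \<le> m \<Longrightarrow> ev f = (\<Sum>i\<le>m. C (Polynomial.coeff f i) * z ^ i)"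
  unfolding ev_def by (intro sum.mono_neutral_left) (auto simp: C_0 Polynomial.coeff_eq_0)

lemma ev_add: "ev (f + g) = ev f + ev g"
proof -
  let ?m = "max (Polynomial.degree f) (Polynomial.degree g)"
  have "Polynomial.degree (f + g) \<le> ?m" by (rule Polynomial.degree_add_le_max)
  thus ?thesis by (simp add: ev_bound[of _ ?m] C_add distrib_right sum.distrib)
qed

lemma ev_0: "ev 0 = 0"
  by (simp add: ev_def C_0)

lemma ev_pCons: "ev (pCons a f) = C a + z * ev f"
proof -
  have "ev (pCons a f) = (\<Sum>i\<le>Suc (Polynomial.degree f). C (Polynomial.coeff (pCons a f) i) * z ^ i)"
    by (rule ev_bound) (rule Polynomial.degree_pCons_le)
  also have "\<dots> = C a + (\<Sum>i\<le>Polynomial.degree f. C (Polynomial.coeff f i) * z ^ Suc i)"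
    by (subst sum.atMost_Suc_shift) simp
  also have "(\<Sum>i\<le>Polynomial.degree f. C (Polynomial.coeff f i) * z ^ Suc i) = z * ev f"
    unfolding ev_def sum_distrib_left
    by (intro sum.cong refl) (simp add: mult.assoc[symmetric] C_comm)
  finally show ?thesis .
qed

lemma ev_const: "ev [:a:] = C a"
  by (simp add: ev_pCons ev_0)

lemma ev_1: "ev 1 = 1"
  using ev_const[of 1] by (simp add: C_1 one_pCons)

lemma ev_smult: "ev (Polynomial.smult a f) = C a * ev f"
proof (induction f)
  case 0
  show ?case by (simp add: ev_0)
next
  case (pCons b f)
  have "C a * (z * ev f) = z * (C a * ev f)"
    by (simp add: mult.assoc[symmetric] C_comm)
  thus ?case using pCons by (simp add: ev_pCons C_mult distrib_left)
qed

lemma ev_mult: "ev (f * g) = ev f * ev g"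
proof (induction f)
  case 0
  show ?case by (simp add: ev_0)
next
  case (pCons a f)
  have "ev (pCons a f * g) = C a * ev g + (C 0 + z * ev (f * g))"
    by (simp only: Polynomial.mult_pCons_left ev_add ev_smult ev_pCons)
  thus ?case using pCons by (simp add: C_0 ev_pCons distrib_right mult.assoc)
qed

lemma ev_uminus: "ev (- f) = - ev f"
proof -
  have "ev (- f) + ev f = 0" using ev_add[of "- f" f] ev_0 by simp
  thus ?thesis by (simp add: eq_neg_iff_add_eq_0)
qed

lemma ev_diff: "ev (f - g) = ev f - ev g"
  using ev_add[of f "- g"] by (simp add: ev_uminus)

lemma ev_power: "ev (f ^ k) = ev f ^ k"
  by (induction k) (simp_all add: ev_1 ev_mult)

lemma ev_X: "ev [:0, 1:] = z"
  by (simp add: ev_pCons C_0 C_1 ev_0)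

lemma ev_monom: "ev (Polynomial.monom a k) = C a * z ^ k"
proof (induction k)
  case 0
  show ?case by (simp add: Polynomial.monom_0 ev_const)
next
  case (Suc k)
  have "ev (Polynomial.monom a (Suc k)) = z * (C a * z ^ k)"
    using Suc by (simp add: Polynomial.monom_Suc ev_pCons C_0)
  also have "\<dots> = C a * z ^ Suc k"
    by (simp add: mult.assoc[symmetric] C_comm)
  finally show ?case .
qed

lemma ev_commute: "(\<And>a. C a * w = w * C a) \<Longrightarrow> z * w = w * z \<Longrightarrow> ev f * w = w * ev f"
  by (induction f) (simp_all add: ev_0 ev_pCons distrib_left distrib_right, metis mult.assoc)

end

lemma central_eval_compose:
  assumes "central_eval C z" "central_eval C w"
    "\<And>a. C a * w = w * C a" "z * w = w * z"
  shows "central_eval (central_eval.ev C z) w"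
proof -
  interpret z: central_eval C z by fact
  show ?thesis
    by (rule central_eval.intro[OF z.ev_add z.ev_mult z.ev_1 z.ev_commute[OF assms(3,4)]])
qed

lemma (in central_scalars) central_eval: "central_eval C z"
  by (rule central_eval.intro[OF C_add C_mult C_1 C_central])

section \<open>Operators on \<open>K[x][y]\<close>\<close>

text \<open>The K-linear endomorphisms of K[x][y], taken as polynomials in y over K[x], where
  \<open>[:c:]\<close> is the scalar c. They form a type so that they can be an instance of
  \<open>ring_1\<close>.\<close>

typedef (overloaded) ('k::field) operator =
  "{f :: 'k poly poly \<Rightarrow> 'k poly poly.
     (\<forall>F G. f (F + G) = f F + f G) \<and> (\<forall>c F. f (Polynomial.smult [:c:] F) = Polynomial.smult [:c:] (f F))}"
  morphisms app Operator
  by (rule exI[of _ "\<lambda>F. F"]) simp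

setup_lifting type_definition_operator

instantiation operator :: (field) ring_1
begin

lift_definition zero_operator :: "'a operator" is "\<lambda>F. 0" by simp
lift_definition one_operator :: "'a operator" is "\<lambda>F. F" by simp
lift_definition plus_operator :: "'a operator \<Rightarrow> 'a operator \<Rightarrow> 'a operator" is "\<lambda>f g F. f F + g F"
  by (simp add: Polynomial.smult_add_right)
lift_definition uminus_operator :: "'a operator \<Rightarrow> 'a operator" is "\<lambda>f F. - f F" by simp
lift_definition minus_operator :: "'a operator \<Rightarrow> 'a operator \<Rightarrow> 'a operator" is "\<lambda>f g F. f F - g F"
  by (simp add: Polynomial.smult_diff_right)
lift_definition times_operator :: "'a operator \<Rightarrow> 'a operator \<Rightarrow> 'a operator" is "\<lambda>f g F. f (g F)"
  by simp

instance
proof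
  fix a b c :: "'a operator"
  show "a + b + c = a + (b + c)" by transfer (simp add: add.assoc)
  show "a + b = b + a" by transfer (simp add: add.commute)
  show "0 + a = a" by transfer simp
  show "- a + a = 0" by transfer simp
  show "a - b = a + - b" by transfer simp
  show "a * b * c = a * (b * c)" by transfer simp
  show "1 * a = a" "a * 1 = a" by (transfer, simp)+
  show "(a + b) * c = a * c + b * c" by transfer simp
  show "a * (b + c) = a * b + a * c" by transfer simp
  show "(0::'a operator) \<noteq> 1"
    by transfer (use zero_neq_one[where 'a = "'a poly poly"] in \<open>metis (mono_tags)\<close>)
qed

end

lemma app_smult: "app a (Polynomial.smult [:c:] F) = Polynomial.smult [:c:] (app a F)" by transfer simp
lemma app_plus: "app (a + b) F = app a F + app b F" by transfer simp
lemma app_times: "app (a * b) F = app a (app b F)" by transfer simp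
lemma app_zero: "app 0 F = 0" by transfer simp
lemma app_one: "app 1 F = F" by transfer simp
lemma operator_eqI: "(\<And>F. app a F = app b F) \<Longrightarrow> a = b" by transfer auto
lemma app_sum: "app (sum f A) F = (\<Sum>a\<in>A. app (f a) F)"
  by (induction A rule: infinite_finite_induct) (simp_all add: app_zero app_plus)

lift_definition scal :: "'k::field \<Rightarrow> 'k operator" is "\<lambda>c F. Polynomial.smult [:c:] F"
  by (simp add: Polynomial.smult_add_right mult.commute)

interpretation scal: central_scalars "scal :: 'k::field \<Rightarrow> 'k operator"
proof
  fix a b :: 'k and z :: "'k operator"
  show "scal (a + b) = scal a + scal b"
    by transfer (auto simp: fun_eq_iff Polynomial.smult_add_left[symmetric])
  show "scal (a * b) = scal a * scal b" by transfer (auto simp: fun_eq_iff mult.commute)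
  show "scal (1::'k) = 1" by transfer (auto simp: fun_eq_iff one_pCons[symmetric])
  show "scal a * z = z * scal a" by (intro operator_eqI) (simp add: app_times scal.rep_eq app_smult)
qed

section \<open>The faithful action of \<open>A1\<close> on K[x][y] and normal forms\<close>

text \<open>The q-integer of m: the coefficient of y^(m-1) that is left over when x is moved past
  y^m.\<close>

definition qnum :: "'k::field \<Rightarrow> nat \<Rightarrow> 'k" where
  "qnum q m = (\<Sum>j<m. q ^ j)"

lemma qnum_0 [simp]: "qnum q 0 = 0" by (simp add: qnum_def)
lemma qnum_Suc: "qnum q (Suc m) = 1 + q * qnum q m"
  unfolding qnum_def by (subst sum.lessThan_Suc_shift) (simp add: sum_distrib_left)
lemma qnum_mult: "(q - 1) * qnum q m = q ^ m - 1"
  by (induction m) (simp_all add: qnum_Suc algebra_simps)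

lift_definition op_y :: "'k::field operator" is "pCons 0" by simp

text \<open>Left multiplication by x sends y^i f to q^i y^i x f plus the q-integer of i times
  y^(i-1) f. The formula collects the coefficient of the result at y^i, hence the shifted index in
  its second term.\<close>

lift_definition op_x_poly :: "'k::field \<Rightarrow> 'k poly poly \<Rightarrow> 'k poly poly" is
  "\<lambda>q F i. Polynomial.smult (q ^ i) (pCons 0 (F i)) + Polynomial.smult (qnum q (Suc i)) (F (Suc i))"
proof -
  fix q :: 'k and F :: "nat \<Rightarrow> 'k poly"
  assume F: "\<forall>\<^sub>\<infinity>i. F i = 0"
  hence "\<forall>\<^sub>\<infinity>i. F (Suc i) = 0" by (rule MOST_SucI)
  with F have "\<forall>\<^sub>\<infinity>i. F i = 0 \<and> F (Suc i) = 0" by (simp add: MOST_conj_distrib)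
  thus "\<forall>\<^sub>\<infinity>i. Polynomial.smult (q ^ i) (pCons 0 (F i)) + Polynomial.smult (qnum q (Suc i)) (F (Suc i)) = 0"
    by (rule MOST_mono) simp
qed

lemma coeff_op_x_poly: "Polynomial.coeff (op_x_poly q F) i =
   Polynomial.smult (q ^ i) (pCons 0 (Polynomial.coeff F i)) + Polynomial.smult (qnum q (Suc i)) (Polynomial.coeff F (Suc i))"
  by (simp add: op_x_poly.rep_eq)

lift_definition op_x :: "'k::field \<Rightarrow> 'k operator" is op_x_poly
proof (intro conjI allI)
  fix q :: 'k and F G :: "'k poly poly"
  show "op_x_poly q (F + G) = op_x_poly q F + op_x_poly q G"
    by (rule poly_eqI) (simp add: coeff_op_x_poly Polynomial.smult_add_right)
next
  fix q c :: 'k and F :: "'k poly poly"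
  show "op_x_poly q (Polynomial.smult [:c:] F) = Polynomial.smult [:c:] (op_x_poly q F)"
    by (rule poly_eqI) (simp add: coeff_op_x_poly Polynomial.smult_add_right mult.commute)
qed

lemma op_x_op_y: "op_x q * op_y = scal q * op_y * op_x q + 1"
proof (rule operator_eqI, rule poly_eqI)
  fix F and i :: nat
  show "Polynomial.coeff (app (op_x q * op_y) F) i = Polynomial.coeff (app (scal q * op_y * op_x q + 1) F) i"
    by (cases i)
       (auto simp: app_times app_plus app_one op_x.rep_eq op_y.rep_eq scal.rep_eq coeff_op_x_poly
         qnum_Suc Polynomial.smult_add_left algebra_simps)
qed

definition rep :: "'k::field \<Rightarrow> 'k free_alg \<Rightarrow> 'k operator" where
  "rep q = scal.free_eval (op_x q) op_y"

lemmas rep_simps = scal.free_eval_simps[of "op_x q" op_y for q, folded rep_def]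

text \<open>The operators of an element of \<open>A1\<close> act as left multiplication on normal
  forms with y to the left of x; applied to 1 they return the normal form of the element
  itself.\<close>

definition nf :: "'k::field \<Rightarrow> 'k free_alg \<Rightarrow> 'k poly poly" where
  "nf q u = app (rep q u) 1"

lemma nf_const: "nf q (free_const c) = [:[:c:]:]"
  by (simp add: nf_def rep_simps scal.rep_eq one_pCons)
lemma nf_add: "nf q (u + v) = nf q u + nf q v"
  by (simp add: nf_def rep_simps app_plus)
lemma nf_x: "nf q (free_x * u) = op_x_poly q (nf q u)"
  by (simp add: nf_def rep_simps app_times op_x.rep_eq)
lemma nf_y: "nf q (free_y * u) = pCons 0 (nf q u)"
  by (simp add: nf_def rep_simps app_times op_y.rep_eq)
lemma nf_const_mult: "nf q (free_const c * u) = Polynomial.smult [:c:] (nf q u)"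
  by (simp add: nf_def rep_simps app_times scal.rep_eq)

definition tideal :: "'r::ring_1 set \<Rightarrow> bool" where
  "tideal J \<longleftrightarrow> 0 \<in> J \<and> (\<forall>u\<in>J. \<forall>v\<in>J. u + v \<in> J) \<and> (\<forall>u\<in>J. \<forall>a. a * u \<in> J \<and> u * a \<in> J)"

lemma tidealD:
  assumes "tideal J"
  shows "0 \<in> J" "u \<in> J \<Longrightarrow> v \<in> J \<Longrightarrow> u + v \<in> J" "u \<in> J \<Longrightarrow> a * u \<in> J" "u \<in> J \<Longrightarrow> u * a \<in> J"
    "u \<in> J \<Longrightarrow> - u \<in> J" "u \<in> J \<Longrightarrow> v \<in> J \<Longrightarrow> u - v \<in> J"
proof -
  show *: "0 \<in> J" "\<And>u v. u \<in> J \<Longrightarrow> v \<in> J \<Longrightarrow> u + v \<in> J" "\<And>u a. u \<in> J \<Longrightarrow> a * u \<in> J" "\<And>u a. u \<in> J \<Longrightarrow> u * a \<in> J"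
    using assms unfolding tideal_def by auto
  show neg: "- u \<in> J" if "u \<in> J" for u using *(3)[OF that, of "- 1"] by simp
  show "u - v \<in> J" if "u \<in> J" "v \<in> J" using *(2)[OF that(1) neg[OF that(2)]] by simp
qed

lemma tideal_sum: "tideal J \<Longrightarrow> (\<And>a. a \<in> A \<Longrightarrow> f a \<in> J) \<Longrightarrow> sum f A \<in> J"
  by (induction A rule: infinite_finite_induct) (auto simp: tidealD)

definition qrel :: "'k::field \<Rightarrow> 'k free_alg" where
  "qrel q = free_x * free_y - free_const q * free_y * free_x - 1"

lemma rep_qrel: "rep q (qrel q) = 0"
  by (simp add: qrel_def rep_simps op_x_op_y)

interpretation fx: central_eval "free_const :: 'k::field \<Rightarrow> 'k free_alg" free_x
  by (rule free.central_eval)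

text \<open>A representative in the free algebra of a given normal form.\<close>

definition nf_inv :: "'k::field poly poly \<Rightarrow> 'k free_alg" where
  "nf_inv F = (\<Sum>i\<le>Polynomial.degree F. free_y ^ i * fx.ev (Polynomial.coeff F i))"

lemma nf_inv_bound:
  "Polynomial.degree F \<le> m \<Longrightarrow> nf_inv F = (\<Sum>i\<le>m. free_y ^ i * fx.ev (Polynomial.coeff F i))"
  unfolding nf_inv_def by (intro sum.mono_neutral_left) (auto simp: fx.ev_0 Polynomial.coeff_eq_0)

lemma nf_inv_add: "nf_inv (F + G) = nf_inv F + nf_inv G"
proof -
  let ?m = "max (Polynomial.degree F) (Polynomial.degree G)"
  have "Polynomial.degree (F + G) \<le> ?m" by (rule Polynomial.degree_add_le_max)
  thus ?thesis by (simp add: nf_inv_bound[of _ ?m] fx.ev_add distrib_left sum.distrib)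
qed

lemma nf_inv_0: "nf_inv 0 = 0"
  by (simp add: nf_inv_def fx.ev_0)

lemma nf_inv_pCons: "nf_inv (pCons f F) = fx.ev f + free_y * nf_inv F"
proof -
  have "nf_inv (pCons f F) = (\<Sum>i\<le>Suc (Polynomial.degree F). free_y ^ i * fx.ev (Polynomial.coeff (pCons f F) i))"
    by (rule nf_inv_bound) (rule Polynomial.degree_pCons_le)
  also have "\<dots> = fx.ev f + (\<Sum>i\<le>Polynomial.degree F. free_y ^ Suc i * fx.ev (Polynomial.coeff F i))"
    by (subst sum.atMost_Suc_shift) simp
  finally show ?thesis by (simp add: nf_inv_def sum_distrib_left mult.assoc)
qed

lemma nf_inv_smult: "nf_inv (Polynomial.smult [:c:] F) = free_const c * nf_inv F"
  by (induction F) (simp_all add: nf_inv_0 nf_inv_pCons fx.ev_smult distrib_left free.C_left_commute)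

lemma op_x_poly_pCons:
  "op_x_poly q (pCons f G) = pCons (pCons 0 f) (Polynomial.smult [:q:] (op_x_poly q G)) + G"
proof (rule poly_eqI)
  fix i show "Polynomial.coeff (op_x_poly q (pCons f G)) i =
     Polynomial.coeff (pCons (pCons 0 f) (Polynomial.smult [:q:] (op_x_poly q G)) + G) i"
    by (cases i)
       (simp_all add: coeff_op_x_poly qnum_Suc distrib_left Polynomial.smult_add_left
         Polynomial.smult_add_right mult.commute)
qed

lemma op_x_poly_0: "op_x_poly q 0 = 0"
  by (rule poly_eqI) (simp add: coeff_op_x_poly)

text \<open>Moving x past one y uses the relation once, which is the summand with
  \<open>qrel\<close>; the rest is a left multiple of the induction hypothesis.\<close>

lemma x_nf_inv:
  assumes J: "tideal J" "qrel q \<in> J"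
  shows "free_x * nf_inv F - nf_inv (op_x_poly q F) \<in> J"
proof (induction F)
  case 0
  show ?case using tidealD(1)[OF J(1)] by (simp add: nf_inv_0 op_x_poly_0)
next
  case (pCons f F)
  have "free_x * nf_inv (pCons f F) - nf_inv (op_x_poly q (pCons f F)) =
    qrel q * nf_inv F + free_const q * free_y * (free_x * nf_inv F - nf_inv (op_x_poly q F))"
    unfolding op_x_poly_pCons nf_inv_add nf_inv_pCons nf_inv_smult fx.ev_pCons
    by (simp add: qrel_def algebra_simps free.C_0 free.C_left_commute)
  thus ?case using pCons J by (simp add: tidealD)
qed

lemma reduction:
  assumes J: "tideal J" "qrel q \<in> J"
  shows "u - nf_inv (nf q u) \<in> J"
proof (induction u rule: free_alg_induct)
  case (const c)
  show ?case using tidealD(1)[OF J(1)] by (simp add: nf_const nf_inv_pCons nf_inv_0 fx.ev_pCons fx.ev_0)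
next
  case (add u v)
  have "u + v - nf_inv (nf q (u + v)) = (u - nf_inv (nf q u)) + (v - nf_inv (nf q v))"
    by (simp add: nf_add nf_inv_add)
  thus ?case using add tidealD(2)[OF J(1)] by metis
next
  case (x u)
  have "free_x * u - nf_inv (nf q (free_x * u)) =
     free_x * (u - nf_inv (nf q u)) + (free_x * nf_inv (nf q u) - nf_inv (op_x_poly q (nf q u)))"
    by (simp add: nf_x algebra_simps)
  thus ?case using x tidealD(2,3)[OF J(1)] x_nf_inv[OF J] by metis
next
  case (y u)
  have "free_y * u - nf_inv (nf q (free_y * u)) = free_y * (u - nf_inv (nf q u))"
    by (simp add: nf_y nf_inv_pCons fx.ev_0 algebra_simps)
  thus ?case using y tidealD(3)[OF J(1)] by metis
qed

lemma tideal_ker: "tideal {u. rep q u = 0}"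
  by (simp add: tideal_def rep_simps)

text \<open>An element is congruent to its normal form modulo the relation alone. So the kernel of
  the action is the smallest ideal that contains the relation, and \<open>A1\<close> acts
  faithfully.\<close>

lemma rep_0_mem:
  assumes "tideal J" "qrel q \<in> J" "rep q u = 0"
  shows "u \<in> J"
  using reduction[OF assms(1,2), of u] assms(3) by (simp add: nf_def app_zero nf_inv_0)

lemma rep_nf_inv: "rep q (nf_inv (nf q u)) = rep q u"
  using reduction[OF tideal_ker[of q], where q = q and u = u] rep_qrel[of q] by (simp add: rep_simps)

lemma nf_ev: "nf q (fx.ev f) = [:f:]"
proof (induction f)
  case 0
  show ?case by (simp add: fx.ev_0 nf_def rep_simps app_zero)
next
  case (pCons a f)
  have "op_x_poly q [:f:] = [:pCons 0 f:]"
    by (simp add: op_x_poly_pCons op_x_poly_0)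
  thus ?case using pCons by (simp add: fx.ev_pCons nf_add nf_const nf_x)
qed

lemma nf_nf_inv: "nf q (nf_inv F) = F"
proof (induction F)
  case 0
  show ?case by (simp add: nf_inv_0 nf_def rep_simps app_zero)
next
  case (pCons f F)
  thus ?case by (simp add: nf_inv_pCons nf_add nf_ev nf_y)
qed

lemma rep_eq_iff_nf: "rep q u = rep q v \<longleftrightarrow> nf q u = nf q v"
  by (metis nf_def rep_nf_inv)

lemma op_x_poly_smult_x: "op_x_poly q (Polynomial.smult [:0, 1:] F) = Polynomial.smult [:0, 1:] (op_x_poly q F)"
  by (rule poly_eqI) (simp add: coeff_op_x_poly Polynomial.smult_add_right)

text \<open>In the normal form x already stands on the right, so nothing has to be moved past
  y.\<close>

lemma nf_right_x: "nf q (u * free_x) = Polynomial.smult [:0, 1:] (nf q u)"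
proof (induction u rule: free_alg_induct)
  case (const c)
  have "free_const c * free_x = free_const c * (free_x * free_const 1)" by (simp add: free.C_1)
  also have "nf q \<dots> = [:[:0, c:]:]"
    unfolding nf_const_mult nf_x nf_const by (simp add: op_x_poly_pCons op_x_poly_0)
  finally show ?case by (simp add: nf_const)
next
  case (add u v)
  thus ?case by (simp add: distrib_right nf_add Polynomial.smult_add_right)
next
  case (x u)
  thus ?case by (simp add: mult.assoc nf_x op_x_poly_smult_x)
next
  case (y u)
  thus ?case by (simp add: mult.assoc nf_y)
qed

section \<open>The domain property\<close>

text \<open>Here k is a bound for the degree and not the degree itself, because the coefficient at
  y^k may vanish in the inductions that use this.\<close>

lemma coeff_op_x_top:
  assumes "Polynomial.degree F \<le> k"
  shows "Polynomial.degree (op_x_poly q F) \<le> k"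
    "Polynomial.coeff (op_x_poly q F) k = [:0, q ^ k:] * Polynomial.coeff F k"
proof -
  show "Polynomial.degree (op_x_poly q F) \<le> k"
    by (rule Polynomial.degree_le) (use assms in \<open>auto simp: coeff_op_x_poly Polynomial.coeff_eq_0\<close>)
  show "Polynomial.coeff (op_x_poly q F) k = [:0, q ^ k:] * Polynomial.coeff F k"
    using assms by (simp add: coeff_op_x_poly Polynomial.coeff_eq_0)
qed

lemma rep_ev_top:
  assumes "Polynomial.degree F \<le> k"
  shows "Polynomial.degree (app (rep q (fx.ev f)) F) \<le> k \<and>
    Polynomial.coeff (app (rep q (fx.ev f)) F) k = pcompose f [:0, q ^ k:] * Polynomial.coeff F k"
proof (induction f)
  case 0
  show ?case by (simp add: fx.ev_0 rep_simps app_zero)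
next
  case (pCons a f)
  let ?G = "app (rep q (fx.ev f)) F"
  have eq: "app (rep q (fx.ev (pCons a f))) F = Polynomial.smult [:a:] F + op_x_poly q ?G"
    by (simp add: fx.ev_pCons rep_simps app_plus app_times scal.rep_eq op_x.rep_eq)
  show ?case
    unfolding eq using pCons.IH coeff_op_x_top[of ?G k q] assms
    by (auto simp: pcompose_pCons distrib_right mult.assoc intro!: Polynomial.degree_add_le
        order.trans[OF Polynomial.degree_smult_le])
qed

text \<open>The coefficient at the top comes from moving the leading coefficient of \<open>G\<close>
  past y^k, which replaces x by q^k x.\<close>

lemma rep_nf_inv_top:
  assumes "G \<noteq> 0"
  shows "Polynomial.degree F \<le> k \<Longrightarrow>
    Polynomial.degree (app (rep q (nf_inv G)) F) \<le> Polynomial.degree G + k \<and>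
    Polynomial.coeff (app (rep q (nf_inv G)) F) (Polynomial.degree G + k) =
      pcompose (Polynomial.lead_coeff G) [:0, q ^ k:] * Polynomial.coeff F k"
  using assms
proof (induction G)
  case 0
  thus ?case by simp
next
  case (pCons f G)
  note F = pCons.prems(1)
  have eq: "app (rep q (nf_inv (pCons f G))) F = app (rep q (fx.ev f)) F + pCons 0 (app (rep q (nf_inv G)) F)"
    by (simp add: nf_inv_pCons rep_simps app_plus app_times op_y.rep_eq)
  note ft = rep_ev_top[OF F, of q f]
  show ?case
  proof (cases "G = 0")
    case True
    have "app (rep q (nf_inv G)) F = 0" by (simp add: True nf_inv_0 rep_simps app_zero)
    thus ?thesis unfolding eq using ft True by simp
  next
    case False
    let ?A = "app (rep q (nf_inv G)) F"
    have IH: "Polynomial.degree ?A \<le> Polynomial.degree G + k"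
      "Polynomial.coeff ?A (Polynomial.degree G + k) = pcompose (Polynomial.lead_coeff G) [:0, q ^ k:] * Polynomial.coeff F k"
      using pCons.IH[OF F False] by auto
    have "Polynomial.degree (app (rep q (fx.ev f)) F) < Suc (Polynomial.degree G + k)"
      using ft by simp
    hence "Polynomial.coeff (app (rep q (fx.ev f)) F) (Suc (Polynomial.degree G + k)) = 0"
      by (rule Polynomial.coeff_eq_0)
    moreover have "Polynomial.degree (pCons 0 ?A) \<le> Suc (Polynomial.degree G + k)"
      using IH(1) by (intro order.trans[OF Polynomial.degree_pCons_le]) simp
    ultimately show ?thesis
      unfolding eq using IH ft False by (auto intro!: Polynomial.degree_add_le)
  qed
qed

text \<open>Leading coefficients in y multiply, up to the substitution of q^k x for x, and this
  substitution is injective on K[x] because q is nonzero.\<close>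

lemma rep_domain:
  assumes q: "q \<noteq> 0" and uv: "rep q (u * v) = 0"
  shows "rep q u = 0 \<or> rep q v = 0"
proof (rule ccontr)
  assume "\<not> ?thesis"
  hence u: "nf q u \<noteq> 0" and v: "nf q v \<noteq> 0"
    using rep_eq_iff_nf[of q _ 0] by (auto simp: rep_simps nf_def app_zero)
  let ?k = "Polynomial.degree (nf q v)"
  have "app (rep q (nf_inv (nf q u))) (nf q v) = 0"
    unfolding rep_nf_inv using uv by (simp add: nf_def app_times[symmetric] rep_simps[symmetric] app_zero)
  hence "pcompose (Polynomial.lead_coeff (nf q u)) [:0, q ^ ?k:] * Polynomial.lead_coeff (nf q v) = 0"
    using rep_nf_inv_top[OF u, of "nf q v" ?k q] by simp
  moreover have "Polynomial.lead_coeff (nf q u) \<noteq> 0" "Polynomial.lead_coeff (nf q v) \<noteq> 0"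
    using u v by simp_all
  moreover have "pcompose f [:0, q ^ ?k:] \<noteq> 0" if "f \<noteq> 0" for f
  proof
    assume "pcompose f [:0, q ^ ?k:] = 0"
    hence "Polynomial.coeff (pcompose f [:0, q ^ ?k:]) (Polynomial.degree f) = 0" by simp
    thus False using that q by (simp add: coeff_pcompose_linear)
  qed
  ultimately show False by simp
qed

section \<open>Skew commutation and the central elements x^n, y^n, h^n\<close>

context central_scalars
begin

lemma skew_left: "A * B = C p * B * A \<Longrightarrow> A ^ i * B = C (p ^ i) * B * A ^ i"
proof (induction i)
  case 0
  show ?case by (simp add: C_1)
next
  case (Suc i)
  have "A ^ Suc i * B = A * (C (p ^ i) * B * A ^ i)"
    using Suc by (simp add: mult.assoc)
  also have "\<dots> = C (p ^ i) * (A * B) * A ^ i"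
    by (simp add: mult.assoc C_left_commute[of A] C_left_commute[of B] C_left_commute[of "B ^ j" for j])
  also have "\<dots> = C (p ^ i) * C p * B * A ^ Suc i"
    unfolding Suc.prems by (simp add: mult.assoc)
  also have "C (p ^ i) * C p = C (p ^ Suc i)"
    by (simp add: C_mult[symmetric] mult.commute)
  finally show ?case .
qed

lemma skew_right: "A * B = C p * B * A \<Longrightarrow> A * B ^ j = C (p ^ j) * B ^ j * A"
proof (induction j)
  case 0
  show ?case by (simp add: C_1)
next
  case (Suc j)
  have "A * B ^ Suc j = (A * B) * B ^ j"
    by (simp add: mult.assoc)
  also have "\<dots> = C p * B * (A * B ^ j)"
    unfolding Suc.prems by (simp add: mult.assoc)
  also have "\<dots> = C (p ^ Suc j) * B ^ Suc j * A"
    using Suc by (simp add: mult.assoc C_mult mult.commute C_left_commute[of A] C_left_commute[of B] C_left_commute[of "B ^ j" for j])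
  finally show ?case .
qed

end

lemma double_delta:
  fixes f :: "nat \<Rightarrow> nat \<Rightarrow> 'a::comm_monoid_add"
  assumes "a < n" "b < n"
  shows "(\<Sum>a'<n. \<Sum>b'<n. if a' = a \<and> b' = b then f a' b' else 0) = f a b"
proof -
  have "(\<Sum>b'<n. if a' = a \<and> b' = b then f a' b' else 0) = (if a' = a then f a b else 0)" for a'
    using assms(2) by (cases "a' = a") (simp_all add: sum.delta)
  thus ?thesis using assms(1) by (simp add: sum.delta)
qed

locale qroot =
  fixes q :: "'k::field" and n :: nat
  assumes n2: "n \<ge> 2" and qn: "q ^ n = 1" and prim: "\<And>m. 0 < m \<Longrightarrow> m < n \<Longrightarrow> q ^ m \<noteq> 1"
begin

lemma n_pos: "n > 0" using n2 by simp

lemma q1: "q \<noteq> 1" using prim[of 1] n2 by auto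

lemma q0: "q \<noteq> 0"
  using qn n_pos by (auto simp: power_0_left)

lemma q_pow_mod: "q ^ m = q ^ (m mod n)"
proof -
  have "q ^ m = q ^ (n * (m div n) + m mod n)" by simp
  also have "\<dots> = q ^ (m mod n)" unfolding power_add power_mult qn by simp
  finally show ?thesis .
qed

lemma q_pow_eq_1_iff: "q ^ m = 1 \<longleftrightarrow> n dvd m"
  using q_pow_mod[of m] prim[of "m mod n"] n_pos by (auto simp: dvd_eq_mod_eq_0)

lemma q_pow_inj: "i < n \<Longrightarrow> j < n \<Longrightarrow> q ^ i = q ^ j \<Longrightarrow> i = j"
proof (induction i j rule: linorder_wlog)
  case (le i j)
  have "q ^ i * q ^ (j - i) = q ^ j"
    using le(1) by (simp add: power_add[symmetric])
  hence "q ^ i * q ^ (j - i) = q ^ i * 1"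
    using le(4) by simp
  hence "q ^ (j - i) = 1" using q0 by simp
  hence "n dvd j - i" by (simp add: q_pow_eq_1_iff)
  thus ?case using le by (auto dest: dvd_imp_le)
qed simp

definition c0 :: 'k where "c0 = 1 / (q - 1)"

lemma c0: "c0 \<noteq> 0" "1 + c0 = q * c0"
  using q1 by (auto simp: c0_def field_simps)

abbreviation ox where "ox \<equiv> op_x q"
abbreviation oy :: "'k operator" where "oy \<equiv> op_y"
definition oh where "oh = oy * ox + scal c0"

definition fh :: "'k free_alg" where "fh = free_y * free_x + free_const c0"

lemma rep_fh: "rep q fh = oh"
  by (simp add: fh_def oh_def rep_simps)

lemmas Cl = scal.C_left_commute[of ox] scal.C_left_commute[of oy] scal.C_left_commute[of oh]
  scal.C_left_commute[of "ox ^ k" for k] scal.C_left_commute[of "oy ^ k" for k]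

lemmas XY = op_x_op_y[of q]

lemma XH: "ox * oh = scal q * oh * ox"
proof -
  have "ox * oh = (ox * oy) * ox + scal c0 * ox"
    by (simp add: oh_def distrib_left mult.assoc scal.C_central)
  also have "\<dots> = scal q * (oy * (ox * ox)) + scal (1 + c0) * ox"
    unfolding XY by (simp add: distrib_right mult.assoc scal.C_add scal.C_1)
  \<comment> \<open>The 1 from the relation has joined c0; the identity 1 + c0 = q c0 makes the sum
    the constant term of q h.\<close>
  also have "\<dots> = scal q * oh * ox"
    unfolding c0(2) by (simp add: oh_def distrib_left distrib_right mult.assoc scal.C_mult)
  finally show ?thesis .
qed

lemma HY: "oh * oy = scal q * oy * oh"
proof -
  have "oh * oy = oy * (ox * oy) + scal c0 * oy"
    by (simp add: oh_def distrib_right mult.assoc)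
  also have "\<dots> = scal q * (oy * (oy * ox)) + scal (1 + c0) * oy"
    unfolding XY by (simp add: distrib_left distrib_right mult.assoc scal.C_add scal.C_1 Cl)
  also have "\<dots> = scal q * oy * oh"
    unfolding c0(2) by (simp add: oh_def distrib_left distrib_right mult.assoc scal.C_mult scal.C_central[of _ oy] Cl)
  finally show ?thesis .
qed

lemma scal_Suc: "scal (q ^ Suc (Suc m)) = scal (q ^ Suc m) * scal q"
  by (simp add: scal.C_mult[symmetric] mult_ac)

lemma power_end: "z ^ m * (z * w) = z ^ Suc m * (w :: 'k operator)"
  by (simp only: power_Suc2 mult.assoc)

text \<open>At the exponent n the scalar becomes 1 and the q-integer becomes 0, so x^n commutes with
  y.\<close>

lemma X_pow_Y: "ox ^ Suc m * oy = scal (q ^ Suc m) * oy * ox ^ Suc m + scal (qnum q (Suc m)) * ox ^ m"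
proof (induction m)
  case 0
  show ?case using XY by (simp add: qnum_Suc scal.C_1)
next
  case (Suc m)
  have "ox ^ Suc (Suc m) * oy = ox * (ox ^ Suc m * oy)" by (simp add: mult.assoc)
  also have "\<dots> = scal (q ^ Suc m) * ((ox * oy) * ox ^ Suc m) + scal (qnum q (Suc m)) * ox ^ Suc m"
    unfolding Suc by (simp add: distrib_left mult.assoc Cl)
  also have "\<dots> = scal (q ^ Suc m) * (scal q * (oy * (ox * ox ^ Suc m))) + (scal (q ^ Suc m) + scal (qnum q (Suc m))) * ox ^ Suc m"
    unfolding XY by (simp add: distrib_left distrib_right mult.assoc)
  also have "scal (q ^ Suc m) * (scal q * (oy * (ox * ox ^ Suc m))) = scal (q ^ Suc (Suc m)) * oy * ox ^ Suc (Suc m)"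
    unfolding scal_Suc by (simp add: mult.assoc)
  also have "scal (q ^ Suc m) + scal (qnum q (Suc m)) = scal (qnum q (Suc (Suc m)))"
    by (simp add: qnum_def scal.C_add)
  finally show ?case .
qed

lemma X_Y_pow: "ox * oy ^ Suc m = scal (q ^ Suc m) * oy ^ Suc m * ox + scal (qnum q (Suc m)) * oy ^ m"
proof (induction m)
  case 0
  show ?case using XY by (simp add: qnum_Suc scal.C_1)
next
  case (Suc m)
  have "ox * oy ^ Suc (Suc m) = (ox * oy ^ Suc m) * oy" by (simp only: power_Suc2[of oy "Suc m"] mult.assoc)
  also have "\<dots> = scal (q ^ Suc m) * (oy ^ Suc m * (ox * oy)) + scal (qnum q (Suc m)) * oy ^ Suc m"
    unfolding Suc by (simp only: distrib_right mult.assoc power_Suc2[of oy m])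
  also have "\<dots> = scal (q ^ Suc m) * (scal q * (oy ^ Suc m * (oy * ox))) + (scal (q ^ Suc m) + scal (qnum q (Suc m))) * oy ^ Suc m"
    unfolding XY by (simp add: distrib_left distrib_right mult.assoc Cl)
  also have "scal (q ^ Suc m) * (scal q * (oy ^ Suc m * (oy * ox))) = scal (q ^ Suc (Suc m)) * oy ^ Suc (Suc m) * ox"
    unfolding scal_Suc mult.assoc power_end ..
  also have "scal (q ^ Suc m) + scal (qnum q (Suc m)) = scal (qnum q (Suc (Suc m)))"
    by (simp add: qnum_def scal.C_add)
  finally show ?case .
qed

lemma qnum_n: "qnum q n = 0"
  using qnum_mult[of q n] qn q1 by simp

lemma Xn_Y: "ox ^ n * oy = oy * ox ^ n"
  using X_pow_Y[of "n - 1"] n_pos qn qnum_n by (simp add: scal.C_0 scal.C_1)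

lemma X_Yn: "ox * oy ^ n = oy ^ n * ox"
  using X_Y_pow[of "n - 1"] n_pos qn qnum_n by (simp add: scal.C_0 scal.C_1)

lemma X_Hn: "ox * oh ^ n = oh ^ n * ox"
  using scal.skew_right[OF XH, of n] by (simp add: qn scal.C_1)

lemma Hn_Y: "oh ^ n * oy = oy * oh ^ n"
  using scal.skew_left[OF HY, of n] by (simp add: qn scal.C_1)

lemma commute_rep:
  assumes "z * ox = ox * z" "z * oy = oy * z"
  shows "z * rep q u = rep q u * z"
proof (induction u rule: free_alg_induct)
  case (const c)
  show ?case by (simp add: rep_simps scal.C_central)
next
  case (add u v)
  thus ?case by (simp add: rep_simps distrib_left distrib_right)
next
  case (x u)
  thus ?case by (simp add: rep_simps) (metis assms(1) mult.assoc)
next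
  case (y u)
  thus ?case by (simp add: rep_simps) (metis assms(2) mult.assoc)
qed

lemma Xn_central: "ox ^ n * rep q u = rep q u * ox ^ n"
  by (rule commute_rep) (simp_all add: power_commutes Xn_Y)

lemma Yn_central: "oy ^ n * rep q u = rep q u * oy ^ n"
  by (rule commute_rep) (simp_all add: power_commutes X_Yn)

lemma Hn_central: "oh ^ n * rep q u = rep q u * oh ^ n"
  by (rule commute_rep) (simp_all add: X_Hn Hn_Y)

lemma Xn_Yn: "ox ^ n * oy ^ n = oy ^ n * ox ^ n"
  using Xn_central[of "free_y ^ n"] by (simp add: rep_simps)

lemma Y_H_pow: "oy ^ m * oh = scal (inverse q ^ m) * oh * oy ^ m"
proof -
  have "oh * oy ^ m = scal (q ^ m) * oy ^ m * oh" by (rule scal.skew_right[OF HY])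
  hence "scal (inverse q ^ m) * oh * oy ^ m = scal (inverse q ^ m) * (scal (q ^ m) * (oy ^ m * oh))"
    by (simp add: mult.assoc)
  also have "\<dots> = oy ^ m * oh"
    using scal.C_inverse[of "q ^ m" "oy ^ m * oh"] q0 by (simp add: power_inverse)
  finally show ?thesis by simp
qed

lemma YX: "oy * ox = oh - scal c0" by (simp add: oh_def)

sublocale evH: central_eval "scal :: 'k \<Rightarrow> 'k operator" oh
  by (rule scal.central_eval)

text \<open>Replace the innermost yx by h - c0; moving h to the left past y^m costs the factor
  q^(-m).\<close>

lemma YX_pow: "oy ^ m * ox ^ m = evH.ev (\<Prod>k<m. [:- c0, inverse q ^ k:])"
proof (induction m)
  case 0
  show ?case by (simp add: evH.ev_1)
next
  case (Suc m)
  have "oy ^ Suc m * ox ^ Suc m = oy ^ m * (oy * ox) * ox ^ m"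
    by (simp only: power_Suc2[of oy] power_Suc[of ox] mult.assoc)
  also have "\<dots> = (oy ^ m * oh - scal c0 * oy ^ m) * ox ^ m"
    unfolding YX by (simp add: right_diff_distrib scal.C_central)
  also have "\<dots> = (scal (inverse q ^ m) * oh - scal c0) * (oy ^ m * ox ^ m)"
    unfolding Y_H_pow by (simp add: left_diff_distrib mult.assoc)
  also have "scal (inverse q ^ m) * oh - scal c0 = evH.ev [:- c0, inverse q ^ m:]"
    by (simp add: evH.ev_pCons evH.ev_0 scal.C_uminus scal.C_central)
  finally show ?case
    unfolding Suc by (simp add: evH.ev_mult[symmetric] mult.commute)
qed

text \<open>Both sides have degree at most n and agree at the n + 1 points 0 and c0 q^k with k < n:
  the latter are roots of both, and at 0 both have the value (-c0)^n.\<close>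

lemma root_product: "(\<Prod>k<n. [:- c0, inverse q ^ k:]) = Polynomial.smult ((-1) ^ n) ([:c0 ^ n:] - Polynomial.monom 1 n)"
  (is "?L = ?R")
proof (rule ccontr)
  assume ne: "?L \<noteq> ?R"
  define D where "D = ?L - ?R"
  have D: "D \<noteq> 0" using ne by (simp add: D_def)
  have "Polynomial.degree ?L \<le> sum (Polynomial.degree \<circ> (\<lambda>k. [:- c0, inverse q ^ k:])) {..<n}"
    by (rule degree_prod_sum_le) simp
  also have "\<dots> \<le> (\<Sum>k<n. 1)"
    by (rule sum_mono) simp
  finally have "Polynomial.degree ?L \<le> n" by simp
  moreover have "Polynomial.degree ?R \<le> n"
    by (intro order.trans[OF Polynomial.degree_smult_le] Polynomial.degree_diff_le)
       (auto simp: Polynomial.degree_monom_le)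
  ultimately have deg: "Polynomial.degree D \<le> n"
    unfolding D_def by (rule Polynomial.degree_diff_le)
  let ?S = "insert 0 ((\<lambda>k. c0 * q ^ k) ` {..<n})"
  have "poly D (c0 * q ^ k) = 0" if "k < n" for k
  proof -
    have "(c0 * q ^ k) ^ n = c0 ^ n"
      using qn by (simp add: power_mult_distrib power_mult[symmetric] mult.commute[of k] power_mult)
    moreover have "poly ?L (c0 * q ^ k) = 0"
      using that q0 by (auto simp: poly_prod field_simps intro!: prod_zero bexI[of _ k])
    ultimately show ?thesis by (simp add: D_def Polynomial.poly_monom)
  qed
  moreover have "poly D 0 = 0"
    using n_pos by (simp add: D_def poly_prod Polynomial.poly_monom power_0_left power_minus[of c0 n] minus_one_mult_self)
  ultimately have "?S \<subseteq> {x. poly D x = 0}" by auto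
  hence "card ?S \<le> card {x. poly D x = 0}"
    by (intro card_mono poly_roots_finite D)
  also have "\<dots> \<le> n" using card_poly_roots_bound[OF D] deg by simp
  finally have "card ?S \<le> n" .
  moreover have "card ?S = Suc n"
  proof -
    have "inj_on (\<lambda>k. c0 * q ^ k) {..<n}" using c0(1) q_pow_inj by (auto simp: inj_on_def)
    moreover have "0 \<notin> (\<lambda>k. c0 * q ^ k) ` {..<n}" using c0(1) q0 by auto
    ultimately show ?thesis by (simp add: card_image)
  qed
  ultimately show False by simp
qed

text \<open>Solved for h^n, this is the formula s = (-1)^(n-1) r t + 1/(q-1)^n.\<close>

lemma YnXn: "oy ^ n * ox ^ n = scal ((-1) ^ n) * (scal (c0 ^ n) - oh ^ n)"
  unfolding YX_pow root_product evH.ev_smult evH.ev_diff evH.ev_const evH.ev_monom by (simp add: scal.C_1)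

section \<open>\<open>A1\<close> as a free module over K[t, r]\<close>

sublocale zt: central_eval "scal :: 'k \<Rightarrow> 'k operator" "ox ^ n"
  by (rule scal.central_eval)

sublocale zz: central_eval zt.ev "oy ^ n"
  by (rule central_eval_compose[OF scal.central_eval scal.central_eval scal.C_central Xn_Yn])

text \<open>The map from K[t][r] to the operators: the inner variable goes to x^n and the outer one
  to y^n.\<close>

abbreviation zeta :: "'k poly poly \<Rightarrow> 'k operator" where "zeta \<equiv> zz.ev"

text \<open>A preimage of \<open>zeta p\<close> in the free algebra, where the ideals live.\<close>

definition fzeta :: "'k poly poly \<Rightarrow> 'k free_alg" where
  "fzeta p = (\<Sum>i\<le>Polynomial.degree p.
     (\<Sum>j\<le>Polynomial.degree (Polynomial.coeff p i). free_const (Polynomial.coeff (Polynomial.coeff p i) j) * (free_x ^ n) ^ j)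
       * (free_y ^ n) ^ i)"

lemma rep_fzeta: "rep q (fzeta p) = zeta p"
  by (simp add: fzeta_def zz.ev_def zt.ev_def rep_simps)

lemma zeta_central: "zeta p * rep q u = rep q u * zeta p"
proof (rule zz.ev_commute)
  show "zt.ev f * rep q u = rep q u * zt.ev f" for f
    by (rule zt.ev_commute) (simp_all add: scal.C_central Xn_central)
qed (rule Yn_central)

lemma app_Yn: "app (oy ^ m) F = Polynomial.monom 1 m * F"
  by (induction m) (simp_all add: app_one app_times op_y.rep_eq Polynomial.monom_Suc one_pCons[symmetric])

text \<open>As x^n is central, it can be put on the right of the element with normal form
  \<open>F\<close>, and there each x just multiplies the coefficients.\<close>

lemma app_Xn: "app (ox ^ n) F = Polynomial.smult (Polynomial.monom 1 n) F"
proof -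
  have "app (rep q u * ox ^ m) 1 = Polynomial.smult (Polynomial.monom 1 m) (nf q u)" for u m
  proof (induction m arbitrary: u)
    case 0
    show ?case by (simp add: nf_def one_pCons[symmetric])
  next
    case (Suc m)
    have "app (rep q u * ox ^ Suc m) 1 = app (rep q (u * free_x) * ox ^ m) 1"
      by (simp add: rep_simps mult.assoc)
    also have "\<dots> = Polynomial.smult (Polynomial.monom 1 m) (nf q (u * free_x))" by (rule Suc)
    also have "\<dots> = Polynomial.smult (Polynomial.monom 1 (Suc m)) (nf q u)"
      by (simp add: nf_right_x Polynomial.monom_Suc)
    finally show ?case .
  qed
  from this[of "nf_inv F" n] show ?thesis
    unfolding Xn_central[symmetric] app_times by (simp add: nf_def[symmetric] nf_nf_inv)
qed

text \<open>The coefficients at the exponents n j + a, regrouped as a polynomial in t = x^n. The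
  bound of the sum suffices because n j + a is at least j.\<close>

definition dec :: "nat \<Rightarrow> 'k poly \<Rightarrow> 'k poly" where
  "dec a f = (\<Sum>j\<le>Polynomial.degree f. Polynomial.monom (Polynomial.coeff f (n * j + a)) j)"

lemma coeff_dec: "Polynomial.coeff (dec a f) j = Polynomial.coeff f (n * j + a)"
proof -
  have "Polynomial.coeff (dec a f) j = (\<Sum>i\<le>Polynomial.degree f. if i = j then Polynomial.coeff f (n * i + a) else 0)"
    by (simp add: dec_def Polynomial.coeff_sum)
  also have "\<dots> = (if j \<le> Polynomial.degree f then Polynomial.coeff f (n * j + a) else 0)"
    by (simp add: sum.delta)
  also have "\<dots> = Polynomial.coeff f (n * j + a)"
  proof (cases "j \<le> Polynomial.degree f")
    case False
    have "j \<le> n * j" using n_pos by simp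
    hence "n * j + a > Polynomial.degree f" using False by linarith
    thus ?thesis using False by (simp add: Polynomial.coeff_eq_0)
  qed simp
  finally show ?thesis .
qed

text \<open>The coordinate at y^b x^a of a normal form, over K[t, r] with t = x^n and r =
  y^n.\<close>

definition crd :: "nat \<Rightarrow> nat \<Rightarrow> 'k poly poly \<Rightarrow> 'k poly poly" where
  "crd a b F = (\<Sum>i\<le>Polynomial.degree F. Polynomial.monom (dec a (Polynomial.coeff F (n * i + b))) i)"

lemma coeff_crd: "Polynomial.coeff (crd a b F) i = dec a (Polynomial.coeff F (n * i + b))"
proof -
  have dec0: "dec a 0 = 0" by (rule poly_eqI) (simp add: coeff_dec)
  have "Polynomial.coeff (crd a b F) i = (\<Sum>k\<le>Polynomial.degree F. if k = i then dec a (Polynomial.coeff F (n * k + b)) else 0)"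
    by (simp add: crd_def Polynomial.coeff_sum)
  also have "\<dots> = (if i \<le> Polynomial.degree F then dec a (Polynomial.coeff F (n * i + b)) else 0)"
    by (simp add: sum.delta)
  also have "\<dots> = dec a (Polynomial.coeff F (n * i + b))"
  proof (cases "i \<le> Polynomial.degree F")
    case False
    have "i \<le> n * i" using n_pos by simp
    hence "n * i + b > Polynomial.degree F" using False by linarith
    thus ?thesis using False by (simp add: Polynomial.coeff_eq_0 dec0)
  qed simp
  finally show ?thesis .
qed

lemma crd_eqI: "(\<And>i j. Polynomial.coeff (Polynomial.coeff F (n * i + b)) (n * j + a) = Polynomial.coeff (Polynomial.coeff p i) j)
   \<Longrightarrow> crd a b F = p"
  by (intro poly_eqI) (simp add: coeff_crd coeff_dec)

lemma crd_add: "crd a b (F + G) = crd a b F + crd a b G"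
  by (rule crd_eqI) (simp add: coeff_crd coeff_dec)

lemma crd_0: "crd a b 0 = 0"
  by (rule crd_eqI) simp

lemma crd_sum: "crd a b (sum f A) = (\<Sum>x\<in>A. crd a b (f x))"
  by (induction A rule: infinite_finite_induct) (simp_all add: crd_0 crd_add)

lemma crd_smult: "crd a b (Polynomial.smult [:c:] F) = Polynomial.smult [:c:] (crd a b F)"
  by (rule crd_eqI) (simp add: coeff_crd coeff_dec)

lemma crd_Xn:
  assumes "a < n"
  shows "crd a b (Polynomial.smult (Polynomial.monom 1 n) F) = Polynomial.smult [:0, 1:] (crd a b F)"
proof (rule crd_eqI)
  fix i j
  show "Polynomial.coeff (Polynomial.coeff (Polynomial.smult (Polynomial.monom 1 n) F) (n * i + b)) (n * j + a) =
     Polynomial.coeff (Polynomial.coeff (Polynomial.smult [:0, 1:] (crd a b F)) i) j"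
    using assms by (cases j) (auto simp: coeff_crd coeff_dec Polynomial.coeff_monom_mult)
qed

lemma crd_Yn:
  assumes "b < n"
  shows "crd a b (Polynomial.monom 1 n * F) = pCons 0 (crd a b F)"
proof (rule crd_eqI)
  fix i j
  show "Polynomial.coeff (Polynomial.coeff (Polynomial.monom 1 n * F) (n * i + b)) (n * j + a) =
     Polynomial.coeff (Polynomial.coeff (pCons 0 (crd a b F)) i) j"
    using assms by (cases i) (auto simp: coeff_crd coeff_dec Polynomial.coeff_monom_mult)
qed

text \<open>Multiplication by x^n or y^n moves exponents by n and keeps their residues, so taking
  coordinates is linear over K[t, r].\<close>

lemma crd_zeta:
  assumes "a < n" "b < n"
  shows "crd a b (app (zeta p) F) = p * crd a b F"
proof -
  have zt: "crd a b (app (zt.ev f) F) = Polynomial.smult f (crd a b F)" for f F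
  proof (induction f)
    case 0
    show ?case by (simp add: zt.ev_0 app_zero crd_0)
  next
    case (pCons c f)
    have "crd a b (app (zt.ev (pCons c f)) F) =
       Polynomial.smult [:c:] (crd a b F) + Polynomial.smult ([:0, 1:] * f) (crd a b F)"
      using pCons by (simp add: zt.ev_pCons app_plus app_times scal.rep_eq app_Xn crd_add crd_smult crd_Xn[OF assms(1)])
    also have "\<dots> = Polynomial.smult (pCons c f) (crd a b F)"
      by (simp add: Polynomial.smult_add_left[symmetric])
    finally show ?case .
  qed
  show ?thesis
    by (induction p) (simp_all add: zz.ev_0 app_zero crd_0 zz.ev_pCons app_plus app_times zt crd_add app_Yn crd_Yn[OF assms(2)])
qed

lemma crd_basis:
  assumes "a < n" "b < n" "a' < n" "b' < n"
  shows "crd a b (app (oy ^ b' * ox ^ a') 1) = (if a = a' \<and> b = b' then 1 else 0)"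
proof -
  have "app (rep q (free_y ^ b' * free_x ^ a')) 1 = Polynomial.monom (Polynomial.monom 1 a') b'"
  proof -
    have ev: "fx.ev (Polynomial.monom 1 a') = (free_x ^ a' :: 'k free_alg)" by (simp add: fx.ev_monom free.C_1)
    have "app (rep q (free_x ^ a')) 1 = [:Polynomial.monom 1 a':]"
      using nf_ev[of q "Polynomial.monom 1 a'"] unfolding ev by (simp add: nf_def)
    thus ?thesis by (simp add: rep_simps app_times app_Yn Polynomial.smult_monom Polynomial.monom_0[symmetric] Polynomial.mult_monom)
  qed
  moreover have "crd a b (Polynomial.monom (Polynomial.monom 1 a') b') = (if a = a' \<and> b = b' then 1 else 0)"
  proof (rule crd_eqI)
    fix i j
    have eq: "n * i + b = b' \<longleftrightarrow> i = 0 \<and> b = b'" "n * j + a = a' \<longleftrightarrow> j = 0 \<and> a = a'"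
      using assms by (cases i; cases j; auto)+
    show "Polynomial.coeff (Polynomial.coeff (Polynomial.monom (Polynomial.monom 1 a') b') (n * i + b)) (n * j + a) =
      Polynomial.coeff (Polynomial.coeff (if a = a' \<and> b = b' then 1 else 0) i) j"
      using eq by (auto simp: eq_commute[of _ b'] eq_commute[of _ a'] Polynomial.coeff_1)
  qed
  ultimately show ?thesis by (simp add: rep_simps)
qed

lemma expansion: "\<exists>c. rep q u = (\<Sum>a<n. \<Sum>b<n. zeta (c a b) * oy ^ b * ox ^ a)"
proof -
  define S where "S = {w. \<exists>c. w = (\<Sum>a<n. \<Sum>b<n. zeta (c a b) * oy ^ b * ox ^ a)}"
  have S0: "0 \<in> S" by (auto simp: S_def zz.ev_0 intro!: exI[of _ "\<lambda>_ _. 0"])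
  have Sadd: "v + w \<in> S" if vw: "v \<in> S" "w \<in> S" for v w
  proof -
    obtain c d where "v = (\<Sum>a<n. \<Sum>b<n. zeta (c a b) * oy ^ b * ox ^ a)" "w = (\<Sum>a<n. \<Sum>b<n. zeta (d a b) * oy ^ b * ox ^ a)"
      using vw unfolding S_def by blast
    hence "v + w = (\<Sum>a<n. \<Sum>b<n. zeta (c a b + d a b) * oy ^ b * ox ^ a)"
      by (simp add: zz.ev_add distrib_right sum.distrib)
    thus ?thesis by (auto simp: S_def)
  qed
  have Ssum: "sum f A \<in> S" if "\<And>x. x \<in> A \<Longrightarrow> f x \<in> S" for f :: "nat \<Rightarrow> 'k operator" and A
    using that by (induction A rule: infinite_finite_induct) (auto simp: S0 Sadd)
  have "scal c * oy ^ i * ox ^ j \<in> S" for c :: 'k and i j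
  proof -
    \<comment> \<open>Divide both exponents by n: the quotients become exponents of t and r, the
      remainders those of x and y.\<close>
    define d where "d a b = (if a = j mod n \<and> b = i mod n then Polynomial.monom (Polynomial.monom c (j div n)) (i div n) else 0)" for a b
    have "(\<Sum>a<n. \<Sum>b<n. zeta (d a b) * oy ^ b * ox ^ a) =
       (\<Sum>a<n. \<Sum>b<n. if a = j mod n \<and> b = i mod n then zeta (d a b) * oy ^ b * ox ^ a else 0)"
      by (intro sum.cong refl) (auto simp: d_def zz.ev_0)
    also have "\<dots> = zeta (d (j mod n) (i mod n)) * oy ^ (i mod n) * ox ^ (j mod n)"
      using n_pos by (intro double_delta) auto
    also have "\<dots> = scal c * (((ox ^ n) ^ (j div n) * ((oy ^ n) ^ (i div n) * oy ^ (i mod n))) * ox ^ (j mod n))"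
      by (simp add: d_def zz.ev_monom zt.ev_monom mult.assoc)
    also have "\<dots> = scal c * ((oy ^ i * (ox ^ n) ^ (j div n)) * ox ^ (j mod n))"
    proof -
      have "(oy ^ n) ^ (i div n) * oy ^ (i mod n) = oy ^ i"
        unfolding power_mult[symmetric] power_add[symmetric] by simp
      moreover have "ox ^ n * oy ^ i = oy ^ i * ox ^ n"
        using Xn_central[of "free_y ^ i"] by (simp add: rep_simps)
      hence "(ox ^ n) ^ (j div n) * oy ^ i = oy ^ i * (ox ^ n) ^ (j div n)"
        by (rule power_commuting_commutes)
      ultimately show ?thesis by simp
    qed
    also have "\<dots> = scal c * oy ^ i * ox ^ j"
    proof -
      have "(ox ^ n) ^ (j div n) * ox ^ (j mod n) = ox ^ j"
        unfolding power_mult[symmetric] power_add[symmetric] by simp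
      thus ?thesis by (simp add: mult.assoc)
    qed
    finally show ?thesis unfolding S_def by (intro CollectI exI[of _ d]) simp
  qed
  hence "rep q (nf_inv (nf q u)) \<in> S"
    by (simp add: nf_inv_def fx.ev_def rep_simps sum_distrib_left)
       (auto intro!: Ssum simp: Cl mult.assoc[symmetric] scal.C_central[symmetric])
  thus ?thesis by (simp add: rep_nf_inv S_def)
qed

text \<open>The functions \<open>crd a b\<close> are dual to the elements y^b x^a, so they return
  the coefficients of any expansion; in particular these elements are independent over
  K[t, r].\<close>

lemma expansion_crd: "rep q u = (\<Sum>a<n. \<Sum>b<n. zeta (crd a b (nf q u)) * oy ^ b * ox ^ a)"
proof -
  obtain c where c: "rep q u = (\<Sum>a<n. \<Sum>b<n. zeta (c a b) * oy ^ b * ox ^ a)"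
    using expansion by blast
  have "crd a b (nf q u) = c a b" if "a < n" "b < n" for a b
  proof -
    have "crd a b (nf q u) = (\<Sum>a'<n. \<Sum>b'<n. c a' b' * (if a = a' \<and> b = b' then 1 else 0))"
      using that by (simp add: nf_def c app_sum crd_sum mult.assoc app_times[of "zeta _"] crd_zeta crd_basis)
    also have "\<dots> = (\<Sum>a'<n. \<Sum>b'<n. if a' = a \<and> b' = b then c a' b' else 0)"
      by (intro sum.cong refl) auto
    also have "\<dots> = c a b" by (rule double_delta[OF that])
    finally show ?thesis .
  qed
  thus ?thesis unfolding c by (intro sum.cong refl) auto
qed

end

section \<open>Completely prime ideals in the free algebra, the centre, and the elements h^i
  x^j\<close>

text \<open>Complete primeness tested on elements of a ring given by its type;
  \<open>Spec_c_A1_iff\<close> connects it with \<open>Spec_c\<close> through preimages.\<close>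

definition cprime :: "'r::ring_1 set \<Rightarrow> bool" where
  "cprime P \<longleftrightarrow> tideal P \<and> 1 \<notin> P \<and> (\<forall>u v. u * v \<in> P \<longrightarrow> u \<in> P \<or> v \<in> P)"

lemma cprimeD:
  assumes "cprime P"
  shows "tideal P" "1 \<notin> P" "u * v \<in> P \<Longrightarrow> u \<in> P \<or> v \<in> P"
  using assms unfolding cprime_def by auto

lemma cprime_pow: "cprime P \<Longrightarrow> u ^ k \<in> P \<Longrightarrow> u \<in> P"
  by (induction k) (auto simp: cprimeD(2) dest: cprimeD(3))

lemma tideal_const_cancel:
  assumes "tideal P" "free_const (c::'k::field) * u \<in> P" "c \<noteq> 0"
  shows "u \<in> P"
  using tidealD(3)[OF assms(1,2), of "free_const (inverse c)"] free.C_inverse[OF assms(3), of u] by simp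

context qroot
begin

lemma rep_ev_oh: "rep q (fx.ev f) * oh = oh * rep q (fx.ev (pcompose f [:0, q:]))"
proof (induction f)
  case 0
  show ?case by (simp add: fx.ev_0 rep_simps)
next
  case (pCons a f)
  let ?g = "rep q (fx.ev (pcompose f [:0, q:]))"
  have "rep q (fx.ev (pCons a f)) * oh = scal a * oh + ox * (rep q (fx.ev f) * oh)"
    by (simp add: fx.ev_pCons rep_simps distrib_right mult.assoc)
  also have "\<dots> = oh * scal a + (ox * oh) * ?g"
    unfolding pCons.IH by (simp add: mult.assoc scal.C_central)
  also have "\<dots> = oh * (scal a + scal q * (ox * ?g))"
    unfolding XH by (simp add: distrib_left mult.assoc scal.C_left_commute[of oh])
  also have "scal a + scal q * (ox * ?g) = rep q (fx.ev (pcompose (pCons a f) [:0, q:]))"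
    by (simp add: pcompose_pCons fx.ev_add fx.ev_const fx.ev_pCons fx.ev_smult rep_simps free.C_0 Cl)
  finally show ?case .
qed

text \<open>Moving h to the left through y^i x^j multiplies by q^j for the powers of x and by q^(-i)
  for those of y; \<open>G\<close> is \<open>F\<close> rescaled accordingly.\<close>

lemma rep_nf_inv_oh:
  "\<exists>G. rep q (nf_inv F) * oh = oh * rep q (nf_inv G) \<and>
    (\<forall>i j. Polynomial.coeff (Polynomial.coeff G i) j = q ^ j * inverse q ^ i * Polynomial.coeff (Polynomial.coeff F i) j)"
proof (induction F)
  case 0
  show ?case by (intro exI[of _ 0]) (simp add: nf_inv_0 rep_simps)
next
  case (pCons f F)
  then obtain G where G: "rep q (nf_inv F) * oh = oh * rep q (nf_inv G)"
    "\<And>i j. Polynomial.coeff (Polynomial.coeff G i) j = q ^ j * inverse q ^ i * Polynomial.coeff (Polynomial.coeff F i) j"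
    by blast
  let ?G = "pCons (pcompose f [:0, q:]) (Polynomial.smult [:inverse q:] G)"
  have "rep q (nf_inv (pCons f F)) * oh = rep q (fx.ev f) * oh + oy * (rep q (nf_inv F) * oh)"
    by (simp add: nf_inv_pCons rep_simps distrib_right mult.assoc)
  also have "\<dots> = oh * rep q (fx.ev (pcompose f [:0, q:])) + (oy ^ 1 * oh) * rep q (nf_inv G)"
    unfolding rep_ev_oh G(1) by (simp add: mult.assoc)
  also have "\<dots> = oh * rep q (nf_inv ?G)"
    unfolding Y_H_pow
    by (simp add: nf_inv_pCons nf_inv_smult rep_simps distrib_left mult.assoc Cl)
  finally have "rep q (nf_inv (pCons f F)) * oh = oh * rep q (nf_inv ?G)" .
  moreover have "Polynomial.coeff (Polynomial.coeff ?G i) j = q ^ j * inverse q ^ i * Polynomial.coeff (Polynomial.coeff (pCons f F) i) j" for i j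
    by (cases i) (simp_all add: coeff_pcompose_linear G(2) mult_ac)
  ultimately show ?case by blast
qed

lemma oh_nonzero: "oh \<noteq> 0"
proof
  assume "oh = 0"
  hence "nf q fh = 0" by (simp add: nf_def rep_fh app_zero)
  moreover have "nf q fh = pCons 0 (nf q (free_x * free_const 1)) + nf q (free_const c0)"
    unfolding fh_def nf_add nf_y[symmetric] by (simp add: free.C_1)
  ultimately show False
    using c0(1) by (simp add: nf_x nf_const op_x_poly_pCons op_x_poly_0)
qed

text \<open>Commuting with x says that the q-integer of i+1 times F_(i+1) is (1 - q^i) x F_i, a
  multiple of the q-integer of i times F_i. By induction the q-integer of i kills F_i, so only
  powers of y^n occur. Commuting with h then compares the scalars q^(j-i) and leaves only powers of
  x^n.\<close>

lemma center:
  assumes central: "\<And>v. rep q u * rep q v = rep q v * rep q u"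
  shows "\<exists>p. rep q u = zeta p"
proof -
  define F where "F = nf q u"
  have "rep q (u * free_x) = rep q (free_x * u)"
    using central[of free_x] by (simp add: rep_simps)
  hence "op_x_poly q F = Polynomial.smult [:0, 1:] F"
    unfolding rep_eq_iff_nf nf_right_x nf_x F_def by simp
  hence x: "Polynomial.coeff (op_x_poly q F) i = pCons 0 (Polynomial.coeff F i)" for i by simp
  have zero: "Polynomial.smult (qnum q i) (Polynomial.coeff F i) = 0" for i
  proof (induction i)
    case (Suc i)
    have "Polynomial.smult (qnum q (Suc i)) (Polynomial.coeff F (Suc i)) = pCons 0 (Polynomial.smult (1 - q ^ i) (Polynomial.coeff F i))"
    proof -
      have "Polynomial.smult (qnum q (Suc i)) (Polynomial.coeff F (Suc i)) =
          pCons 0 (Polynomial.coeff F i) - Polynomial.smult (q ^ i) (pCons 0 (Polynomial.coeff F i))"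
        using x[of i] unfolding coeff_op_x_poly by (metis add_diff_cancel_left')
      thus ?thesis by (simp add: Polynomial.smult_diff_left)
    qed
    also have "1 - q ^ i = (1 - q) * qnum q i"
      using qnum_mult[of q i] by (simp add: algebra_simps)
    also have "Polynomial.smult ((1 - q) * qnum q i) (Polynomial.coeff F i) = Polynomial.smult (1 - q) (Polynomial.smult (qnum q i) (Polynomial.coeff F i))"
      by simp
    finally show ?case using Suc by simp
  qed simp
  have dvd_i: "n dvd i" if "Polynomial.coeff F i \<noteq> 0" for i
  proof -
    have "qnum q i = 0" using zero[of i] that by simp
    hence "q ^ i = 1" using qnum_mult[of q i] by simp
    thus ?thesis by (simp add: q_pow_eq_1_iff)
  qed
  obtain G where G: "rep q (nf_inv F) * oh = oh * rep q (nf_inv G)"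
    "\<And>i j. Polynomial.coeff (Polynomial.coeff G i) j = q ^ j * inverse q ^ i * Polynomial.coeff (Polynomial.coeff F i) j"
    using rep_nf_inv_oh by blast
  have "oh * rep q (nf_inv G) = oh * rep q (nf_inv F)"
    using G(1) central[of fh] by (simp add: F_def rep_nf_inv rep_fh)
  hence "rep q (fh * (nf_inv G - nf_inv F)) = 0"
    by (simp add: rep_simps rep_fh right_diff_distrib)
  \<comment> \<open>The domain property cancels the left factor h.\<close>
  hence "rep q (nf_inv G - nf_inv F) = 0"
    using rep_domain[OF q0, of fh] oh_nonzero by (auto simp: rep_fh)
  hence "rep q (nf_inv G) = rep q (nf_inv F)"
    by (simp add: rep_simps)
  hence GF: "G = F" by (simp add: rep_eq_iff_nf nf_nf_inv)
  have dvd_j: "n dvd j" if nz: "Polynomial.coeff (Polynomial.coeff F i) j \<noteq> 0" for i j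
  proof -
    have "n dvd i" using nz by (intro dvd_i) auto
    hence "inverse q ^ i = 1" using q_pow_eq_1_iff[of i] by (simp add: power_inverse)
    hence "q ^ j = 1" using G(2)[of i j] nz by (simp add: GF)
    thus ?thesis by (simp add: q_pow_eq_1_iff)
  qed
  have cr0: "crd a b F = 0" if "a < n" "b < n" "a \<noteq> 0 \<or> b \<noteq> 0" for a b
  proof (rule crd_eqI)
    fix i j
    have "Polynomial.coeff (Polynomial.coeff F (n * i + b)) (n * j + a) = 0"
    proof (rule ccontr)
      assume nz: "Polynomial.coeff (Polynomial.coeff F (n * i + b)) (n * j + a) \<noteq> 0"
      hence "n dvd n * j + a" "n dvd n * i + b"
        using dvd_j[OF nz] by (auto intro!: dvd_i)
      hence "n dvd a" "n dvd b" by (simp_all add: dvd_add_right_iff)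
      thus False using that by (auto dest: dvd_imp_le)
    qed
    thus "Polynomial.coeff (Polynomial.coeff F (n * i + b)) (n * j + a) = Polynomial.coeff (Polynomial.coeff 0 i) j" by simp
  qed
  have "rep q u = (\<Sum>a<n. \<Sum>b<n. zeta (crd a b F) * oy ^ b * ox ^ a)"
    unfolding F_def by (rule expansion_crd)
  also have "\<dots> = (\<Sum>a<n. \<Sum>b<n. if a = 0 \<and> b = 0 then zeta (crd a b F) * oy ^ b * ox ^ a else 0)"
    by (intro sum.cong refl) (auto simp: cr0 zz.ev_0)
  also have "\<dots> = zeta (crd 0 0 F) * oy ^ 0 * ox ^ 0"
    using n_pos by (intro double_delta)
  also have "\<dots> = zeta (crd 0 0 F)" by simp
  finally show ?thesis by blast
qed

lemma Xn_zeta: "ox ^ n = zeta [:[:0, 1:]:]"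
  by (simp add: zz.ev_const zt.ev_X)

lemma scal_zeta: "scal c = zeta [:[:c:]:]"
  by (simp add: zz.ev_const zt.ev_const)

lemma Hn_zeta: "\<exists>s. oh ^ n = zeta s"
  using center[of "fh ^ n"] Hn_central by (simp add: rep_simps rep_fh)

text \<open>Combinations over K[t, r] of elements that conjugation by x and by h multiplies by
  powers of q. The generator y is replaced by h here.\<close>

definition dsum :: "(nat \<Rightarrow> nat \<Rightarrow> 'k poly poly) \<Rightarrow> 'k operator" where
  "dsum c = (\<Sum>i<n. \<Sum>j<n. zeta (c i j) * oh ^ i * ox ^ j)"

lemma dsum_add: "dsum c + dsum d = dsum (\<lambda>i j. c i j + d i j)"
  by (simp add: dsum_def zz.ev_add distrib_right sum.distrib)

text \<open>Exponents from n on are lowered by means of h^n and x^n, which both lie in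
  K[t, r].\<close>

lemma dsum_monom: "\<exists>d. zeta p * oh ^ i * ox ^ j = dsum d"
proof -
  obtain s where s: "oh ^ n = zeta s" using Hn_zeta by blast
  let ?i = "i mod n" and ?j = "j mod n"
  define r where "r = p * s ^ (i div n) * [:[:0, 1:]:] ^ (j div n)"
  define d where "d a b = (if a = ?i \<and> b = ?j then r else 0)" for a b
  have comm: "zeta t * oh ^ k = oh ^ k * zeta t" for t k
    using zeta_central[of t "fh ^ k"] by (simp add: rep_simps rep_fh)
  have pow: "z ^ k = (z ^ n) ^ (k div n) * z ^ (k mod n)" for z :: "'k operator" and k
  proof -
    have "z ^ k = z ^ (n * (k div n) + k mod n)" by simp
    thus ?thesis by (simp only: power_add power_mult)
  qed
  define S where "S = s ^ (i div n)"
  define T :: "'k poly poly" where "T = [:[:0, 1:]:] ^ (j div n)"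
  have hi: "oh ^ i = zeta S * oh ^ ?i"
    using pow[of oh i] unfolding s S_def zz.ev_power .
  have xj: "ox ^ j = zeta T * ox ^ ?j"
    using pow[of ox j] unfolding T_def zz.ev_power Xn_zeta[symmetric] .
  have "zeta p * oh ^ i * ox ^ j = zeta p * zeta S * (oh ^ ?i * zeta T) * ox ^ ?j"
    unfolding hi xj mult.assoc ..
  also have "\<dots> = zeta p * zeta S * (zeta T * oh ^ ?i) * ox ^ ?j"
    unfolding comm[of T "?i"] ..
  also have "\<dots> = zeta r * oh ^ ?i * ox ^ ?j"
    unfolding r_def S_def[symmetric] T_def[symmetric] zz.ev_mult mult.assoc ..
  also have "\<dots> = dsum d"
  proof -
    have "dsum d = (\<Sum>a<n. \<Sum>b<n. if a = ?i \<and> b = ?j then zeta (d a b) * oh ^ a * ox ^ b else 0)"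
      unfolding dsum_def by (intro sum.cong refl) (auto simp: d_def zz.ev_0)
    also have "\<dots> = zeta (d ?i ?j) * oh ^ ?i * ox ^ ?j"
      using n_pos by (intro double_delta) auto
    finally show ?thesis by (simp add: d_def)
  qed
  finally show ?thesis by blast
qed

lemma dsum_sum: "finite A \<Longrightarrow> (\<And>x. x \<in> A \<Longrightarrow> \<exists>d. f x = dsum d) \<Longrightarrow> \<exists>d. sum f A = dsum d"
proof (induction A rule: finite_induct)
  case empty
  have "dsum (\<lambda>_ _. 0) = 0" by (simp add: dsum_def zz.ev_0)
  thus ?case by (metis sum.empty)
next
  case (insert x A)
  obtain d where d: "f x = dsum d" using insert.prems[of x] by blast
  obtain e where e: "sum f A = dsum e" using insert.IH insert.prems by blast
  have "sum f (insert x A) = dsum (\<lambda>i j. d i j + e i j)"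
    using insert.hyps by (simp add: d e dsum_add)
  thus ?case by blast
qed

lemma dsum_map:
  assumes "\<And>p i j. \<exists>d. w * (zeta p * oh ^ i * ox ^ j) = dsum d"
  shows "\<exists>d. w * dsum c = dsum d"
  unfolding dsum_def[of c] sum_distrib_left using assms by (intro dsum_sum) auto

lemma zeta_oh_comm: "zeta t * oh = oh * zeta t"
  using zeta_central[of t fh] by (simp add: rep_fh)

lemma zeta_ox_comm: "zeta t * ox = ox * zeta t"
  using zeta_central[of t free_x] by (simp add: rep_simps)

lemma dsum_closed:
  "\<exists>d. zeta r * dsum c = dsum d" "\<exists>d. oh * dsum c = dsum d" "\<exists>d. ox * dsum c = dsum d"
proof -
  show "\<exists>d. zeta r * dsum c = dsum d"
    by (rule dsum_map) (use dsum_monom in \<open>simp add: mult.assoc[symmetric] zz.ev_mult[symmetric]\<close>)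
  show "\<exists>d. oh * dsum c = dsum d"
  proof (rule dsum_map)
    fix p i j
    have "oh * (zeta p * oh ^ i * ox ^ j) = zeta p * oh ^ Suc i * ox ^ j"
      by (simp add: mult.assoc[symmetric] zeta_oh_comm)
    thus "\<exists>d. oh * (zeta p * oh ^ i * ox ^ j) = dsum d" using dsum_monom by metis
  qed
  show "\<exists>d. ox * dsum c = dsum d"
  proof (rule dsum_map)
    fix p i j
    have "ox * (zeta p * oh ^ i * ox ^ j) = zeta p * (ox * oh ^ i) * ox ^ j"
      by (simp add: mult.assoc[symmetric] zeta_ox_comm)
    also have "\<dots> = zeta p * scal (q ^ i) * oh ^ i * ox ^ Suc j"
      unfolding scal.skew_right[OF XH] by (simp add: mult.assoc)
    also have "\<dots> = zeta (p * [:[:q ^ i:]:]) * oh ^ i * ox ^ Suc j"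
      by (simp only: zz.ev_mult scal_zeta[of "q ^ i"])
    finally show "\<exists>d. ox * (zeta p * oh ^ i * ox ^ j) = dsum d" using dsum_monom by metis
  qed
qed

lemma dsum_ox_pow: "\<exists>d. ox ^ m * dsum c = dsum d"
proof (induction m)
  case 0
  show ?case by (rule exI[of _ c]) simp
next
  case (Suc m)
  then obtain d where d: "ox ^ m * dsum c = dsum d" by blast
  obtain e where e: "ox * dsum d = dsum e" using dsum_closed(3)[of d] by blast
  have "ox ^ Suc m * dsum c = dsum e"
    unfolding power_Suc mult.assoc d e ..
  thus ?case by blast
qed

text \<open>The only generator that leads out of these combinations is y, and one factor x^n repairs
  this: x^n y = y x^n = (h - c0) x^(n-1).\<close>

lemma density: "\<exists>N c. ox ^ (n * N) * rep q u = dsum c"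
proof -
  \<comment> \<open>Exponents can be raised at will, so that two summands get a common one.\<close>
  have up: "\<exists>d. ox ^ (n * (M + N)) * w = dsum d" if w: "ox ^ (n * N) * w = dsum c" for M N w c
  proof -
    have e: "n * (M + N) = n * M + n * N" by (rule distrib_left)
    obtain d where d: "ox ^ (n * M) * dsum c = dsum d" using dsum_ox_pow[of "n * M" c] by blast
    have "ox ^ (n * (M + N)) * w = ox ^ (n * M) * (ox ^ (n * N) * w)"
      unfolding e power_add mult.assoc ..
    hence "ox ^ (n * (M + N)) * w = dsum d" unfolding w d .
    thus ?thesis by blast
  qed
  show ?thesis
  proof (induction u rule: free_alg_induct)
    case (const c)
    obtain d where d: "zeta [:[:c:]:] * oh ^ 0 * ox ^ 0 = dsum d"
      using dsum_monom[of "[:[:c:]:]" 0 0] by blast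
    have "ox ^ (n * 0) * rep q (free_const c) = dsum d"
      using d by (simp add: rep_simps scal_zeta[of c])
    thus ?case by blast
  next
    case (add u v)
    from add(1) obtain N c where c: "ox ^ (n * N) * rep q u = dsum c" by blast
    from add(2) obtain M d where d: "ox ^ (n * M) * rep q v = dsum d" by blast
    from up[OF c, of M] obtain c' where c': "ox ^ (n * (M + N)) * rep q u = dsum c'" by blast
    from up[OF d, of N] obtain d' where "ox ^ (n * (N + M)) * rep q v = dsum d'" by blast
    hence d': "ox ^ (n * (M + N)) * rep q v = dsum d'" unfolding add.commute[of N M] .
    have "ox ^ (n * (M + N)) * rep q (u + v) = dsum (\<lambda>i j. c' i j + d' i j)"
      unfolding rep_simps distrib_left[of "ox ^ _"] c' d' dsum_add ..
    thus ?case by blast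
  next
    case (x u)
    then obtain N c where c: "ox ^ (n * N) * rep q u = dsum c" by blast
    obtain d where d: "ox * dsum c = dsum d" using dsum_closed(3)[of c] by blast
    have "ox ^ (n * N) * rep q (free_x * u) = (ox ^ (n * N) * ox) * rep q u"
      unfolding rep_simps mult.assoc ..
    also have "\<dots> = dsum d"
      unfolding power_commutes mult.assoc c d ..
    finally show ?case by blast
  next
    case (y u)
    then obtain N c where c: "ox ^ (n * N) * rep q u = dsum c" by blast
    obtain m where m: "n = Suc m" using n_pos by (cases n) auto
    have comm: "ox ^ (n * N) * oy = oy * ox ^ (n * N)"
      unfolding power_mult by (rule power_commuting_commutes[OF Xn_Y])
    obtain d where d: "ox ^ m * dsum c = dsum d" using dsum_ox_pow[of m c] by blast
    obtain d1 where d1: "oh * dsum d = dsum d1" using dsum_closed(2)[of d] by blast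
    obtain d2 where d2: "zeta [:[:- c0:]:] * dsum d = dsum d2" using dsum_closed(1)[of _ d] by blast
    have mm: "oy * ox ^ n = (oy * ox) * ox ^ m"
      using m by (simp add: mult.assoc)
    have yx: "oy * ox = oh + zeta [:[:- c0:]:]"
      unfolding scal_zeta[symmetric] YX scal.C_uminus by simp
    have "ox ^ (n * Suc N) * rep q (free_y * u) = ox ^ n * ((ox ^ (n * N) * oy) * rep q u)"
      unfolding rep_simps mult_Suc_right power_add mult.assoc ..
    also have "\<dots> = (ox ^ n * oy) * (ox ^ (n * N) * rep q u)"
      unfolding comm mult.assoc ..
    also have "\<dots> = (oh + zeta [:[:- c0:]:]) * (ox ^ m * dsum c)"
      unfolding Xn_Y mm yx c by (simp only: mult.assoc)
    also have "\<dots> = dsum (\<lambda>i j. d1 i j + d2 i j)"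
      unfolding d distrib_right d1 d2 dsum_add ..
    finally show ?case by blast
  qed
qed

text \<open>Modulo \<open>P\<close> the v_j are eigenvectors, with distinct eigenvalues, of
  conjugation by an element g that can be cancelled though perhaps not inverted. The argument is the
  one that separates eigenvectors: eliminate one of them from the sum, apply induction to the
  others, and cancel g by primality.\<close>

lemma interpolation:
  assumes P: "cprime (P :: 'k free_alg set)" and g: "g \<notin> P"
    and \<omega>: "\<And>i j. i < n \<Longrightarrow> j < n \<Longrightarrow> \<omega> i = \<omega> j \<Longrightarrow> i = j" and J: "finite J"
  shows "J \<subseteq> {..<n} \<Longrightarrow> (\<And>j. j \<in> J \<Longrightarrow> v j * g - free_const (\<omega> j) * g * v j \<in> P) \<Longrightarrow>
    sum v J \<in> P \<Longrightarrow> \<forall>j\<in>J. v j \<in> P"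
  using J
proof (induction J arbitrary: v rule: finite_induct)
  case empty
  show ?case by simp
next
  case (insert k J)
  note Pi = tidealD[OF cprimeD(1)[OF P]]
  let ?e = "\<lambda>j. v j * g - free_const (\<omega> j) * g * v j"
  \<comment> \<open>What remains of v_j in (sum) g - \<omega>_k g (sum), modulo \<open>P\<close>.
    The term at k has disappeared, and w_j has the same eigenvalue as v_j.\<close>
  define w where "w j = free_const (\<omega> j - \<omega> k) * g * v j" for j
  have "sum v (insert k J) * g - free_const (\<omega> k) * g * sum v (insert k J) = ?e k + (\<Sum>j\<in>J. ?e j + w j)"
    using insert.hyps
    by (simp add: w_def free.C_diff algebra_simps sum_distrib_left sum_distrib_right sum.distrib sum_subtractf)
  moreover have "sum v (insert k J) * g - free_const (\<omega> k) * g * sum v (insert k J) \<in> P"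
    by (rule Pi(6)[OF Pi(4)[OF insert.prems(3)] Pi(3)[OF insert.prems(3)]])
  ultimately have "?e k + (\<Sum>j\<in>J. ?e j + w j) \<in> P" by simp
  moreover have "?e k \<in> P" using insert.prems(2) by blast
  moreover have "(\<Sum>j\<in>J. ?e j) \<in> P"
    using insert.prems(2) by (intro tideal_sum[OF cprimeD(1)[OF P]]) blast
  ultimately have "?e k + (\<Sum>j\<in>J. ?e j + w j) - ?e k - (\<Sum>j\<in>J. ?e j) \<in> P"
    using Pi(6) by blast
  hence "sum w J \<in> P" by (simp add: sum.distrib)
  moreover have "w j * g - free_const (\<omega> j) * g * w j \<in> P" if "j \<in> J" for j
  proof -
    have "free_const (\<omega> j) * g * w j = free_const (\<omega> j - \<omega> k) * g * (free_const (\<omega> j) * g * v j)"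
      unfolding w_def mult.assoc free.C_left_commute[of g] by (rule free.C_left_commute)
    hence "w j * g - free_const (\<omega> j) * g * w j = free_const (\<omega> j - \<omega> k) * g * ?e j"
      by (simp add: w_def right_diff_distrib mult.assoc)
    thus ?thesis using insert.prems(2) that by (auto intro!: Pi(3))
  qed
  ultimately have "\<forall>j\<in>J. w j \<in> P"
    using insert.IH[of w] insert.prems(1) by auto
  hence J: "v j \<in> P" if "j \<in> J" for j
  proof -
    have "\<omega> j - \<omega> k \<noteq> 0" using \<omega>[of j k] that insert.prems(1) insert.hyps(2) by auto
    moreover have "free_const (\<omega> j - \<omega> k) * (g * v j) \<in> P"
      using \<open>\<forall>j\<in>J. w j \<in> P\<close> that by (auto simp: w_def mult.assoc)
    ultimately have "g * v j \<in> P" using tideal_const_cancel[OF cprimeD(1)[OF P]] by blast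
    thus ?thesis using cprimeD(3)[OF P] g by blast
  qed
  have "sum v (insert k J) - sum v J \<in> P"
    using J by (intro Pi(6)[OF insert.prems(3)] tideal_sum[OF cprimeD(1)[OF P]])
  hence "v k \<in> P" using insert.hyps by simp
  thus ?case using J by blast
qed

lemma mem_cong:
  assumes "tideal P" "{u. rep q u = 0} \<subseteq> P" "rep q u = rep q v" "u \<in> P"
  shows "v \<in> P"
proof -
  have "v - u \<in> P" using assms(2,3) by (auto simp: rep_simps)
  thus ?thesis using tidealD(2)[OF assms(1,4)] by fastforce
qed

definition fsum :: "(nat \<Rightarrow> nat \<Rightarrow> 'k poly poly) \<Rightarrow> 'k free_alg" where
  "fsum c = (\<Sum>i<n. \<Sum>j<n. fzeta (c i j) * fh ^ i * free_x ^ j)"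

lemma rep_fsum: "rep q (fsum c) = dsum c"
  by (simp add: fsum_def dsum_def rep_simps rep_fzeta rep_fh)

text \<open>First h separates the powers of x, by the eigenvalues q^j; then x separates the powers
  of h, by the eigenvalues q^(-i). The factors x^j and h^i are removed by primality.\<close>

lemma coefficients_in_prime:
  assumes P: "cprime P" "{u. rep q u = 0} \<subseteq> P" and x: "free_x \<notin> P" and h: "fh \<notin> P"
    and s: "fsum c \<in> P" and i: "i < n" and j: "j < n"
  shows "fzeta (c i j) \<in> P"
proof -
  define w where "w j = (\<Sum>i<n. fzeta (c i j) * fh ^ i)" for j
  have comm: "oh * (zeta t * oh ^ k) = zeta t * oh ^ k * oh" for t k
  proof -
    have "oh * (zeta t * oh ^ k) = (oh * zeta t) * oh ^ k" unfolding mult.assoc ..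
    also have "\<dots> = zeta t * (oh * oh ^ k)" unfolding zeta_oh_comm[symmetric] mult.assoc ..
    also have "oh * oh ^ k = oh ^ k * oh" by (rule power_commutes[symmetric])
    finally show ?thesis unfolding mult.assoc .
  qed
  have woh: "rep q (w j) * oh = oh * rep q (w j)" for j
    by (simp add: w_def rep_simps rep_fzeta rep_fh sum_distrib_left sum_distrib_right comm)
  have "sum (\<lambda>j. w j * free_x ^ j) {..<n} = fsum c"
    unfolding fsum_def w_def sum_distrib_right by (rule sum.swap)
  hence "sum (\<lambda>j. w j * free_x ^ j) {..<n} \<in> P" using s by simp
  moreover have "w j * free_x ^ j * fh - free_const (q ^ j) * fh * (w j * free_x ^ j) \<in> P" for j
  proof -
    have "rep q (w j) * (ox ^ j * oh) = scal (q ^ j) * (rep q (w j) * oh) * ox ^ j"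
      unfolding scal.skew_left[OF XH] by (simp add: mult.assoc scal.C_left_commute)
    hence "rep q (w j * free_x ^ j * fh - free_const (q ^ j) * fh * (w j * free_x ^ j)) = 0"
      unfolding woh by (simp add: rep_simps rep_fh mult.assoc)
    thus ?thesis using P(2) by blast
  qed
  ultimately have "\<forall>j\<in>{..<n}. w j * free_x ^ j \<in> P"
    using q_pow_inj
    by (intro interpolation[OF P(1) h, where \<omega> = "\<lambda>j. q ^ j"]) auto
  hence wj: "w j \<in> P"
    using cprimeD(3)[OF P(1)] cprime_pow[OF P(1)] x j by blast
  have "fzeta (c i j) * fh ^ i * free_x - free_const (inverse (q ^ i)) * free_x * (fzeta (c i j) * fh ^ i) \<in> P" for i
  proof -
    have "scal (inverse (q ^ i)) * (ox * (zeta (c i j) * oh ^ i)) = scal (inverse (q ^ i)) * (zeta (c i j) * (ox * oh ^ i))"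
      unfolding mult.assoc[symmetric, of ox "zeta _"] zeta_ox_comm[symmetric] mult.assoc ..
    also have "\<dots> = scal (inverse (q ^ i)) * (scal (q ^ i) * (zeta (c i j) * (oh ^ i * ox)))"
      unfolding scal.skew_right[OF XH] by (simp add: mult.assoc scal.C_left_commute[of "zeta _"])
    also have "\<dots> = zeta (c i j) * (oh ^ i * ox)"
      using q0 by (intro scal.C_inverse) simp
    finally have "rep q (fzeta (c i j) * fh ^ i * free_x - free_const (inverse (q ^ i)) * free_x * (fzeta (c i j) * fh ^ i)) = 0"
      by (simp add: rep_simps rep_fzeta rep_fh mult.assoc)
    thus ?thesis using P(2) by blast
  qed
  hence "\<forall>i\<in>{..<n}. fzeta (c i j) * fh ^ i \<in> P"
    using wj q_pow_inj unfolding w_def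
    by (intro interpolation[OF P(1) x, where \<omega> = "\<lambda>i. inverse (q ^ i)"]) auto
  thus ?thesis
    using cprimeD(3)[OF P(1)] cprime_pow[OF P(1)] h i by blast
qed

end

section \<open>The quotient by h and its prime ideals\<close>

definition poly_fract :: "'k::field \<Rightarrow> 'k poly fract" where
  "poly_fract c = to_fract [:c:]"

interpretation fract: central_scalars "poly_fract :: 'k::field \<Rightarrow> 'k poly fract"
  by standard (simp_all add: poly_fract_def to_fract_add[symmetric] to_fract_mult[symmetric] mult.commute
      one_pCons[symmetric])

context qroot
begin

text \<open>Modulo h one has yx = -c0, so y becomes -c0/x. The image in K(x) is the ring of Laurent
  polynomials K[x, 1/x].\<close>

definition laurent :: "'k free_alg \<Rightarrow> 'k poly fract" where
  "laurent = fract.free_eval (to_fract [:0, 1:]) (- poly_fract c0 / to_fract [:0, 1:])"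

lemmas laurent_simps = fract.free_eval_simps[of "to_fract [:0, 1:]" "- poly_fract c0 / to_fract [:0, 1:]", folded laurent_def]

abbreviation kers :: "'k free_alg set" where "kers \<equiv> {u. rep q u = 0}"

lemma X_fract_nonzero: "to_fract [:0, 1 :: 'k:] \<noteq> 0"
  by (simp add: to_fract_eq_0_iff)

lemma laurent_qrel: "laurent (qrel q) = 0"
proof -
  have "laurent (qrel q) = - poly_fract c0 + poly_fract q * poly_fract c0 - 1"
    using X_fract_nonzero by (simp add: qrel_def laurent_simps field_simps)
  also have "poly_fract q * poly_fract c0 = 1 + poly_fract c0"
    unfolding fract.C_mult[symmetric] c0(2)[symmetric] fract.C_add fract.C_1 ..
  finally show ?thesis by simp
qed

lemma laurent_fh: "laurent fh = 0"
  using X_fract_nonzero by (simp add: fh_def laurent_simps)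

lemma tideal_laurent: "tideal {u. laurent u = 0}"
  by (simp add: tideal_def laurent_simps)

lemma kers_laurent: "kers \<subseteq> {u. laurent u = 0}"
  using rep_0_mem[OF tideal_laurent] laurent_qrel by blast

lemma laurent_ev: "laurent (fx.ev f) = to_fract f"
proof (induction f)
  case 0
  show ?case by (simp add: fx.ev_0 laurent_simps)
next
  case (pCons a f)
  have "to_fract (pCons a f) = to_fract ([:a:] + [:0, 1:] * f)" by simp
  also have "\<dots> = poly_fract a + to_fract [:0, 1:] * to_fract f"
    by (simp only: to_fract_add to_fract_mult poly_fract_def)
  finally show ?case using pCons by (simp add: fx.ev_pCons laurent_simps)
qed

lemma laurent_X: "laurent (free_x ^ N) = to_fract ([:0, 1:] ^ N)"
proof (induction N)
  case 0
  show ?case by (simp add: laurent_simps)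
next
  case (Suc N)
  have "laurent (free_x ^ Suc N) = to_fract [:0, 1:] * laurent (free_x ^ N)"
    unfolding power_Suc laurent_simps ..
  thus ?case unfolding Suc power_Suc to_fract_mult .
qed

text \<open>Modulo h also xy = -c0, so each letter y is used up by one additional factor x on the
  left.\<close>

lemma laurent_reduction:
  assumes J: "tideal J" "kers \<subseteq> J" "fh \<in> J"
  shows "\<exists>N f. free_x ^ N * u - fx.ev f \<in> J"
proof (induction u rule: free_alg_induct)
  case (const c)
  show ?case
    by (rule exI[of _ 0], rule exI[of _ "[:c:]"]) (simp add: fx.ev_const tidealD(1)[OF J(1)])
next
  case (add u v)
  from add(1) obtain N f where f: "free_x ^ N * u - fx.ev f \<in> J" by blast
  from add(2) obtain M g where g: "free_x ^ M * v - fx.ev g \<in> J" by blast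
  have "free_x ^ (N + M) * (u + v) - fx.ev ([:0, 1:] ^ M * f + [:0, 1:] ^ N * g) =
      free_x ^ M * (free_x ^ N * u - fx.ev f) + free_x ^ N * (free_x ^ M * v - fx.ev g)"
  proof -
    have "free_x ^ (N + M) * u = free_x ^ M * (free_x ^ N * u)" for u :: "'k free_alg"
      by (simp add: power_add[symmetric] mult.assoc[symmetric] add.commute)
    moreover have "free_x ^ (N + M) * u = free_x ^ N * (free_x ^ M * u)" for u :: "'k free_alg"
      by (simp add: power_add mult.assoc)
    ultimately show ?thesis
      unfolding distrib_left right_diff_distrib fx.ev_add fx.ev_mult fx.ev_power fx.ev_X by simp
  qed
  also have "\<dots> \<in> J"
    by (rule tidealD(2)[OF J(1) tidealD(3)[OF J(1) f] tidealD(3)[OF J(1) g]])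
  finally show ?case by blast
next
  case (x u)
  then obtain N f where f: "free_x ^ N * u - fx.ev f \<in> J" by blast
  have "free_x ^ N * (free_x * u) - fx.ev ([:0, 1:] * f) = free_x * (free_x ^ N * u - fx.ev f)"
    unfolding fx.ev_mult fx.ev_X right_diff_distrib mult.assoc[symmetric] power_commutes ..
  also have "\<dots> \<in> J" by (rule tidealD(3)[OF J(1) f])
  finally show ?case by blast
next
  case (y u)
  then obtain N f where f: "free_x ^ N * u - fx.ev f \<in> J" by blast
  \<comment> \<open>By 1 + c0 = q c0 the relation takes the form xy + c0 = q h.\<close>
  have "rep q (free_x * free_y + free_const c0 - free_const q * fh) = 0"
  proof -
    have "scal q * scal c0 = 1 + scal c0"
      unfolding scal.C_mult[symmetric] c0(2)[symmetric] scal.C_add scal.C_1 ..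
    thus ?thesis by (simp add: rep_simps rep_fh XY oh_def distrib_left mult.assoc)
  qed
  hence "free_x * free_y + free_const c0 - free_const q * fh \<in> J" using J(2) by blast
  from tidealD(2)[OF J(1) this tidealD(3)[OF J(1,3), of "free_const q"]]
  have xy: "free_x * free_y + free_const c0 \<in> J" by simp
  have "free_x ^ Suc N * (free_y * u) - fx.ev (Polynomial.smult (- c0) f) =
    free_x ^ N * (free_x * free_y + free_const c0) * u - free_const c0 * (free_x ^ N * u - fx.ev f)"
    unfolding fx.ev_smult
    by (simp add: distrib_left distrib_right right_diff_distrib mult.assoc free.C_uminus free.C_left_commute[of "free_x ^ N"]
        power_Suc2 del: power_Suc)
  also have "\<dots> \<in> J"
    by (rule tidealD(6)[OF J(1) tidealD(4)[OF J(1) tidealD(3)[OF J(1) xy]] tidealD(3)[OF J(1) f]])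
  finally show ?case by blast
qed

text \<open>Modulo \<open>J\<close> the element x has the left inverse -y/c0, because yx + c0 = h
  lies in \<open>J\<close>.\<close>

lemma x_cancel:
  assumes J: "tideal J" "kers \<subseteq> J" "fh \<in> J"
  shows "free_x ^ N * u \<in> J \<Longrightarrow> u \<in> J"
proof (induction N)
  case (Suc N)
  let ?v = "free_x ^ N * u"
  have "free_y * (free_x ^ Suc N * u) - fh * ?v \<in> J"
    by (rule tidealD(6)[OF J(1) tidealD(3)[OF J(1) Suc.prems] tidealD(4)[OF J(1,3)]])
  moreover have "free_y * (free_x ^ Suc N * u) - fh * ?v = free_const (- c0) * ?v"
    by (simp add: fh_def distrib_right mult.assoc free.C_uminus)
  ultimately have "?v \<in> J"
    using tideal_const_cancel[OF J(1), of "- c0" ?v] c0(1) by simp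
  thus ?case by (rule Suc.IH)
qed simp

lemma laurent_ker_minimal:
  assumes J: "tideal J" "kers \<subseteq> J" "fh \<in> J" and u: "laurent u = 0"
  shows "u \<in> J"
proof -
  \<comment> \<open>The reduction takes place in the intersection with the kernel, so that the same
    remainder f has image 0 in K(x) and therefore vanishes.\<close>
  let ?J = "J \<inter> {u. laurent u = 0}"
  have J': "tideal ?J" using J(1) tideal_laurent unfolding tideal_def by blast
  moreover have "kers \<subseteq> ?J" using J(2) kers_laurent by blast
  moreover have "fh \<in> ?J" using J(3) laurent_fh by simp
  ultimately obtain N f where f: "free_x ^ N * u - fx.ev f \<in> ?J"
    using laurent_reduction by blast
  hence "to_fract f = 0" using u by (simp add: laurent_simps laurent_ev)
  hence "f = 0" by (simp add: to_fract_eq_0_iff)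
  hence "free_x ^ N * u \<in> J" using f by (simp add: fx.ev_0)
  thus ?thesis by (rule x_cancel[OF J])
qed

lemma cprime_laurent: "cprime {u. laurent u = 0}"
  using tideal_laurent by (simp add: cprime_def laurent_simps)

lemma laurent_poly: "\<exists>N f. to_fract ([:0, 1:] ^ N) * laurent u = to_fract f"
proof -
  obtain N f where "free_x ^ N * u - fx.ev f \<in> {u. laurent u = 0}"
    using laurent_reduction[OF tideal_laurent kers_laurent] laurent_fh by blast
  hence "laurent (free_x ^ N) * laurent u = to_fract f"
    by (simp add: laurent_simps(4-11) laurent_ev)
  thus ?thesis unfolding laurent_X by blast
qed

text \<open>The preimage of the ideal generated by f in K[x, 1/x], with the denominators x^N
  cleared.\<close>

definition point_ideal :: "'k poly \<Rightarrow> 'k free_alg set" where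
  "point_ideal f = {u. \<exists>N g. to_fract ([:0, 1:] ^ N) * laurent u = to_fract (f * g)}"

text \<open>By degrees, a monic polynomial of positive degree that divides x is x itself. The second
  part keeps f from becoming a unit in K[x, 1/x].\<close>

lemma Irr_m_facts:
  assumes f: "f \<in> Irr_m - {[:0, 1 :: 'k:]}"
  shows "prime_elem f" "\<not> f dvd [:0, 1:] ^ N"
proof -
  have irr: "Factorial_Ring.irreducible f" and lc: "Polynomial.lead_coeff f = 1" and ne: "f \<noteq> [:0, 1:]"
    using f by (auto simp: Irr_m_def)
  show pr: "prime_elem f" using irr by (rule field_poly_irreducible_imp_prime)
  have deg: "Polynomial.degree f > 0"
  proof (rule ccontr)
    assume "\<not> ?thesis"
    hence "f = [:1:]" using lc by (metis Polynomial.degree_0_id coeff_pCons_0 degree_eq_zeroE gr0I)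
    thus False using irr by (simp add: one_pCons[symmetric])
  qed
  have "\<not> f dvd [:0, 1:]"
  proof
    assume "f dvd [:0, 1:]"
    then obtain g where g: "[:0, 1:] = f * g" by (rule dvdE)
    have nz: "f \<noteq> 0" "g \<noteq> 0" using g by auto
    have "Polynomial.degree f + Polynomial.degree g = 1"
      using Polynomial.degree_mult_eq[OF nz] g by (metis degree_pCons_eq_if one_neq_zero One_nat_def pCons_eq_0_iff degree_pCons_0)
    hence "Polynomial.degree g = 0" using deg by simp
    then obtain c where c: "g = [:c:]" by (rule degree_eq_zeroE)
    have "Polynomial.lead_coeff [:0, 1 :: 'k:] = Polynomial.lead_coeff f * Polynomial.lead_coeff g"
      unfolding g by (rule Polynomial.lead_coeff_mult)
    hence "c = 1" using lc c by simp
    thus False using g ne c by simp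
  qed
  thus "\<not> f dvd [:0, 1:] ^ N"
    using prime_elem_dvd_power[OF pr] by blast
qed

lemma point_ideal_facts:
  assumes f: "f \<in> Irr_m - {[:0, 1:]}"
  shows "cprime (point_ideal f)" "{u. laurent u = 0} \<subseteq> point_ideal f" "fx.ev f \<in> point_ideal f"
    "\<And>J. tideal J \<Longrightarrow> kers \<subseteq> J \<Longrightarrow> fh \<in> J \<Longrightarrow> fx.ev f \<in> J \<Longrightarrow> point_ideal f \<subseteq> J"
proof -
  let ?X = "[:0, 1 :: 'k:]"
  note pr = Irr_m_facts[OF f]
  have cancel: "f dvd g" if "?X ^ N * g = ?X ^ M * (f * k)" for N M g k
  proof -
    have "f dvd ?X ^ N * g" unfolding that by simp
    hence "f dvd ?X ^ N \<or> f dvd g" by (rule prime_elem_dvd_multD[OF pr(1)])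
    thus ?thesis using pr(2)[of N] by simp
  qed
  \<comment> \<open>Divisibility by f can be tested with any denominator x^N, since the prime f does
    not divide a power of x.\<close>
  have mem: "f dvd g" if u: "u \<in> point_ideal f" and g: "to_fract (?X ^ N) * laurent u = to_fract g" for u N g
  proof -
    obtain M k where k: "to_fract (?X ^ M) * laurent u = to_fract (f * k)"
      using u unfolding point_ideal_def by blast
    have "to_fract (?X ^ M * g) = to_fract (?X ^ M) * (to_fract (?X ^ N) * laurent u)"
      unfolding to_fract_mult g ..
    also have "\<dots> = to_fract (?X ^ N) * (to_fract (?X ^ M) * laurent u)" by (rule mult.left_commute)
    also have "\<dots> = to_fract (?X ^ N * (f * k))" unfolding k to_fract_mult ..
    finally have "?X ^ M * g = ?X ^ N * (f * k)" by (simp only: to_fract_eq_iff)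
    thus ?thesis by (rule cancel)
  qed
  have memI: "u \<in> point_ideal f" if eqg: "to_fract (?X ^ N) * laurent u = to_fract g" and dvd: "f dvd g" for u N g
  proof -
    obtain k where "g = f * k" using dvd by (rule dvdE)
    thus ?thesis using eqg unfolding point_ideal_def by blast
  qed
  show ker: "{u. laurent u = 0} \<subseteq> point_ideal f"
    using memI[of 0 _ 0] by auto
  show "fx.ev f \<in> point_ideal f"
    using memI[of 0 "fx.ev f" f] by (simp add: laurent_ev)
  show "cprime (point_ideal f)"
    unfolding cprime_def
  proof (intro conjI allI impI)
    show "tideal (point_ideal f)"
      unfolding tideal_def
    proof (intro conjI ballI allI)
      show "0 \<in> point_ideal f" using ker by (auto simp: laurent_simps)
    next
      fix u v assume u: "u \<in> point_ideal f" and v: "v \<in> point_ideal f"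
      obtain N g where g: "to_fract (?X ^ N) * laurent u = to_fract g" using laurent_poly by blast
      obtain M k where k: "to_fract (?X ^ M) * laurent v = to_fract k" using laurent_poly by blast
      have "to_fract (?X ^ (N + M)) * laurent (u + v) =
         to_fract (?X ^ M) * (to_fract (?X ^ N) * laurent u) + to_fract (?X ^ N) * (to_fract (?X ^ M) * laurent v)"
        unfolding power_add to_fract_mult laurent_simps distrib_left by (simp only: mult_ac)
      also have "\<dots> = to_fract (?X ^ M * g + ?X ^ N * k)"
        unfolding g k to_fract_mult to_fract_add ..
      finally show "u + v \<in> point_ideal f"
        by (rule memI) (use mem[OF u g] mem[OF v k] in simp)
    next
      fix u a assume u: "u \<in> point_ideal f"
      obtain N g where g: "to_fract (?X ^ N) * laurent u = to_fract g" using laurent_poly by blast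
      obtain M k where k: "to_fract (?X ^ M) * laurent a = to_fract k" using laurent_poly by blast
      have eq: "to_fract (?X ^ (N + M)) * (laurent a * laurent u) = to_fract (k * g)"
        unfolding to_fract_mult g[symmetric] k[symmetric] power_add by (simp only: mult_ac)
      show "a * u \<in> point_ideal f"
        by (rule memI[of "N + M" _ "k * g"]) (use eq mem[OF u g] in \<open>simp_all add: laurent_simps\<close>)
      show "u * a \<in> point_ideal f"
        by (rule memI[of "N + M" _ "k * g"]) (use eq mem[OF u g] in \<open>simp_all add: laurent_simps mult.commute\<close>)
    qed
    show "1 \<notin> point_ideal f"
    proof
      assume "1 \<in> point_ideal f"
      from mem[OF this, of 0 1] have "f dvd 1" by (simp add: laurent_simps)
      thus False using pr(1) by (simp add: prime_elem_def)
    qed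
    fix u v assume uv: "u * v \<in> point_ideal f"
    obtain N g where g: "to_fract (?X ^ N) * laurent u = to_fract g" using laurent_poly by blast
    obtain M k where k: "to_fract (?X ^ M) * laurent v = to_fract k" using laurent_poly by blast
    have "to_fract (?X ^ (N + M)) * laurent (u * v) = to_fract (g * k)"
      unfolding to_fract_mult g[symmetric] k[symmetric] power_add laurent_simps by (simp only: mult_ac)
    from mem[OF uv this] have "f dvd g \<or> f dvd k" by (rule prime_elem_dvd_multD[OF pr(1)])
    thus "u \<in> point_ideal f \<or> v \<in> point_ideal f"
      using memI[OF g] memI[OF k] by blast
  qed
  show "point_ideal f \<subseteq> J" if J: "tideal J" "kers \<subseteq> J" "fh \<in> J" and fJ: "fx.ev f \<in> J" for J
  proof
    fix u assume u: "u \<in> point_ideal f"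
    obtain N g where g: "free_x ^ N * u - fx.ev g \<in> {u. laurent u = 0}"
      using laurent_reduction[OF tideal_laurent kers_laurent] laurent_fh by blast
    hence "laurent (free_x ^ N) * laurent u = to_fract g"
      by (simp add: laurent_simps(4-11) laurent_ev)
    hence "f dvd g" unfolding laurent_X by (rule mem[OF u])
    then obtain k where k: "g = f * k" by (rule dvdE)
    have "fx.ev g \<in> J" unfolding k fx.ev_mult by (rule tidealD(4)[OF J(1) fJ])
    moreover have "free_x ^ N * u - fx.ev g \<in> J" using laurent_ker_minimal[OF J] g by blast
    ultimately have "free_x ^ N * u \<in> J" using tidealD(2)[OF J(1)] by fastforce
    thus "u \<in> J" by (rule x_cancel[OF J])
  qed
qed

text \<open>This is the ideal theory of K[x, 1/x]: a polynomial of least degree in a nonzero prime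
  ideal divides all the others, and primality together with the least degree makes it
  irreducible.\<close>

lemma cprime_containing_h:
  assumes P: "cprime P" "kers \<subseteq> P" "fh \<in> P"
  shows "P = {u. laurent u = 0} \<or> (\<exists>f\<in>Irr_m - {[:0, 1:]}. P = point_ideal f)"
proof (cases "P = {u. laurent u = 0}")
  case False
  note tP = cprimeD(1)[OF P(1)]
  have kP: "{u. laurent u = 0} \<subseteq> P" using laurent_ker_minimal[OF tP P(2,3)] by blast
  then obtain u where u: "u \<in> P" "laurent u \<noteq> 0" using False by blast
  have red: "\<exists>N g. to_fract ([:0, 1:] ^ N) * laurent u = to_fract g \<and> fx.ev g \<in> P" if uP: "u \<in> P" for u
  proof -
    obtain N g where g: "free_x ^ N * u - fx.ev g \<in> {u. laurent u = 0}"
      using laurent_reduction[OF tideal_laurent kers_laurent] laurent_fh by blast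
    hence "laurent (free_x ^ N) * laurent u = to_fract g"
      by (simp add: laurent_simps(4-11) laurent_ev)
    moreover have "free_x ^ N * u - fx.ev g \<in> P" using g kP by blast
    hence "free_x ^ N * u - (free_x ^ N * u - fx.ev g) \<in> P"
      by (rule tidealD(6)[OF tP tidealD(3)[OF tP uP]])
    ultimately show ?thesis unfolding laurent_X by auto
  qed
  obtain N g where g: "to_fract ([:0, 1:] ^ N) * laurent u = to_fract g" "fx.ev g \<in> P"
    using red[OF u(1)] by blast
  have "to_fract ([:0, 1:] ^ N) \<noteq> (0 :: 'k poly fract)" by (simp add: to_fract_eq_0_iff)
  hence g0: "g \<noteq> 0" using g(1) u(2) by auto
  define Q where "Q m \<longleftrightarrow> (\<exists>g. g \<noteq> 0 \<and> fx.ev g \<in> P \<and> Polynomial.degree g = m)" for m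
  have "Q (Polynomial.degree g)" using g g0 by (auto simp: Q_def)
  hence "Q (LEAST m. Q m)" by (rule LeastI)
  then obtain k where k: "k \<noteq> 0" "fx.ev k \<in> P" "Polynomial.degree k = (LEAST m. Q m)" by (auto simp: Q_def)
  have least: "Polynomial.degree k \<le> Polynomial.degree g" if "g \<noteq> 0" "fx.ev g \<in> P" for g
    unfolding k(3) using that by (intro Least_le) (auto simp: Q_def)
  define f where "f = Polynomial.smult (inverse (Polynomial.lead_coeff k)) k"
  have f: "f \<noteq> 0" "fx.ev f \<in> P" "Polynomial.lead_coeff f = 1" "Polynomial.degree f = Polynomial.degree k"
    using k(1,2) tidealD(3)[OF tP] by (auto simp: f_def fx.ev_smult)
  have cst: "c = 0" if "fx.ev [:c:] \<in> P" for c
  proof (rule ccontr)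
    assume "c \<noteq> 0"
    hence "1 \<in> P" using tideal_const_cancel[OF tP, of c 1] that by (simp add: fx.ev_const)
    thus False using cprimeD(2)[OF P(1)] by blast
  qed
  have "\<not> is_unit f"
  proof
    assume "is_unit f"
    hence "Polynomial.degree f = 0" by (simp add: is_unit_iff_degree f(1))
    then obtain c where "f = [:c:]" by (rule degree_eq_zeroE)
    thus False using cst[of c] f(1,2) by simp
  qed
  moreover have "is_unit a \<or> is_unit b" if ab: "f = a * b" for a b
  proof -
    have nz: "a \<noteq> 0" "b \<noteq> 0" using ab f(1) by auto
    have deg: "Polynomial.degree f = Polynomial.degree a + Polynomial.degree b"
      unfolding ab by (rule Polynomial.degree_mult_eq[OF nz])
    have "fx.ev a \<in> P \<or> fx.ev b \<in> P"
      using f(2) unfolding ab fx.ev_mult by (rule cprimeD(3)[OF P(1)])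
    hence "Polynomial.degree a = 0 \<or> Polynomial.degree b = 0"
      using least[OF nz(1)] least[OF nz(2)] deg f(4) by linarith
    thus ?thesis using nz by (auto simp: is_unit_iff_degree)
  qed
  ultimately have "Factorial_Ring.irreducible f"
    using f(1) by (auto simp: Factorial_Ring.irreducible_def)
  \<comment> \<open>x is invertible modulo \<open>P\<close>, so it cannot be the generator.\<close>
  moreover have "f \<noteq> [:0, 1:]"
  proof
    assume "f = [:0, 1:]"
    hence "free_x \<in> P" using f(2) by (simp add: fx.ev_X)
    hence "free_x ^ 1 * 1 \<in> P" by simp
    hence "1 \<in> P" by (rule x_cancel[OF tP P(2,3)])
    thus False using cprimeD(2)[OF P(1)] by blast
  qed
  ultimately have fI: "f \<in> Irr_m - {[:0, 1:]}" using f(3) by (simp add: Irr_m_def)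
  have "P \<subseteq> point_ideal f"
  proof
    fix u assume "u \<in> P"
    then obtain N g where g: "to_fract ([:0, 1:] ^ N) * laurent u = to_fract g" "fx.ev g \<in> P"
      using red by blast
    have eq: "g = f * (g div f) + g mod f" by simp
    have "fx.ev (g mod f) = fx.ev g - fx.ev f * fx.ev (g div f)"
      unfolding fx.ev_mult[symmetric] fx.ev_diff[symmetric] by (simp add: minus_mult_div_eq_mod)
    also have "\<dots> \<in> P" by (rule tidealD(6)[OF tP g(2) tidealD(4)[OF tP f(2)]])
    finally have "g mod f = 0"
      using least[of "g mod f"] degree_mod_less'[of f g] f(1,4) by linarith
    hence "g = f * (g div f)" using eq by simp
    hence "to_fract ([:0, 1:] ^ N) * laurent u = to_fract (f * (g div f))" using g(1) by simp
    thus "u \<in> point_ideal f" unfolding point_ideal_def by blast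
  qed
  moreover have "point_ideal f \<subseteq> P" by (rule point_ideal_facts(4)[OF fI tP P(2,3) f(2)])
  ultimately show ?thesis using fI by blast
qed simp

end

section \<open>The field of fractions\<close>

context domain
begin

abbreviation F where "F \<equiv> fraction_field R"

definition nz :: "'a set" where "nz = carrier R - {\<zero>}"

lemma nzD: "b \<in> nz \<Longrightarrow> b \<in> carrier R" "b \<in> nz \<Longrightarrow> b \<noteq> \<zero>"
  by (auto simp: nz_def)

lemma nz_mult: "b \<in> nz \<Longrightarrow> d \<in> nz \<Longrightarrow> b \<otimes> d \<in> nz"
  by (auto simp: nz_def integral_iff)

lemma nz_one: "\<one> \<in> nz"
  by (simp add: nz_def)

lemma fraction_mem: "(c, d) \<in> fraction R a b \<longleftrightarrow>
    a \<in> carrier R \<and> b \<in> nz \<and> c \<in> carrier R \<and> d \<in> nz \<and> a \<otimes> d = c \<otimes> b"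
  by (auto simp: fraction_def frac_rel_def nz_def)

lemma fraction_eq_iff:
  assumes "a \<in> carrier R" "b \<in> nz" "c \<in> carrier R" "d \<in> nz"
  shows "fraction R a b = fraction R c d \<longleftrightarrow> a \<otimes> d = c \<otimes> b"
proof
  assume "fraction R a b = fraction R c d"
  hence "(c, d) \<in> fraction R a b" using assms by (simp add: fraction_mem m_comm nzD)
  thus "a \<otimes> d = c \<otimes> b" by (simp add: fraction_mem)
next
  assume eq: "a \<otimes> d = c \<otimes> b"
  have "a \<otimes> f = e \<otimes> b \<longleftrightarrow> c \<otimes> f = e \<otimes> d" if e: "e \<in> carrier R" and f: "f \<in> nz" for e f
  proof -
    note carr = assms(1,3) nzD(1)[OF assms(2)] nzD(1)[OF assms(4)] e nzD(1)[OF f]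
    have "a \<otimes> f = e \<otimes> b \<longleftrightarrow> d \<otimes> (a \<otimes> f) = d \<otimes> (e \<otimes> b)"
      using carr nzD(2)[OF assms(4)] by (simp add: m_lcancel)
    also have "d \<otimes> (a \<otimes> f) = (a \<otimes> d) \<otimes> f" using carr by (simp add: m_ac)
    also have "\<dots> = b \<otimes> (c \<otimes> f)" unfolding eq using carr by (simp add: m_ac)
    also have "d \<otimes> (e \<otimes> b) = b \<otimes> (e \<otimes> d)" using carr by (simp add: m_ac)
    also have "b \<otimes> (c \<otimes> f) = b \<otimes> (e \<otimes> d) \<longleftrightarrow> c \<otimes> f = e \<otimes> d"
      using carr nzD(2)[OF assms(2)] by (simp add: m_lcancel)
    finally show ?thesis .
  qed
  thus "fraction R a b = fraction R c d" using assms by (auto simp: fraction_mem)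
qed

lemma fraction_closed: "a \<in> carrier R \<Longrightarrow> b \<in> nz \<Longrightarrow> fraction R a b \<in> carrier F"
  by (auto simp: fraction_field_def nz_def)

lemma fractionE:
  assumes "P \<in> carrier F" obtains a b where "a \<in> carrier R" "b \<in> nz" "P = fraction R a b"
  using assms by (auto simp: fraction_field_def nz_def)

text \<open>The product of classes is a union over all pairs of representatives. Every pair yields
  the same class, so the union of these equal sets is that class.\<close>

lemma F_mult:
  assumes "a \<in> carrier R" "b \<in> nz" "c \<in> carrier R" "d \<in> nz"
  shows "fraction R a b \<otimes>\<^bsub>F\<^esub> fraction R c d = fraction R (a \<otimes> c) (b \<otimes> d)"
proof -
  let ?g = "\<lambda>(a, b) (c, d). fraction R (a \<otimes> c) (b \<otimes> d)"
  have const: "?g p r = fraction R (a \<otimes> c) (b \<otimes> d)" if "p \<in> fraction R a b" "r \<in> fraction R c d" for p r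
  proof -
    obtain a' b' c' d' where [simp]: "p = (a', b')" "r = (c', d')" by (cases p, cases r) auto
    have *: "a' \<in> carrier R" "b' \<in> nz" "c' \<in> carrier R" "d' \<in> nz" "a \<otimes> b' = a' \<otimes> b" "c \<otimes> d' = c' \<otimes> d"
      using that by (simp_all add: fraction_mem)
    note carr = assms(1,3) *(1,3) nzD(1)[OF assms(2)] nzD(1)[OF assms(4)] nzD(1)[OF *(2)] nzD(1)[OF *(4)]
    have "(a' \<otimes> c') \<otimes> (b \<otimes> d) = (a' \<otimes> b) \<otimes> (c' \<otimes> d)" using carr by (simp add: m_ac)
    also have "\<dots> = (a \<otimes> c) \<otimes> (b' \<otimes> d')" unfolding *(5)[symmetric] *(6)[symmetric] using carr by (simp add: m_ac)
    finally show ?thesis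
      using carr assms * by (simp add: fraction_eq_iff nz_mult)
  qed
  have ne: "(a, b) \<in> fraction R a b" "(c, d) \<in> fraction R c d"
    using assms by (auto simp: fraction_mem)
  have "fraction R a b \<otimes>\<^bsub>F\<^esub> fraction R c d = (\<Union>p\<in>fraction R a b. \<Union>r\<in>fraction R c d. ?g p r)"
    by (simp add: fraction_field_def case_prod_beta)
  also have "\<dots> = (\<Union>p\<in>fraction R a b. \<Union>r\<in>fraction R c d. fraction R (a \<otimes> c) (b \<otimes> d))"
    using const by (intro SUP_cong refl)
  also have "\<dots> = fraction R (a \<otimes> c) (b \<otimes> d)" using ne by auto
  finally show ?thesis .
qed

lemma F_add:
  assumes "a \<in> carrier R" "b \<in> nz" "c \<in> carrier R" "d \<in> nz"
  shows "fraction R a b \<oplus>\<^bsub>F\<^esub> fraction R c d = fraction R (a \<otimes> d \<oplus> c \<otimes> b) (b \<otimes> d)"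
proof -
  let ?g = "\<lambda>(a, b) (c, d). fraction R (a \<otimes> d \<oplus> c \<otimes> b) (b \<otimes> d)"
  have const: "?g p r = fraction R (a \<otimes> d \<oplus> c \<otimes> b) (b \<otimes> d)" if "p \<in> fraction R a b" "r \<in> fraction R c d" for p r
  proof -
    obtain a' b' c' d' where [simp]: "p = (a', b')" "r = (c', d')" by (cases p, cases r) auto
    have *: "a' \<in> carrier R" "b' \<in> nz" "c' \<in> carrier R" "d' \<in> nz" "a \<otimes> b' = a' \<otimes> b" "c \<otimes> d' = c' \<otimes> d"
      using that by (simp_all add: fraction_mem)
    note carr = assms(1,3) *(1,3) nzD(1)[OF assms(2)] nzD(1)[OF assms(4)] nzD(1)[OF *(2)] nzD(1)[OF *(4)]
    have "(a' \<otimes> d' \<oplus> c' \<otimes> b') \<otimes> (b \<otimes> d) = (a' \<otimes> b) \<otimes> (d' \<otimes> d) \<oplus> (c' \<otimes> d) \<otimes> (b' \<otimes> b)"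
      using carr by algebra
    also have "\<dots> = (a \<otimes> d \<oplus> c \<otimes> b) \<otimes> (b' \<otimes> d')"
      unfolding *(5)[symmetric] *(6)[symmetric] using carr by algebra
    finally show ?thesis
      using carr assms * by (simp add: fraction_eq_iff nz_mult)
  qed
  have ne: "(a, b) \<in> fraction R a b" "(c, d) \<in> fraction R c d"
    using assms by (auto simp: fraction_mem)
  have "fraction R a b \<oplus>\<^bsub>F\<^esub> fraction R c d = (\<Union>p\<in>fraction R a b. \<Union>r\<in>fraction R c d. ?g p r)"
    by (simp add: fraction_field_def case_prod_beta)
  also have "\<dots> = (\<Union>p\<in>fraction R a b. \<Union>r\<in>fraction R c d. fraction R (a \<otimes> d \<oplus> c \<otimes> b) (b \<otimes> d))"
    using const by (intro SUP_cong refl)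
  also have "\<dots> = fraction R (a \<otimes> d \<oplus> c \<otimes> b) (b \<otimes> d)" using ne by auto
  finally show ?thesis .
qed

lemma F_one: "\<one>\<^bsub>F\<^esub> = fraction R \<one> \<one>" and F_zero: "\<zero>\<^bsub>F\<^esub> = fraction R \<zero> \<one>"
  by (simp_all add: fraction_field_def)

lemma fraction_field: "field F"
proof (rule cring.cring_fieldI)
  show "cring F"
  proof (rule cringI)
    show "abelian_group F"
    proof (rule abelian_groupI)
      fix P Q assume PQ: "P \<in> carrier F" "Q \<in> carrier F"
      obtain a b where 1: "a \<in> carrier R" "b \<in> nz" "P = fraction R a b" using PQ(1) by (rule fractionE)
      obtain c d where 2: "c \<in> carrier R" "d \<in> nz" "Q = fraction R c d" using PQ(2) by (rule fractionE)
      note * = 1 2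
      note carr = *(1,4) nzD(1)[OF *(2)] nzD(1)[OF *(5)]
      show "P \<oplus>\<^bsub>F\<^esub> Q \<in> carrier F" using * carr by (simp add: F_add fraction_closed nz_mult)
      show "P \<oplus>\<^bsub>F\<^esub> Q = Q \<oplus>\<^bsub>F\<^esub> P" using * carr by (simp add: F_add a_comm m_comm)
    next
      fix P Q T assume PQ: "P \<in> carrier F" "Q \<in> carrier F" "T \<in> carrier F"
      obtain a b where 1: "a \<in> carrier R" "b \<in> nz" "P = fraction R a b" using PQ(1) by (rule fractionE)
      obtain c d where 2: "c \<in> carrier R" "d \<in> nz" "Q = fraction R c d" using PQ(2) by (rule fractionE)
      obtain e f where 3: "e \<in> carrier R" "f \<in> nz" "T = fraction R e f" using PQ(3) by (rule fractionE)
      note * = 1 2 3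
      note carr = *(1,4,7) nzD(1)[OF *(2)] nzD(1)[OF *(5)] nzD(1)[OF *(8)]
      show "P \<oplus>\<^bsub>F\<^esub> Q \<oplus>\<^bsub>F\<^esub> T = P \<oplus>\<^bsub>F\<^esub> (Q \<oplus>\<^bsub>F\<^esub> T)"
      proof -
        have "(a \<otimes> d \<oplus> c \<otimes> b) \<otimes> f \<oplus> e \<otimes> (b \<otimes> d) = a \<otimes> (d \<otimes> f) \<oplus> (c \<otimes> f \<oplus> e \<otimes> d) \<otimes> b"
          using carr by algebra
        moreover have "b \<otimes> d \<otimes> f = b \<otimes> (d \<otimes> f)" using carr by (simp add: m_assoc)
        moreover have "P \<oplus>\<^bsub>F\<^esub> Q \<oplus>\<^bsub>F\<^esub> T = fraction R ((a \<otimes> d \<oplus> c \<otimes> b) \<otimes> f \<oplus> e \<otimes> (b \<otimes> d)) (b \<otimes> d \<otimes> f)"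
          using * carr by (simp add: F_add nz_mult)
        moreover have "P \<oplus>\<^bsub>F\<^esub> (Q \<oplus>\<^bsub>F\<^esub> T) = fraction R (a \<otimes> (d \<otimes> f) \<oplus> (c \<otimes> f \<oplus> e \<otimes> d) \<otimes> b) (b \<otimes> (d \<otimes> f))"
          using * carr by (simp add: F_add nz_mult)
        ultimately show ?thesis by metis
      qed
    next
      fix P assume "P \<in> carrier F"
      then obtain a b where *: "a \<in> carrier R" "b \<in> nz" "P = fraction R a b" by (rule fractionE)
      note carr = *(1) nzD(1)[OF *(2)]
      show "\<zero>\<^bsub>F\<^esub> \<oplus>\<^bsub>F\<^esub> P = P" using * carr by (simp add: F_add F_zero nz_one)
      have "fraction R (\<ominus> a) b \<oplus>\<^bsub>F\<^esub> P = \<zero>\<^bsub>F\<^esub>"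
        using * carr by (simp add: F_add F_zero fraction_eq_iff nz_one nz_mult l_minus l_neg)
      thus "\<exists>Q\<in>carrier F. Q \<oplus>\<^bsub>F\<^esub> P = \<zero>\<^bsub>F\<^esub>"
        using * by (intro bexI[of _ "fraction R (\<ominus> a) b"]) (simp_all add: fraction_closed)
    qed (simp add: F_zero fraction_closed nz_one)
    show "Group.comm_monoid F"
    proof (rule comm_monoidI)
      fix P Q assume PQ: "P \<in> carrier F" "Q \<in> carrier F"
      obtain a b where 1: "a \<in> carrier R" "b \<in> nz" "P = fraction R a b" using PQ(1) by (rule fractionE)
      obtain c d where 2: "c \<in> carrier R" "d \<in> nz" "Q = fraction R c d" using PQ(2) by (rule fractionE)
      note * = 1 2
      note carr = *(1,4) nzD(1)[OF *(2)] nzD(1)[OF *(5)]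
      show "P \<otimes>\<^bsub>F\<^esub> Q \<in> carrier F" using * carr by (simp add: F_mult fraction_closed nz_mult)
      show "P \<otimes>\<^bsub>F\<^esub> Q = Q \<otimes>\<^bsub>F\<^esub> P" using * carr by (simp add: F_mult m_comm)
    next
      fix P Q T assume PQ: "P \<in> carrier F" "Q \<in> carrier F" "T \<in> carrier F"
      obtain a b where 1: "a \<in> carrier R" "b \<in> nz" "P = fraction R a b" using PQ(1) by (rule fractionE)
      obtain c d where 2: "c \<in> carrier R" "d \<in> nz" "Q = fraction R c d" using PQ(2) by (rule fractionE)
      obtain e f where 3: "e \<in> carrier R" "f \<in> nz" "T = fraction R e f" using PQ(3) by (rule fractionE)
      note * = 1 2 3
      note carr = *(1,4,7) nzD(1)[OF *(2)] nzD(1)[OF *(5)] nzD(1)[OF *(8)]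
      show "P \<otimes>\<^bsub>F\<^esub> Q \<otimes>\<^bsub>F\<^esub> T = P \<otimes>\<^bsub>F\<^esub> (Q \<otimes>\<^bsub>F\<^esub> T)"
        using * carr by (simp add: F_mult nz_mult m_ac)
    next
      fix P assume "P \<in> carrier F"
      then obtain a b where *: "a \<in> carrier R" "b \<in> nz" "P = fraction R a b" by (rule fractionE)
      show "\<one>\<^bsub>F\<^esub> \<otimes>\<^bsub>F\<^esub> P = P" using * nzD(1)[OF *(2)] by (simp add: F_mult F_one nz_one)
    qed (simp add: F_one fraction_closed nz_one)
    fix P Q T assume PQ: "P \<in> carrier F" "Q \<in> carrier F" "T \<in> carrier F"
    obtain a b where 1: "a \<in> carrier R" "b \<in> nz" "P = fraction R a b" using PQ(1) by (rule fractionE)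
    obtain c d where 2: "c \<in> carrier R" "d \<in> nz" "Q = fraction R c d" using PQ(2) by (rule fractionE)
    obtain e f where 3: "e \<in> carrier R" "f \<in> nz" "T = fraction R e f" using PQ(3) by (rule fractionE)
    note * = 1 2 3
    note carr = *(1,4,7) nzD(1)[OF *(2)] nzD(1)[OF *(5)] nzD(1)[OF *(8)]
    show "(P \<oplus>\<^bsub>F\<^esub> Q) \<otimes>\<^bsub>F\<^esub> T = P \<otimes>\<^bsub>F\<^esub> T \<oplus>\<^bsub>F\<^esub> Q \<otimes>\<^bsub>F\<^esub> T"
    proof -
      have L: "(P \<oplus>\<^bsub>F\<^esub> Q) \<otimes>\<^bsub>F\<^esub> T = fraction R ((a \<otimes> d \<oplus> c \<otimes> b) \<otimes> e) (b \<otimes> d \<otimes> f)"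
        using * carr by (simp add: F_add F_mult nz_mult)
      have Rh: "P \<otimes>\<^bsub>F\<^esub> T \<oplus>\<^bsub>F\<^esub> Q \<otimes>\<^bsub>F\<^esub> T = fraction R ((a \<otimes> e) \<otimes> (d \<otimes> f) \<oplus> (c \<otimes> e) \<otimes> (b \<otimes> f)) ((b \<otimes> f) \<otimes> (d \<otimes> f))"
        using * carr by (simp add: F_add F_mult nz_mult)
      have "((a \<otimes> d \<oplus> c \<otimes> b) \<otimes> e) \<otimes> ((b \<otimes> f) \<otimes> (d \<otimes> f)) = ((a \<otimes> e) \<otimes> (d \<otimes> f) \<oplus> (c \<otimes> e) \<otimes> (b \<otimes> f)) \<otimes> (b \<otimes> d \<otimes> f)"
        using carr by algebra
      thus ?thesis unfolding L Rh using * carr by (simp add: fraction_eq_iff nz_mult)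
    qed
  qed
  then interpret F: cring F .
  show "Units F = carrier F - {\<zero>\<^bsub>F\<^esub>}"
  proof (intro equalityI subsetI)
    fix P assume P: "P \<in> Units F"
    have "\<one>\<^bsub>F\<^esub> \<noteq> \<zero>\<^bsub>F\<^esub>" by (simp add: F_one F_zero fraction_eq_iff nz_one)
    thus "P \<in> carrier F - {\<zero>\<^bsub>F\<^esub>}" using P by (auto simp: Units_def)
  next
    fix P assume P: "P \<in> carrier F - {\<zero>\<^bsub>F\<^esub>}"
    hence P': "P \<in> carrier F" by simp
    obtain a b where *: "a \<in> carrier R" "b \<in> nz" "P = fraction R a b" using P' by (rule fractionE)
    have "a \<noteq> \<zero>" using P * nzD(1)[OF *(2)] by (auto simp: F_zero fraction_eq_iff nz_one)
    hence a: "a \<in> nz" using *(1) by (simp add: nz_def)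
    have "P \<otimes>\<^bsub>F\<^esub> fraction R b a = \<one>\<^bsub>F\<^esub>"
      using * a nzD(1)[OF *(2)] by (simp add: F_mult F_one fraction_eq_iff nz_one nz_mult m_comm)
    moreover have "fraction R b a \<in> carrier F" using a nzD(1)[OF *(2)] by (rule fraction_closed[rotated])
    ultimately show "P \<in> Units F" using P' F.m_comm[OF P'] unfolding Units_def by force
  qed
qed

lemma fraction_hom: "(\<lambda>z. fraction R z \<one>) \<in> Ring.ring_hom R F"
  by (rule ring_hom_memI) (auto simp: fraction_closed nz_one F_mult F_add F_one)

lemma fraction_eq_0: "z \<in> carrier R \<Longrightarrow> fraction R z \<one> = \<zero>\<^bsub>F\<^esub> \<longleftrightarrow> z = \<zero>"
  by (simp add: F_zero fraction_eq_iff nz_one)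

lemma fraction_denominator:
  assumes "P \<in> carrier F"
  shows "\<exists>a\<in>carrier R. \<exists>b\<in>carrier R. b \<noteq> \<zero> \<and> P \<otimes>\<^bsub>F\<^esub> fraction R b \<one> = fraction R a \<one>"
proof -
  obtain a b where *: "a \<in> carrier R" "b \<in> nz" "P = fraction R a b" using assms by (rule fractionE)
  have "P \<otimes>\<^bsub>F\<^esub> fraction R b \<one> = fraction R a \<one>"
    using * nzD(1)[OF *(2)] by (simp add: F_mult fraction_eq_iff nz_one)
  thus ?thesis using * nzD[OF *(2)] by blast
qed

end

section \<open>Radical extensions\<close>

lemma (in ring) eval_eq_finsum:
  assumes "set p \<subseteq> carrier R" "a \<in> carrier R"
  shows "eval p a = (\<Oplus>i\<in>{..<length p}. coeff p i \<otimes> a [^] i)"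
  using assms(1)
proof (induction p)
  case Nil
  thus ?case by simp
next
  case (Cons c p)
  have c: "c \<in> carrier R" and p: "set p \<subseteq> carrier R" using Cons.prems by auto
  have "(\<Oplus>i\<in>{..<length p}. coeff (c # p) i \<otimes> a [^] i) = (\<Oplus>i\<in>{..<length p}. coeff p i \<otimes> a [^] i)"
    using p assms(2) by (intro finsum_cong') (auto simp: coeff_in_carrier)
  moreover have "(\<lambda>i. coeff (c # p) i \<otimes> a [^] i) \<in> {..<length p} \<rightarrow> carrier R"
    using p c assms(2) coeff_in_carrier[OF Cons.prems] by auto
  ultimately show ?case
    using Cons.IH[OF p] c p assms(2) by (simp add: lessThan_Suc)
qed

context field
begin

abbreviation PK where "PK \<equiv> (carrier R)[X]"

text \<open>The polynomial of \<open>E_modulus\<close> over an arbitrary field;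
  \<open>E_modulus_eq\<close> makes the link.\<close>

definition radical_poly :: "nat \<Rightarrow> 'a \<Rightarrow> 'a list" where
  "radical_poly n s = (X [^]\<^bsub>PK\<^esub> n) \<ominus>\<^bsub>PK\<^esub> poly_of_const s"

abbreviation rad :: "nat \<Rightarrow> 'a \<Rightarrow> 'a list set ring" where
  "rad n s \<equiv> Rupt (carrier R) (radical_poly n s)"

abbreviation rad_class :: "nat \<Rightarrow> 'a \<Rightarrow> 'a list \<Rightarrow> 'a list set" where
  "rad_class n s \<equiv> rupture_surj (carrier R) (radical_poly n s)"

abbreviation rad_const :: "nat \<Rightarrow> 'a \<Rightarrow> 'a \<Rightarrow> 'a list set" where
  "rad_const n s c \<equiv> rad_class n s (poly_of_const c)"

abbreviation rad_h :: "nat \<Rightarrow> 'a \<Rightarrow> 'a list set" where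
  "rad_h n s \<equiv> rad_class n s X"

lemma PK_domain: "domain PK"
  by (rule univ_poly_is_domain[OF carrier_is_subring])

lemma poly_of_const_hom: "ring_hom_ring R PK poly_of_const"
  using canonical_embedding_ring_hom[OF carrier_is_subring] by simp

context
  fixes n :: nat and s :: 'a
  assumes n: "n > 0" and s: "s \<in> carrier R"
begin

interpretation PK: domain PK by (rule PK_domain)
interpretation pc: ring_hom_ring R PK poly_of_const by (rule poly_of_const_hom)

lemma radical_poly_closed: "radical_poly n s \<in> carrier PK"
  unfolding radical_poly_def using s var_pow_closed[OF carrier_is_subring] by simp

text \<open>Polynomials are lists with the leading coefficient first, so the length is the degree
  plus one; n > 0 keeps the constant term away from the leading one.\<close>

lemma radical_poly_length: "length (radical_poly n s) = Suc n"
proof -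
  let ?c = "\<ominus>\<^bsub>PK\<^esub> poly_of_const s"
  have eq: "radical_poly n s = poly_add (monom \<one> n) ?c"
    unfolding radical_poly_def PK.minus_eq unitary_monom_eq_var_pow[OF carrier_is_subring] univ_poly_add ..
  have "length ?c = length (poly_of_const s)"
    using univ_poly_a_inv_length[OF carrier_is_subring] s by simp
  also have "\<dots> \<le> 1" by (simp add: poly_of_const_def)
  finally have lc: "length ?c \<le> 1" .
  have lm: "length (monom \<one> n) = Suc n" by (simp add: monom_def)
  have c: "polynomial (carrier R) ?c" using s by (simp add: univ_poly_carrier)
  have m: "polynomial (carrier R) (monom \<one> n)" by (rule monom_is_polynomial[OF carrier_is_subring]) simp
  have "length (monom \<one> n) \<noteq> length ?c" using lc lm n by simp
  hence "length (radical_poly n s) = max (length (monom \<one> n)) (length ?c)"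
    unfolding eq by (rule poly_add_length_eq[OF carrier_is_subring m c])
  thus ?thesis using lc lm by simp
qed

lemma rad_hom: "ring_hom_ring PK (rad n s) (rad_class n s)"
  by (rule rupture_surj_hom(2)[OF carrier_is_subring radical_poly_closed])

lemma rad_cring: "cring (rad n s)"
  unfolding rupture_def
  by (rule ideal.quotient_is_cring[OF PK.cgenideal_ideal[OF radical_poly_closed] PK.is_cring])

interpretation E: cring "rad n s" by (rule rad_cring)
interpretation cl: ring_hom_ring PK "rad n s" "rad_class n s" by (rule rad_hom)

lemma rad_class_surj: "e \<in> carrier (rad n s) \<Longrightarrow> \<exists>p\<in>carrier PK. e = rad_class n s p"
  unfolding rupture_def FactRing_def A_RCOSETS_def' by auto

lemma rad_class_eq_0_iff:
  assumes "p \<in> carrier PK"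
  shows "rad_class n s p = \<zero>\<^bsub>rad n s\<^esub> \<longleftrightarrow> (\<exists>q\<in>carrier PK. p = q \<otimes>\<^bsub>PK\<^esub> radical_poly n s)"
proof -
  have I: "ideal (PIdl\<^bsub>PK\<^esub> (radical_poly n s)) PK" by (rule PK.cgenideal_ideal[OF radical_poly_closed])
  have "\<zero>\<^bsub>rad n s\<^esub> = PIdl\<^bsub>PK\<^esub> (radical_poly n s)" unfolding rupture_def FactRing_def by simp
  moreover have "rad_class n s p = PIdl\<^bsub>PK\<^esub> (radical_poly n s) \<longleftrightarrow> p \<in> PIdl\<^bsub>PK\<^esub> (radical_poly n s)"
  proof
    assume "rad_class n s p = PIdl\<^bsub>PK\<^esub> (radical_poly n s)"
    thus "p \<in> PIdl\<^bsub>PK\<^esub> (radical_poly n s)" by (rule ideal.rcos_const_imp_mem[OF I assms])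
  next
    assume "p \<in> PIdl\<^bsub>PK\<^esub> (radical_poly n s)"
    thus "rad_class n s p = PIdl\<^bsub>PK\<^esub> (radical_poly n s)" by (rule PK.a_rcos_zero[OF I])
  qed
  ultimately show ?thesis unfolding cgenideal_def by blast
qed

lemma rad_const_hom: "ring_hom_ring R (rad n s) (rad_const n s)"
proof (rule ring_hom_ringI2[OF ring_axioms E.ring_axioms])
  have "rad_class n s \<circ> poly_of_const \<in> Ring.ring_hom R (rad n s)"
    by (rule ring_hom_trans[OF pc.homh cl.homh])
  thus "(\<lambda>c. rad_const n s c) \<in> Ring.ring_hom R (rad n s)" unfolding comp_def .
qed

interpretation C: ring_hom_ring R "rad n s" "rad_const n s" by (rule rad_const_hom)

lemma X_closed: "X \<in> carrier PK"
  by (rule var_closed(1)[OF carrier_is_subring])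

lemma rad_h_closed: "rad_h n s \<in> carrier (rad n s)"
  using X_closed by simp

lemma rad_h_pow: "rad_h n s [^]\<^bsub>rad n s\<^esub> n = rad_const n s s"
proof -
  have Xn: "X [^]\<^bsub>PK\<^esub> n \<in> carrier PK" using X_closed by simp
  have "rad_class n s (radical_poly n s) = \<zero>\<^bsub>rad n s\<^esub>"
    unfolding rad_class_eq_0_iff[OF radical_poly_closed]
    by (rule bexI[of _ "\<one>\<^bsub>PK\<^esub>"]) (simp_all add: radical_poly_closed)
  moreover have "rad_class n s (radical_poly n s) = rad_class n s ((X [^]\<^bsub>PK\<^esub> n) \<ominus>\<^bsub>PK\<^esub> poly_of_const s)"
    by (rule arg_cong[OF radical_poly_def])
  moreover have "\<dots> = rad_class n s (X [^]\<^bsub>PK\<^esub> n) \<ominus>\<^bsub>rad n s\<^esub> rad_const n s s"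
    using Xn s unfolding PK.minus_eq E.minus_eq by simp
  ultimately have "rad_class n s (X [^]\<^bsub>PK\<^esub> n) \<ominus>\<^bsub>rad n s\<^esub> rad_const n s s = \<zero>\<^bsub>rad n s\<^esub>" by metis
  hence "rad_class n s (X [^]\<^bsub>PK\<^esub> n) = rad_const n s s"
    using E.r_right_minus_eq[OF cl.hom_closed[OF Xn] C.hom_closed[OF s]] by blast
  thus ?thesis using cl.hom_nat_pow[OF X_closed] by metis
qed

lemma rad_class_eval:
  assumes "p \<in> carrier PK"
  shows "rad_class n s p = E.eval (map (rad_const n s) p) (rad_h n s)"
proof -
  have p: "set p \<subseteq> carrier R"
    using assms by (auto simp: univ_poly_carrier[symmetric] polynomial_def)
  have "rad_class n s p = rad_class n s (PK.eval (map poly_of_const p) X)"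
    using eval_rewrite[OF carrier_is_subring assms] by simp
  also have "\<dots> = E.eval (map (rad_class n s) (map poly_of_const p)) (rad_h n s)"
    using p by (intro cl.eval_hom'[OF X_closed]) auto
  finally show ?thesis by (simp add: comp_def)
qed

lemma rad_class_sum:
  assumes "p \<in> carrier PK" "length p \<le> n"
  shows "rad_class n s p = (\<Oplus>\<^bsub>rad n s\<^esub>i\<in>{..<n}. rad_const n s (coeff p i) \<otimes>\<^bsub>rad n s\<^esub> rad_h n s [^]\<^bsub>rad n s\<^esub> i)"
proof -
  have p: "set p \<subseteq> carrier R"
    using assms by (auto simp: univ_poly_carrier[symmetric] polynomial_def)
  have "rad_class n s p = (\<Oplus>\<^bsub>rad n s\<^esub>i\<in>{..<length p}. E.coeff (map (rad_const n s) p) i \<otimes>\<^bsub>rad n s\<^esub> rad_h n s [^]\<^bsub>rad n s\<^esub> i)"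
    unfolding rad_class_eval[OF assms(1)] using p rad_h_closed
    by (subst E.eval_eq_finsum) (auto simp del: cl.hom_closed)
  also have "\<dots> = (\<Oplus>\<^bsub>rad n s\<^esub>i\<in>{..<length p}. rad_const n s (coeff p i) \<otimes>\<^bsub>rad n s\<^esub> rad_h n s [^]\<^bsub>rad n s\<^esub> i)"
    unfolding C.coeff_hom'[OF p, symmetric] ..
  also have "\<dots> = (\<Oplus>\<^bsub>rad n s\<^esub>i\<in>{..<n}. rad_const n s (coeff p i) \<otimes>\<^bsub>rad n s\<^esub> rad_h n s [^]\<^bsub>rad n s\<^esub> i)"
  proof (rule E.add.finprod_mono_neutral_cong_left)
    show "rad_const n s (coeff p i) \<otimes>\<^bsub>rad n s\<^esub> rad_h n s [^]\<^bsub>rad n s\<^esub> i = \<zero>\<^bsub>rad n s\<^esub>"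
      if "i \<in> {..<n} - {..<length p}" for i
    proof -
      have "coeff p i = \<zero>" using that by (intro coeff_length) auto
      thus ?thesis using C.hom_zero E.nat_pow_closed[OF rad_h_closed] by simp
    qed
  qed (use assms(2) coeff_in_carrier[OF p] C.hom_closed E.nat_pow_closed[OF rad_h_closed] in auto)
  finally show ?thesis .
qed

text \<open>The coefficients are those of the remainder on division by X^n - s.\<close>

lemma rad_expansion:
  assumes "e \<in> carrier (rad n s)"
  shows "\<exists>c. (\<forall>i. c i \<in> carrier R) \<and>
    e = (\<Oplus>\<^bsub>rad n s\<^esub>i\<in>{..<n}. rad_const n s (c i) \<otimes>\<^bsub>rad n s\<^esub> rad_h n s [^]\<^bsub>rad n s\<^esub> i)"
proof -
  obtain p where p: "p \<in> carrier PK" "e = rad_class n s p" using rad_class_surj[OF assms] by blast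
  have "radical_poly n s \<noteq> \<zero>\<^bsub>PK\<^esub>" using radical_poly_length by (auto simp: univ_poly_zero)
  then obtain b r where br: "b \<in> carrier PK" "r \<in> carrier PK" "p = (radical_poly n s \<otimes>\<^bsub>PK\<^esub> b) \<oplus>\<^bsub>PK\<^esub> r"
    "r = [] \<or> length r - 1 < length (radical_poly n s) - 1"
    using field_long_division_theorem_shell[OF carrier_is_subfield p(1) radical_poly_closed]
    by (auto simp: univ_poly_zero)
  have "length r \<le> n" using br(4) radical_poly_length by auto
  moreover have "rad_class n s p = rad_class n s r"
  proof -
    have m0: "rad_class n s (radical_poly n s \<otimes>\<^bsub>PK\<^esub> b) = \<zero>\<^bsub>rad n s\<^esub>"
      using br(1) radical_poly_closed rad_class_eq_0_iff[of "radical_poly n s \<otimes>\<^bsub>PK\<^esub> b"] by (auto simp: PK.m_comm)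
    have "rad_class n s p = rad_class n s (radical_poly n s \<otimes>\<^bsub>PK\<^esub> b) \<oplus>\<^bsub>rad n s\<^esub> rad_class n s r"
      unfolding br(3) using br radical_poly_closed by (intro cl.hom_add) auto
    thus ?thesis using m0 cl.hom_closed[OF br(2)] by simp
  qed
  moreover have "set r \<subseteq> carrier R"
    using br(2) by (auto simp: univ_poly_carrier[symmetric] polynomial_def)
  ultimately show ?thesis
    using rad_class_sum[OF br(2)] p(2) coeff_in_carrier by (intro exI[of _ "coeff r"]) auto
qed

text \<open>A vanishing combination comes from a polynomial of degree below n that is divisible by
  X^n - s, and such a polynomial is zero.\<close>

lemma rad_independent:
  assumes c: "\<And>i. i < n \<Longrightarrow> c i \<in> carrier R"
    and z: "(\<Oplus>\<^bsub>rad n s\<^esub>i\<in>{..<n}. rad_const n s (c i) \<otimes>\<^bsub>rad n s\<^esub> rad_h n s [^]\<^bsub>rad n s\<^esub> i) = \<zero>\<^bsub>rad n s\<^esub>"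
    and i: "i < n"
  shows "c i = \<zero>"
proof -
  \<comment> \<open>Reversed because lists begin with the leading coefficient;
    \<open>normalize\<close> then drops leading zeros.\<close>
  define l where "l = map c (rev [0..<n])"
  define p where "p = normalize l"
  have l: "set l \<subseteq> carrier R" using c by (auto simp: l_def)
  have p: "p \<in> carrier PK"
    unfolding p_def univ_poly_carrier[symmetric] by (rule normalize_gives_polynomial[OF l])
  have lp: "length p \<le> n" unfolding p_def using normalize_length_le[of l] by (simp add: l_def)
  have cf: "coeff p j = c j" if "j < n" for j
    unfolding p_def normalize_coeff[of l, symmetric] using that
    by (subst coeff_nth) (auto simp: l_def rev_nth)
  have "rad_class n s p = (\<Oplus>\<^bsub>rad n s\<^esub>i\<in>{..<n}. rad_const n s (c i) \<otimes>\<^bsub>rad n s\<^esub> rad_h n s [^]\<^bsub>rad n s\<^esub> i)"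
    unfolding rad_class_sum[OF p lp] using cf c E.nat_pow_closed[OF rad_h_closed] C.hom_closed
    by (intro E.finsum_cong') auto
  hence "rad_class n s p = \<zero>\<^bsub>rad n s\<^esub>" using z by simp
  then obtain b where b: "b \<in> carrier PK" "p = b \<otimes>\<^bsub>PK\<^esub> radical_poly n s"
    using rad_class_eq_0_iff[OF p] by blast
  have "p = []"
  proof (rule ccontr)
    assume ne: "p \<noteq> []"
    have bne: "b \<noteq> []"
    proof
      assume "b = []"
      hence "b = \<zero>\<^bsub>PK\<^esub>" by (simp add: univ_poly_zero)
      hence "p = \<zero>\<^bsub>PK\<^esub>" using b radical_poly_closed by simp
      thus False using ne by (simp add: univ_poly_zero)
    qed
    have "length p - 1 = (length b - 1) + (length (radical_poly n s) - 1)"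
      unfolding b(2) univ_poly_mult
      using poly_mult_degree_eq[OF carrier_is_subring, of b "radical_poly n s"] b(1) radical_poly_closed bne radical_poly_length
      by (auto simp: univ_poly_carrier)
    hence "length p - 1 \<ge> n" using radical_poly_length by simp
    thus False using lp ne n by (cases p) auto
  qed
  thus ?thesis using cf[OF i] by simp
qed

text \<open>If the quotient is a domain then X^n - s is a prime element, and in the principal ideal
  domain K[X] a nonzero prime generates a maximal ideal.\<close>

lemma rad_field:
  assumes "domain (rad n s)"
  shows "field (rad n s)"
proof -
  interpret D: domain "rad n s" by fact
  interpret P: principal_domain PK by (rule univ_poly_is_principal[OF carrier_is_subfield])
  have m0: "radical_poly n s \<noteq> \<zero>\<^bsub>PK\<^esub>" using radical_poly_length by (auto simp: univ_poly_zero)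
  have dvd: "radical_poly n s divides\<^bsub>PK\<^esub> p \<longleftrightarrow> rad_class n s p = \<zero>\<^bsub>rad n s\<^esub>" if "p \<in> carrier PK" for p
    unfolding rad_class_eq_0_iff[OF that] factor_def using radical_poly_closed by (auto simp: PK.m_comm)
  have "Divisibility.prime PK (radical_poly n s)"
  proof (rule Divisibility.primeI)
    show "radical_poly n s \<notin> Units PK"
    proof
      assume "radical_poly n s \<in> Units PK"
      hence "radical_poly n s divides\<^bsub>PK\<^esub> \<one>\<^bsub>PK\<^esub>" using PK.unit_divides[OF _ PK.one_closed] by blast
      thus False using dvd[OF PK.one_closed] by simp
    qed
    fix a b assume a: "a \<in> carrier PK" and b: "b \<in> carrier PK" and "radical_poly n s divides\<^bsub>PK\<^esub> (a \<otimes>\<^bsub>PK\<^esub> b)"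
    hence "rad_class n s a \<otimes>\<^bsub>rad n s\<^esub> rad_class n s b = \<zero>\<^bsub>rad n s\<^esub>"
      using dvd[OF PK.m_closed[OF a b]] by simp
    thus "radical_poly n s divides\<^bsub>PK\<^esub> a \<or> radical_poly n s divides\<^bsub>PK\<^esub> b"
      using D.integral cl.hom_closed[OF a] cl.hom_closed[OF b] dvd[OF a] dvd[OF b] by blast
  qed
  hence "ring_prime\<^bsub>PK\<^esub> (radical_poly n s)"
    using m0 unfolding ring_prime_def by blast
  moreover have "radical_poly n s \<in> carrier PK - {\<zero>\<^bsub>PK\<^esub>}" using radical_poly_closed m0 by blast
  ultimately show ?thesis
    unfolding rupture_def using P.field_iff_prime by blast
qed

text \<open>Every element is a polynomial in h with constant coefficients. The lemma is applied to
  \<theta>^n, which fixes h because the multiplier w satisfies w^n = 1.\<close>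

lemma rad_hom_unique:
  assumes t: "\<theta> \<in> Ring.ring_hom (rad n s) (rad n s)"
    and c: "\<And>c. c \<in> carrier R \<Longrightarrow> \<theta> (rad_const n s c) = rad_const n s c"
    and h: "\<theta> (rad_h n s) = rad_h n s" and e: "e \<in> carrier (rad n s)"
  shows "\<theta> e = e"
proof -
  interpret T: ring_hom_ring "rad n s" "rad n s" \<theta>
    by (rule ring_hom_ringI2[OF E.ring_axioms E.ring_axioms t])
  obtain p where p: "p \<in> carrier PK" "e = rad_class n s p" using rad_class_surj[OF e] by blast
  have sp: "set p \<subseteq> carrier R" using p(1) by (auto simp: univ_poly_carrier[symmetric] polynomial_def)
  have eq: "e = E.eval (map (rad_const n s) p) (rad_h n s)" unfolding p(2) by (rule rad_class_eval[OF p(1)])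
  have "set (map (rad_const n s) p) \<subseteq> carrier (rad n s)" using sp C.hom_closed by auto
  hence "\<theta> e = E.eval (map \<theta> (map (rad_const n s) p)) (\<theta> (rad_h n s))"
    unfolding eq by (intro T.eval_hom'[OF rad_h_closed])
  also have "map \<theta> (map (rad_const n s) p) = map (rad_const n s) p"
    using sp c by (auto simp: map_eq_conv subset_iff)
  finally show ?thesis unfolding h eq .
qed

lemma rad_hom_pow_h:
  assumes t: "\<theta> \<in> Ring.ring_hom (rad n s) (rad n s)"
    and c: "\<And>c. c \<in> carrier R \<Longrightarrow> \<theta> (rad_const n s c) = rad_const n s c"
    and w: "w \<in> carrier R" and h: "\<theta> (rad_h n s) = rad_const n s w \<otimes>\<^bsub>rad n s\<^esub> rad_h n s"
  shows "(\<theta> ^^ m) (rad_h n s) = rad_const n s (w [^] m) \<otimes>\<^bsub>rad n s\<^esub> rad_h n s"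
proof (induction m)
  case 0
  show ?case using C.hom_one E.l_one[OF rad_h_closed] by simp
next
  case (Suc m)
  have wm: "w [^] m \<in> carrier R" using w by simp
  have "(\<theta> ^^ Suc m) (rad_h n s) = \<theta> (rad_const n s (w [^] m) \<otimes>\<^bsub>rad n s\<^esub> rad_h n s)" using Suc.IH by simp
  also have "\<dots> = rad_const n s (w [^] m) \<otimes>\<^bsub>rad n s\<^esub> (rad_const n s w \<otimes>\<^bsub>rad n s\<^esub> rad_h n s)"
    unfolding ring_hom_mult[OF t C.hom_closed[OF wm] rad_h_closed] c[OF wm] h ..
  also have "\<dots> = rad_const n s (w [^] Suc m) \<otimes>\<^bsub>rad n s\<^esub> rad_h n s"
    using E.m_assoc[OF C.hom_closed[OF wm] C.hom_closed[OF w] rad_h_closed] C.hom_mult[OF wm w] by (metis nat_pow_Suc)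
  finally show ?case .
qed

lemma rad_hom_order:
  assumes t: "\<theta> \<in> Ring.ring_hom (rad n s) (rad n s)"
    and c: "\<And>c. c \<in> carrier R \<Longrightarrow> \<theta> (rad_const n s c) = rad_const n s c"
    and w: "w \<in> carrier R" "w [^] n = \<one>" and h: "\<theta> (rad_h n s) = rad_const n s w \<otimes>\<^bsub>rad n s\<^esub> rad_h n s"
    and e: "e \<in> carrier (rad n s)"
  shows "(\<theta> ^^ n) e = e"
proof (rule rad_hom_unique[OF E.hom_pow[OF t] _ _ e])
  fix b assume b: "b \<in> carrier R"
  have "(\<theta> ^^ k) (rad_const n s b) = rad_const n s b" for k by (induction k) (simp_all add: c[OF b])
  thus "(\<theta> ^^ n) (rad_const n s b) = rad_const n s b" .
next
  have "(\<theta> ^^ n) (rad_h n s) = rad_const n s (w [^] n) \<otimes>\<^bsub>rad n s\<^esub> rad_h n s" by (rule rad_hom_pow_h[OF t c w(1) h])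
  thus "(\<theta> ^^ n) (rad_h n s) = rad_h n s"
    unfolding w(2) C.hom_one E.l_one[OF rad_h_closed] .
qed

text \<open>As w^n = 1, substituting w h for X kills X^n - s, so the substitution descends to the
  quotient. The inverse of the resulting map is its power with exponent n - 1.\<close>

lemma rad_automorphism:
  assumes w: "w \<in> carrier R" "w [^] n = \<one>"
  shows "\<exists>\<theta>. \<theta> \<in> ring_iso (rad n s) (rad n s) \<and> (\<forall>c\<in>carrier R. \<theta> (rad_const n s c) = rad_const n s c)
    \<and> \<theta> (rad_h n s) = rad_const n s w \<otimes>\<^bsub>rad n s\<^esub> rad_h n s"
proof -
  define g where "g = rad_const n s w \<otimes>\<^bsub>rad n s\<^esub> rad_h n s"
  have g: "g \<in> carrier (rad n s)" unfolding g_def by (rule E.m_closed[OF C.hom_closed[OF w(1)] rad_h_closed])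
  define psi where "psi p = E.eval (map (rad_const n s) p) g" for p
  have sp: "set p \<subseteq> carrier R" if "p \<in> carrier PK" for p
    using that by (auto simp: univ_poly_carrier[symmetric] polynomial_def)
  have smp: "set (map (rad_const n s) p) \<subseteq> carrier (rad n s)" if "p \<in> carrier PK" for p
    using sp[OF that] C.hom_closed by auto
  have norm: "E.eval (E.normalize p) g = E.eval p g" if "set p \<subseteq> carrier (rad n s)" for p
    by (rule E.eval_normalize[OF that g])
  have psi: "psi \<in> Ring.ring_hom PK (rad n s)"
  proof (rule ring_hom_memI)
    fix p assume p: "p \<in> carrier PK"
    show "psi p \<in> carrier (rad n s)" unfolding psi_def by (rule E.eval_in_carrier[OF smp[OF p] g])
    fix p' assume p': "p' \<in> carrier PK"
    have "psi (p \<oplus>\<^bsub>PK\<^esub> p') = E.eval (E.normalize (map (rad_const n s) (poly_add p p'))) g"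
      unfolding psi_def univ_poly_add using norm smp[OF PK.a_closed[OF p p'], unfolded univ_poly_add] by simp
    also have "\<dots> = psi p \<oplus>\<^bsub>rad n s\<^esub> psi p'"
      unfolding psi_def C.poly_add_hom'[OF sp[OF p] sp[OF p']] by (rule E.eval_poly_add[OF smp[OF p] smp[OF p'] g])
    finally show "psi (p \<oplus>\<^bsub>PK\<^esub> p') = psi p \<oplus>\<^bsub>rad n s\<^esub> psi p'" .
    have "psi (p \<otimes>\<^bsub>PK\<^esub> p') = E.eval (E.normalize (map (rad_const n s) (poly_mult p p'))) g"
      unfolding psi_def univ_poly_mult using norm smp[OF PK.m_closed[OF p p'], unfolded univ_poly_mult] by simp
    also have "\<dots> = psi p \<otimes>\<^bsub>rad n s\<^esub> psi p'"
      unfolding psi_def C.poly_mult_hom'[OF sp[OF p] sp[OF p']] by (rule E.eval_poly_mult[OF smp[OF p] smp[OF p'] g])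
    finally show "psi (p \<otimes>\<^bsub>PK\<^esub> p') = psi p \<otimes>\<^bsub>rad n s\<^esub> psi p'" .
  next
    show "psi \<one>\<^bsub>PK\<^esub> = \<one>\<^bsub>rad n s\<^esub>" unfolding psi_def univ_poly_one using C.hom_one g by simp
  qed
  then interpret psi: ring_hom_ring PK "rad n s" psi
    by (rule ring_hom_ringI2[OF PK.ring_axioms E.ring_axioms])
  have psi_const: "psi (poly_of_const c) = rad_const n s c" if c: "c \<in> carrier R" for c
  proof (cases "c = \<zero>")
    case True
    thus ?thesis unfolding psi_def poly_of_const_def using C.hom_zero[unfolded poly_of_const_def] by simp
  next
    case False
    hence "psi (poly_of_const c) = rad_const n s c \<otimes>\<^bsub>rad n s\<^esub> \<one>\<^bsub>rad n s\<^esub> \<oplus>\<^bsub>rad n s\<^esub> \<zero>\<^bsub>rad n s\<^esub>"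
      unfolding psi_def by (simp add: poly_of_const_def)
    thus ?thesis using C.hom_closed[OF c] E.r_one E.r_zero by metis
  qed
  have psi_X: "psi X = g"
  proof -
    have "psi X = rad_const n s \<one> \<otimes>\<^bsub>rad n s\<^esub> (g [^]\<^bsub>rad n s\<^esub> (1::nat)) \<oplus>\<^bsub>rad n s\<^esub> (rad_const n s \<zero> \<otimes>\<^bsub>rad n s\<^esub> \<one>\<^bsub>rad n s\<^esub> \<oplus>\<^bsub>rad n s\<^esub> \<zero>\<^bsub>rad n s\<^esub>)"
      unfolding psi_def var_def by simp
    also have "\<dots> = g" unfolding C.hom_one C.hom_zero using g by simp
    finally show ?thesis .
  qed
  have gn: "g [^]\<^bsub>rad n s\<^esub> n = rad_const n s s"
  proof -
    have "g [^]\<^bsub>rad n s\<^esub> n = rad_const n s w [^]\<^bsub>rad n s\<^esub> n \<otimes>\<^bsub>rad n s\<^esub> rad_h n s [^]\<^bsub>rad n s\<^esub> n"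
      unfolding g_def by (rule E.nat_pow_distrib[OF C.hom_closed[OF w(1)] rad_h_closed])
    also have "rad_const n s w [^]\<^bsub>rad n s\<^esub> n = \<one>\<^bsub>rad n s\<^esub>"
      using C.hom_nat_pow[OF w(1), of n] unfolding w(2) C.hom_one by simp
    finally show ?thesis unfolding rad_h_pow using E.l_one[OF C.hom_closed[OF s]] by simp
  qed
  have Xn: "X [^]\<^bsub>PK\<^esub> n \<in> carrier PK" by (rule PK.nat_pow_closed[OF X_closed])
  have psi_m: "psi (radical_poly n s) = \<zero>\<^bsub>rad n s\<^esub>"
  proof -
    have "psi ((X [^]\<^bsub>PK\<^esub> n) \<ominus>\<^bsub>PK\<^esub> poly_of_const s) = psi (X [^]\<^bsub>PK\<^esub> n) \<ominus>\<^bsub>rad n s\<^esub> psi (poly_of_const s)"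
      unfolding PK.minus_eq E.minus_eq psi.hom_add[OF Xn PK.a_inv_closed[OF pc.hom_closed[OF s]]]
        psi.hom_a_inv[OF pc.hom_closed[OF s]] ..
    also have "\<dots> = \<zero>\<^bsub>rad n s\<^esub>"
      unfolding psi.hom_nat_pow[OF X_closed] psi_X gn psi_const[OF s] E.r_right_minus_eq[OF C.hom_closed[OF s] C.hom_closed[OF s]] ..
    finally show ?thesis unfolding arg_cong[OF radical_poly_def, of psi] .
  qed
  have kernel: "psi p = \<zero>\<^bsub>rad n s\<^esub>" if p: "p \<in> carrier PK" "rad_class n s p = \<zero>\<^bsub>rad n s\<^esub>" for p
  proof -
    obtain b where b: "b \<in> carrier PK" "p = b \<otimes>\<^bsub>PK\<^esub> radical_poly n s" using p(2) rad_class_eq_0_iff[OF p(1)] by blast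
    show ?thesis unfolding b(2) psi.hom_mult[OF b(1) radical_poly_closed] psi_m
      by (rule E.r_null[OF psi.hom_closed[OF b(1)]])
  qed
  \<comment> \<open>The value on a class is taken at a chosen representative; by
    \<open>kernel\<close> any two representatives give the same value.\<close>
  define th where "th e = psi (SOME p. p \<in> carrier PK \<and> e = rad_class n s p)" for e
  have th: "th (rad_class n s p) = psi p" if p: "p \<in> carrier PK" for p
  proof -
    define p' where "p' = (SOME p'. p' \<in> carrier PK \<and> rad_class n s p = rad_class n s p')"
    have "p' \<in> carrier PK \<and> rad_class n s p = rad_class n s p'" unfolding p'_def by (rule someI[of _ p]) (simp add: p)
    hence p': "p' \<in> carrier PK" "rad_class n s p' = rad_class n s p" by simp_all
    have "rad_class n s (p' \<ominus>\<^bsub>PK\<^esub> p) = rad_class n s p' \<ominus>\<^bsub>rad n s\<^esub> rad_class n s p"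
      unfolding PK.minus_eq E.minus_eq cl.hom_add[OF p'(1) PK.a_inv_closed[OF p]] cl.hom_a_inv[OF p] ..
    also have "\<dots> = \<zero>\<^bsub>rad n s\<^esub>"
      unfolding p'(2) E.r_right_minus_eq[OF cl.hom_closed[OF p] cl.hom_closed[OF p]] ..
    finally have "psi (p' \<ominus>\<^bsub>PK\<^esub> p) = \<zero>\<^bsub>rad n s\<^esub>" by (rule kernel[OF PK.minus_closed[OF p'(1) p]])
    hence "psi p' \<ominus>\<^bsub>rad n s\<^esub> psi p = \<zero>\<^bsub>rad n s\<^esub>"
      unfolding PK.minus_eq E.minus_eq psi.hom_add[OF p'(1) PK.a_inv_closed[OF p]] psi.hom_a_inv[OF p] .
    hence "psi p' = psi p" unfolding E.r_right_minus_eq[OF psi.hom_closed[OF p'(1)] psi.hom_closed[OF p]] .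
    thus ?thesis unfolding th_def p'_def .
  qed
  have hom: "th \<in> Ring.ring_hom (rad n s) (rad n s)"
  proof (rule ring_hom_memI)
    fix e assume e: "e \<in> carrier (rad n s)"
    obtain p where p: "p \<in> carrier PK" "e = rad_class n s p" using rad_class_surj[OF e] by blast
    show "th e \<in> carrier (rad n s)" unfolding p(2) th[OF p(1)] by (rule psi.hom_closed[OF p(1)])
    fix e' assume e': "e' \<in> carrier (rad n s)"
    obtain p' where p': "p' \<in> carrier PK" "e' = rad_class n s p'" using rad_class_surj[OF e'] by blast
    show "th (e \<oplus>\<^bsub>rad n s\<^esub> e') = th e \<oplus>\<^bsub>rad n s\<^esub> th e'"
      unfolding p(2) p'(2) th[OF p(1)] th[OF p'(1)] cl.hom_add[OF p(1) p'(1), symmetric] th[OF PK.a_closed[OF p(1) p'(1)]]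
      by (rule psi.hom_add[OF p(1) p'(1)])
    show "th (e \<otimes>\<^bsub>rad n s\<^esub> e') = th e \<otimes>\<^bsub>rad n s\<^esub> th e'"
      unfolding p(2) p'(2) th[OF p(1)] th[OF p'(1)] cl.hom_mult[OF p(1) p'(1), symmetric] th[OF PK.m_closed[OF p(1) p'(1)]]
      by (rule psi.hom_mult[OF p(1) p'(1)])
  next
    show "th \<one>\<^bsub>rad n s\<^esub> = \<one>\<^bsub>rad n s\<^esub>" using th[OF PK.one_closed] cl.hom_one psi.hom_one by metis
  qed
  have tc: "th (rad_const n s c) = rad_const n s c" if "c \<in> carrier R" for c
    unfolding th[OF pc.hom_closed[OF that]] by (rule psi_const[OF that])
  have tX: "th (rad_h n s) = rad_const n s w \<otimes>\<^bsub>rad n s\<^esub> rad_h n s"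
    unfolding th[OF X_closed] psi_X g_def ..
  obtain m where m: "n = Suc m" using n by (cases n) auto
  have ord: "(th ^^ Suc m) e = e" if "e \<in> carrier (rad n s)" for e
    using rad_hom_order[OF hom tc w tX that] m by simp
  have "bij_betw th (carrier (rad n s)) (carrier (rad n s))"
  proof (rule bij_betw_byWitness[where f' = "th ^^ m"])
    show "\<forall>e\<in>carrier (rad n s). (th ^^ m) (th e) = e" using ord unfolding funpow_Suc_right comp_apply by blast
    show "\<forall>e\<in>carrier (rad n s). th ((th ^^ m) e) = e" using ord unfolding funpow.simps comp_apply by blast
    show "th ` carrier (rad n s) \<subseteq> carrier (rad n s)" by (intro image_subsetI ring_hom_closed[OF hom])
    show "(th ^^ m) ` carrier (rad n s) \<subseteq> carrier (rad n s)" by (intro image_subsetI E.hom_pow_closed[OF hom])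
  qed
  hence "th \<in> ring_iso (rad n s) (rad n s)" using hom unfolding ring_iso_def by blast
  thus ?thesis using tc tX by blast
qed

end

end

section \<open>The action on the cyclic module\<close>

lemma free_alg_single_induct:
  assumes "\<And>w c. P (Poly_Mapping.single w c)" "\<And>u v. P u \<Longrightarrow> P v \<Longrightarrow> P (u + v)"
  shows "P (u :: 'k::field free_alg)"
proof (induction u rule: Poly_Mapping.update_induct)
  case const
  show ?case using assms(1)[of 0 0] by simp
next
  case (update f w c)
  have "Poly_Mapping.update w c f = f + Poly_Mapping.single w c"
    using update.hyps
    by (intro poly_mapping_eqI) (auto simp: lookup_add lookup_update lookup_single when_def in_keys_iff)
  thus ?case using assms(2)[OF update.IH assms(1)] by simp
qed

context qroot
begin

text \<open>The preimage of the centre of \<open>A1\<close> in the free algebra.\<close>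

definition Cen :: "'k free_alg set" where
  "Cen = {u. \<forall>v. rep q u * rep q v = rep q v * rep q u}"

lemma CenD: "u \<in> Cen \<Longrightarrow> rep q u * rep q v = rep q v * rep q u"
  by (simp add: Cen_def)

lemma zeta_one: "zeta 1 = 1"
  using scal_zeta[of 1] by (simp add: one_pCons scal.C_1)

lemma Cen_const: "free_const c \<in> Cen"
  by (simp add: Cen_def rep_simps scal.C_central)

lemma Cen_one: "1 \<in> Cen"
  by (simp add: Cen_def rep_simps)

lemma Cen_zero: "0 \<in> Cen"
  by (simp add: Cen_def rep_simps)

lemma Cen_add: "u \<in> Cen \<Longrightarrow> v \<in> Cen \<Longrightarrow> u + v \<in> Cen"
  by (simp add: Cen_def rep_simps distrib_left distrib_right)

lemma Cen_mult: "u \<in> Cen \<Longrightarrow> v \<in> Cen \<Longrightarrow> u * v \<in> Cen"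
  unfolding Cen_def mem_Collect_eq rep_simps by (metis mult.assoc)

lemma Cen_fzeta: "fzeta p \<in> Cen"
  by (simp add: Cen_def rep_fzeta zeta_central)

lemma Cen_xn: "free_x ^ n \<in> Cen" and Cen_yn: "free_y ^ n \<in> Cen" and Cen_hn: "fh ^ n \<in> Cen"
  by (simp_all add: Cen_def rep_simps rep_fh Xn_central Yn_central Hn_central)

lemma Cen_cong: "rep q u = rep q v \<Longrightarrow> u \<in> Cen \<Longrightarrow> v \<in> Cen"
  by (simp add: Cen_def)

end

text \<open>An abstraction of E(s, p) with the map \<open>iota\<close> into it from central
  elements; \<open>Pz\<close> stands for the preimage of p. \<open>R\<close> is a commutative ring
  here, so that the construction is available before E(s, p) is known to be a field. The last two
  assumptions say that 1, h, ..., h^(n-1) are independent over the image of the centre and span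
  \<open>R\<close> up to denominators.\<close>

locale central_action = qroot q n + twisted_shift R \<theta> n a
  for q :: "'k::field" and n :: nat and R (structure) and \<theta> and a +
  fixes iota :: "'k free_alg \<Rightarrow> 'a" and h :: 'a and Pz :: "'k free_alg set"
  assumes iota_closed: "u \<in> Cen \<Longrightarrow> iota u \<in> carrier R"
    and iota_add: "u \<in> Cen \<Longrightarrow> v \<in> Cen \<Longrightarrow> iota (u + v) = iota u \<oplus> iota v"
    and iota_mult: "u \<in> Cen \<Longrightarrow> v \<in> Cen \<Longrightarrow> iota (u * v) = iota u \<otimes> iota v"
    and iota_one: "iota 1 = \<one>"
    and iota_zero: "u \<in> Cen \<Longrightarrow> iota u = \<zero> \<longleftrightarrow> u \<in> Pz"
    and iota_unit: "u \<in> Cen \<Longrightarrow> u \<notin> Pz \<Longrightarrow> iota u \<in> Units R"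
    and iota_fixed: "u \<in> Cen \<Longrightarrow> \<theta> (iota u) = iota u"
    and Pz_kers: "rep q u = 0 \<Longrightarrow> u \<in> Pz"
    and h_closed: "h \<in> carrier R"
    and h_hom: "\<theta> h = iota (free_const q) \<otimes> h"
    and h_pow: "h [^] n = iota (fh ^ n)"
    and iota_x: "iota (free_x ^ n) = a"
    and x_notin: "free_x ^ n \<notin> Pz" and h_notin: "fh ^ n \<notin> Pz" and one_notin: "1 \<notin> Pz"
    and indep: "\<lbrakk>\<And>i. i < n \<Longrightarrow> c i \<in> Cen; (\<Oplus>i\<in>{..<n}. iota (c i) \<otimes> h [^] i) = \<zero>; i < n\<rbrakk> \<Longrightarrow> c i \<in> Pz"
    and generation: "e \<in> carrier R \<Longrightarrow> \<exists>z\<in>Cen - Pz. \<exists>c. (\<forall>i. c i \<in> Cen) \<and>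
      iota z \<otimes> e = (\<Oplus>i\<in>{..<n}. iota (c i) \<otimes> h [^] i)"
begin

text \<open>The difference of two representatives of one element of \<open>A1\<close> is a central
  element in \<open>Pz\<close>, so \<open>iota\<close> factors through \<open>A1\<close>.\<close>

lemma iota_cong:
  assumes "u \<in> Cen" "rep q u = rep q v"
  shows "iota u = iota v"
proof -
  have v: "v \<in> Cen" using Cen_cong assms by blast
  have d: "rep q (u - v) = 0" using assms by (simp add: rep_simps)
  have c: "u - v \<in> Cen" using d by (simp add: Cen_def)
  have "iota (u - v) = \<zero>" using iota_zero[OF c] Pz_kers[OF d] by blast
  thus ?thesis using iota_add[OF c v] iota_closed[OF v] by simp
qed

lemma iota_0: "iota 0 = \<zero>"
  using iota_zero[OF Cen_zero] Pz_kers[of 0] by (simp add: rep_simps)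

lemma a_unit: "a \<in> Units R"
  using iota_unit[OF Cen_xn x_notin] iota_x by simp

lemma one_nonzero: "\<one> \<noteq> \<zero>"
  using iota_zero[OF Cen_one] one_notin iota_one by simp

abbreviation e0 :: "nat \<Rightarrow> 'a" where "e0 \<equiv> unit_fun R 0"

abbreviation kappa :: "'k \<Rightarrow> 'a" where "kappa c \<equiv> iota (free_const c)"

lemma kappa_closed: "kappa c \<in> carrier R"
  by (rule iota_closed[OF Cen_const])

lemma kappa_add: "kappa (c + d) = kappa c \<oplus> kappa d"
  unfolding free.C_add by (rule iota_add[OF Cen_const Cen_const])

lemma kappa_mult: "kappa (c * d) = kappa c \<otimes> kappa d"
  unfolding free.C_mult by (rule iota_mult[OF Cen_const Cen_const])

lemma kappa_0: "kappa 0 = \<zero>" and kappa_1: "kappa 1 = \<one>"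
  by (simp_all add: free.C_0 free.C_1 iota_0 iota_one)

lemma kappa_fixed: "\<theta> (kappa c) = kappa c"
  by (rule iota_fixed[OF Cen_const])

lemma kappa_nonzero: "c \<noteq> 0 \<Longrightarrow> kappa c \<noteq> \<zero>"
  using kappa_mult[of c "inverse c"] kappa_1 one_nonzero kappa_closed[of "inverse c"] by auto

sublocale V: cring "V n" by (rule V_cring)

lemma e0_closed: "e0 \<in> carrier (V n)"
  by (rule unit_fun_in_V[OF n_pos])

text \<open>From yx = h - c0 and x^n = a one gets y = (h - c0) x^(-1) = (h - c0) a^(-1) x^(n-1);
  this is the coefficient in front of x^(n-1).\<close>

definition y_factor where "y_factor = (h \<ominus> kappa c0) \<otimes> inv a"

lemma y_factor_closed: "y_factor \<in> carrier R"
  unfolding y_factor_def using h_closed kappa_closed a_unit by simp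

lemma y_factor_a: "y_factor \<otimes> a = h \<ominus> kappa c0"
proof -
  have "y_factor \<otimes> a = (h \<ominus> kappa c0) \<otimes> (inv a \<otimes> a)"
    unfolding y_factor_def using h_closed kappa_closed a_unit a_closed by (simp add: m_assoc)
  thus ?thesis using a_unit h_closed kappa_closed by simp
qed

definition act_y :: "(nat \<Rightarrow> 'a) \<Rightarrow> nat \<Rightarrow> 'a" where
  "act_y b = smul R y_factor ((shift ^^ (n - 1)) b)"

lemma act_y_closed: "b \<in> carrier (V n) \<Longrightarrow> act_y b \<in> carrier (V n)"
  unfolding act_y_def by (intro smul_in_V y_factor_closed shift_pow_closed)

lemma shift_fixed_smul:
  assumes "c \<in> carrier R" "\<theta> c = c" "b \<in> carrier (V n)"
  shows "shift (smul R c b) = smul R c (shift b)"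
  using semilinearD(3)[OF semilinear_shift assms(3,1)] assms(2) by simp

lemma shift_pow_fixed_smul:
  assumes "c \<in> carrier R" "\<theta> c = c" "b \<in> carrier (V n)"
  shows "(shift ^^ m) (smul R c b) = smul R c ((shift ^^ m) b)"
  by (induction m) (simp_all add: shift_fixed_smul[OF assms(1,2) shift_pow_closed[OF assms(3)]])

lemma shift_pow_add:
  assumes "v \<in> carrier (V n)" "b \<in> carrier (V n)"
  shows "(shift ^^ m) (v \<oplus>\<^bsub>V n\<^esub> b) = (shift ^^ m) v \<oplus>\<^bsub>V n\<^esub> (shift ^^ m) b"
  by (rule semilinearD(2)[OF semilinear_pow[OF semilinear_shift hom] assms])

lemma act_y_add:
  assumes "v \<in> carrier (V n)" "b \<in> carrier (V n)"
  shows "act_y (v \<oplus>\<^bsub>V n\<^esub> b) = act_y v \<oplus>\<^bsub>V n\<^esub> act_y b"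
  unfolding act_y_def shift_pow_add[OF assms]
  by (rule smul_add[OF y_factor_closed shift_pow_closed[OF assms(1)] shift_pow_closed[OF assms(2)]])

lemma smul_commute:
  assumes "c \<in> carrier R" "d \<in> carrier R" "b \<in> carrier (V n)"
  shows "smul R c (smul R d b) = smul R d (smul R c b)"
  using assms by (simp add: smul_smul m_comm)

lemma act_y_fixed_smul:
  assumes "c \<in> carrier R" "\<theta> c = c" "b \<in> carrier (V n)"
  shows "act_y (smul R c b) = smul R c (act_y b)"
  unfolding act_y_def shift_pow_fixed_smul[OF assms]
  by (rule smul_commute[OF y_factor_closed assms(1) shift_pow_closed[OF assms(3)]])

primrec word_act :: "letter list \<Rightarrow> nat \<Rightarrow> 'a" where
  "word_act [] = e0"
| "word_act (l # ls) = (case l of Letter_x \<Rightarrow> shift (word_act ls) | Letter_y \<Rightarrow> act_y (word_act ls))"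

lemma shift_in: "v \<in> carrier (V n) \<Longrightarrow> shift v \<in> carrier (V n)"
  by (rule semilinearD(1)[OF semilinear_shift])

lemma word_act_closed: "word_act l \<in> carrier (V n)"
  by (induction l) (auto simp: e0_closed shift_in act_y_closed split: letter.split)

text \<open>The result of letting u act on 1, with x acting by \<open>shift\<close> and y by
  \<open>act_y\<close>. It will turn out to be the homomorphism from \<open>A1\<close> to the cyclic
  algebra, in coordinates.\<close>

definition hat :: "'k free_alg \<Rightarrow> nat \<Rightarrow> 'a" where
  "hat u = (\<Oplus>\<^bsub>V n\<^esub>w\<in>Poly_Mapping.keys u. smul R (kappa (Poly_Mapping.lookup u w)) (word_act (letters w)))"

lemma hat_term_closed: "smul R (kappa c) (word_act l) \<in> carrier (V n)"
  by (rule smul_in_V[OF kappa_closed word_act_closed])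

lemma hat_closed: "hat u \<in> carrier (V n)"
  unfolding hat_def using hat_term_closed by (intro V.finsum_closed) auto

lemma hat_superset:
  assumes "finite A" "Poly_Mapping.keys u \<subseteq> A"
  shows "hat u = (\<Oplus>\<^bsub>V n\<^esub>w\<in>A. smul R (kappa (Poly_Mapping.lookup u w)) (word_act (letters w)))"
  unfolding hat_def using assms hat_term_closed
  by (intro V.add.finprod_mono_neutral_cong_left) (auto simp: in_keys_iff kappa_0 smul_zero[OF word_act_closed])

lemma hat_add: "hat (u + v) = hat u \<oplus>\<^bsub>V n\<^esub> hat v"
proof -
  let ?A = "Poly_Mapping.keys u \<union> Poly_Mapping.keys v"
  let ?f = "\<lambda>u w. smul R (kappa (Poly_Mapping.lookup u w)) (word_act (letters w))"
  have s: "Poly_Mapping.keys (u + v) \<subseteq> ?A" by (rule keys_add)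
  have "hat (u + v) = (\<Oplus>\<^bsub>V n\<^esub>w\<in>?A. ?f (u + v) w)" by (rule hat_superset[OF _ s]) simp
  also have "\<dots> = (\<Oplus>\<^bsub>V n\<^esub>w\<in>?A. ?f u w \<oplus>\<^bsub>V n\<^esub> ?f v w)"
    unfolding lookup_add kappa_add using hat_term_closed
    by (intro V.finsum_cong' refl add_smul[OF kappa_closed kappa_closed word_act_closed]) auto
  also have "\<dots> = (\<Oplus>\<^bsub>V n\<^esub>w\<in>?A. ?f u w) \<oplus>\<^bsub>V n\<^esub> (\<Oplus>\<^bsub>V n\<^esub>w\<in>?A. ?f v w)"
    using hat_term_closed by (intro V.finsum_addf) auto
  also have "(\<Oplus>\<^bsub>V n\<^esub>w\<in>?A. ?f u w) = hat u" by (rule hat_superset[symmetric]) auto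
  also have "(\<Oplus>\<^bsub>V n\<^esub>w\<in>?A. ?f v w) = hat v" by (rule hat_superset[symmetric]) auto
  finally show ?thesis .
qed

lemma hat_single: "hat (Poly_Mapping.single w c) = smul R (kappa c) (word_act (letters w))"
proof -
  have "hat (Poly_Mapping.single w c) =
      (\<Oplus>\<^bsub>V n\<^esub>w'\<in>{w}. smul R (kappa (Poly_Mapping.lookup (Poly_Mapping.single w c) w')) (word_act (letters w')))"
    by (rule hat_superset) (auto simp: lookup_single when_def in_keys_iff)
  thus ?thesis using hat_term_closed by (simp add: lookup_single)
qed

lemma hat_0: "hat 0 = \<zero>\<^bsub>V n\<^esub>"
  by (simp add: hat_def)

lemma hat_const: "hat (free_const c) = smul R (kappa c) e0"
  by (simp add: free_const_def hat_single zero_nc_word_def)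

lemma hat_x: "hat (free_x * u) = shift (hat u)"
proof (induction u rule: free_alg_single_induct)
  case (1 w c)
  show ?case
    by (simp add: free_x_def mult_single hat_single plus_nc_word_def shift_fixed_smul[OF kappa_closed kappa_fixed word_act_closed])
next
  case (2 u v)
  thus ?case by (simp add: distrib_left hat_add semilinearD(2)[OF semilinear_shift hat_closed hat_closed])
qed

lemma hat_y: "hat (free_y * u) = act_y (hat u)"
proof (induction u rule: free_alg_single_induct)
  case (1 w c)
  show ?case
    by (simp add: free_y_def mult_single hat_single plus_nc_word_def act_y_fixed_smul[OF kappa_closed kappa_fixed word_act_closed])
next
  case (2 u v)
  thus ?case by (simp add: distrib_left hat_add act_y_add[OF hat_closed hat_closed])
qed

lemma hat_const_mult: "hat (free_const c * u) = smul R (kappa c) (hat u)"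
proof (induction u rule: free_alg_single_induct)
  case (1 w d)
  show ?case
    unfolding free_const_mult_single hat_single kappa_mult
    by (rule smul_smul[OF kappa_closed kappa_closed word_act_closed, symmetric])
next
  case (2 u v)
  thus ?case by (simp add: distrib_left hat_add smul_add[OF kappa_closed hat_closed hat_closed])
qed

lemma rmult_add: "v \<in> carrier (V n) \<Longrightarrow> b \<in> carrier (V n) \<Longrightarrow> c \<in> carrier (V n) \<Longrightarrow>
    rmult v (b \<oplus>\<^bsub>V n\<^esub> c) = rmult v b \<oplus>\<^bsub>V n\<^esub> rmult v c"
  using linear_mapD(2)[OF orbit_comb_linear] by blast

lemma rmult_smul: "v \<in> carrier (V n) \<Longrightarrow> b \<in> carrier (V n) \<Longrightarrow> e \<in> carrier R \<Longrightarrow>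
    rmult v (smul R e b) = smul R e (rmult v b)"
  by (rule orbit_comb_smul[OF semilinear_shift])

lemma rmult_0: "v \<in> carrier (V n) \<Longrightarrow> rmult v \<zero>\<^bsub>V n\<^esub> = \<zero>\<^bsub>V n\<^esub>"
  using rmult_smul[of v "\<zero>\<^bsub>V n\<^esub>" \<zero>] smul_zero[OF V.zero_closed] smul_zero[OF rmult_closed[of v "\<zero>\<^bsub>V n\<^esub>"]] by simp

lemma rmult_fixed:
  assumes c: "c \<in> carrier R" "\<theta> c = c" and b: "b \<in> carrier (V n)"
  shows "rmult (smul R c e0) b = smul R c b"
proof -
  have "(\<theta> ^^ j) c = c" for j by (induction j) (simp_all add: c(2))
  thus ?thesis unfolding rmult_const[OF c(1) b] using V_mem[OF b] c(1) by (simp add: m_comm smul_def)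
qed

text \<open>The letters act by left multiplications, and these commute with right multiplication by
  \<open>hat v\<close>.\<close>

lemma hat_mult: "hat (u * v) = rmult (hat v) (hat u)"
proof (induction u rule: free_alg_induct)
  case (const c)
  show ?case unfolding hat_const_mult hat_const rmult_smul[OF hat_closed e0_closed kappa_closed] rmult_unit[OF hat_closed] ..
next
  case (add u u')
  thus ?case by (simp add: distrib_right hat_add rmult_add[OF hat_closed hat_closed hat_closed])
next
  case (x u)
  thus ?case by (simp add: mult.assoc hat_x rmult_shift[OF hat_closed hat_closed])
next
  case (y u)
  thus ?case
    by (simp add: mult.assoc hat_y act_y_def rmult_smul[OF hat_closed shift_pow_closed[OF hat_closed] y_factor_closed]
        rmult_shift_pow[OF hat_closed hat_closed])
qed

lemma rmult_0_left: "b \<in> carrier (V n) \<Longrightarrow> rmult \<zero>\<^bsub>V n\<^esub> b = \<zero>\<^bsub>V n\<^esub>"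
  using rmult_fixed[of \<zero> b] smul_zero[OF e0_closed] smul_zero[of b n] iota_0 iota_fixed[OF Cen_zero] by simp

lemma tideal_hat: "tideal {u. hat u = \<zero>\<^bsub>V n\<^esub>}"
  by (simp add: tideal_def hat_0 hat_add hat_mult rmult_0[OF hat_closed] rmult_0_left[OF hat_closed])

lemma shift_pow_Suc_e0: "(shift ^^ (n - 1)) (shift b) = (shift ^^ n) b" "shift ((shift ^^ (n - 1)) b) = (shift ^^ n) b"
  using n_pos by (cases n; simp add: funpow_swap1)+

lemma hat_yx: "hat (free_y * (free_x * u)) = smul R (h \<ominus> kappa c0) (hat u)"
  unfolding hat_y hat_x act_y_def shift_pow_Suc_e0 shift_pow_n[OF hat_closed] smul_smul[OF y_factor_closed a_closed hat_closed]
    y_factor_a ..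

lemma hat_fh: "hat (fh * u) = smul R h (hat u)"
proof -
  have hc: "h \<ominus> kappa c0 \<in> carrier R" using h_closed kappa_closed by simp
  have "h \<ominus> kappa c0 \<oplus> kappa c0 = h"
    using h_closed kappa_closed[of c0] by (simp add: minus_eq a_assoc l_neg)
  thus ?thesis
    unfolding fh_def distrib_right mult.assoc hat_add hat_yx hat_const_mult
    using add_smul[OF hc kappa_closed hat_closed, of c0 u] by simp
qed

lemma hat_one: "hat 1 = e0"
  using hat_const[of 1] smul_one[OF e0_closed] by (simp add: iota_one free.C_1)

text \<open>Applied to 1, the word xy gives \<theta>(h - c0) = q h - c0, since x twists the
  coefficient of y. The other side gives q (h - c0) + 1, which is the same because q c0 = c0 +
  1.\<close>

lemma hat_qrel: "hat (qrel q) = \<zero>\<^bsub>V n\<^esub>"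
proof -
  let ?B = "free_const q * free_y * free_x + 1 :: 'k free_alg"
  have hc: "h \<ominus> kappa c0 \<in> carrier R" using h_closed kappa_closed by simp
  have th: "\<theta> (h \<ominus> kappa c0) = kappa q \<otimes> h \<ominus> kappa c0"
  proof -
    have "\<theta> (h \<ominus> kappa c0) \<oplus> kappa c0 = \<theta> (h \<ominus> kappa c0 \<oplus> kappa c0)"
      using ring_hom_add[OF hom hc kappa_closed] kappa_fixed by simp
    also have "h \<ominus> kappa c0 \<oplus> kappa c0 = h"
      using h_closed kappa_closed[of c0] by (simp add: minus_eq a_assoc l_neg)
    finally have "\<theta> (h \<ominus> kappa c0) \<oplus> kappa c0 = kappa q \<otimes> h" unfolding h_hom .
    moreover have "\<theta> (h \<ominus> kappa c0) = \<theta> (h \<ominus> kappa c0) \<oplus> kappa c0 \<ominus> kappa c0"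
      using hom_closed[OF hc] kappa_closed[of c0] by (simp add: minus_eq a_assoc r_neg)
    ultimately show ?thesis by metis
  qed
  have "hat (free_x * free_y) = shift (act_y (hat 1))" using hat_x[of free_y] hat_y[of 1] by simp
  also have h1: "hat 1 = e0" by (rule hat_one)
  also have "shift (act_y e0) = smul R (\<theta> y_factor) (smul R a e0)"
    unfolding act_y_def semilinearD(3)[OF semilinear_shift shift_pow_closed[OF e0_closed] y_factor_closed]
      shift_pow_Suc_e0 shift_pow_n[OF e0_closed] ..
  also have "\<dots> = smul R (\<theta> (y_factor \<otimes> a)) e0"
    unfolding smul_smul[OF hom_closed[OF y_factor_closed] a_closed e0_closed] ring_hom_mult[OF hom y_factor_closed a_closed] fix_a ..
  also have "\<theta> (y_factor \<otimes> a) = kappa q \<otimes> (h \<ominus> kappa c0) \<oplus> \<one>"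
  proof -
    have "kappa q \<otimes> (h \<ominus> kappa c0) \<oplus> \<one> = kappa q \<otimes> h \<ominus> kappa q \<otimes> kappa c0 \<oplus> kappa 1"
      using h_closed kappa_closed by (simp add: minus_eq r_distr r_minus kappa_1)
    also have "kappa q \<otimes> kappa c0 = kappa c0 \<oplus> kappa 1"
      unfolding kappa_mult[symmetric] kappa_add[symmetric] using c0(2) by (simp add: add.commute)
    also have "kappa q \<otimes> h \<ominus> (kappa c0 \<oplus> kappa 1) \<oplus> kappa 1 = kappa q \<otimes> h \<ominus> kappa c0"
      using h_closed kappa_closed m_closed[OF kappa_closed h_closed] by (simp add: minus_eq minus_add a_assoc l_neg)
    finally show ?thesis unfolding y_factor_a th ..
  qed
  also have "smul R (kappa q \<otimes> (h \<ominus> kappa c0) \<oplus> \<one>) e0 = hat ?B"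
  proof -
    have "hat ?B = hat (free_const q * (free_y * (free_x * 1))) \<oplus>\<^bsub>V n\<^esub> e0" by (simp add: hat_add h1 mult.assoc)
    also have "\<dots> = smul R (kappa q \<otimes> (h \<ominus> kappa c0)) e0 \<oplus>\<^bsub>V n\<^esub> smul R \<one> e0"
      unfolding hat_const_mult hat_yx h1 smul_smul[OF kappa_closed hc e0_closed] smul_one[OF e0_closed] ..
    also have "\<dots> = smul R (kappa q \<otimes> (h \<ominus> kappa c0) \<oplus> \<one>) e0"
      by (rule add_smul[OF m_closed[OF kappa_closed hc] one_closed e0_closed, symmetric])
    finally show ?thesis ..
  qed
  finally have eq: "hat (free_x * free_y) = hat ?B" .
  have "free_x * free_y = qrel q + ?B" by (simp add: qrel_def)
  hence "hat (qrel q) \<oplus>\<^bsub>V n\<^esub> hat ?B = \<zero>\<^bsub>V n\<^esub> \<oplus>\<^bsub>V n\<^esub> hat ?B"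
    using eq hat_add[of "qrel q" ?B] hat_closed by simp
  thus ?thesis using V.add.right_cancel[OF hat_closed hat_closed V.zero_closed] by blast
qed

lemma hat_cong: "rep q u = rep q v \<Longrightarrow> hat u = hat v"
proof -
  assume "rep q u = rep q v"
  hence "rep q (u - v) = 0" by (simp add: rep_simps)
  hence "hat (u - v) = \<zero>\<^bsub>V n\<^esub>" using rep_0_mem[OF tideal_hat, of q] hat_qrel by simp
  thus ?thesis using hat_add[of "u - v" v] hat_closed by simp
qed

lemma hat_x_pow: "hat (free_x ^ m * u) = (shift ^^ m) (hat u)"
  by (induction m) (simp_all add: mult.assoc hat_x)

lemma hat_fh_pow: "hat (fh ^ m * u) = smul R (h [^] m) (hat u)"
proof (induction m)
  case 0
  show ?case by (simp add: smul_one[OF hat_closed])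
next
  case (Suc m)
  have "hat (fh ^ Suc m * u) = smul R h (hat (fh ^ m * u))" by (simp add: mult.assoc hat_fh)
  also have "\<dots> = smul R (h \<otimes> h [^] m) (hat u)"
    unfolding Suc.IH by (rule smul_smul[OF h_closed nat_pow_closed[OF h_closed] hat_closed])
  also have "h \<otimes> h [^] m = h [^] Suc m" unfolding nat_pow_Suc by (rule m_comm[OF h_closed nat_pow_closed[OF h_closed]])
  finally show ?case .
qed

text \<open>The central elements that act on 1 as the scalar prescribed by \<open>iota\<close>. They
  are closed under sums and products, so it is enough to find the constants and the generators of
  the centre among them.\<close>

definition good :: "'k free_alg \<Rightarrow> bool" where
  "good u \<longleftrightarrow> u \<in> Cen \<and> hat u = smul R (iota u) e0"

lemma good_const: "good (free_const c)"
  by (simp add: good_def Cen_const hat_const)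

lemma good_add: "good u \<Longrightarrow> good v \<Longrightarrow> good (u + v)"
  unfolding good_def by (simp add: Cen_add hat_add iota_add add_smul[OF iota_closed iota_closed e0_closed])

lemma good_mult: "good u \<Longrightarrow> good v \<Longrightarrow> good (u * v)"
  unfolding good_def
  by (simp add: Cen_mult hat_mult iota_mult rmult_fixed[OF iota_closed iota_fixed smul_in_V[OF iota_closed e0_closed]]
      smul_smul[OF iota_closed iota_closed e0_closed] m_comm iota_closed)

lemma good_cong: "good u \<Longrightarrow> rep q u = rep q v \<Longrightarrow> good v"
  unfolding good_def using Cen_cong hat_cong iota_cong by metis

lemma good_xn: "good (free_x ^ n)"
  unfolding good_def iota_x using Cen_xn hat_x_pow[of n 1] by (simp add: hat_one shift_pow_n[OF e0_closed])

lemma good_hn: "good (fh ^ n)"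
  unfolding good_def using Cen_hn hat_fh_pow[of n 1] h_pow by (simp add: hat_one)

text \<open>y^n is reached by division: y^n x^n is a polynomial in h^n by \<open>YnXn\<close>, and
  x^n acts as the unit a.\<close>

lemma good_yn: "good (free_y ^ n)"
proof -
  let ?w = "free_const ((-1) ^ n) * (free_const (c0 ^ n) + free_const (-1) * fh ^ n)"
  have w: "good ?w" by (intro good_mult good_add good_const good_hn)
  have "rep q (free_y ^ n * free_x ^ n) = rep q ?w"
    by (simp add: rep_simps YnXn rep_fh scal.C_uminus scal.C_1)
  hence g: "good (free_y ^ n * free_x ^ n)" using good_cong[OF w] by metis
  have yc: "iota (free_y ^ n) \<in> carrier R" by (rule iota_closed[OF Cen_yn])
  have "smul R a (hat (free_y ^ n)) = hat (free_y ^ n * free_x ^ n)"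
    unfolding hat_mult using good_xn rmult_fixed[OF a_closed fix_a hat_closed] by (simp add: good_def iota_x)
  also have "\<dots> = smul R (a \<otimes> iota (free_y ^ n)) e0"
    using g iota_mult[OF Cen_yn Cen_xn] yc a_closed by (simp add: good_def iota_x m_comm)
  also have "\<dots> = smul R a (smul R (iota (free_y ^ n)) e0)" by (rule smul_smul[OF a_closed yc e0_closed, symmetric])
  finally have "smul R (inv a) (smul R a (hat (free_y ^ n))) = smul R (inv a) (smul R a (smul R (iota (free_y ^ n)) e0))" by simp
  moreover have "smul R (inv a) (smul R a b) = b" if "b \<in> carrier (V n)" for b
    unfolding smul_smul[OF Units_inv_closed[OF a_unit] a_closed that] Units_l_inv[OF a_unit] by (rule smul_one[OF that])
  ultimately have "hat (free_y ^ n) = smul R (iota (free_y ^ n)) e0"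
    using hat_closed smul_in_V[OF yc e0_closed] by metis
  thus ?thesis using Cen_yn by (simp add: good_def)
qed

lemma hat_central:
  assumes "u \<in> Cen"
  shows "hat u = smul R (iota u) e0"
proof -
  have t: "\<exists>w. good w \<and> rep q w = zt.ev f" for f
  proof (induction f)
    case 0
    show ?case using good_const[of 0] by (intro exI[of _ "free_const 0"]) (simp add: rep_simps zt.ev_0 scal.C_0)
  next
    case (pCons c f)
    then obtain w where w: "good w" "rep q w = zt.ev f" by blast
    show ?case
      using good_add[OF good_const[of c] good_mult[OF good_xn w(1)]] w(2)
      by (intro exI[of _ "free_const c + free_x ^ n * w"]) (simp add: rep_simps zt.ev_pCons)
  qed
  have "\<exists>w. good w \<and> rep q w = zeta p" for p
  proof (induction p)
    case 0
    show ?case using good_const[of 0] by (intro exI[of _ "free_const 0"]) (simp add: rep_simps zz.ev_0 scal.C_0)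
  next
    case (pCons c p)
    then obtain w where w: "good w" "rep q w = zeta p" by blast
    obtain w' where w': "good w'" "rep q w' = zt.ev c" using t by blast
    show ?case
      using good_add[OF w'(1) good_mult[OF good_yn w(1)]] w(2) w'(2)
      by (intro exI[of _ "w' + free_y ^ n * w"]) (simp add: rep_simps zz.ev_pCons)
  qed
  moreover obtain p where "rep q u = zeta p" using center[of u] CenD[OF assms] by blast
  ultimately obtain w where "good w" "rep q w = rep q u" by metis
  thus ?thesis using good_cong unfolding good_def by blast
qed

lemma hat_central_mult:
  assumes "z \<in> Cen"
  shows "hat (z * u) = smul R (iota z) (hat u)"
proof -
  have "hat (z * u) = hat (u * z)" by (rule hat_cong) (simp add: rep_simps CenD[OF assms])
  also have "\<dots> = smul R (iota z) (hat u)"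
    unfolding hat_mult hat_central[OF assms] by (rule rmult_fixed[OF iota_closed[OF assms] iota_fixed[OF assms] hat_closed])
  finally show ?thesis .
qed

definition zi :: "'k poly poly \<Rightarrow> 'a" where "zi p = iota (fzeta p)"

lemma zi_closed: "zi p \<in> carrier R"
  unfolding zi_def by (rule iota_closed[OF Cen_fzeta])

lemma zi_add: "zi (p + p') = zi p \<oplus> zi p'"
  unfolding zi_def iota_add[OF Cen_fzeta Cen_fzeta, symmetric]
  by (rule iota_cong[OF Cen_fzeta]) (simp add: rep_simps rep_fzeta zz.ev_add)

lemma zi_mult: "zi (p * p') = zi p \<otimes> zi p'"
  unfolding zi_def iota_mult[OF Cen_fzeta Cen_fzeta, symmetric]
  by (rule iota_cong[OF Cen_fzeta]) (simp add: rep_simps rep_fzeta zz.ev_mult)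

lemma zi_0: "zi 0 = \<zero>"
  unfolding zi_def iota_0[symmetric] by (rule iota_cong[OF Cen_fzeta]) (simp add: rep_simps rep_fzeta zz.ev_0)

lemma zi_1: "zi 1 = \<one>"
proof -
  have "rep q (fzeta 1) = rep q 1"
    using scal_zeta[of 1] by (simp add: rep_simps rep_fzeta one_pCons scal.C_1)
  thus ?thesis unfolding zi_def iota_one[symmetric] by (rule iota_cong[OF Cen_fzeta])
qed

lemma zi_pow: "zi (p ^ k) = zi p [^] k"
proof (induction k)
  case 0
  show ?case by (simp add: zi_1)
next
  case (Suc k)
  have "zi (p ^ Suc k) = zi p [^] k \<otimes> zi p" unfolding power_Suc2 zi_mult Suc.IH ..
  thus ?case by simp
qed

lemma zi_t: "zi [:[:0, 1:]:] = a"
  unfolding zi_def iota_x[symmetric]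
proof (rule iota_cong[OF Cen_fzeta])
  show "rep q (fzeta [:[:0, 1:]:]) = rep q (free_x ^ n)"
    unfolding rep_fzeta Xn_zeta[symmetric] by (simp add: rep_simps)
qed

lemma zi_eq_0: "zi p = \<zero> \<longleftrightarrow> fzeta p \<in> Pz"
  unfolding zi_def by (rule iota_zero[OF Cen_fzeta])

lemma zi_sum_0: "(\<And>x. x \<in> A \<Longrightarrow> zi (f x) = \<zero>) \<Longrightarrow> zi (sum f A) = \<zero>"
  proof (induction A rule: infinite_finite_induct)
  case (insert x A)
  thus ?case unfolding sum.insert[OF insert.hyps] zi_add by simp
qed (simp_all add: zi_0)

lemma hat_sum: "finite A \<Longrightarrow> hat (sum f A) = (\<Oplus>\<^bsub>V n\<^esub>x\<in>A. hat (f x))"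
  by (induction A rule: finite_induct) (simp_all add: hat_0 hat_add V.finsum_insert hat_closed)

end

context central_action
begin

lemma hat_sum_apply: "finite A \<Longrightarrow> hat (sum f A) k = (\<Oplus>x\<in>A. hat (f x) k)"
  unfolding hat_sum using V_finsum[of A "\<lambda>x. hat (f x)" n] hat_closed by simp

lemma hat_fsum_term:
  assumes "j < n"
  shows "hat (fzeta p * fh ^ i * free_x ^ j) k = zi p \<otimes> h [^] i \<otimes> (if j = k then \<one> else \<zero>)"
proof -
  have "hat (free_x ^ j) = unit_fun R j"
    using hat_x_pow[of j 1] shift_pow_unit[OF assms] by (simp add: hat_one)
  hence "hat (fzeta p * (fh ^ i * free_x ^ j)) = smul R (zi p) (smul R (h [^] i) (unit_fun R j))"
    unfolding hat_central_mult[OF Cen_fzeta] hat_fh_pow zi_def by simp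
  thus ?thesis
    using zi_closed nat_pow_closed[OF h_closed] by (simp add: mult.assoc smul_def unit_fun_def m_assoc)
qed

text \<open>The coordinate at x^k of the image is a combination of 1, h, ..., h^(n-1) with central
  coefficients, and these powers are independent.\<close>

lemma hat_fsum_0:
  assumes "hat (fsum c) = \<zero>\<^bsub>V n\<^esub>" "i < n" "k < n"
  shows "fzeta (c i k) \<in> Pz"
proof -
  have hc: "h [^] (i::nat) \<in> carrier R" for i by (rule nat_pow_closed[OF h_closed])
  have "hat (fsum c) k = (\<Oplus>i\<in>{..<n}. \<Oplus>j\<in>{..<n}. hat (fzeta (c i j) * fh ^ i * free_x ^ j) k)"
    unfolding fsum_def by (subst hat_sum_apply) (simp_all add: hat_sum_apply)
  also have "\<dots> = (\<Oplus>i\<in>{..<n}. iota (fzeta (c i k)) \<otimes> h [^] i)"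
  proof (rule finsum_cong')
    fix i
    have "(\<Oplus>j\<in>{..<n}. hat (fzeta (c i j) * fh ^ i * free_x ^ j) k) = hat (fzeta (c i k) * fh ^ i * free_x ^ k) k"
      using assms(3) zi_closed hc V_mem[OF hat_closed]
      by (intro finsum_single) (simp_all add: hat_fsum_term)
    thus "(\<Oplus>j\<in>{..<n}. hat (fzeta (c i j) * fh ^ i * free_x ^ j) k) = iota (fzeta (c i k)) \<otimes> h [^] i"
      using hat_fsum_term[OF assms(3), of "c i k" i k] zi_closed[of "c i k"] hc[of i] by (simp add: zi_def)
  qed (use zi_closed[unfolded zi_def] hc in auto)
  finally have "(\<Oplus>i\<in>{..<n}. iota (fzeta (c i k)) \<otimes> h [^] i) = \<zero>" using assms(1) by (simp add: V_simps)
  thus ?thesis using indep[of "\<lambda>i. fzeta (c i k)" i] Cen_fzeta assms(2) by blast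
qed

lemma unit_cancel: "u \<in> Units R \<Longrightarrow> x \<in> carrier R \<Longrightarrow> u \<otimes> x = \<zero> \<Longrightarrow> x = \<zero>"
  by (metis Units_closed Units_l_cancel r_null zero_closed)

text \<open>The right side describes the ideal generated by p in the basis y^b x^a. For the
  direction from left to right, a power of t brings u into the span of the h^i x^j, where all
  coefficients must lie in \<open>Pz\<close>; then t^N times each coordinate of u lies in
  \<open>Pz\<close>, and t maps to the unit a.\<close>

lemma hat_eq_0_iff: "hat u = \<zero>\<^bsub>V n\<^esub> \<longleftrightarrow> (\<forall>a<n. \<forall>b<n. fzeta (crd a b (nf q u)) \<in> Pz)"
proof
  assume u: "hat u = \<zero>\<^bsub>V n\<^esub>"
  obtain N c where d: "ox ^ (n * N) * rep q u = dsum c" using density by blast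
  have "rep q (free_x ^ (n * N) * u) = rep q (fsum c)" using d by (simp add: rep_simps rep_fsum)
  hence "hat (fsum c) = hat (free_x ^ (n * N) * u)" by (rule hat_cong[symmetric])
  also have "\<dots> = \<zero>\<^bsub>V n\<^esub>" unfolding hat_mult u by (rule rmult_0_left[OF hat_closed])
  finally have c: "fzeta (c i j) \<in> Pz" if "i < n" "j < n" for i j using hat_fsum_0 that by blast
  have X: "ox ^ (n * N) = zeta ([:[:0, 1:]:] ^ N)"
  proof -
    have "zeta [:[:0, 1:]:] ^ N = zeta ([:[:0, 1:]:] ^ N)"
    proof (induction N)
      case 0
      show ?case by (simp add: zeta_one)
    next
      case (Suc N)
      show ?case unfolding power_Suc zz.ev_mult Suc.IH ..
    qed
    thus ?thesis unfolding power_mult Xn_zeta[symmetric] .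
  qed
  show "\<forall>a<n. \<forall>b<n. fzeta (crd a b (nf q u)) \<in> Pz"
  proof (intro allI impI)
    fix i j assume i: "i < n" and j: "j < n"
    \<comment> \<open>Coordinates are linear over K[t, r], so both the factor t^N and the
      coefficients \<open>c\<close> can be taken out.\<close>
    have "[:[:0, 1:]:] ^ N * crd i j (nf q u) = crd i j (app (ox ^ (n * N) * rep q u) 1)"
      unfolding X app_times crd_zeta[OF i j] nf_def ..
    also have "\<dots> = (\<Sum>i'<n. \<Sum>j'<n. c i' j' * crd i j (app (oh ^ i' * ox ^ j') 1))"
      unfolding d dsum_def by (simp add: app_sum crd_sum mult.assoc app_times crd_zeta[OF i j])
    finally have "zi ([:[:0, 1:]:] ^ N * crd i j (nf q u)) = \<zero>"
      using c zi_closed by (simp only:) (intro zi_sum_0, simp add: zi_mult zi_eq_0[THEN iffD2])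
    hence "a [^] N \<otimes> zi (crd i j (nf q u)) = \<zero>" unfolding zi_mult zi_pow zi_t .
    hence "zi (crd i j (nf q u)) = \<zero>" using unit_cancel Units_pow_closed[OF a_unit] zi_closed by blast
    thus "fzeta (crd i j (nf q u)) \<in> Pz" by (simp add: zi_eq_0)
  qed
next
  assume c: "\<forall>a<n. \<forall>b<n. fzeta (crd a b (nf q u)) \<in> Pz"
  let ?J = "{u. hat u = \<zero>\<^bsub>V n\<^esub>}"
  let ?w = "\<Sum>a<n. \<Sum>b<n. fzeta (crd a b (nf q u)) * free_y ^ b * free_x ^ a"
  have fz: "fzeta (crd i j (nf q u)) \<in> ?J" if "i < n" "j < n" for i j
  proof -
    have "iota (fzeta (crd i j (nf q u))) = \<zero>" using c that iota_zero[OF Cen_fzeta] by blast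
    thus ?thesis unfolding mem_Collect_eq hat_central[OF Cen_fzeta] by (simp add: smul_zero[OF e0_closed])
  qed
  have w: "?w \<in> ?J" by (rule tideal_sum[OF tideal_hat], rule tideal_sum[OF tideal_hat],
      rule tidealD(4)[OF tideal_hat], rule tidealD(4)[OF tideal_hat], rule fz) auto
  have "rep q ?w = (\<Sum>a<n. \<Sum>b<n. zeta (crd a b (nf q u)) * oy ^ b * ox ^ a)"
    by (simp add: rep_simps rep_fzeta)
  hence "rep q ?w = rep q u" unfolding expansion_crd[symmetric] .
  hence "hat ?w = hat u" by (rule hat_cong)
  thus "hat u = \<zero>\<^bsub>V n\<^esub>" using w unfolding mem_Collect_eq by simp
qed

lemma hat_Pz: "z \<in> Cen \<Longrightarrow> z \<in> Pz \<Longrightarrow> hat z = \<zero>\<^bsub>V n\<^esub>"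
  using hat_central[of z] iota_zero[of z] smul_zero[OF e0_closed] by simp

lemma denominators_mult:
  assumes "z \<in> Cen - Pz" "w \<in> Cen - Pz"
  shows "z * w \<in> Cen - Pz"
proof -
  have "iota (z * w) \<noteq> \<zero>"
    using unit_cancel[OF iota_unit[of z], of "iota w"] iota_closed[of w] iota_zero[of w] assms by (auto simp: iota_mult)
  thus ?thesis using assms iota_zero[OF Cen_mult[of z w]] Cen_mult[of z w] by auto
qed

text \<open>The vectors that some central denominator brings into the image of \<open>hat\<close>.
  By \<open>dense_eq\<close> these are all vectors: the cyclic algebra is a central localisation of
  the image of \<open>A1\<close>.\<close>

definition dense :: "(nat \<Rightarrow> 'a) set" where
  "dense = {b \<in> carrier (V n). \<exists>z\<in>Cen - Pz. \<exists>u. hat u = smul R (iota z) b}"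

lemma denseI: "b \<in> carrier (V n) \<Longrightarrow> z \<in> Cen - Pz \<Longrightarrow> hat u = smul R (iota z) b \<Longrightarrow> b \<in> dense"
  unfolding dense_def by blast

lemma denseE:
  assumes "b \<in> dense" obtains z u where "b \<in> carrier (V n)" "z \<in> Cen" "z \<notin> Pz" "hat u = smul R (iota z) b"
  using assms unfolding dense_def by blast

lemma dense_add:
  assumes "b \<in> dense" "b' \<in> dense" shows "b \<oplus>\<^bsub>V n\<^esub> b' \<in> dense"
proof -
  obtain z u where u: "b \<in> carrier (V n)" "z \<in> Cen" "z \<notin> Pz" "hat u = smul R (iota z) b" using assms(1) by (rule denseE)
  obtain z' u' where u': "b' \<in> carrier (V n)" "z' \<in> Cen" "z' \<notin> Pz" "hat u' = smul R (iota z') b'" using assms(2) by (rule denseE)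
  note cl = iota_closed[OF u(2)] iota_closed[OF u'(2)]
  have "hat (z' * u + z * u') = smul R (iota z') (smul R (iota z) b) \<oplus>\<^bsub>V n\<^esub> smul R (iota z) (smul R (iota z') b')"
    unfolding hat_add hat_central_mult[OF u(2)] hat_central_mult[OF u'(2)] u(4) u'(4) ..
  also have "\<dots> = smul R (iota (z * z')) (b \<oplus>\<^bsub>V n\<^esub> b')"
    unfolding smul_smul[OF cl(2) cl(1) u(1)] smul_smul[OF cl u'(1)] iota_mult[OF u(2) u'(2)]
      smul_add[OF m_closed[OF cl] u(1) u'(1)] m_comm[OF cl(2) cl(1)] ..
  finally show ?thesis using denseI denominators_mult[of z z'] u u' by blast
qed

text \<open>Covers the operations induced by left multiplication with an element w of the free
  algebra: the shift, powers of h, and central elements.\<close>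

lemma dense_map:
  assumes b: "b \<in> dense" and closed: "F b \<in> carrier (V n)"
    and F: "\<And>z u. z \<in> Cen \<Longrightarrow> hat u = smul R (iota z) b \<Longrightarrow> hat (w * u) = smul R (iota z) (F b)"
  shows "F b \<in> dense"
proof -
  obtain z u where u: "z \<in> Cen" "z \<notin> Pz" "hat u = smul R (iota z) b" using b by (rule denseE)
  show ?thesis using denseI[OF closed _ F[OF u(1,3)]] u(1,2) by blast
qed

lemma dense_carrier: "b \<in> dense \<Longrightarrow> b \<in> carrier (V n)"
  by (simp add: dense_def)

lemma dense_shift: "b \<in> dense \<Longrightarrow> shift b \<in> dense"
  by (rule dense_map[where F = shift and w = free_x])
    (simp_all add: hat_x shift_in dense_carrier shift_fixed_smul iota_closed iota_fixed)

lemma dense_h: "b \<in> dense \<Longrightarrow> smul R (h [^] (i::nat)) b \<in> dense"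
  by (rule dense_map[where F = "smul R (h [^] i)" and w = "fh ^ i"])
    (simp_all add: hat_fh_pow smul_in_V dense_carrier h_closed iota_closed smul_commute[of "h [^] i"])

lemma dense_iota: "c \<in> Cen \<Longrightarrow> b \<in> dense \<Longrightarrow> smul R (iota c) b \<in> dense"
  by (rule dense_map[where F = "smul R (iota c)" and w = c])
    (simp_all add: hat_central_mult smul_in_V dense_carrier iota_closed smul_commute[of "iota c"])

lemma dense_divide:
  assumes b: "b \<in> carrier (V n)" and z: "z \<in> Cen - Pz" and d: "smul R (iota z) b \<in> dense"
  shows "b \<in> dense"
proof -
  obtain w u where u: "w \<in> Cen" "w \<notin> Pz" "hat u = smul R (iota w) (smul R (iota z) b)" using d by (rule denseE)
  have zc: "z \<in> Cen" using z by blast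
  have "hat u = smul R (iota (w * z)) b"
    unfolding u(3) smul_smul[OF iota_closed[OF u(1)] iota_closed[OF zc] b] iota_mult[OF u(1) zc] ..
  thus ?thesis using denseI[OF b] denominators_mult[OF _ z, of w] u(1,2) by blast
qed

lemma dense_zero: "\<zero>\<^bsub>V n\<^esub> \<in> dense"
proof (rule denseI)
  show "1 \<in> Cen - Pz" using Cen_one one_notin by simp
  show "hat 0 = smul R (iota 1) \<zero>\<^bsub>V n\<^esub>" unfolding iota_one hat_0 by (rule smul_one[OF V.zero_closed, symmetric])
qed simp

text \<open>Up to a denominator, a scalar is a combination of powers of h with central coefficients,
  and each such term preserves \<open>dense\<close>.\<close>

lemma dense_smul:
  assumes e: "e \<in> carrier R" and b: "b \<in> dense"
  shows "smul R e b \<in> dense"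
proof -
  obtain z c where z: "z \<in> Cen - Pz" and c: "\<And>i. c i \<in> Cen"
    and eq: "iota z \<otimes> e = (\<Oplus>i\<in>{..<n}. iota (c i) \<otimes> h [^] i)" using generation[OF e] by blast
  have zc: "iota z \<in> carrier R" using iota_closed z by blast
  note bc = dense_carrier[OF b]
  have tc: "iota (c i) \<otimes> h [^] i \<in> carrier R" for i :: nat using iota_closed[OF c] h_closed by simp
  have "smul R (\<Oplus>i\<in>A. iota (c i) \<otimes> h [^] i) b \<in> dense" if "finite A" for A :: "nat set" using that
  proof induction
    case empty
    show ?case using smul_zero[OF bc] dense_zero by simp
  next
    case (insert i A)
    have s: "(\<Oplus>i\<in>A. iota (c i) \<otimes> h [^] i) \<in> carrier R" using tc by (intro finsum_closed) auto
    have "smul R (iota (c i) \<otimes> h [^] i) b \<in> dense"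
      unfolding smul_smul[OF iota_closed[OF c] nat_pow_closed[OF h_closed] bc, symmetric]
      by (rule dense_iota[OF c dense_h[OF b]])
    thus ?case using dense_add insert s tc by (simp add: finsum_insert add_smul[OF tc s bc])
  qed
  from this[of "{..<n}"] have "smul R (iota z) (smul R e b) \<in> dense"
    unfolding eq[symmetric] smul_smul[OF zc e bc] by simp
  thus ?thesis by (rule dense_divide[OF smul_in_V[OF e bc] z])
qed

lemma dense_eq: "dense = carrier (V n)"
proof (rule shift_subspace_unit)
  show "shift_subspace dense"
    unfolding shift_subspace_def
    using subspaceI[of dense n, OF _ dense_zero dense_add dense_smul] n_pos dense_carrier dense_shift by blast
  show "e0 \<in> dense"
  proof (rule denseI[OF e0_closed])
    show "1 \<in> Cen - Pz" using Cen_one one_notin by simp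
    show "hat 1 = smul R (iota 1) e0" unfolding iota_one hat_one by (rule smul_one[OF e0_closed, symmetric])
  qed
qed

lemma dense_witness:
  assumes "b \<in> carrier (V n)" obtains z u where "z \<in> Cen" "z \<notin> Pz" "hat u = smul R (iota z) b"
  using assms unfolding dense_eq[symmetric] by (rule denseE)

lemma smul_iota_0:
  assumes "z \<in> Cen" "z \<notin> Pz" "b \<in> carrier (V n)" "smul R (iota z) b = \<zero>\<^bsub>V n\<^esub>"
  shows "b = \<zero>\<^bsub>V n\<^esub>"
proof -
  have "iota z \<otimes> b i = \<zero>" for i using fun_cong[OF assms(4), of i] by (simp add: smul_def V_simps)
  hence "b i = \<zero>" for i using unit_cancel[OF iota_unit[OF assms(1,2)] V_mem[OF assms(3)]] by blast
  thus ?thesis by (simp add: V_simps fun_eq_iff)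
qed

lemma smul_V_zero: "e \<in> carrier R \<Longrightarrow> smul R e \<zero>\<^bsub>V n\<^esub> = \<zero>\<^bsub>V n\<^esub>"
  by (simp add: smul_def V_simps)

lemma e0_nonzero: "e0 \<noteq> \<zero>\<^bsub>V n\<^esub>"
  using one_nonzero by (auto simp: unit_fun_def V_simps fun_eq_iff)

text \<open>After denominators are cleared, b and v are images of elements u' and u with u' u in the
  kernel of \<open>hat\<close>, and that kernel is completely prime.\<close>

lemma rmult_integral:
  assumes P: "cprime {u. hat u = \<zero>\<^bsub>V n\<^esub>}" and v: "v \<in> carrier (V n)" and b: "b \<in> carrier (V n)"
    and vb: "rmult v b = \<zero>\<^bsub>V n\<^esub>" and v0: "v \<noteq> \<zero>\<^bsub>V n\<^esub>"
  shows "b = \<zero>\<^bsub>V n\<^esub>"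
proof -
  obtain z u where u: "z \<in> Cen" "z \<notin> Pz" "hat u = smul R (iota z) v" using v by (rule dense_witness)
  obtain w u' where u': "w \<in> Cen" "w \<notin> Pz" "hat u' = smul R (iota w) b" using b by (rule dense_witness)
  have "smul R (iota z) v = rmult v (smul R (iota z) e0)"
    unfolding rmult_smul[OF v e0_closed iota_closed[OF u(1)]] rmult_unit[OF v] ..
  hence "hat (u' * u) = rmult (rmult v (smul R (iota z) e0)) (smul R (iota w) b)" unfolding hat_mult u u' by simp
  also have "\<dots> = rmult v (rmult (smul R (iota z) e0) (smul R (iota w) b))"
    by (rule rmult_rmult[symmetric, OF v smul_in_V[OF iota_closed[OF u(1)] e0_closed] smul_in_V[OF iota_closed[OF u'(1)] b]])
  also have "\<dots> = smul R (iota z) (smul R (iota w) (rmult v b))"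
    unfolding rmult_fixed[OF iota_closed[OF u(1)] iota_fixed[OF u(1)] smul_in_V[OF iota_closed[OF u'(1)] b]]
      rmult_smul[OF v smul_in_V[OF iota_closed[OF u'(1)] b] iota_closed[OF u(1)]] rmult_smul[OF v b iota_closed[OF u'(1)]] ..
  also have "\<dots> = \<zero>\<^bsub>V n\<^esub>" unfolding vb smul_V_zero[OF iota_closed[OF u(1)]] smul_V_zero[OF iota_closed[OF u'(1)]] ..
  finally have "u' * u \<in> {u. hat u = \<zero>\<^bsub>V n\<^esub>}" by simp
  from cprimeD(3)[OF P this] show ?thesis
  proof
    assume "u' \<in> {u. hat u = \<zero>\<^bsub>V n\<^esub>}"
    hence "hat u' = \<zero>\<^bsub>V n\<^esub>" by simp
    thus ?thesis unfolding u'(3) by (rule smul_iota_0[OF u'(1,2) b])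
  next
    assume "u \<in> {u. hat u = \<zero>\<^bsub>V n\<^esub>}"
    hence "hat u = \<zero>\<^bsub>V n\<^esub>" by simp
    hence "v = \<zero>\<^bsub>V n\<^esub>" unfolding u(3) by (rule smul_iota_0[OF u(1,2) v])
    thus ?thesis using v0 by blast
  qed
qed

text \<open>\<open>R\<close> sits inside the cyclic algebra as the multiples of 1, which is
  \<open>e0\<close>.\<close>

lemma domain_of_cprime:
  assumes P: "cprime {u. hat u = \<zero>\<^bsub>V n\<^esub>}"
  shows "domain R"
proof (rule domainI[OF is_cring])
  show "\<one> \<noteq> \<zero>" by (rule one_nonzero)
  fix c d assume cd: "c \<otimes> d = \<zero>" "c \<in> carrier R" "d \<in> carrier R"
  have eq: "smul R f e0 = \<zero>\<^bsub>V n\<^esub> \<longleftrightarrow> f = \<zero>" if "f \<in> carrier R" for f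
    using that by (auto simp: smul_def unit_fun_def V_simps fun_eq_iff split: if_splits)
  have "rmult (smul R c e0) (smul R d e0) = smul R d (smul R c e0)"
    unfolding rmult_smul[OF smul_in_V[OF cd(2) e0_closed] e0_closed cd(3)] rmult_unit[OF smul_in_V[OF cd(2) e0_closed]] ..
  also have "\<dots> = smul R (c \<otimes> d) e0" unfolding smul_smul[OF cd(3,2) e0_closed] m_comm[OF cd(3,2)] ..
  also have "\<dots> = \<zero>\<^bsub>V n\<^esub>" unfolding cd(1) by (rule smul_zero[OF e0_closed])
  finally show "c = \<zero> \<or> d = \<zero>"
    using rmult_integral[OF P smul_in_V[OF cd(2) e0_closed] smul_in_V[OF cd(3) e0_closed]] eq cd(2,3) by blast
qed

lemma hom_h_pow: "(\<theta> ^^ j) h = kappa (q ^ j) \<otimes> h"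
proof (induction j)
  case 0
  show ?case using h_closed by (simp add: kappa_1)
next
  case (Suc j)
  have "(\<theta> ^^ Suc j) h = kappa (q ^ j) \<otimes> (kappa q \<otimes> h)"
    using Suc.IH ring_hom_mult[OF hom kappa_closed h_closed, of "q ^ j"] kappa_fixed h_hom by simp
  also have "\<dots> = kappa (q ^ Suc j) \<otimes> h"
    unfolding power_Suc2 kappa_mult by (rule m_assoc[OF kappa_closed kappa_closed h_closed, symmetric])
  finally show ?case .
qed

lemma h_unit: "h \<in> Units R"
proof -
  have "h [^] n \<in> Units R" unfolding h_pow by (rule iota_unit[OF Cen_hn h_notin])
  moreover obtain m where "n = Suc m" using n_pos by (cases n) auto
  ultimately show ?thesis using h_closed prod_unit_r[of "h [^] m" h] Units_closed
    by (metis m_comm nat_pow_Suc nat_pow_closed unit_factor)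
qed

text \<open>\<theta>^j(h) = q^j h differs from h for 0 < j < n, because h is a unit and
  \<open>kappa\<close> sends the nonzero constant q^j - 1 to a nonzero element.\<close>

lemma cyclic:
  assumes "field R"
  shows "cyclic_data R \<theta> n a h"
proof -
  interpret F: field R by fact
  show ?thesis
  proof unfold_locales
    show "h \<in> carrier R" by (rule h_closed)
    show "a \<noteq> \<zero>" using a_unit F.field_Units by blast
    fix j :: nat assume j: "0 < j" "j < n"
    show "(\<theta> ^^ j) h \<noteq> h"
    proof
      assume "(\<theta> ^^ j) h = h"
      hence "kappa (q ^ j) \<otimes> h = \<one> \<otimes> h" unfolding hom_h_pow using h_closed by simp
      hence k: "kappa (q ^ j) = \<one>"
        using h_unit kappa_closed h_closed m_comm by (metis Units_l_cancel one_closed)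
      have "kappa (q ^ j - 1) \<oplus> kappa 1 = kappa (q ^ j)" unfolding kappa_add[symmetric] by simp
      hence "kappa (q ^ j - 1) = \<zero>" unfolding k kappa_1 using kappa_closed by (simp add: add.r_cancel_one')
      thus False using kappa_nonzero[of "q ^ j - 1"] prim[OF j] by simp
    qed
  qed
qed

text \<open>If u v lies in the kernel while u and v do not, the left annihilator of
  \<open>hat v\<close> is a left ideal that contains \<open>hat u\<close> but not 1; such an ideal
  yields a matrix of the excluded kind.\<close>

lemma cprime_hat:
  assumes F: "field R"
    and min: "\<And>d M. 1 \<le> d \<Longrightarrow> d < n \<Longrightarrow> d dvd n \<Longrightarrow> M \<in> mats R d \<Longrightarrow> twisted_power R d \<theta> M n \<noteq> scalar_mat R d a"
  shows "cprime {u. hat u = \<zero>\<^bsub>V n\<^esub>}"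
  unfolding cprime_def
proof (intro conjI allI impI tideal_hat)
  interpret C: cyclic_data R \<theta> n a h by (rule cyclic[OF F])
  show "1 \<notin> {u. hat u = \<zero>\<^bsub>V n\<^esub>}" using e0_nonzero by (simp add: hat_one)
  fix u v assume uv: "u * v \<in> {u. hat u = \<zero>\<^bsub>V n\<^esub>}"
  show "u \<in> {u. hat u = \<zero>\<^bsub>V n\<^esub>} \<or> v \<in> {u. hat u = \<zero>\<^bsub>V n\<^esub>}"
  proof (rule ccontr)
    assume "\<not> ?thesis"
    hence ne: "hat u \<noteq> \<zero>\<^bsub>V n\<^esub>" "hat v \<noteq> \<zero>\<^bsub>V n\<^esub>" by auto
    define L where "L = {b \<in> carrier (V n). rmult (hat v) b = \<zero>\<^bsub>V n\<^esub>}"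
    have "shift_subspace L"
    proof (rule C.shift_subspaceI)
      fix b c e assume "b \<in> L" "c \<in> L"
      thus "b \<oplus>\<^bsub>V n\<^esub> c \<in> L" by (simp add: L_def rmult_add[OF hat_closed])
    next
      fix b e assume "e \<in> carrier R" "b \<in> L"
      thus "smul R e b \<in> L" by (simp add: L_def rmult_smul[OF hat_closed] smul_in_V) (simp add: smul_def V_simps)
    next
      fix b assume b: "b \<in> L"
      have "shift \<zero>\<^bsub>V n\<^esub> = \<zero>\<^bsub>V n\<^esub>" using hat_x[of 0] by (simp add: hat_0)
      thus "shift b \<in> L" using b by (simp add: L_def rmult_shift[OF hat_closed] shift_in)
    qed (auto simp: L_def rmult_0[OF hat_closed])
    moreover have "L \<noteq> carrier (V n)"
    proof
      assume "L = carrier (V n)"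
      hence "e0 \<in> L" using e0_closed by simp
      thus False using ne(2) rmult_unit[OF hat_closed] by (simp add: L_def)
    qed
    moreover have "hat u \<in> L" using uv hat_closed by (simp add: L_def hat_mult)
    ultimately show False using C.divisor_of_proper_subspace[of L] ne(1) min by blast
  qed
qed

text \<open>A solution of size d < n gives a proper nonzero left ideal. In a domain right
  multiplication by a nonzero element of it is injective, which makes the ideal everything.\<close>

lemma no_small_matrix:
  assumes F: "field R" and P: "cprime {u. hat u = \<zero>\<^bsub>V n\<^esub>}" and d: "1 \<le> d" "d < n" and M: "M \<in> mats R d"
  shows "twisted_power R d \<theta> M n \<noteq> scalar_mat R d a"
proof
  interpret C: cyclic_data R \<theta> n a h by (rule cyclic[OF F])
  assume "twisted_power R d \<theta> M n = scalar_mat R d a"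
  then obtain L where L: "shift_subspace L" "L \<noteq> carrier (V n)" "L \<noteq> {\<zero>\<^bsub>V n\<^esub>}"
    using C.proper_subspace_of_matrix[OF M _ d] by blast
  note Ls = subspaceD[OF shift_subspaceD(1)[OF L(1)]]
  obtain u where u: "u \<in> L" "u \<noteq> \<zero>\<^bsub>V n\<^esub>" using L(3) Ls(2) by blast
  hence "u \<in> carrier (V n)" using Ls(1) by blast
  hence "L = carrier (V n)" using C.shift_subspace_full[OF L(1) u(1)] rmult_integral[OF P _ _ _ u(2)] by blast
  thus False using L(2) by blast
qed

text \<open>The whole algebra is a left ideal of dimension n. So n belongs to the set of sizes whose
  minimum is taken.\<close>

lemma full_matrix:
  assumes F: "field R"
  shows "\<exists>M\<in>mats R n. twisted_power R n \<theta> M n = scalar_mat R n a"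
proof -
  interpret C: cyclic_data R \<theta> n a h by (rule cyclic[OF F])
  show ?thesis by (rule C.shift_subspace_matrix[OF C.shift_subspace_carrier C.V_dimension[OF n_pos]])
qed

end

section \<open>Completely prime ideals of the quotient\<close>

text \<open>If two ideals are not inside \<open>P\<close>, elements of theirs outside
  \<open>P\<close> have a product outside \<open>P\<close>; thus the condition on elements yields
  the one on ideals.\<close>

lemma (in ring) Spec_c_iff:
  "P \<in> Spec_c R \<longleftrightarrow> ideal P R \<and> \<one> \<notin> P \<and> (\<forall>a\<in>carrier R. \<forall>b\<in>carrier R. a \<otimes> b \<in> P \<longrightarrow> a \<in> P \<or> b \<in> P)"
proof (cases "ideal P R")
  case False
  thus ?thesis by (simp add: Spec_c_def nc_prime_ideal_def)
next
  case I: True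
  interpret I: ideal P R by fact
  have z: "P +> a = P \<longleftrightarrow> a \<in> P" if "a \<in> carrier R" for a
    using a_rcos_zero[OF I] I.rcos_const_imp_mem[OF that] by blast
  have carr: "carrier (R Quot P) = {P +> a | a. a \<in> carrier R}"
    unfolding FactRing_def A_RCOSETS_def' by auto
  have zero: "\<zero>\<^bsub>R Quot P\<^esub> = P" by (simp add: FactRing_def)
  have one: "\<one>\<^bsub>R Quot P\<^esub> = P +> \<one>" by (simp add: FactRing_def)
  have mult: "(P +> a) \<otimes>\<^bsub>R Quot P\<^esub> (P +> b) = P +> a \<otimes> b" if "a \<in> carrier R" "b \<in> carrier R" for a b
    using ring_hom_mult[OF I.rcos_ring_hom that] by simp
  have "nc_domain (R Quot P) \<longleftrightarrow> \<one> \<notin> P \<and> (\<forall>a\<in>carrier R. \<forall>b\<in>carrier R. a \<otimes> b \<in> P \<longrightarrow> a \<in> P \<or> b \<in> P)"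
  proof -
    have "(\<forall>x\<in>carrier (R Quot P). \<forall>y\<in>carrier (R Quot P). x \<otimes>\<^bsub>R Quot P\<^esub> y = P \<longrightarrow> x = P \<or> y = P) \<longleftrightarrow>
      (\<forall>a\<in>carrier R. \<forall>b\<in>carrier R. (P +> a) \<otimes>\<^bsub>R Quot P\<^esub> (P +> b) = P \<longrightarrow> P +> a = P \<or> P +> b = P)"
      unfolding carr by blast
    also have "\<dots> \<longleftrightarrow> (\<forall>a\<in>carrier R. \<forall>b\<in>carrier R. a \<otimes> b \<in> P \<longrightarrow> a \<in> P \<or> b \<in> P)"
      by (simp add: mult z)
    finally show ?thesis unfolding nc_domain_def zero one z[OF one_closed] using I.quotient_is_ring by blast
  qed
  moreover have "nc_prime_ideal P R"
    if one: "\<one> \<notin> P" and pr: "\<forall>a\<in>carrier R. \<forall>b\<in>carrier R. a \<otimes> b \<in> P \<longrightarrow> a \<in> P \<or> b \<in> P"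
    unfolding nc_prime_ideal_def
  proof (intro conjI allI impI I)
    show "P \<noteq> carrier R" using one by auto
    fix I' J assume IJ: "ideal I' R" "ideal J R" "ideal_prod R I' J \<subseteq> P"
    show "I' \<subseteq> P \<or> J \<subseteq> P"
    proof (rule ccontr)
      assume "\<not> ?thesis"
      then obtain i j where ij: "i \<in> I'" "i \<notin> P" "j \<in> J" "j \<notin> P" by blast
      have "i \<otimes> j \<in> P" using ideal_prod.prod[OF ij(1,3)] IJ(3) by blast
      thus False using pr ij ideal.Icarr[OF IJ(1) ij(1)] ideal.Icarr[OF IJ(2) ij(3)] by blast
    qed
  qed
  ultimately show ?thesis unfolding Spec_c_def using I by blast
qed

section \<open>From the free algebra to \<open>A1\<close> and its centre\<close>

lemma Free_simps:
  "carrier Free = UNIV" "monoid.mult Free u v = u * v" "\<one>\<^bsub>Free\<^esub> = 1" "\<zero>\<^bsub>Free\<^esub> = 0" "add Free u v = u + v"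
  by (simp_all add: Free_def ring_of_type_algebra_def)

lemma Free_ring: "ring (Free :: 'k::field free_alg ring)"
proof -
  have "\<exists>y. x + y = 0" for x :: "'k free_alg" using add.right_inverse by blast
  thus ?thesis
    unfolding Free_def ring_of_type_algebra_def using add.right_inverse
    by unfold_locales (auto simp: algebra_simps Units_def)
qed

interpretation Free: ring "Free :: 'k::field free_alg ring" by (rule Free_ring)

lemma Free_minus: "a_inv Free u = - u" "a_minus Free u v = u - v"
proof -
  show *: "a_inv Free u = - u" for u :: "'k::field free_alg"
    by (rule Free.minus_equality) (simp_all add: Free_simps)
  show "a_minus Free u v = u - v" by (simp add: a_minus_def * Free_simps)
qed

lemma ideal_Free_iff: "ideal J Free \<longleftrightarrow> tideal J"
proof
  assume "ideal J Free"
  then interpret J: ideal J Free .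
  show "tideal J"
    unfolding tideal_def
    using J.zero_closed J.a_closed J.I_l_closed J.I_r_closed by (auto simp: Free_simps)
next
  assume J: "tideal J"
  show "ideal J Free"
  proof (rule idealI[OF Free_ring])
    show "subgroup J (add_monoid Free)"
      using tidealD[OF J] by (intro Free.add.subgroupI) (auto simp: Free_simps Free_minus a_inv_def[symmetric])
  qed (auto simp: Free_simps tidealD(3,4)[OF J])
qed

context qroot
begin

abbreviation cls :: "'k free_alg \<Rightarrow> 'k free_alg set" where "cls \<equiv> A1_class q"

text \<open>The operators satisfy the relation, which gives one inclusion; the other is faithfulness
  of the action, \<open>rep_0_mem\<close>.\<close>

lemma qweyl_ideal_eq: "qweyl_ideal q = kers"
proof
  show "qweyl_ideal q \<subseteq> kers"
    unfolding qweyl_ideal_def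
    by (rule Free.genideal_minimal) (auto simp: ideal_Free_iff tideal_ker rep_qrel[unfolded qrel_def])
  have "ideal (qweyl_ideal q) Free" unfolding qweyl_ideal_def by (rule Free.genideal_ideal) (simp add: Free_simps)
  hence t: "tideal (qweyl_ideal q)" by (simp add: ideal_Free_iff)
  have "qrel q \<in> qweyl_ideal q"
    unfolding qweyl_ideal_def qrel_def using Free.genideal_self[of "{_}"] by (simp add: Free_simps)
  thus "kers \<subseteq> qweyl_ideal q" using rep_0_mem[OF t] by blast
qed

lemma kers_ideal: "ideal kers (Free :: 'k free_alg ring)"
  by (simp add: ideal_Free_iff tideal_ker)

lemma A1_eq: "A1 q = Free Quot kers" and cls_eq: "cls u = kers +>\<^bsub>Free\<^esub> u"
  by (simp_all add: A1_def A1_class_def qweyl_ideal_eq)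

sublocale A: ring "A1 q"
  unfolding A1_eq by (rule ideal.quotient_is_ring[OF kers_ideal])

lemma cls_iff: "cls u = cls v \<longleftrightarrow> rep q u = rep q v"
  unfolding cls_eq
  using Free.quotient_eq_iff_same_a_r_cos[OF kers_ideal, of u v] by (simp add: Free_simps Free_minus rep_simps)

lemma cls_hom: "cls \<in> Ring.ring_hom Free (A1 q)"
  unfolding A1_eq cls_eq[abs_def] by (rule ideal.rcos_ring_hom[OF kers_ideal])

lemma cls_add: "cls u \<oplus>\<^bsub>A1 q\<^esub> cls v = cls (u + v)"
  and cls_mult: "cls u \<otimes>\<^bsub>A1 q\<^esub> cls v = cls (u * v)"
  and cls_one: "\<one>\<^bsub>A1 q\<^esub> = cls 1"
  using ring_hom_add[OF cls_hom, of u v] ring_hom_mult[OF cls_hom, of u v] ring_hom_one[OF cls_hom]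
  by (simp_all add: Free_simps)

lemma cls_zero: "\<zero>\<^bsub>A1 q\<^esub> = cls 0"
  using ring_hom_zero[OF cls_hom Free_ring A.ring_axioms] by (simp add: Free_simps)

lemma cls_pow: "cls u [^]\<^bsub>A1 q\<^esub> (m::nat) = cls (u ^ m)"
  by (induction m) (simp_all add: cls_one cls_mult power_Suc2 del: power_Suc)

lemma carrier_A1: "carrier (A1 q) = range cls"
  unfolding A1_eq cls_eq[abs_def] FactRing_def A_RCOSETS_def' by (auto simp: Free_simps)

text \<open>Allows ideals of the quotient to be studied through their preimages, where no carrier
  has to be kept track of.\<close>

lemma ideal_A1_iff: "ideal P (A1 q) \<longleftrightarrow> P \<subseteq> range cls \<and> tideal (cls -` P)"
proof
  assume "ideal P (A1 q)"
  then interpret P: ideal P "A1 q" .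
  have "P \<subseteq> range cls" using P.a_subset carrier_A1 by simp
  moreover have "tideal (cls -` P)"
    unfolding tideal_def
  proof (intro conjI ballI allI)
    show "0 \<in> cls -` P" using P.zero_closed by (simp add: cls_zero)
    fix u v assume "u \<in> cls -` P" "v \<in> cls -` P"
    thus "u + v \<in> cls -` P" using P.a_closed[of "cls u" "cls v"] by (simp add: cls_add)
  next
    fix u w assume "u \<in> cls -` P"
    thus "w * u \<in> cls -` P" "u * w \<in> cls -` P"
      using P.I_l_closed[of "cls u" "cls w"] P.I_r_closed[of "cls u" "cls w"] by (simp_all add: cls_mult carrier_A1)
  qed
  ultimately show "P \<subseteq> range cls \<and> tideal (cls -` P)" ..
next
  assume P: "P \<subseteq> range cls \<and> tideal (cls -` P)"
  note tP = tidealD[OF conjunct2[OF P]]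
  have ex: "\<exists>u. x = cls u \<and> u \<in> cls -` P" if "x \<in> P" for x using that P by auto
  show "ideal P (A1 q)"
  proof (rule idealI[OF A.ring_axioms])
    show "subgroup P (add_monoid (A1 q))"
    proof (rule A.add.subgroupI)
      show "P \<subseteq> carrier (A1 q)" using P carrier_A1 by simp
      show "P \<noteq> {}" using tP(1) by auto
      fix x y assume x: "x \<in> P" and y: "y \<in> P"
      obtain u v where u: "x = cls u" "u \<in> cls -` P" and v: "y = cls v" "v \<in> cls -` P" using ex[OF x] ex[OF y] by blast
      show "x \<oplus>\<^bsub>A1 q\<^esub> y \<in> P" using tP(2)[OF u(2) v(2)] by (simp add: u(1) v(1) cls_add)
    next
      fix x assume x: "x \<in> P"
      obtain u where u: "x = cls u" "u \<in> cls -` P" using ex[OF x] by blast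
      have "a_inv (A1 q) (cls u) = cls (- u)"
        by (rule A.minus_equality) (simp_all add: cls_add cls_zero carrier_A1)
      thus "\<ominus>\<^bsub>A1 q\<^esub> x \<in> P" using tP(5)[OF u(2)] by (simp add: u(1))
    qed
    fix x y assume x: "x \<in> P" and "y \<in> carrier (A1 q)"
    then obtain u v where u: "x = cls u" "u \<in> cls -` P" "y = cls v" using ex[OF x] carrier_A1 by auto
    show "y \<otimes>\<^bsub>A1 q\<^esub> x \<in> P" "x \<otimes>\<^bsub>A1 q\<^esub> y \<in> P"
      using tP(3,4)[OF u(2), of v] by (simp_all add: u(1,3) cls_mult)
  qed
qed

lemma Spec_c_A1_iff: "P \<in> Spec_c (A1 q) \<longleftrightarrow> P \<subseteq> range cls \<and> cprime (cls -` P)"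
  unfolding A.Spec_c_iff ideal_A1_iff cprime_def carrier_A1 by (auto simp: cls_one cls_mult)

lemma kers_vimage: "tideal (cls -` P) \<Longrightarrow> kers \<subseteq> cls -` P"
proof
  fix u assume t: "tideal (cls -` P)" and "u \<in> kers"
  hence "cls u = cls 0" by (simp add: cls_iff rep_simps)
  thus "u \<in> cls -` P" using tidealD(1)[OF t] by simp
qed

lemma vimage_image:
  assumes Q: "tideal Q" "kers \<subseteq> Q"
  shows "cls -` cls ` Q = Q"
proof (intro equalityI subsetI)
  fix u assume "u \<in> cls -` cls ` Q"
  then obtain v where "v \<in> Q" "cls u = cls v" by auto
  thus "u \<in> Q" using mem_cong[OF Q, of v u] cls_iff[of u v] by simp
qed simp

lemma image_vimage: "P \<subseteq> range cls \<Longrightarrow> cls ` (cls -` P) = P"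
  by auto

text \<open>Reduces the computation of a generated ideal of \<open>A1\<close> to a minimality
  statement in the free algebra, as supplied by \<open>laurent_ker_minimal\<close> and
  \<open>point_ideal_facts\<close>.\<close>

lemma Idl_cls:
  assumes Q: "tideal Q" "kers \<subseteq> Q" "S \<subseteq> Q"
    and least: "\<And>J. tideal J \<Longrightarrow> kers \<subseteq> J \<Longrightarrow> S \<subseteq> J \<Longrightarrow> Q \<subseteq> J"
  shows "Idl\<^bsub>A1 q\<^esub> (cls ` S) = cls ` Q"
proof
  have "ideal (cls ` Q) (A1 q)" unfolding ideal_A1_iff vimage_image[OF Q(1,2)] using Q(1) by auto
  thus "Idl\<^bsub>A1 q\<^esub> (cls ` S) \<subseteq> cls ` Q" using Q(3) by (intro A.genideal_minimal) auto
  have sub: "cls ` S \<subseteq> carrier (A1 q)" using carrier_A1 by auto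
  have t: "tideal (cls -` (Idl\<^bsub>A1 q\<^esub> (cls ` S)))" using A.genideal_ideal[OF sub] by (simp add: ideal_A1_iff)
  have "S \<subseteq> cls -` (Idl\<^bsub>A1 q\<^esub> (cls ` S))" using A.genideal_self[OF sub] by blast
  hence "Q \<subseteq> cls -` (Idl\<^bsub>A1 q\<^esub> (cls ` S))" by (rule least[OF t kers_vimage[OF t]])
  thus "cls ` Q \<subseteq> Idl\<^bsub>A1 q\<^esub> (cls ` S)" by blast
qed

lemma A1_h_cls: "A1_h q = cls fh"
  by (simp add: A1_h_def A1_y_def A1_x_def A1_const_def cls_add cls_mult fh_def c0_def)

lemma A1_poly_cls: "A1_poly q f = cls (fx.ev f)"
  by (simp add: A1_poly_def fx.ev_def)

lemma A1_t_cls: "A1_t q n = cls (free_x ^ n)" and A1_r_cls: "A1_r q n = cls (free_y ^ n)"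
  and A1_s_cls: "A1_s q n = cls (fh ^ n)" and A1_const_cls: "A1_const q c = cls (free_const c)"
  by (simp_all add: A1_t_def A1_r_def A1_s_def A1_x_def A1_y_def A1_h_cls cls_pow A1_const_def)

lemma zero_ideal: "{\<zero>\<^bsub>A1 q\<^esub>} = cls ` kers"
proof -
  have "cls u = cls 0" if "u \<in> kers" for u using that by (simp add: cls_iff rep_simps)
  moreover have "0 \<in> kers" by (simp add: rep_simps)
  ultimately show ?thesis unfolding cls_zero by blast
qed

lemma carrier_Z1: "carrier (Z1 q) = cls ` Cen"
proof -
  have "(\<forall>a\<in>carrier (A1 q). cls u \<otimes>\<^bsub>A1 q\<^esub> a = a \<otimes>\<^bsub>A1 q\<^esub> cls u) \<longleftrightarrow> u \<in> Cen" for u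
    unfolding carrier_A1 Cen_def by (simp add: cls_mult cls_iff rep_simps)
  hence "{z \<in> range cls. \<forall>a\<in>carrier (A1 q). z \<otimes>\<^bsub>A1 q\<^esub> a = a \<otimes>\<^bsub>A1 q\<^esub> z} = cls ` Cen" by blast
  thus ?thesis by (simp add: Z1_def ring_center_def carrier_A1)
qed

lemma Z1_simps: "monoid.mult (Z1 q) = monoid.mult (A1 q)" "add (Z1 q) = add (A1 q)"
  "\<one>\<^bsub>Z1 q\<^esub> = \<one>\<^bsub>A1 q\<^esub>" "\<zero>\<^bsub>Z1 q\<^esub> = \<zero>\<^bsub>A1 q\<^esub>"
  by (simp_all add: Z1_def ring_center_def)

lemma Z1_cring: "cring (Z1 q)"
proof -
  let ?C = "{z \<in> carrier (A1 q). \<forall>a \<in> carrier (A1 q). z \<otimes>\<^bsub>A1 q\<^esub> a = a \<otimes>\<^bsub>A1 q\<^esub> z}"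
  have C: "?C = cls ` Cen" using carrier_Z1 by (simp add: Z1_def ring_center_def)
  have inv: "a_inv (A1 q) (cls u) = cls (- u)" for u
    by (rule A.minus_equality) (simp_all add: cls_add cls_zero carrier_A1)
  have neg: "- u \<in> Cen" if "u \<in> Cen" for u using Cen_mult[OF Cen_const[of "-1"] that] by (simp add: free.C_uminus free.C_1)
  have "subring (cls ` Cen) (A1 q)"
    using Cen_one Cen_add Cen_mult neg by (intro A.subringI) (auto simp: carrier_A1 cls_one cls_mult cls_add inv)
  hence "subcring (cls ` Cen) (A1 q)"
  proof (rule A.subcringI)
    fix x y assume "x \<in> cls ` Cen" "y \<in> cls ` Cen"
    then obtain u v where u: "x = cls u" "u \<in> Cen" and v: "y = cls v" by blast
    show "x \<otimes>\<^bsub>A1 q\<^esub> y = y \<otimes>\<^bsub>A1 q\<^esub> x"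
      unfolding u(1) v cls_mult cls_iff by (simp add: rep_simps CenD[OF u(2)])
  qed
  moreover have "cls ` Cen \<subseteq> carrier (A1 q)" unfolding carrier_A1 by blast
  ultimately have "cring (A1 q\<lparr>carrier := cls ` Cen\<rparr>)" using A.subcring_iff by blast
  thus ?thesis unfolding Z1_def ring_center_def C .
qed

end

section \<open>The residue field and the radical extension\<close>

context qroot
begin

lemma Cen_uminus: "u \<in> Cen \<Longrightarrow> - u \<in> Cen"
  using Cen_mult[OF Cen_const[of "-1"], of u] by (simp add: free.C_uminus free.C_1)

lemma Z1_prime_contraction:
  assumes P: "P \<in> Spec_c (A1 q)"
  shows "primeideal (P \<inter> cls ` Cen) (Z1 q)"
proof -
  interpret Z: cring "Z1 q" by (rule Z1_cring)
  have cp: "cprime (cls -` P)" using P Spec_c_A1_iff by blast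
  note t = tidealD[OF cprimeD(1)[OF cp]]
  have inv: "\<ominus>\<^bsub>Z1 q\<^esub> (cls u) = cls (- u)" if "u \<in> Cen" for u
    by (rule Z.minus_equality) (use that in \<open>simp_all add: carrier_Z1 Z1_simps cls_add cls_zero Cen_uminus\<close>)
  show ?thesis
  proof (rule primeidealI)
    show "ideal (P \<inter> cls ` Cen) (Z1 q)"
    proof (rule idealI[OF Z.ring_axioms])
      show "subgroup (P \<inter> cls ` Cen) (add_monoid (Z1 q))"
      proof (rule Z.add.subgroupI)
        show "P \<inter> cls ` Cen \<subseteq> carrier (Z1 q)" using carrier_Z1 by simp
        have "cls 0 \<in> P \<inter> cls ` Cen" using t(1) Cen_zero by simp
        thus "P \<inter> cls ` Cen \<noteq> {}" by blast
        fix x assume "x \<in> P \<inter> cls ` Cen"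
        then obtain u where u: "x = cls u" "u \<in> Cen" "u \<in> cls -` P" by auto
        show "\<ominus>\<^bsub>Z1 q\<^esub> x \<in> P \<inter> cls ` Cen" unfolding u(1) inv[OF u(2)] using t(5)[OF u(3)] Cen_uminus[OF u(2)] by simp
        fix y assume "y \<in> P \<inter> cls ` Cen"
        then obtain v where v: "y = cls v" "v \<in> Cen" "v \<in> cls -` P" by auto
        show "x \<oplus>\<^bsub>Z1 q\<^esub> y \<in> P \<inter> cls ` Cen"
          unfolding u(1) v(1) Z1_simps cls_add using t(2)[OF u(3) v(3)] Cen_add[OF u(2) v(2)] by simp
      qed
      fix x y assume "x \<in> P \<inter> cls ` Cen" "y \<in> carrier (Z1 q)"
      then obtain u v where u: "x = cls u" "u \<in> Cen" "u \<in> cls -` P" and v: "y = cls v" "v \<in> Cen"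
        unfolding carrier_Z1 by auto
      show "y \<otimes>\<^bsub>Z1 q\<^esub> x \<in> P \<inter> cls ` Cen" "x \<otimes>\<^bsub>Z1 q\<^esub> y \<in> P \<inter> cls ` Cen"
        unfolding u(1) v(1) Z1_simps cls_mult
        using t(3,4)[OF u(3), of v] Cen_mult[OF u(2) v(2)] Cen_mult[OF v(2) u(2)] by simp_all
    qed
    have "cls 1 \<notin> P" using cprimeD(2)[OF cp] by simp
    thus "carrier (Z1 q) \<noteq> P \<inter> cls ` Cen" using Cen_one unfolding carrier_Z1 by blast
    fix x y assume "x \<in> carrier (Z1 q)" "y \<in> carrier (Z1 q)" and xy: "x \<otimes>\<^bsub>Z1 q\<^esub> y \<in> P \<inter> cls ` Cen"
    then obtain u v where u: "x = cls u" "u \<in> Cen" and v: "y = cls v" "v \<in> Cen" unfolding carrier_Z1 by auto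
    have "u * v \<in> cls -` P" using xy unfolding u(1) v(1) Z1_simps cls_mult by simp
    thus "x \<in> P \<inter> cls ` Cen \<or> y \<in> P \<inter> cls ` Cen" using cprimeD(3)[OF cp, of u v] u v by auto
  qed (rule Z1_cring)
qed

end

locale residue = qroot q n for q :: "'k::field" and n +
  fixes p :: "'k free_alg set set"
  assumes prime: "primeideal p (Z1 q)"
begin

sublocale p: primeideal p "Z1 q" by (rule prime)

sublocale D: domain "Z1 q Quot p" by (rule p.quotient_is_domain)

sublocale K: field "kp q p" unfolding kp_def by (rule D.fraction_field)

definition Pz :: "'k free_alg set" where "Pz = {u \<in> Cen. cls u \<in> p}"

lemma p_eq: "p = cls ` Pz"
  using p.a_subset unfolding carrier_Z1 Pz_def by auto

lemma zero_in_p: "cls 0 \<in> p"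
  using additive_subgroup.zero_closed[OF ideal.axioms(1)[OF p.is_ideal]] by (simp add: Z1_simps cls_zero)

lemma kp_of_hom: "kp_of q p \<in> Ring.ring_hom (Z1 q) (kp q p)"
proof -
  have "(\<lambda>z. fraction (Z1 q Quot p) z \<one>\<^bsub>Z1 q Quot p\<^esub>) \<circ> ((+>\<^bsub>Z1 q\<^esub>) p) \<in> Ring.ring_hom (Z1 q) (fraction_field (Z1 q Quot p))"
    by (rule ring_hom_trans[OF p.rcos_ring_hom D.fraction_hom])
  thus ?thesis unfolding kp_def comp_def kp_of_def[abs_def] .
qed

text \<open>The canonical map from the centre to k(p), evaluated on representatives in the free
  algebra.\<close>

definition kz :: "'k free_alg \<Rightarrow> 'k kfield" where "kz u = kp_of q p (cls u)"

lemma kz_closed: "u \<in> Cen \<Longrightarrow> kz u \<in> carrier (kp q p)"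
  unfolding kz_def using ring_hom_closed[OF kp_of_hom] carrier_Z1 by blast

lemma kz_add: "u \<in> Cen \<Longrightarrow> v \<in> Cen \<Longrightarrow> kz (u + v) = kz u \<oplus>\<^bsub>kp q p\<^esub> kz v"
  unfolding kz_def using ring_hom_add[OF kp_of_hom, of "cls u" "cls v"] by (simp add: carrier_Z1 Z1_simps cls_add)

lemma kz_mult: "u \<in> Cen \<Longrightarrow> v \<in> Cen \<Longrightarrow> kz (u * v) = kz u \<otimes>\<^bsub>kp q p\<^esub> kz v"
  unfolding kz_def using ring_hom_mult[OF kp_of_hom, of "cls u" "cls v"] by (simp add: carrier_Z1 Z1_simps cls_mult)

lemma kz_one: "kz 1 = \<one>\<^bsub>kp q p\<^esub>"
  unfolding kz_def using ring_hom_one[OF kp_of_hom] by (simp add: Z1_simps cls_one)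

lemma kz_eq_0: "u \<in> Cen \<Longrightarrow> kz u = \<zero>\<^bsub>kp q p\<^esub> \<longleftrightarrow> u \<in> Pz"
proof -
  assume u: "u \<in> Cen"
  hence c: "cls u \<in> carrier (Z1 q)" using carrier_Z1 by blast
  have d: "p +>\<^bsub>Z1 q\<^esub> cls u \<in> carrier (Z1 q Quot p)" by (rule ring_hom_closed[OF p.rcos_ring_hom c])
  have "kz u = \<zero>\<^bsub>kp q p\<^esub> \<longleftrightarrow> p +>\<^bsub>Z1 q\<^esub> cls u = \<zero>\<^bsub>Z1 q Quot p\<^esub>"
    unfolding kz_def kp_of_def kp_def by (rule D.fraction_eq_0[OF d])
  also have "\<zero>\<^bsub>Z1 q Quot p\<^esub> = p" by (simp add: FactRing_def)
  also have "p +>\<^bsub>Z1 q\<^esub> cls u = p \<longleftrightarrow> cls u \<in> p"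
    using p.a_rcos_zero[OF p.is_ideal] p.rcos_const_imp_mem[OF c] by blast
  finally show ?thesis using u by (simp add: Pz_def)
qed

lemma kz_denominator:
  assumes k: "k \<in> carrier (kp q p)"
  shows "\<exists>z\<in>Cen - Pz. \<exists>w\<in>Cen. kz z \<otimes>\<^bsub>kp q p\<^esub> k = kz w"
proof -
  obtain a b where ab: "a \<in> carrier (Z1 q Quot p)" "b \<in> carrier (Z1 q Quot p)" "b \<noteq> \<zero>\<^bsub>Z1 q Quot p\<^esub>"
    "k \<otimes>\<^bsub>kp q p\<^esub> fraction (Z1 q Quot p) b \<one>\<^bsub>Z1 q Quot p\<^esub> = fraction (Z1 q Quot p) a \<one>\<^bsub>Z1 q Quot p\<^esub>"
    using D.fraction_denominator[of k] k unfolding kp_def by blast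
  have ex: "\<exists>w\<in>Cen. c = p +>\<^bsub>Z1 q\<^esub> cls w" if "c \<in> carrier (Z1 q Quot p)" for c
    using that carrier_Z1 unfolding FactRing_def A_RCOSETS_def' by auto
  obtain w z where w: "w \<in> Cen" "a = p +>\<^bsub>Z1 q\<^esub> cls w" and z: "z \<in> Cen" "b = p +>\<^bsub>Z1 q\<^esub> cls z"
    using ex[OF ab(1)] ex[OF ab(2)] by blast
  have kzz: "kz z = fraction (Z1 q Quot p) b \<one>\<^bsub>Z1 q Quot p\<^esub>" unfolding kz_def kp_of_def z(2) ..
  have "kz z \<noteq> \<zero>\<^bsub>kp q p\<^esub>" unfolding kzz kp_def D.fraction_eq_0[OF ab(2)] by (rule ab(3))
  hence "z \<in> Cen - Pz" using kz_eq_0[OF z(1)] z(1) by blast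
  moreover have "kz z \<otimes>\<^bsub>kp q p\<^esub> k = kz w"
    unfolding K.m_comm[OF kz_closed[OF z(1)] k] using ab(4) unfolding kzz w(2) kz_def[of w] kp_of_def .
  ultimately show ?thesis using w(1) by blast
qed

lemma Pz_prime: "u \<in> Cen - Pz \<Longrightarrow> v \<in> Cen - Pz \<Longrightarrow> u * v \<in> Cen - Pz"
  using kz_eq_0[of u] kz_eq_0[of v] kz_eq_0[of "u * v"] kz_mult[of u v] K.integral[of "kz u" "kz v"]
    kz_closed[of u] kz_closed[of v] Cen_mult[of u v] by auto

lemma one_Pz: "1 \<in> Cen - Pz"
  using kz_one kz_eq_0[OF Cen_one] K.one_not_zero Cen_one by auto

text \<open>Denominators are multiplied together; the product stays outside p because p is
  prime.\<close>

lemma common_denominator: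
  assumes "finite A" "\<And>i. i \<in> A \<Longrightarrow> k i \<in> carrier (kp q p)"
  shows "\<exists>z\<in>Cen - Pz. \<forall>i\<in>A. \<exists>w\<in>Cen. kz z \<otimes>\<^bsub>kp q p\<^esub> k i = kz w"
  using assms
proof (induction A)
  case empty
  show ?case using one_Pz by blast
next
  case (insert j A)
  obtain z where z: "z \<in> Cen - Pz" "\<And>i. i \<in> A \<Longrightarrow> \<exists>w\<in>Cen. kz z \<otimes>\<^bsub>kp q p\<^esub> k i = kz w" using insert by blast
  obtain y w where y: "y \<in> Cen - Pz" "w \<in> Cen" "kz y \<otimes>\<^bsub>kp q p\<^esub> k j = kz w"
    using kz_denominator[of "k j"] insert.prems by blast
  have zc: "z \<in> Cen" and yc: "y \<in> Cen" using z y by auto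
  note cl = kz_closed[OF zc] kz_closed[OF yc]
  have "\<exists>w\<in>Cen. kz (z * y) \<otimes>\<^bsub>kp q p\<^esub> k i = kz w" if i: "i \<in> insert j A" for i
  proof (cases "i = j")
    case True
    have "kz (z * y) \<otimes>\<^bsub>kp q p\<^esub> k j = kz (z * w)"
      unfolding kz_mult[OF zc yc] kz_mult[OF zc y(2)] y(3)[symmetric]
      using cl insert.prems[of j] by (simp add: K.m_assoc)
    thus ?thesis using True Cen_mult[OF zc y(2)] by blast
  next
    case False
    then obtain w' where w': "w' \<in> Cen" "kz z \<otimes>\<^bsub>kp q p\<^esub> k i = kz w'" using z(2)[of i] i by blast
    have "kz (z * y) \<otimes>\<^bsub>kp q p\<^esub> k i = kz (y * w')"
      unfolding kz_mult[OF zc yc] kz_mult[OF yc w'(1)] w'(2)[symmetric]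
      using cl insert.prems[OF i] by (simp add: K.m_comm[OF cl] K.m_assoc)
    thus ?thesis using Cen_mult[OF yc w'(1)] by blast
  qed
  thus ?case using Pz_prime[OF z(1) y(1)] by blast
qed

abbreviation s where "s \<equiv> kp_of q p (A1_s q n)"

lemma s_closed: "s \<in> carrier (kp q p)"
  using kz_closed[OF Cen_hn] by (simp add: kz_def A1_s_cls)

lemma E_modulus_eq: "E_modulus q n p = K.radical_poly n s"
  unfolding E_modulus_def K.radical_poly_def kp_poly_def ..

lemma E_eq: "E q n p = K.rad n s"
  unfolding E_def E_modulus_eq ..

lemma E_class_eq: "E_class q n p g = K.rad_class n s g"
  unfolding E_class_def E_modulus_eq kp_poly_def ..

lemma E_const_eq: "E_const q n p c = K.rad_const n s c" and E_h_eq: "E_h q n p = K.rad_h n s"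
  unfolding E_const_def E_h_def E_class_eq by (rule refl)+

sublocale Ep: cring "E q n p"
  unfolding E_eq by (rule K.rad_cring[OF n_pos s_closed])

sublocale C: ring_hom_ring "kp q p" "E q n p" "E_const q n p"
  unfolding E_eq E_const_eq[abs_def] by (rule K.rad_const_hom[OF n_pos s_closed])

lemma E_h_closed: "E_h q n p \<in> carrier (E q n p)"
  unfolding E_eq E_h_eq by (rule K.rad_h_closed[OF n_pos s_closed])

lemma E_independent:
  assumes "\<And>i. i < n \<Longrightarrow> c i \<in> carrier (kp q p)"
    "(\<Oplus>\<^bsub>E q n p\<^esub>i\<in>{..<n}. E_const q n p (c i) \<otimes>\<^bsub>E q n p\<^esub> E_h q n p [^]\<^bsub>E q n p\<^esub> i) = \<zero>\<^bsub>E q n p\<^esub>" "i < n"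
  shows "c i = \<zero>\<^bsub>kp q p\<^esub>"
proof (rule K.rad_independent[OF n_pos s_closed, where c = c and i = i])
  show "c j \<in> carrier (kp q p)" if "j < n" for j by (rule assms(1)[OF that])
  show "(\<Oplus>\<^bsub>K.rad n s\<^esub>i\<in>{..<n}. K.rad_const n s (c i) \<otimes>\<^bsub>K.rad n s\<^esub> K.rad_h n s [^]\<^bsub>K.rad n s\<^esub> i) = \<zero>\<^bsub>K.rad n s\<^esub>"
    using assms(2) unfolding E_eq E_const_eq E_h_eq .
qed (rule assms(3))

text \<open>k(p) embeds in E(s, p) because 1 is one of the independent powers of h, as n >
  0.\<close>

lemma E_const_eq_0:
  assumes c: "c \<in> carrier (kp q p)" and z: "E_const q n p c = \<zero>\<^bsub>E q n p\<^esub>"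
  shows "c = \<zero>\<^bsub>kp q p\<^esub>"
proof -
  define d where "d i = (if i = 0 then c else \<zero>\<^bsub>kp q p\<^esub>)" for i :: nat
  have "d 0 = \<zero>\<^bsub>kp q p\<^esub>"
  proof (rule E_independent)
    show "d i \<in> carrier (kp q p)" for i using c by (simp add: d_def)
    have "E_const q n p (d i) \<otimes>\<^bsub>E q n p\<^esub> E_h q n p [^]\<^bsub>E q n p\<^esub> i = \<zero>\<^bsub>E q n p\<^esub>" for i
      using z Ep.nat_pow_closed[OF E_h_closed] by (simp add: d_def)
    thus "(\<Oplus>\<^bsub>E q n p\<^esub>i\<in>{..<n}. E_const q n p (d i) \<otimes>\<^bsub>E q n p\<^esub> E_h q n p [^]\<^bsub>E q n p\<^esub> i) = \<zero>\<^bsub>E q n p\<^esub>"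
      by simp
  qed (rule n_pos)
  thus ?thesis by (simp add: d_def)
qed

definition ez :: "'k free_alg \<Rightarrow> 'k kfield list set" where "ez u = E_const q n p (kz u)"

text \<open>The image of q in k(p) is still an n-th root of 1, so h may be replaced by q h.\<close>

lemma is_sigma_exists: "\<exists>\<theta>. is_sigma q n p \<theta>"
proof -
  have w: "kz (free_const q) \<in> carrier (kp q p)" by (rule kz_closed[OF Cen_const])
  have "kz (free_const q) [^]\<^bsub>kp q p\<^esub> m = kz (free_const (q ^ m))" for m :: nat
    by (induction m) (simp_all add: free.C_1 kz_one free.C_mult power_Suc2 kz_mult Cen_const del: power_Suc)
  hence wn: "kz (free_const q) [^]\<^bsub>kp q p\<^esub> n = \<one>\<^bsub>kp q p\<^esub>" by (simp add: qn free.C_1 kz_one)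
  show ?thesis
    using K.rad_automorphism[OF n_pos s_closed w wn] unfolding is_sigma_def E_eq E_const_eq E_h_eq kz_def A1_const_cls .
qed

text \<open>The abstract data are realised by E(s, p), with \<open>iota\<close> the composite of the
  maps from the centre to k(p) and from k(p) to E(s, p).\<close>

lemma action:
  assumes \<theta>: "is_sigma q n p \<theta>" and t: "A1_t q n \<notin> p" and s: "A1_s q n \<notin> p"
  shows "central_action q n (E q n p) \<theta> (E_const q n p (kp_of q p (A1_t q n))) ez (E_h q n p) Pz"
proof -
  have hom: "\<theta> \<in> Ring.ring_hom (E q n p) (E q n p)" using \<theta> unfolding is_sigma_def ring_iso_def by blast
  have fix_c: "\<theta> (E_const q n p c) = E_const q n p c" if "c \<in> carrier (kp q p)" for c
    using \<theta> that unfolding is_sigma_def by blast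
  have th: "\<theta> (E_h q n p) = E_const q n p (kz (free_const q)) \<otimes>\<^bsub>E q n p\<^esub> E_h q n p"
    using \<theta> unfolding is_sigma_def kz_def A1_const_cls by blast
  have w: "kz (free_const q) \<in> carrier (kp q p)" by (rule kz_closed[OF Cen_const])
  have "kz (free_const q) [^]\<^bsub>kp q p\<^esub> m = kz (free_const (q ^ m))" for m :: nat
    by (induction m) (simp_all add: free.C_1 kz_one free.C_mult power_Suc2 kz_mult Cen_const del: power_Suc)
  hence wn: "kz (free_const q) [^]\<^bsub>kp q p\<^esub> n = \<one>\<^bsub>kp q p\<^esub>" by (simp add: qn free.C_1 kz_one)
  have tk: "kp_of q p (A1_t q n) = kz (free_x ^ n)" by (simp add: A1_t_cls kz_def)
  note kzx = kz_closed[OF Cen_xn]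
  have ezc: "ez u \<in> carrier (E q n p)" if "u \<in> Cen" for u unfolding ez_def by (rule C.hom_closed[OF kz_closed[OF that]])
  have hp: "E_h q n p [^]\<^bsub>E q n p\<^esub> i \<in> carrier (E q n p)" for i :: nat by (rule Ep.nat_pow_closed[OF E_h_closed])
  show ?thesis
  proof unfold_locales
    show "\<theta> \<in> Ring.ring_hom (E q n p) (E q n p)" by (rule hom)
    show "0 < n" by (rule n_pos)
    show "E_const q n p (kp_of q p (A1_t q n)) \<in> carrier (E q n p)" unfolding tk by (rule C.hom_closed[OF kzx])
    show "\<theta> (E_const q n p (kp_of q p (A1_t q n))) = E_const q n p (kp_of q p (A1_t q n))" unfolding tk by (rule fix_c[OF kzx])
    show "(\<theta> ^^ n) e = e" if "e \<in> carrier (E q n p)" for e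
      using K.rad_hom_order[OF n_pos s_closed, folded E_eq E_const_eq E_h_eq, OF hom fix_c w wn th that] .
    show "ez u \<in> carrier (E q n p)" if "u \<in> Cen" for u by (rule ezc[OF that])
    show "ez (u + v) = ez u \<oplus>\<^bsub>E q n p\<^esub> ez v" if "u \<in> Cen" "v \<in> Cen" for u v
      unfolding ez_def kz_add[OF that] by (rule C.hom_add[OF kz_closed[OF that(1)] kz_closed[OF that(2)]])
    show "ez (u * v) = ez u \<otimes>\<^bsub>E q n p\<^esub> ez v" if "u \<in> Cen" "v \<in> Cen" for u v
      unfolding ez_def kz_mult[OF that] by (rule C.hom_mult[OF kz_closed[OF that(1)] kz_closed[OF that(2)]])
    show "ez 1 = \<one>\<^bsub>E q n p\<^esub>" unfolding ez_def kz_one by (rule C.hom_one)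
    show "ez u = \<zero>\<^bsub>E q n p\<^esub> \<longleftrightarrow> u \<in> Pz" if "u \<in> Cen" for u
      unfolding kz_eq_0[OF that, symmetric] ez_def using E_const_eq_0[OF kz_closed[OF that]] C.hom_zero by metis
    show "ez u \<in> Units (E q n p)" if u: "u \<in> Cen" "u \<notin> Pz" for u
    proof -
      have ku: "kz u \<in> Units (kp q p)" using kz_closed[OF u(1)] kz_eq_0[OF u(1)] u(2) K.field_Units by blast
      note inv = K.Units_inv_closed[OF ku]
      have "ez u \<otimes>\<^bsub>E q n p\<^esub> E_const q n p (inv\<^bsub>kp q p\<^esub> kz u) = \<one>\<^bsub>E q n p\<^esub>"
        unfolding ez_def C.hom_mult[OF kz_closed[OF u(1)] inv, symmetric] K.Units_r_inv[OF ku] by (rule C.hom_one)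
      hence "\<exists>x\<in>carrier (E q n p). x \<otimes>\<^bsub>E q n p\<^esub> ez u = \<one>\<^bsub>E q n p\<^esub> \<and> ez u \<otimes>\<^bsub>E q n p\<^esub> x = \<one>\<^bsub>E q n p\<^esub>"
        using Ep.m_comm[OF ezc[OF u(1)] C.hom_closed[OF inv]] C.hom_closed[OF inv] by metis
      thus ?thesis using ezc[OF u(1)] unfolding Units_def by blast
    qed
    show "\<theta> (ez u) = ez u" if "u \<in> Cen" for u unfolding ez_def by (rule fix_c[OF kz_closed[OF that]])
    show "u \<in> Pz" if "rep q u = 0" for u
    proof -
      have "cls u = cls 0" using that by (simp add: cls_iff rep_simps)
      moreover note zero_in_p
      ultimately show ?thesis using that by (simp add: Pz_def Cen_def)
    qed
    show "E_h q n p \<in> carrier (E q n p)" by (rule E_h_closed)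
    show "\<theta> (E_h q n p) = ez (free_const q) \<otimes>\<^bsub>E q n p\<^esub> E_h q n p" unfolding ez_def by (rule th)
    show "E_h q n p [^]\<^bsub>E q n p\<^esub> n = ez (fh ^ n)"
      using K.rad_h_pow[OF n_pos s_closed] unfolding ez_def kz_def A1_s_cls[symmetric] E_eq E_h_eq E_const_eq .
    show "ez (free_x ^ n) = E_const q n p (kp_of q p (A1_t q n))" unfolding ez_def tk ..
    show "free_x ^ n \<notin> Pz" using t by (simp add: Pz_def A1_t_cls)
    show "fh ^ n \<notin> Pz" using s by (simp add: Pz_def A1_s_cls)
    show "1 \<notin> Pz" using one_Pz by blast
    show "c i \<in> Pz" if c: "\<And>i. i < n \<Longrightarrow> c i \<in> Cen"
      "(\<Oplus>\<^bsub>E q n p\<^esub>i\<in>{..<n}. ez (c i) \<otimes>\<^bsub>E q n p\<^esub> E_h q n p [^]\<^bsub>E q n p\<^esub> i) = \<zero>\<^bsub>E q n p\<^esub>" "i < n" for c and i :: nat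
    proof -
      have "kz (c i) = \<zero>\<^bsub>kp q p\<^esub>" using E_independent[of "\<lambda>i. kz (c i)" i] kz_closed c unfolding ez_def by blast
      thus ?thesis using kz_eq_0[OF c(1)[OF c(3)]] by blast
    qed
    show "\<exists>z\<in>Cen - Pz. \<exists>c. (\<forall>i. c i \<in> Cen) \<and>
        ez z \<otimes>\<^bsub>E q n p\<^esub> e = (\<Oplus>\<^bsub>E q n p\<^esub>i\<in>{..<n}. ez (c i) \<otimes>\<^bsub>E q n p\<^esub> E_h q n p [^]\<^bsub>E q n p\<^esub> i)"
      if e: "e \<in> carrier (E q n p)" for e
    proof -
      obtain k where k: "\<And>i. k i \<in> carrier (kp q p)"
        and eq: "e = (\<Oplus>\<^bsub>E q n p\<^esub>i\<in>{..<n}. E_const q n p (k i) \<otimes>\<^bsub>E q n p\<^esub> E_h q n p [^]\<^bsub>E q n p\<^esub> i)"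
        using K.rad_expansion[OF n_pos s_closed, of e] e unfolding E_eq E_const_eq E_h_eq by blast
      obtain z where z: "z \<in> Cen - Pz" "\<forall>i\<in>{..<n}. \<exists>w\<in>Cen. kz z \<otimes>\<^bsub>kp q p\<^esub> k i = kz w"
        using common_denominator[of "{..<n}" k] k by blast
      have zc: "z \<in> Cen" using z(1) by blast
      have "\<forall>i. \<exists>w. w \<in> Cen \<and> (i < n \<longrightarrow> kz z \<otimes>\<^bsub>kp q p\<^esub> k i = kz w)" using z(2) Cen_one by (metis lessThan_iff)
      then obtain c where c: "\<And>i. c i \<in> Cen" "\<And>i. i < n \<Longrightarrow> kz z \<otimes>\<^bsub>kp q p\<^esub> k i = kz (c i)" by metis
      have "ez z \<otimes>\<^bsub>E q n p\<^esub> e = (\<Oplus>\<^bsub>E q n p\<^esub>i\<in>{..<n}. ez z \<otimes>\<^bsub>E q n p\<^esub> (E_const q n p (k i) \<otimes>\<^bsub>E q n p\<^esub> E_h q n p [^]\<^bsub>E q n p\<^esub> i))"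
        unfolding eq using C.hom_closed[OF k] hp ezc[OF zc] by (intro Ep.finsum_rdistr) auto
      also have "\<dots> = (\<Oplus>\<^bsub>E q n p\<^esub>i\<in>{..<n}. ez (c i) \<otimes>\<^bsub>E q n p\<^esub> E_h q n p [^]\<^bsub>E q n p\<^esub> i)"
      proof (rule Ep.finsum_cong')
        fix i assume "i \<in> {..<n}"
        hence i: "i < n" by simp
        show "ez z \<otimes>\<^bsub>E q n p\<^esub> (E_const q n p (k i) \<otimes>\<^bsub>E q n p\<^esub> E_h q n p [^]\<^bsub>E q n p\<^esub> i) = ez (c i) \<otimes>\<^bsub>E q n p\<^esub> E_h q n p [^]\<^bsub>E q n p\<^esub> i"
          unfolding Ep.m_assoc[OF ezc[OF zc] C.hom_closed[OF k] hp, symmetric]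
          unfolding ez_def C.hom_mult[OF kz_closed[OF zc] k, symmetric] c(2)[OF i] ..
      qed (use ezc[OF c(1)] hp in auto)
      finally show ?thesis using z(1) c(1) by blast
    qed
  qed
qed

end

section \<open>The classification\<close>

text \<open>A name for the set whose minimum occurs in the theorem.\<close>

definition matrix_sizes :: "'k::field \<Rightarrow> nat \<Rightarrow> 'k free_alg set set \<Rightarrow> ('k kfield list set \<Rightarrow> 'k kfield list set) \<Rightarrow> nat set" where
  "matrix_sizes q n p \<theta> = {d. 1 \<le> d \<and> d dvd n \<and>
    (\<exists>M \<in> mats (E q n p) d. twisted_power (E q n p) d \<theta> M n =
       scalar_mat (E q n p) d (E_const q n p (kp_of q p (A1_t q n))))}"

context qroot
begin

abbreviation extension :: "'k free_alg set set \<Rightarrow> 'k free_alg set set" where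
  "extension p \<equiv> ideal_prod (A1 q) (carrier (A1 q)) p"

lemma finite_matrix_sizes: "finite (matrix_sizes q n p \<theta>)"
  by (rule finite_subset[of _ "{..n}"]) (use n_pos in \<open>auto simp: matrix_sizes_def dvd_imp_le\<close>)

end

locale residue_action = residue +
  fixes \<theta>
  assumes sigma: "is_sigma q n p \<theta>" and t: "A1_t q n \<notin> p" and s: "A1_s q n \<notin> p"
begin

sublocale CA: central_action q n "E q n p" \<theta> "E_const q n p (kp_of q p (A1_t q n))" ez "E_h q n p" Pz
  by (rule action[OF sigma t s])

abbreviation zeroV where "zeroV \<equiv> \<zero>\<^bsub>fun_ring (E q n p) n\<^esub>"

lemma extension_hat: "x \<in> extension p \<Longrightarrow> \<exists>u. x = cls u \<and> CA.hat u = zeroV"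
proof (induction rule: ideal_prod.induct)
  case (prod i j)
  obtain v where v: "i = cls v" using prod(1) carrier_A1 by auto
  obtain z where z: "j = cls z" "z \<in> Pz" using prod(2) p_eq by auto
  have zc: "z \<in> Cen" using z(2) by (simp add: Pz_def)
  have "CA.hat z = zeroV" by (rule CA.hat_Pz[OF zc z(2)])
  hence "CA.hat (v * z) = zeroV" unfolding CA.hat_mult using CA.rmult_0_left[OF CA.hat_closed] by simp
  thus ?case unfolding v z(1) cls_mult by blast
next
  case (sum x y)
  then obtain u v where "x = cls u" "CA.hat u = zeroV" "y = cls v" "CA.hat v = zeroV" by blast
  hence "x \<oplus>\<^bsub>A1 q\<^esub> y = cls (u + v)" "CA.hat (u + v) = zeroV"
    by (simp_all add: cls_add CA.hat_add)
  thus ?case by blast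
qed

text \<open>By \<open>hat_eq_0_iff\<close> the coordinates of u in the basis y^b x^a represent
  elements of p, so u is a sum of products with such elements.\<close>

lemma hat_extension:
  assumes u: "CA.hat u = zeroV"
  shows "cls u \<in> extension p"
proof -
  note zero_in_p
  hence zero: "cls 0 \<in> extension p" using ideal_prod.prod[of "cls 0" "carrier (A1 q)" "cls 0" p "A1 q"]
    by (simp add: carrier_A1 cls_mult)
  have sum: "cls (sum f A) \<in> extension p" if "\<And>x. x \<in> A \<Longrightarrow> cls (f x) \<in> extension p" for f and A :: "nat set"
    using that
  proof (induction A rule: infinite_finite_induct)
    case (insert x A)
    thus ?case using ideal_prod.sum[of "cls (f x)" "A1 q" "carrier (A1 q)" p "cls (sum f A)"] by (simp add: cls_add)
  qed (simp_all add: zero)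
  have summand: "cls (fzeta (crd i j (nf q u)) * free_y ^ j * free_x ^ i) \<in> extension p" if "i < n" "j < n" for i j
  proof -
    have "cls (fzeta (crd i j (nf q u))) \<in> p" using u that by (simp add: CA.hat_eq_0_iff Pz_def)
    hence "cls (free_y ^ j * free_x ^ i) \<otimes>\<^bsub>A1 q\<^esub> cls (fzeta (crd i j (nf q u))) \<in> extension p"
      by (intro ideal_prod.prod) (simp add: carrier_A1)
    also have "cls (free_y ^ j * free_x ^ i) \<otimes>\<^bsub>A1 q\<^esub> cls (fzeta (crd i j (nf q u)))
        = cls (fzeta (crd i j (nf q u)) * free_y ^ j * free_x ^ i)"
      unfolding cls_mult cls_iff using CenD[OF Cen_fzeta, of "crd i j (nf q u)" "free_y ^ j * free_x ^ i"]
      by (simp only: rep_simps mult.assoc)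
    finally show ?thesis .
  qed
  let ?w = "\<Sum>a<n. \<Sum>b<n. fzeta (crd a b (nf q u)) * free_y ^ b * free_x ^ a"
  have "rep q ?w = (\<Sum>a<n. \<Sum>b<n. zeta (crd a b (nf q u)) * oy ^ b * ox ^ a)"
    by (simp add: rep_simps rep_fzeta)
  hence "rep q ?w = rep q u" unfolding expansion_crd[symmetric] .
  hence "cls u = cls ?w" by (simp add: cls_iff)
  also have "\<dots> \<in> extension p" by (rule sum, rule sum, rule summand) auto
  finally show ?thesis .
qed

lemma extension_vimage: "cls -` extension p = {u. CA.hat u = zeroV}"
proof (intro equalityI subsetI)
  fix u assume "u \<in> cls -` extension p"
  then obtain v where "cls u = cls v" "CA.hat v = zeroV" using extension_hat[of "cls u"] by auto
  thus "u \<in> {u. CA.hat u = zeroV}" using CA.hat_cong[of u v] by (simp add: cls_iff)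
next
  fix u assume "u \<in> {u. CA.hat u = zeroV}"
  thus "u \<in> cls -` extension p" using hat_extension[of u] by simp
qed

lemma extension_range: "extension p \<subseteq> range cls"
  using extension_hat by blast

lemma extension_Spec_c:
  assumes F: "field (E q n p)" and m: "n = Min (matrix_sizes q n p \<theta>)"
  shows "extension p \<in> Spec_c (A1 q)"
proof -
  have "cprime {u. CA.hat u = zeroV}"
  proof (rule CA.cprime_hat[OF F])
    fix d M assume d: "1 \<le> d" "d < n" "d dvd n" and M: "M \<in> mats (E q n p) d"
    show "twisted_power (E q n p) d \<theta> M n \<noteq> scalar_mat (E q n p) d (E_const q n p (kp_of q p (A1_t q n)))"
    proof
      assume "twisted_power (E q n p) d \<theta> M n = scalar_mat (E q n p) d (E_const q n p (kp_of q p (A1_t q n)))"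
      hence "d \<in> matrix_sizes q n p \<theta>" using d M unfolding matrix_sizes_def by blast
      hence "Min (matrix_sizes q n p \<theta>) \<le> d" by (rule Min_le[OF finite_matrix_sizes])
      hence "n \<le> d" unfolding m[symmetric] .
      thus False using d(2) by linarith
    qed
  qed
  thus ?thesis unfolding Spec_c_A1_iff extension_vimage using extension_range by blast
qed

text \<open>E(s, p) is a domain as a part of the cyclic algebra, hence a field, being a quotient of
  a polynomial ring in one variable. The size n occurs by \<open>full_matrix\<close>, and none below
  it by \<open>no_small_matrix\<close>.\<close>

lemma field_and_Min:
  assumes P: "cprime {u. CA.hat u = zeroV}"
  shows "field (E q n p)" "n = Min (matrix_sizes q n p \<theta>)"
proof -
  show F: "field (E q n p)"
    using K.rad_field[OF n_pos s_closed] CA.domain_of_cprime[OF P] unfolding E_eq by blast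
  show "n = Min (matrix_sizes q n p \<theta>)"
  proof (rule Min_eqI[symmetric, OF finite_matrix_sizes])
    show "n \<in> matrix_sizes q n p \<theta>"
      using CA.full_matrix[OF F] n_pos unfolding matrix_sizes_def by simp
    fix d assume d: "d \<in> matrix_sizes q n p \<theta>"
    show "n \<le> d"
    proof (rule ccontr)
      assume "\<not> n \<le> d"
      thus False using d CA.no_small_matrix[OF F P, of d] unfolding matrix_sizes_def by auto
    qed
  qed
qed

end

context qroot
begin

text \<open>Either of x and y would bring xy and yx into \<open>P\<close>, and with them 1 = xy - q
  yx.\<close>

lemma x_y_not_in_cprime:
  assumes P: "cprime P" "kers \<subseteq> P"
  shows "free_x \<notin> P" "free_y \<notin> P"
proof -
  note tP = tidealD[OF cprimeD(1)[OF P(1)]]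
  have r: "qrel q \<in> P" using P(2) rep_qrel[of q] by blast
  have "free_x * free_y \<in> P \<Longrightarrow> free_const q * free_y * free_x \<in> P \<Longrightarrow> False"
  proof -
    assume "free_x * free_y \<in> P" "free_const q * free_y * free_x \<in> P"
    hence "free_x * free_y - free_const q * free_y * free_x - qrel q \<in> P" by (rule tP(6)[OF tP(6) r])
    thus False using cprimeD(2)[OF P(1)] by (simp add: qrel_def)
  qed
  thus "free_x \<notin> P" "free_y \<notin> P"
    using tP(3)[of free_x "free_const q * free_y"] tP(4)[of free_x free_y]
      tP(3)[of free_y free_x] tP(4)[OF tP(3)[of free_y "free_const q"], of free_x] by blast+
qed

text \<open>p is the contraction of \<open>P\<close> to the centre, and the point is that
  \<open>P\<close> is not larger than the ideal p generates. A power of t carries an element of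
  \<open>P\<close> into the span of the h^i x^j; separation of eigenvectors puts the coefficients
  into \<open>P\<close>, hence into p; and t is cancelled again because it is not in p.\<close>

lemma Spec_c_without_h:
  assumes P: "P \<in> Spec_c (A1 q)" and h: "fh \<notin> cls -` P" and ne: "P \<noteq> {\<zero>\<^bsub>A1 q\<^esub>}"
  shows "\<exists>p. P = extension p \<and> primeideal p (Z1 q) \<and> p \<noteq> {\<zero>\<^bsub>Z1 q\<^esub>} \<and>
    A1_t q n \<notin> p \<and> A1_r q n \<notin> p \<and> A1_s q n \<notin> p \<and> field (E q n p) \<and>
    (\<exists>\<theta>. is_sigma q n p \<theta> \<and> n = Min (matrix_sizes q n p \<theta>))"
proof -
  define p where "p = P \<inter> cls ` Cen"
  have cp: "cprime (cls -` P)" and Pr: "P \<subseteq> range cls" using P Spec_c_A1_iff by blast+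
  note tP = cprimeD(1)[OF cp]
  note kP = kers_vimage[OF tP]
  note xy = x_y_not_in_cprime[OF cp kP]
  have not_pow: "cls (u ^ m) \<notin> p" if "u \<notin> cls -` P" for u m
    using cprime_pow[OF cp, of u m] that by (auto simp: p_def)
  have t: "A1_t q n \<notin> p" unfolding A1_t_cls by (rule not_pow[OF xy(1)])
  have r: "A1_r q n \<notin> p" unfolding A1_r_cls by (rule not_pow[OF xy(2)])
  have s: "A1_s q n \<notin> p" unfolding A1_s_cls by (rule not_pow[OF h])
  have prime: "primeideal p (Z1 q)" unfolding p_def by (rule Z1_prime_contraction[OF P])
  interpret res: residue q n p by (rule residue.intro[OF qroot_axioms residue_axioms.intro[OF prime]])
  obtain \<theta> where \<theta>: "is_sigma q n p \<theta>" using res.is_sigma_exists by blast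
  interpret ra: residue_action q n p \<theta>
    by (rule residue_action.intro[OF res.residue_axioms residue_action_axioms.intro[OF \<theta> t s]])
  have vim: "cls -` P = {u. ra.CA.hat u = ra.zeroV}"
  proof (intro equalityI subsetI)
    fix u assume u: "u \<in> cls -` P"
    obtain N c where d: "ox ^ (n * N) * rep q u = dsum c" using density by blast
    let ?z = "free_x ^ (n * N) :: 'k free_alg"
    have e: "rep q (?z * u) = rep q (fsum c)" using d by (simp add: rep_simps rep_fsum)
    have f: "fsum c \<in> cls -` P" by (rule mem_cong[OF tP kP e tidealD(3)[OF tP u]])
    have ci: "fzeta (c i j) \<in> cls -` P" if "i < n" "j < n" for i j
      by (rule coefficients_in_prime[OF cp kP xy(1) h f that])
    have hz: "ra.CA.hat (fzeta (c i j)) = ra.zeroV" if ij: "i < n" "j < n" for i j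
    proof -
      have "cls (fzeta (c i j)) \<in> p" using ci[OF ij] Cen_fzeta[of "c i j"] by (simp add: p_def)
      hence "fzeta (c i j) \<in> res.Pz" using Cen_fzeta unfolding res.Pz_def by blast
      thus ?thesis by (rule ra.CA.hat_Pz[OF Cen_fzeta])
    qed
    have "fsum c \<in> {u. ra.CA.hat u = ra.zeroV}"
      unfolding fsum_def
      by (rule tideal_sum[OF ra.CA.tideal_hat], rule tideal_sum[OF ra.CA.tideal_hat],
          rule tidealD(4)[OF ra.CA.tideal_hat], rule tidealD(4)[OF ra.CA.tideal_hat]) (simp add: hz)
    hence 0: "ra.CA.hat (?z * u) = ra.zeroV" using ra.CA.hat_cong[OF e] by simp
    have zc: "?z \<in> Cen"
    proof -
      have "(free_x ^ n) ^ N \<in> Cen" by (induction N) (simp_all add: Cen_one Cen_mult Cen_xn)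
      thus ?thesis by (simp add: power_mult)
    qed
    have zP: "?z \<notin> res.Pz" using not_pow[OF xy(1), of "n * N"] by (simp add: res.Pz_def)
    have "smul (E q n p) (res.ez ?z) (ra.CA.hat u) = ra.zeroV" using 0 unfolding ra.CA.hat_central_mult[OF zc] .
    hence "ra.CA.hat u = ra.zeroV" by (rule ra.CA.smul_iota_0[OF zc zP ra.CA.hat_closed])
    thus "u \<in> {u. ra.CA.hat u = ra.zeroV}" by simp
  next
    fix u assume "u \<in> {u. ra.CA.hat u = ra.zeroV}"
    hence "cls u \<in> extension p" using ra.hat_extension[of u] by simp
    moreover have "x \<in> P" if "x \<in> extension p" for x using that
    proof (induction rule: ideal_prod.induct)
      case (prod i j)
      obtain v where "i = cls v" using prod(1) carrier_A1 by auto
      moreover obtain w where "j = cls w" "w \<in> cls -` P" using prod(2) by (auto simp: p_def)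
      ultimately show ?case using tidealD(3)[OF tP, of w v] by (simp add: cls_mult)
    next
      case (sum x y)
      have "x \<in> range cls" "y \<in> range cls" by (rule subsetD[OF Pr sum.IH(1)], rule subsetD[OF Pr sum.IH(2)])
      then obtain v w where v: "x = cls v" "y = cls w" by (elim rangeE)
      hence "v \<in> cls -` P" "w \<in> cls -` P" using sum.IH by simp_all
      thus ?case unfolding v using tidealD(2)[OF tP, of v w] by (simp add: cls_add)
    qed
    ultimately show "u \<in> cls -` P" by simp
  qed
  have "cls ` (cls -` P) = cls ` (cls -` extension p)" unfolding vim ra.extension_vimage ..
  hence eq: "P = extension p" unfolding image_vimage[OF Pr] image_vimage[OF ra.extension_range] .
  \<comment> \<open>A zero p would generate the zero ideal, and \<open>P\<close> is nonzero.\<close>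
  have "p \<noteq> {\<zero>\<^bsub>Z1 q\<^esub>}"
  proof
    assume p0: "p = {\<zero>\<^bsub>Z1 q\<^esub>}"
    have "x = \<zero>\<^bsub>A1 q\<^esub>" if "x \<in> extension p" for x using that
    proof (induction rule: ideal_prod.induct)
      case (prod i j)
      have "j = \<zero>\<^bsub>A1 q\<^esub>" using prod(2) unfolding p0 Z1_simps by blast
      thus ?case using A.r_null[OF prod(1)] by simp
    next
      case (sum x y)
      show ?case unfolding sum.IH by (rule A.l_zero[OF A.zero_closed])
    qed
    moreover have "\<zero>\<^bsub>A1 q\<^esub> \<in> P" using tidealD(1)[OF tP] by (simp add: cls_zero)
    ultimately have "P = {\<zero>\<^bsub>A1 q\<^esub>}" unfolding eq[symmetric] by blast
    thus False using ne by blast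
  qed
  note p_nonzero = this
  have "cprime {u. ra.CA.hat u = ra.zeroV}" using cp unfolding vim .
  note fm = ra.field_and_Min[OF this]
  show ?thesis
    by (intro exI[of _ p] conjI exI[of _ \<theta>]) (rule eq prime p_nonzero t r s fm \<theta>)+
qed

lemma Idl_h: "Idl\<^bsub>A1 q\<^esub> {A1_h q} = cls ` {u. laurent u = 0}"
proof -
  have "Idl\<^bsub>A1 q\<^esub> (cls ` {fh}) = cls ` {u. laurent u = 0}"
  proof (rule Idl_cls[OF tideal_laurent kers_laurent])
    show "{fh} \<subseteq> {u. laurent u = 0}" using laurent_fh by simp
    fix J assume J: "tideal J" "kers \<subseteq> J" "{fh} \<subseteq> J"
    have "fh \<in> J" using J(3) by simp
    thus "{u. laurent u = 0} \<subseteq> J" using laurent_ker_minimal[OF J(1,2)] by blast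
  qed
  thus ?thesis by (simp add: A1_h_cls)
qed

lemma Idl_h_f:
  assumes f: "f \<in> Irr_m - {[:0, 1:]}"
  shows "Idl\<^bsub>A1 q\<^esub> {A1_h q, A1_poly q f} = cls ` point_ideal f"
proof -
  note pf = point_ideal_facts[OF f]
  have "fh \<in> point_ideal f" using pf(2) laurent_fh by blast
  hence sub: "{fh, fx.ev f} \<subseteq> point_ideal f" using pf(3) by blast
  have ker: "kers \<subseteq> point_ideal f" using pf(2) kers_laurent by blast
  have "Idl\<^bsub>A1 q\<^esub> (cls ` {fh, fx.ev f}) = cls ` point_ideal f"
  proof (rule Idl_cls[OF cprimeD(1)[OF pf(1)] ker sub])
    fix J assume J: "tideal J" "kers \<subseteq> J" "{fh, fx.ev f} \<subseteq> J"
    have "fh \<in> J" "fx.ev f \<in> J" using J(3) by simp_all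
    thus "point_ideal f \<subseteq> J" by (rule pf(4)[OF J(1,2)])
  qed
  thus ?thesis by (simp add: A1_h_cls A1_poly_cls)
qed

lemma image_Spec_c: "cprime Q \<Longrightarrow> kers \<subseteq> Q \<Longrightarrow> cls ` Q \<in> Spec_c (A1 q)"
  unfolding Spec_c_A1_iff using vimage_image[OF cprimeD(1)] by auto

lemma cprime_kers: "cprime kers"
  unfolding cprime_def
  using tideal_ker rep_domain[OF q0] by (auto simp: rep_simps)

end

theorem corollary5p18:
  fixes q :: "'k::field" and n :: nat
  assumes "n \<ge> 2"
    and "q ^ n = 1" and "\<And>m. 0 < m \<Longrightarrow> m < n \<Longrightarrow> q ^ m \<noteq> 1"
  shows "Spec_c (A1 q) =
    {{\<zero>\<^bsub>A1 q\<^esub>}, Idl\<^bsub>A1 q\<^esub> {A1_h q}}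
    \<union> {Idl\<^bsub>A1 q\<^esub> {A1_h q, A1_poly q f} | f. f \<in> Irr_m - {[:0, 1:]}}
    \<union> {ideal_prod (A1 q) (carrier (A1 q)) p | p.
         primeideal p (Z1 q) \<and> p \<noteq> {\<zero>\<^bsub>Z1 q\<^esub>} \<and>
         A1_t q n \<notin> p \<and> A1_r q n \<notin> p \<and> A1_s q n \<notin> p \<and>
         field (E q n p) \<and>
         (\<exists>\<sigma>. is_sigma q n p \<sigma> \<and>
            n = Min {d. 1 \<le> d \<and> d dvd n \<and>
                  (\<exists>M \<in> mats (E q n p) d.
                     twisted_power (E q n p) d \<sigma> M n =
                     scalar_mat (E q n p) d (E_const q n p (kp_of q p (A1_t q n))))})}"
  (is "_ = ?A \<union> ?B \<union> ?C")
proof -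
  interpret qroot q n using assms by unfold_locales
  have C: "?C = {extension p | p. primeideal p (Z1 q) \<and> p \<noteq> {\<zero>\<^bsub>Z1 q\<^esub>} \<and>
    A1_t q n \<notin> p \<and> A1_r q n \<notin> p \<and> A1_s q n \<notin> p \<and> field (E q n p) \<and>
    (\<exists>\<theta>. is_sigma q n p \<theta> \<and> n = Min (matrix_sizes q n p \<theta>))}"
    unfolding matrix_sizes_def ..
  show ?thesis
  proof (intro equalityI subsetI)
    fix P assume P: "P \<in> Spec_c (A1 q)"
    hence cp: "cprime (cls -` P)" and Pr: "P \<subseteq> range cls" unfolding Spec_c_A1_iff by blast+
    note kP = kers_vimage[OF cprimeD(1)[OF cp]]
    show "P \<in> ?A \<union> ?B \<union> ?C"
    \<comment> \<open>Primes with h come from the Laurent polynomials, the others from cyclic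
      algebras. The zero ideal is on the second side and is set apart there, since its contraction
      to the centre is zero.\<close>
    proof (cases "fh \<in> cls -` P")
      case True
      from cprime_containing_h[OF cp kP True] consider "cls -` P = {u. laurent u = 0}"
        | f where "f \<in> Irr_m - {[:0, 1:]}" "cls -` P = point_ideal f" by blast
      thus ?thesis
      proof cases
        case 1
        hence "P = Idl\<^bsub>A1 q\<^esub> {A1_h q}" unfolding Idl_h using image_vimage[OF Pr] by simp
        thus ?thesis by blast
      next
        case 2
        hence "P = Idl\<^bsub>A1 q\<^esub> {A1_h q, A1_poly q f}" unfolding Idl_h_f[OF 2(1)] using image_vimage[OF Pr] by simp
        thus ?thesis using 2(1) by blast
      qed
    next
      case False
      show ?thesis
      proof (cases "P = {\<zero>\<^bsub>A1 q\<^esub>}")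
        case False
        have "P \<in> ?C" unfolding C using Spec_c_without_h[OF P \<open>fh \<notin> cls -` P\<close> False] by blast
        thus ?thesis by blast
      qed blast
    qed
  next
    fix P assume "P \<in> ?A \<union> ?B \<union> ?C"
    then consider "P = {\<zero>\<^bsub>A1 q\<^esub>}" | "P = Idl\<^bsub>A1 q\<^esub> {A1_h q}"
      | f where "f \<in> Irr_m - {[:0, 1:]}" "P = Idl\<^bsub>A1 q\<^esub> {A1_h q, A1_poly q f}"
      | p \<theta> where "P = extension p" "primeideal p (Z1 q)" "A1_t q n \<notin> p" "A1_s q n \<notin> p" "field (E q n p)"
          "is_sigma q n p \<theta>" "n = Min (matrix_sizes q n p \<theta>)"
      unfolding C by blast
    thus "P \<in> Spec_c (A1 q)"
    proof cases
      case 1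
      thus ?thesis using image_Spec_c[OF cprime_kers] by (simp add: zero_ideal)
    next
      case 2
      thus ?thesis using image_Spec_c[OF cprime_laurent kers_laurent] by (simp add: Idl_h)
    next
      case 3
      note pf = point_ideal_facts[OF 3(1)]
      have "kers \<subseteq> point_ideal f" using pf(2) kers_laurent by blast
      thus ?thesis using image_Spec_c[OF pf(1)] by (simp add: 3(2) Idl_h_f[OF 3(1)])
    next
      case 4
      interpret res: residue q n p by (rule residue.intro[OF qroot_axioms residue_axioms.intro[OF 4(2)]])
      interpret residue_action q n p \<theta>
        by (rule residue_action.intro[OF res.residue_axioms residue_action_axioms.intro[OF 4(6,3,4)]])
      show ?thesis unfolding 4(1) by (rule extension_Spec_c[OF 4(5,7)])
    qed
  qed
qed

end
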